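(* Let $\mathcal R$ be a polynomially bounded o-minimal structure expanding the real field, and let $\xi$ be a $C^1$ vector field in a neighborhood of $0\in\mathbb R^3$, definable in $\mathcal R$, with $\xi(0)=0$. Let $\Gamma,\Delta$ be trajectories of $\xi$ at $0$ such that $\Gamma$ has the regular separation property and $\Gamma,\Delta$ have flat contact. Then either $\Gamma$ and $\Delta$ are interlaced, or for any definable projection $F$ adapted to $(\Gamma,\Delta)$ the germ at $0$ of $F(\Gamma)\cap F(\Delta)$ has a connected representative. The two properties of this alternative are mutually exclusive.
   Context: Definable means definable with parameters in $\mathcal R$; functions "$f:\mathbb R^n\to\mathbb R$" may be partially defined with definable domain. Trajectory: the image $\Gamma=c((0,a))$ of a parameterized $C^1$ curve $c:(0,a)\to\mathbb R^3\setminus\{0\}$, $a>0$, with $\lim_{t\to0^+}c(t)=0$, $\xi(c(t))\ne0$ for all $t$ and $\xi(c)\wedge c'=0$. Trajectories with the same germ at $0$ are identified. Definable chart at $0$: a pair $C=(V,X)$ with $V\subset\mathbb R^3$ open definable, $0\in\overline V$, and $X:V\to\mathbb R^3$ a definable diffeomorphism onto its image with $\lim_{V\ni p\to0}X(p)=0$. A chart $C=(V,(x,y_1,y_2))$ is adapted to a trajectory $\Gamma$ if $V$ contains a representative of the germ of $\Gamma$ at $0$ on which $x>0$ and on which $dx(\xi)$ (the derivative of $x$ along $\xi$) has no zero. Then $\Gamma\cap V$ near $0$ has a unique parameterization $c:(0,a)\to V$ with $x(c(t))=t$; put $\gamma_C(x):=(y_1(c(x)),y_2(c(x)))$. For a trajectory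 $\Delta$ to which $C$ is adapted, $\delta_C$ is defined in the same way. Regular separation property of a trajectory $\Gamma$: there is a definable chart $C$ adapted to $\Gamma$ such that (i) for every definable $f:\mathbb R^3\to\mathbb R$ whose domain contains the graph of $\gamma_C$ (for small $x$) there is $a>0$ such that either $f(x,\gamma_C(x))=0$ for all $x\in(0,a)$, or there is $k\in\mathbb N$ with $|f(x,\gamma_C(x))|\ge x^k$ for all $x\in(0,a)$; and (ii) for every such definable $f$ with $\lim_{x\to0}f(x,\gamma_C(x))=0$, there are $k\in\mathbb N$, $k\geq 1$, and $a>0$ with $|f(x,\gamma_C(x))|<x^{1/k}$ for all $x\in(0,a)$. Flat contact of $\Gamma,\Delta$: there is a common adapted chart $C$ such that $\gamma_C,\delta_C$ are different and, for every $k\in\mathbb N$, there is $a>0$ with $\|\delta_C(x)-\gamma_C(x)\|\le x^k$ for all $x\in(0,a)$. Interlaced trajectories: there is a common adapted chart $C$ such that $\gamma_C,\delta_C$ are interlaced, i.e. with $\varepsilon=\delta_C-\gamma_C$, any continuous measure $\theta:(0,a)\to\mathbb R$ of the angle between $(1,0)$ and $\varepsilon(x)/\|\varepsilon(x)\|$ tends to $+\infty$ or to $-\infty$ as $x\to0$. Definable projection adapted to $(\Gamma,\Delta)$: a definable submersion $F:U\to\mathbb R^2$ on an open domain $U\subset\mathbb R^3$ with $\lim_{p\to0}F(p)=0$, such that $\Gamma\cap U$ (resp. $\Delta\cap U$) is a representative of the germ at $0$ of $\Gamma$ (resp. $\Delta$). Since trajectories are considered as germs, "the germ at $0$ of $F(\Gamma)\cap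 F(\Delta)$ has a connected representative" means that there are representatives $\widetilde\Gamma,\widetilde\Delta\subset U$ of the germs of $\Gamma,\Delta$ (themselves trajectories) such that $F(\widetilde\Gamma)\cap F(\widetilde\Delta)$ is connected; the empty set counts as connected. *)

theory Defs
  imports "HOL-Analysis.Analysis"
begin

section \<open>O-minimal structures expanding the real field\<close>

text \<open>
  \<^term>\<open>S n\<close> is the collection of definable subsets of the \<^term>\<open>n\<close>-th Cartesian power of the
  reals, whose points are encoded as real lists of length \<^term>\<open>n\<close>.  By \<open>ominimal\<close> every
  singleton belongs to \<^term>\<open>S 1\<close>, so definability is definability with parameters.  The order
  is definable from the field operations and is not listed.
\<close>

locale ominimal_real_field =
  fixes S :: "nat \<Rightarrow> real list set set"
  assumes in_power: "A \<in> S n \<Longrightarrow> A \<subseteq> {v. length v = n}"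
    and empty: "{} \<in> S n"
    and union: "A \<in> S n \<Longrightarrow> B \<in> S n \<Longrightarrow> A \<union> B \<in> S n"
    and complement: "A \<in> S n \<Longrightarrow> {v. length v = n} - A \<in> S n"
    and cylinder_left: "A \<in> S n \<Longrightarrow> {r # v | r v. v \<in> A} \<in> S (Suc n)"
    and cylinder_right: "A \<in> S n \<Longrightarrow> {v @ [r] | r v. v \<in> A} \<in> S (Suc n)"
    and diagonal: "i < n \<Longrightarrow> j < n \<Longrightarrow> {v. length v = n \<and> v ! i = v ! j} \<in> S n"
    and projection: "A \<in> S (Suc n) \<Longrightarrow> butlast ` A \<in> S n"
    and addition: "{[x, y, x + y] | x y. True} \<in> S 3"
    and multiplication: "{[x, y, x * y] | x y. True} \<in> S 3"
    and ominimal: "A \<in> S 1 \<longleftrightarrow>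
      (\<exists>\<I>. finite \<I> \<and> (\<forall>I\<in>\<I>. is_interval I) \<and> A = (\<lambda>r. [r]) ` \<Union>\<I>)"

locale polynomially_bounded_ominimal = ominimal_real_field +
  assumes polynomially_bounded:
    "{[t, f t] | t. True} \<in> S 2 \<Longrightarrow>
      \<exists>N::nat. \<forall>\<^sub>F t :: real in at_top. \<bar>f t :: real\<bar> \<le> t ^ N"

definition coords3 :: "real^3 \<Rightarrow> real list" where
  "coords3 p = [p $ 1, p $ 2, p $ 3]"

definition coords2 :: "real^2 \<Rightarrow> real list" where
  "coords2 q = [q $ 1, q $ 2]"

definition definable_set :: "(nat \<Rightarrow> real list set set) \<Rightarrow> (real^3) set \<Rightarrow> bool" where
  "definable_set S A \<longleftrightarrow> coords3 ` A \<in> S 3"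

text \<open>The graph of a map with domain \<^term>\<open>U\<close> and \<^term>\<open>m\<close> real components, listed by
  \<^term>\<open>g\<close>, is definable.\<close>

definition definable_map ::
  "(nat \<Rightarrow> real list set set) \<Rightarrow> nat \<Rightarrow> (real^3) set \<Rightarrow> (real^3 \<Rightarrow> real list) \<Rightarrow> bool" where
  "definable_map S m U g \<longleftrightarrow> (\<lambda>p. coords3 p @ g p) ` U \<in> S (3 + m)"

section \<open>Maps of class C1\<close>

text \<open>Used for open \<^term>\<open>U\<close> only; the derivative is continuous for the operator norm.\<close>

definition C1_on ::
  "('a::real_normed_vector \<Rightarrow> 'b::real_normed_vector) \<Rightarrow> 'a set \<Rightarrow> bool" where
  "C1_on f U \<longleftrightarrow> (\<exists>f' :: 'a \<Rightarrow> 'a \<Rightarrow>\<^sub>L 'b.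
     (\<forall>p\<in>U. (f has_derivative blinfun_apply (f' p)) (at p)) \<and> continuous_on U f')"

definition diffeomorphism_onto_image ::
  "(real^3 \<Rightarrow> real^3) \<Rightarrow> (real^3) set \<Rightarrow> bool" where
  "diffeomorphism_onto_image X V \<longleftrightarrow>
     C1_on X V \<and> open (X ` V) \<and> (\<exists>Y. C1_on Y (X ` V) \<and> (\<forall>p\<in>V. Y (X p) = p))"

section \<open>Trajectories\<close>

definition definable_C1_vector_field ::
  "(nat \<Rightarrow> real list set set) \<Rightarrow> (real^3) set \<Rightarrow> (real^3 \<Rightarrow> real^3) \<Rightarrow> bool" where
  "definable_C1_vector_field S W \<xi> \<longleftrightarrow>
     open W \<and> 0 \<in> W \<and> C1_on \<xi> W \<and> definable_map S 3 W (\<lambda>p. coords3 (\<xi> p))"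

text \<open>The condition that the wedge product of the field and the velocity vanishes is stated
  with the cross product.\<close>

definition trajectory_param ::
  "(real^3) set \<Rightarrow> (real^3 \<Rightarrow> real^3) \<Rightarrow> real \<Rightarrow> (real \<Rightarrow> real^3) \<Rightarrow> bool" where
  "trajectory_param W \<xi> a c \<longleftrightarrow>
     a > 0 \<and> c C1_differentiable_on {0<..<a} \<and> (c \<longlongrightarrow> 0) (at_right 0) \<and>
     (\<forall>t\<in>{0<..<a}. c t \<in> W \<and> c t \<noteq> 0 \<and> \<xi> (c t) \<noteq> 0 \<and>
        cross3 (\<xi> (c t)) (vector_derivative c (at t)) = 0)"

definition trajectory ::
  "(real^3) set \<Rightarrow> (real^3 \<Rightarrow> real^3) \<Rightarrow> (real^3) set \<Rightarrow> bool" where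
  "trajectory W \<xi> \<Gamma> \<longleftrightarrow> (\<exists>a c. trajectory_param W \<xi> a c \<and> \<Gamma> = c ` {0<..<a})"

definition same_germ :: "(real^3) set \<Rightarrow> (real^3) set \<Rightarrow> bool" where
  "same_germ A B \<longleftrightarrow> (\<forall>\<^sub>F p in nhds 0. p \<in> A \<longleftrightarrow> p \<in> B)"

definition representative ::
  "(real^3) set \<Rightarrow> (real^3 \<Rightarrow> real^3) \<Rightarrow> (real^3) set \<Rightarrow> (real^3) set \<Rightarrow> bool" where
  "representative W \<xi> \<Gamma> \<Gamma>' \<longleftrightarrow> trajectory W \<xi> \<Gamma>' \<and> same_germ \<Gamma>' \<Gamma>"

section \<open>Charts\<close>

text \<open>The coordinates \<open>x\<close>, \<open>y\<^sub>1\<close>, \<open>y\<^sub>2\<close> of the chart are the three components of \<^term>\<open>X\<close>.\<close>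

definition definable_chart ::
  "(nat \<Rightarrow> real list set set) \<Rightarrow> (real^3) set \<Rightarrow> (real^3 \<Rightarrow> real^3) \<Rightarrow> bool" where
  "definable_chart S V X \<longleftrightarrow>
     open V \<and> definable_set S V \<and> 0 \<in> closure V \<and>
     definable_map S 3 V (\<lambda>p. coords3 (X p)) \<and> diffeomorphism_onto_image X V \<and>
     (X \<longlongrightarrow> 0) (at 0 within V)"

definition adapted_chart ::
  "(nat \<Rightarrow> real list set set) \<Rightarrow> (real^3) set \<Rightarrow> (real^3 \<Rightarrow> real^3) \<Rightarrow>
   (real^3) set \<Rightarrow> (real^3 \<Rightarrow> real^3) \<Rightarrow> (real^3) set \<Rightarrow> bool" where
  "adapted_chart S W \<xi> V X \<Gamma> \<longleftrightarrow>
     definable_chart S V X \<and>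
     (\<exists>\<Gamma>'. representative W \<xi> \<Gamma> \<Gamma>' \<and> \<Gamma>' \<subseteq> V \<and>
       (\<forall>p\<in>\<Gamma>'. X p $ 1 > 0 \<and> frechet_derivative (\<lambda>q. X q $ 1) (at p) (\<xi> p) \<noteq> 0))"

text \<open>When the chart is adapted to \<^term>\<open>\<Gamma>\<close>, the chosen parameterization exists and its germ
  at \<open>0\<close> is unique; its values away from \<open>0\<close> carry no information, so \<open>chart_curve\<close> is only
  used through its germ.\<close>

definition chart_param ::
  "(real^3) set \<Rightarrow> (real^3 \<Rightarrow> real^3) \<Rightarrow> (real^3) set \<Rightarrow> (real^3 \<Rightarrow> real^3) \<Rightarrow>
   (real^3) set \<Rightarrow> real \<Rightarrow> real^3" where
  "chart_param W \<xi> V X \<Gamma> = (SOME c. \<exists>a. trajectory_param W \<xi> a c \<and>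
     c ` {0<..<a} \<subseteq> V \<and> same_germ (c ` {0<..<a}) \<Gamma> \<and> (\<forall>t\<in>{0<..<a}. X (c t) $ 1 = t))"

definition chart_curve ::
  "(real^3) set \<Rightarrow> (real^3 \<Rightarrow> real^3) \<Rightarrow> (real^3) set \<Rightarrow> (real^3 \<Rightarrow> real^3) \<Rightarrow>
   (real^3) set \<Rightarrow> real \<Rightarrow> real^2" where
  "chart_curve W \<xi> V X \<Gamma> x =
     (let p = chart_param W \<xi> V X \<Gamma> x in vector [X p $ 2, X p $ 3])"

section \<open>Regular separation, flat contact, interlacement\<close>

definition graph_point :: "(real \<Rightarrow> real^2) \<Rightarrow> real \<Rightarrow> real^3" where
  "graph_point \<gamma> x = vector [x, \<gamma> x $ 1, \<gamma> x $ 2]"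

definition definable_near_graph ::
  "(nat \<Rightarrow> real list set set) \<Rightarrow> (real \<Rightarrow> real^2) \<Rightarrow> (real^3) set \<Rightarrow> (real^3 \<Rightarrow> real) \<Rightarrow> bool" where
  "definable_near_graph S \<gamma> D f \<longleftrightarrow>
     definable_map S 1 D (\<lambda>p. [f p]) \<and> (\<forall>\<^sub>F x in at_right 0. graph_point \<gamma> x \<in> D)"

definition regular_separation ::
  "(nat \<Rightarrow> real list set set) \<Rightarrow> (real^3) set \<Rightarrow> (real^3 \<Rightarrow> real^3) \<Rightarrow> (real^3) set \<Rightarrow> bool" where
  "regular_separation S W \<xi> \<Gamma> \<longleftrightarrow>
     (\<exists>V X. adapted_chart S W \<xi> V X \<Gamma> \<and>
       (let \<gamma> = chart_curve W \<xi> V X \<Gamma> in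
        (\<forall>D f. definable_near_graph S \<gamma> D f \<longrightarrow>
          (\<exists>a>0. (\<forall>x\<in>{0<..<a}. f (graph_point \<gamma> x) = 0) \<or>
                 (\<exists>k::nat. \<forall>x\<in>{0<..<a}. \<bar>f (graph_point \<gamma> x)\<bar> \<ge> x ^ k))) \<and>
        (\<forall>D f. definable_near_graph S \<gamma> D f \<and>
               ((\<lambda>x. f (graph_point \<gamma> x)) \<longlongrightarrow> 0) (at_right 0) \<longrightarrow>
          (\<exists>k::nat. k \<ge> 1 \<and>
            (\<exists>a>0. \<forall>x\<in>{0<..<a}. \<bar>f (graph_point \<gamma> x)\<bar> < x powr (1 / real k))))))"

definition flat_contact ::
  "(nat \<Rightarrow> real list set set) \<Rightarrow> (real^3) set \<Rightarrow> (real^3 \<Rightarrow> real^3) \<Rightarrow>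
   (real^3) set \<Rightarrow> (real^3) set \<Rightarrow> bool" where
  "flat_contact S W \<xi> \<Gamma> \<Delta> \<longleftrightarrow>
     (\<exists>V X. adapted_chart S W \<xi> V X \<Gamma> \<and> adapted_chart S W \<xi> V X \<Delta> \<and>
       (let \<gamma> = chart_curve W \<xi> V X \<Gamma>; \<delta> = chart_curve W \<xi> V X \<Delta> in
        \<not> (\<forall>\<^sub>F x in at_right 0. \<gamma> x = \<delta> x) \<and>
        (\<forall>k::nat. \<exists>a>0. \<forall>x\<in>{0<..<a}. norm (\<delta> x - \<gamma> x) \<le> x ^ k)))"

definition angle_measure :: "(real \<Rightarrow> real^2) \<Rightarrow> real \<Rightarrow> (real \<Rightarrow> real) \<Rightarrow> bool" where
  "angle_measure \<epsilon> a \<theta> \<longleftrightarrow> continuous_on {0<..<a} \<theta> \<and>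
     (\<forall>x\<in>{0<..<a}. \<epsilon> x \<noteq> 0 \<and> \<epsilon> x /\<^sub>R norm (\<epsilon> x) = vector [cos (\<theta> x), sin (\<theta> x)])"

text \<open>A continuous angle measure must exist near \<open>0\<close>, so that quantification over all of them is
  not vacuous.\<close>

definition interlaced_curves :: "(real \<Rightarrow> real^2) \<Rightarrow> (real \<Rightarrow> real^2) \<Rightarrow> bool" where
  "interlaced_curves \<gamma> \<delta> \<longleftrightarrow>
     (let \<epsilon> = (\<lambda>x. \<delta> x - \<gamma> x) in
      (\<exists>a>0. \<exists>\<theta>. angle_measure \<epsilon> a \<theta>) \<and>
      (\<forall>a>0. \<forall>\<theta>. angle_measure \<epsilon> a \<theta> \<longrightarrow>
         filterlim \<theta> at_top (at_right 0) \<or> filterlim \<theta> at_bot (at_right 0)))"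

definition interlaced ::
  "(nat \<Rightarrow> real list set set) \<Rightarrow> (real^3) set \<Rightarrow> (real^3 \<Rightarrow> real^3) \<Rightarrow>
   (real^3) set \<Rightarrow> (real^3) set \<Rightarrow> bool" where
  "interlaced S W \<xi> \<Gamma> \<Delta> \<longleftrightarrow>
     (\<exists>V X. adapted_chart S W \<xi> V X \<Gamma> \<and> adapted_chart S W \<xi> V X \<Delta> \<and>
       interlaced_curves (chart_curve W \<xi> V X \<Gamma>) (chart_curve W \<xi> V X \<Delta>))"

section \<open>Projections\<close>

definition adapted_projection ::
  "(nat \<Rightarrow> real list set set) \<Rightarrow> (real^3) set \<Rightarrow> (real^3) set \<Rightarrow>
   (real^3) set \<Rightarrow> (real^3 \<Rightarrow> real^2) \<Rightarrow> bool" where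
  "adapted_projection S \<Gamma> \<Delta> U F \<longleftrightarrow>
     open U \<and> definable_map S 2 U (\<lambda>p. coords2 (F p)) \<and>
     C1_on F U \<and> (\<forall>p\<in>U. surj (frechet_derivative F (at p))) \<and>
     (F \<longlongrightarrow> 0) (at 0 within U) \<and>
     same_germ (\<Gamma> \<inter> U) \<Gamma> \<and> same_germ (\<Delta> \<inter> U) \<Delta>"

definition connected_germ_of_intersection ::
  "(real^3) set \<Rightarrow> (real^3 \<Rightarrow> real^3) \<Rightarrow> (real^3) set \<Rightarrow> (real^3) set \<Rightarrow>
   (real^3) set \<Rightarrow> (real^3 \<Rightarrow> real^2) \<Rightarrow> bool" where
  "connected_germ_of_intersection W \<xi> \<Gamma> \<Delta> U F \<longleftrightarrow>
     (\<exists>\<Gamma>' \<Delta>'. representative W \<xi> \<Gamma> \<Gamma>' \<and> \<Gamma>' \<subseteq> U \<and> representative W \<xi> \<Delta> \<Delta>' \<and> \<Delta>' \<subseteq> U \<and>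
       connected (F ` \<Gamma>' \<inter> F ` \<Delta>'))"

end

theory Submission
  imports Defs
begin

text \<open>
  Suppose a projection \<open>(F1, F2)\<close> satisfies \<open>dF1 (\<xi>) \<noteq> 0\<close> along \<open>\<Gamma>\<close>.  Pair each point of \<open>\<Gamma>\<close> with the
  point of \<open>\<Delta>\<close> on the same level of \<open>F1\<close> and follow the difference \<open>w\<close> of the values of \<open>F2\<close>.
  The fibre of the projection through a point \<open>p\<close> of \<open>\<Gamma>\<close> has two sides, and on each of them, near \<open>p\<close>,
  the slope \<open>dF2 (\<xi>) / dF1 (\<xi>)\<close> compares with its value at \<open>p\<close> in one of finitely many ways.
  Regular separation selects one alternative for all small times, on a neighbourhood of radius \<open>t ^ k\<close>,
  and by flatness the point of \<open>\<Delta>\<close> belongs to this neighbourhood.  Hence at its zeros \<open>w\<close> crosses in a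
  direction that depends on the side of \<open>\<Delta>\<close> only.  Two successive zeros cannot be crossed in the same
  direction; and where the slopes are equal, \<open>w\<close> vanishes identically by uniqueness of solutions on a
  level set.  So either the projected curves are disjoint near the origin, or one contains the
  other, or \<open>\<Delta>\<close> visits both sides arbitrarily near the origin.  In the last case some coordinate of
  \<open>\<Delta> - \<Gamma>\<close> in the chart changes sign infinitely often, and the same analysis of the projection to \<open>x\<close>
  and this coordinate shows that the angle turns in a constant direction: the curves are interlaced.

  Conversely, for interlaced curves the projection to \<open>x\<close> and the first of the other coordinates has its
  common points exactly at the zeros of \<open>cos \<theta>\<close>, and these accumulate at the origin without
  filling an interval.
\<close>

section \<open>Definable predicates and maps\<close>

text \<open>Neither trajectory is definable, and only \<Gamma> is assumed to have regular
  separation; a definable function evaluated along \<Delta> might oscillate. Every statement about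
  \<Delta> is therefore a condition on a point \<open>p\<close> of \<Gamma> and on all points within
  some radius of \<open>p\<close>, and \<Delta> enters only because flatness puts it inside. The
  largest admissible radius is a positive definable function of \<open>p\<close>, so along \<Gamma>
  it is at least a power of the clock: this is how regular separation makes a local property
  uniform. For the same reason the zeros of \<open>w\<close> cannot be counted by o-minimality, and
  only the direction of a crossing is controlled; o-minimality itself acts on the fibre through a
  single point. Two further obstacles: regular separation is given in a chart of its own, whose
  clock has to be compared with that of the flat contact; and a representative of a germ may be a
  long trajectory, so in the converse the domain of the projection is cut down until representatives
  stay on a short arc.\<close>

class coord =
  fixes enc :: "'a \<Rightarrow> real list" and cdim :: "'a itself \<Rightarrow> nat"
  assumes inj_enc: "inj enc" and range_enc: "range enc = {v. length v = cdim TYPE('a)}"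

lemma length_enc [simp]: "length (enc (e::'a::coord)) = cdim TYPE('a)"
  using range_enc[where 'a='a] by blast

lemma enc_eq_iff [simp]: "enc x = enc y \<longleftrightarrow> x = (y::'a::coord)"
  using inj_enc[where 'a='a] by (auto dest: injD)

lemma enc_surj: "length v = cdim TYPE('a) \<Longrightarrow> \<exists>e::'a::coord. v = enc e"
  using range_enc[where 'a='a] by blast

instantiation real :: coord
begin
definition "enc (r::real) = [r]"
definition "cdim (_::real itself) = 1"
instance
proof
  show "inj (enc :: real \<Rightarrow> _)" by (auto simp: inj_def enc_real_def)
  show "range (enc :: real \<Rightarrow> _) = {v. length v = cdim TYPE(real)}"
    by (auto simp: enc_real_def cdim_real_def length_Suc_conv)
qed
end

text \<open>A pair is coded by concatenation. With contexts built as nested pairs, binding a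
  variable of type \<open>'b\<close> in a context \<open>'a\<close> means forgetting the last block
  of coordinates.\<close>

instantiation prod :: (coord, coord) coord
begin
definition "enc p = enc (fst p) @ enc (snd p)"
definition "cdim (_::('a\<times>'b) itself) = cdim TYPE('a) + cdim TYPE('b)"
instance
proof
  show "inj (enc :: 'a\<times>'b \<Rightarrow> _)" by (auto simp: inj_def enc_prod_def prod_eq_iff)
  have "\<exists>p::'a\<times>'b. v = enc p" if "length v = cdim TYPE('a) + cdim TYPE('b)" for v
  proof -
    have "length (take (cdim TYPE('a)) v) = cdim TYPE('a)" using that by simp
    then obtain a :: 'a where a: "take (cdim TYPE('a)) v = enc a" using enc_surj by blast
    have "length (drop (cdim TYPE('a)) v) = cdim TYPE('b)" using that by simp
    then obtain b :: 'b where b: "drop (cdim TYPE('a)) v = enc b" using enc_surj by blast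
    have "v = enc (a, b)"
      unfolding enc_prod_def fst_conv snd_conv a[symmetric] b[symmetric] by simp
    then show "\<exists>p::'a\<times>'b. v = enc p" by (rule exI)
  qed
  moreover have "length (enc p) = cdim TYPE('a) + cdim TYPE('b)" for p :: "'a \<times> 'b"
    by (simp add: enc_prod_def)
  ultimately show "range (enc :: 'a\<times>'b \<Rightarrow> _) = {v. length v = cdim TYPE('a\<times>'b)}"
    unfolding cdim_prod_def by blast
qed
end

lemma enc_Pair [simp]: "enc (a, b) = enc a @ enc b"
  by (simp add: enc_prod_def)

definition vec3 :: "real \<times> real \<times> real \<Rightarrow> real^3" where
  "vec3 t = vector [fst t, fst (snd t), snd (snd t)]"

lemma vec3_nth [simp]:
  "vec3 t $ 1 = fst t" "vec3 t $ 2 = fst (snd t)" "vec3 t $ 3 = snd (snd t)"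
  by (simp_all add: vec3_def)

lemma vec3_eta: "vec3 (p $ 1, p $ 2, p $ 3) = p"
  by (simp add: vec_eq_iff forall_3)

lemma ex_vec3: "(\<exists>q. P q) \<longleftrightarrow> (\<exists>t. P (vec3 t))"
  by (metis vec3_eta)

lemma enc_triple: "enc (t :: real \<times> real \<times> real) = coords3 (vec3 t)"
  by (cases t) (simp add: enc_real_def coords3_def)

section \<open>Closure of the structure under rearrangement of coordinates and quantifiers\<close>

context ominimal_real_field
begin

lemma full: "{v. length v = n} \<in> S n"
  using complement[OF empty, of n] by simp

lemma inter:
  assumes "A \<in> S n" "B \<in> S n"
  shows "A \<inter> B \<in> S n"
proof -
  have "A \<inter> B = {v. length v = n} - (({v. length v = n} - A) \<union> ({v. length v = n} - B))"
    using in_power[OF assms(1)] by blast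
  then show ?thesis
    using complement[OF union[OF complement[OF assms(1)] complement[OF assms(2)]]] by simp
qed

lemma cylinder_left_iterated:
  assumes "A \<in> S n"
  shows "{u @ v | u v. length u = m \<and> v \<in> A} \<in> S (m + n)"
proof (induction m)
  case 0
  then show ?case using assms by simp
next
  case (Suc m)
  have "{u @ v | u v. length u = Suc m \<and> v \<in> A} =
        {r # w | r w. w \<in> {u @ v | u v. length u = m \<and> v \<in> A}}" (is "?L = ?R")
  proof
    show "?L \<subseteq> ?R"
    proof
      fix x assume "x \<in> ?L"
      then obtain u v where x: "x = u @ v" "length u = Suc m" "v \<in> A" by blast
      then obtain r u' where "u = r # u'" "length u' = m" by (auto simp: length_Suc_conv)
      with x show "x \<in> ?R" by auto
    qed
    show "?R \<subseteq> ?L"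
    proof
      fix x assume "x \<in> ?R"
      then obtain r u v where "x = r # (u @ v)" "length u = m" "v \<in> A" by blast
      then have "x = (r # u) @ v \<and> length (r # u) = Suc m \<and> v \<in> A" by simp
      then show "x \<in> ?L" by blast
    qed
  qed
  then show ?case using cylinder_left[OF Suc] by simp
qed

lemma projection_iterated: "A \<in> S (n + m) \<Longrightarrow> take n ` A \<in> S n"
proof (induction m arbitrary: A)
  case 0
  then have "take n ` A = A" using in_power[OF 0] by force
  then show ?case using 0 by simp
next
  case (Suc m)
  have B: "butlast ` A \<in> S (n + m)" using projection Suc.prems by simp
  have "take n ` A = take n ` butlast ` A"
  proof -
    have "take n v = take n (butlast v)" if "v \<in> A" for v
    proof -
      have "length v = Suc (n + m)" using in_power[OF Suc.prems] that by auto
      then show ?thesis by (simp add: butlast_conv_take)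
    qed
    then show ?thesis by (auto simp: image_image)
  qed
  then show ?case using Suc.IH[OF B] by simp
qed

lemma diagonals:
  fixes k :: nat
  assumes "\<And>j. j < k \<Longrightarrow> f j < n \<and> g j < n"
  shows "{v. length v = n \<and> (\<forall>j<k. v ! f j = v ! g j)} \<in> S n"
  using assms
proof (induction k)
  case 0
  then show ?case using full by simp
next
  case (Suc k)
  have eq: "{v. length v = n \<and> (\<forall>j<Suc k. v ! f j = v ! g j)} =
      {v. length v = n \<and> (\<forall>j<k. v ! f j = v ! g j)} \<inter> {v. length v = n \<and> v ! f k = v ! g k}"
    by (auto simp: less_Suc_eq)
  show ?case
    unfolding eq
  proof (rule inter)
    show "{v. length v = n \<and> v ! f k = v ! g k} \<in> S n"
      using diagonal[of "f k" n "g k"] Suc.prems by blast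
  qed (use Suc in simp)
qed

text \<open>Append a point of \<open>A\<close> behind \<open>n\<close> free coordinates, force its
  entries by diagonals to equal those listed in \<open>ix\<close>, and project it away. As
  \<open>ix\<close> may permute, repeat or omit indices, this covers every rearrangement of
  variables.\<close>

lemma substitution:
  assumes A: "A \<in> S m" and ix: "length ix = m" "\<And>i. i \<in> set ix \<Longrightarrow> i < n"
  shows "{v. length v = n \<and> map ((!) v) ix \<in> A} \<in> S n"
proof -
  let ?B = "{u @ v | u v. length u = n \<and> v \<in> A}"
  let ?D = "{w. length w = n + m \<and> (\<forall>j<m. w ! (ix ! j) = w ! (n + j))}"
  have D: "?D \<in> S (n + m)"
  proof (rule diagonals)
    fix j assume j: "j < m"
    then have "ix ! j \<in> set ix" using ix by simp
    then show "ix ! j < n + m \<and> n + j < n + m" using ix(2) j by fastforce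
  qed
  have BD: "take n ` (?B \<inter> ?D) \<in> S n"
    by (intro projection_iterated[of _ n m] inter D cylinder_left_iterated A)
  have "take n ` (?B \<inter> ?D) = {v. length v = n \<and> map ((!) v) ix \<in> A}" (is "?L = ?R")
  proof
    show "?L \<subseteq> ?R"
    proof
      fix x assume "x \<in> ?L"
      then obtain u v where u: "x = u" "length u = n" "v \<in> A" "u @ v \<in> ?D" by force
      have lv: "length v = m" using in_power[OF A] u by auto
      have "map ((!) u) ix = v"
      proof (rule nth_equalityI)
        show "length (map ((!) u) ix) = length v" using ix lv by simp
        fix j assume "j < length (map ((!) u) ix)"
        then have j: "j < m" using ix by simp
        have "ix ! j < n" using ix j nth_mem by blast
        then have "u ! (ix ! j) = (u @ v) ! (ix ! j)" using u by (simp add: nth_append)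
        also have "\<dots> = (u @ v) ! (n + j)" using u j by blast
        also have "\<dots> = v ! j" using u by (simp add: nth_append)
        finally show "map ((!) u) ix ! j = v ! j" using j ix by simp
      qed
      then show "x \<in> ?R" using u by simp
    qed
    show "?R \<subseteq> ?L"
    proof
      fix x assume x: "x \<in> ?R"
      let ?w = "x @ map ((!) x) ix"
      have "ix ! j < n" if "j < m" for j using ix that nth_mem by blast
      then have "?w \<in> ?B \<inter> ?D" using x ix by (auto simp: nth_append)
      moreover have "take n ?w = x" using x by simp
      ultimately show "x \<in> ?L" by (intro image_eqI[of x _ ?w]) simp_all
    qed
  qed
  then show ?thesis using BD by simp
qed

text \<open>Definability is transported to predicates and maps on tuples, so that the closure properties
  become introduction rules that follow the syntax of a formula.\<close>

definition dp :: "('a::coord \<Rightarrow> bool) \<Rightarrow> bool" where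
  "dp P \<longleftrightarrow> enc ` Collect P \<in> S (cdim TYPE('a))"

definition dm :: "('a::coord \<Rightarrow> 'b::coord) \<Rightarrow> bool" where
  "dm f \<longleftrightarrow> dp (\<lambda>z. snd z = f (fst z))"

lemma dp_not: assumes "dp P" shows "dp (\<lambda>e. \<not> P e)"
proof -
  have "enc ` {e::'a. \<not> P e} = range (enc :: 'a \<Rightarrow> _) - enc ` Collect P"
    by auto
  then show ?thesis
    using complement[OF assms[unfolded dp_def]] unfolding dp_def range_enc by simp
qed

lemma dp_or: assumes "dp P" "dp Q" shows "dp (\<lambda>e. P e \<or> Q e)"
  using union[OF assms[unfolded dp_def]] unfolding dp_def
  by (simp add: image_Un[symmetric] Collect_disj_eq)

lemma dp_and: assumes "dp P" "dp Q" shows "dp (\<lambda>e. P e \<and> Q e)"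
proof -
  have "dp (\<lambda>e. \<not> (\<not> P e \<or> \<not> Q e))"
    by (intro dp_not dp_or assms)
  then show ?thesis by simp
qed

lemma dp_imp: assumes "dp P" "dp Q" shows "dp (\<lambda>e. P e \<longrightarrow> Q e)"
  unfolding imp_conv_disj by (intro dp_not dp_or assms)

lemma dp_iff: assumes "dp P" "dp Q" shows "dp (\<lambda>e. P e \<longleftrightarrow> Q e)"
  unfolding iff_conv_conj_imp by (intro dp_and dp_imp assms)

lemma dp_ex:
  assumes "dp (\<lambda>z::'a::coord \<times> 'b::coord. P (fst z) (snd z))"
  shows "dp (\<lambda>e. \<exists>y. P e y)"
proof -
  let ?A = "enc ` {z::'a \<times> 'b. P (fst z) (snd z)}"
  have "take (cdim TYPE('a)) ` ?A = enc ` {e. \<exists>y. P e y}"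
  proof -
    have "take (cdim TYPE('a)) (enc z) = enc (fst z)" for z :: "'a \<times> 'b"
      by (cases z) simp
    then have "take (cdim TYPE('a)) ` ?A = (\<lambda>z. enc (fst z)) ` {z::'a \<times> 'b. P (fst z) (snd z)}"
      by (simp only: image_image)
    also have "\<dots> = enc ` {e. \<exists>y. P e y}"
    proof (intro equalityI subsetI)
      fix v assume "v \<in> enc ` {e. \<exists>y. P e y}"
      then obtain e y where "v = enc e" "P e y" by blast
      then show "v \<in> (\<lambda>z. enc (fst z)) ` {z::'a \<times> 'b. P (fst z) (snd z)}"
        by (intro image_eqI[of _ _ "(e, y)"]) simp_all
    qed auto
    finally show ?thesis .
  qed
  moreover have "take (cdim TYPE('a)) ` ?A \<in> S (cdim TYPE('a))"
    using assms unfolding dp_def cdim_prod_def by (rule projection_iterated)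
  ultimately show ?thesis unfolding dp_def by simp
qed

lemma dp_all:
  assumes "dp (\<lambda>z::'a::coord \<times> 'b::coord. P (fst z) (snd z))"
  shows "dp (\<lambda>e. \<forall>y. P e y)"
proof -
  have "dp (\<lambda>e. \<not> (\<exists>q. \<not> P e q))"
    by (rule dp_not, rule dp_ex, rule dp_not, rule assms)
  then show ?thesis by simp
qed

text \<open>Pure rearrangements of coordinates, reached by substitution alone. They come before
  general definable maps because composing such maps already requires moving variables into a larger
  context.\<close>

definition coordinate_map :: "('a::coord \<Rightarrow> 'b::coord) \<Rightarrow> bool" where
  "coordinate_map f \<longleftrightarrow> (\<exists>ix. (\<forall>i\<in>set ix. i < cdim TYPE('a)) \<and>
     (\<forall>e. enc (f e) = map ((!) (enc e)) ix))"

lemma coordinate_map_fst: "coordinate_map (fst :: 'a::coord \<times> 'b::coord \<Rightarrow> 'a)"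
  unfolding coordinate_map_def
  by (rule exI[of _ "[0..<cdim TYPE('a)]"])
    (auto simp: cdim_prod_def enc_prod_def nth_append intro!: nth_equalityI)

lemma coordinate_map_snd: "coordinate_map (snd :: 'a::coord \<times> 'b::coord \<Rightarrow> 'b)"
  unfolding coordinate_map_def
  by (rule exI[of _ "[cdim TYPE('a)..<cdim TYPE('a) + cdim TYPE('b)]"])
    (auto simp: cdim_prod_def enc_prod_def nth_append intro!: nth_equalityI)

lemma coordinate_map_Pair:
  assumes "coordinate_map f" "coordinate_map g"
  shows "coordinate_map (\<lambda>e. (f e, g e))"
proof -
  obtain ix js where ix: "\<forall>i\<in>set ix. i < cdim TYPE('a)" "\<And>e. enc (f e) = map ((!) (enc e)) ix"
    and js: "\<forall>i\<in>set js. i < cdim TYPE('a)" "\<And>e. enc (g e) = map ((!) (enc e)) js"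
    using assms unfolding coordinate_map_def by metis
  show ?thesis
    unfolding coordinate_map_def
    by (rule exI[of _ "ix @ js"]) (use ix js in auto)
qed

lemma coordinate_map_comp:
  assumes "coordinate_map g" "coordinate_map f"
  shows "coordinate_map (\<lambda>e. g (f e))"
proof -
  obtain ix js where ix: "\<forall>i\<in>set ix. i < cdim TYPE('c)" "\<And>e. enc (f e) = map ((!) (enc e)) ix"
    and js: "\<forall>i\<in>set js. i < cdim TYPE('a)" "\<And>e. enc (g e) = map ((!) (enc e)) js"
    using assms unfolding coordinate_map_def by metis
  have li: "length ix = cdim TYPE('a)"
    using arg_cong[OF ix(2), of length] by simp
  show ?thesis
    unfolding coordinate_map_def
    by (rule exI[of _ "map ((!) ix) js"]) (use ix js li in auto)
qed

lemma dp_coordinate_map: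
  assumes f: "coordinate_map (f :: 'a::coord \<Rightarrow> 'b::coord)" and P: "dp P"
  shows "dp (\<lambda>e. P (f e))"
proof -
  obtain ix where ix: "\<And>i. i \<in> set ix \<Longrightarrow> i < cdim TYPE('a)" "\<And>e. enc (f e) = map ((!) (enc e)) ix"
    using f unfolding coordinate_map_def by metis
  have li: "length ix = cdim TYPE('b)"
    using arg_cong[OF ix(2), of length] by simp
  have eq: "{v. length v = cdim TYPE('a) \<and> map ((!) v) ix \<in> enc ` Collect P} = enc ` {e. P (f e)}"
    (is "?L = ?R")
  proof
    have *: "map ((!) (enc e)) ix \<in> enc ` Collect P \<longleftrightarrow> P (f e)" for e
      unfolding ix(2)[symmetric] by (simp add: inj_image_mem_iff[OF inj_enc])
    show "?L \<subseteq> ?R"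
    proof
      fix v assume v: "v \<in> ?L"
      then obtain e :: 'a where "v = enc e" using enc_surj by blast
      then show "v \<in> ?R" using v * by simp
    qed
    show "?R \<subseteq> ?L" using * by auto
  qed
  show ?thesis
    using substitution[OF P[unfolded dp_def] li ix(1)] unfolding dp_def eq by simp
qed

lemma dm_coordinate_map:
  assumes f: "coordinate_map (f :: 'a::coord \<Rightarrow> 'b::coord)"
  shows "dm f"
proof -
  obtain ix where ix: "\<And>i. i \<in> set ix \<Longrightarrow> i < cdim TYPE('a)" "\<And>e. enc (f e) = map ((!) (enc e)) ix"
    using f unfolding coordinate_map_def by metis
  have li: "length ix = cdim TYPE('b)"
    using arg_cong[OF ix(2), of length] by simp
  let ?a = "cdim TYPE('a)" and ?b = "cdim TYPE('b)"
  have isj: "ix ! j < ?a" if "j < ?b" for j using ix(1) li that nth_mem by metis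
  have "{v. length v = ?a + ?b \<and> (\<forall>j<?b. v ! (ix ! j) = v ! (?a + j))} \<in> S (?a + ?b)"
    by (rule diagonals) (use isj in force)
  moreover have "{v. length v = ?a + ?b \<and> (\<forall>j<?b. v ! (ix ! j) = v ! (?a + j))} =
      enc ` {z. snd z = f (fst z)}" (is "?L = ?R")
  proof -
    have *: "(\<forall>j<?b. enc z ! (ix ! j) = enc z ! (?a + j)) \<longleftrightarrow> snd z = f (fst z)" for z :: "'a \<times> 'b"
    proof -
      have "(\<forall>j<?b. enc z ! (ix ! j) = enc z ! (?a + j)) \<longleftrightarrow>
        (\<forall>j<?b. map ((!) (enc (fst z))) ix ! j = enc (snd z) ! j)"
        using isj li by (auto simp: enc_prod_def nth_append)
      also have "\<dots> \<longleftrightarrow> map ((!) (enc (fst z))) ix = enc (snd z)"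
        using li by (auto simp: list_eq_iff_nth_eq)
      also have "\<dots> \<longleftrightarrow> snd z = f (fst z)"
        unfolding ix(2)[symmetric] enc_eq_iff by (rule eq_commute)
      finally show ?thesis .
    qed
    show ?thesis
    proof
      show "?L \<subseteq> ?R"
      proof
        fix v assume v: "v \<in> ?L"
        then obtain z :: "'a \<times> 'b" where "v = enc z"
          using enc_surj[where 'a="'a \<times> 'b", of v] by (auto simp: cdim_prod_def)
        then show "v \<in> ?R" using v * by auto
      qed
      have "length (enc z) = ?a + ?b" for z :: "'a \<times> 'b" by (simp add: cdim_prod_def)
      then show "?R \<subseteq> ?L" using * by blast
    qed
  qed
  ultimately show ?thesis unfolding dm_def dp_def cdim_prod_def by simp
qed

lemmas dp_fst = dp_coordinate_map[OF coordinate_map_fst]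
lemmas dp_snd = dp_coordinate_map[OF coordinate_map_snd]

text \<open>The value of \<open>f\<close> becomes a new variable, constrained to the graph and then
  projected away.\<close>

lemma dp_map:
  assumes f: "dm (f :: 'a::coord \<Rightarrow> 'b::coord)" and P: "dp P"
  shows "dp (\<lambda>e. P (f e))"
proof -
  have "dp (\<lambda>e. \<exists>y. y = f e \<and> P y)"
    by (intro dp_ex dp_and f[unfolded dm_def] dp_snd P)
  then show ?thesis by simp
qed

lemma dm_id: "dm (\<lambda>e. e)"
proof -
  have "coordinate_map (\<lambda>e::'a. e)"
    unfolding coordinate_map_def
    by (rule exI[of _ "[0..<cdim TYPE('a)]"]) (auto intro!: nth_equalityI)
  then show ?thesis by (rule dm_coordinate_map)
qed

lemmas coordinate_map_projections = coordinate_map_fst coordinate_map_snd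
  coordinate_map_comp[OF coordinate_map_fst coordinate_map_fst]
  coordinate_map_comp[OF coordinate_map_snd coordinate_map_fst]
  coordinate_map_comp[OF coordinate_map_fst coordinate_map_snd]
  coordinate_map_comp[OF coordinate_map_snd coordinate_map_snd]

lemma dm_Pair:
  assumes "dm (f :: 'a::coord \<Rightarrow> 'b::coord)" "dm (g :: 'a \<Rightarrow> 'c::coord)"
  shows "dm (\<lambda>e. (f e, g e))"
proof -
  have 1: "coordinate_map (\<lambda>z::'a \<times> 'b \<times> 'c. (fst z, fst (snd z)))"
    "coordinate_map (\<lambda>z::'a \<times> 'b \<times> 'c. (fst z, snd (snd z)))"
    by (rule coordinate_map_Pair; rule coordinate_map_projections)+
  have "dp (\<lambda>z::'a \<times> 'b \<times> 'c. fst (snd z) = f (fst z) \<and> snd (snd z) = g (fst z))"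
    using dp_coordinate_map[OF 1(1) assms(1)[unfolded dm_def]]
      dp_coordinate_map[OF 1(2) assms(2)[unfolded dm_def]] by (auto intro!: dp_and)
  then show ?thesis unfolding dm_def by (simp add: prod_eq_iff)
qed

lemma dm_comp:
  assumes "dm (g :: 'b::coord \<Rightarrow> 'c::coord)" "dm (f :: 'a::coord \<Rightarrow> 'b)"
  shows "dm (\<lambda>e. g (f e))"
proof -
  have 1: "coordinate_map (\<lambda>w::('a \<times> 'c) \<times> 'b. (fst (fst w), snd w))"
    "coordinate_map (\<lambda>w::('a \<times> 'c) \<times> 'b. (snd w, snd (fst w)))"
    by (rule coordinate_map_Pair; rule coordinate_map_projections)+
  have "dp (\<lambda>u::'a \<times> 'c. \<exists>y. y = f (fst u) \<and> snd u = g y)"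
    using dp_coordinate_map[OF 1(1) assms(2)[unfolded dm_def]]
      dp_coordinate_map[OF 1(2) assms(1)[unfolded dm_def]] by (intro dp_ex dp_and) simp_all
  then show ?thesis unfolding dm_def by simp
qed

lemma dm_fst: "dm f \<Longrightarrow> dm (\<lambda>e. fst (f e))"
  by (rule dm_comp[OF dm_coordinate_map[OF coordinate_map_fst]])

lemma dm_snd: "dm f \<Longrightarrow> dm (\<lambda>e. snd (f e))"
  by (rule dm_comp[OF dm_coordinate_map[OF coordinate_map_snd]])

section \<open>Real arithmetic and order\<close>

lemma dp_real_interval:
  assumes "is_interval A"
  shows "dp (\<lambda>x::real. x \<in> A)"
proof -
  \<comment> \<open>This direction of the o-minimality axiom provides the parameters, as singletons,
    and the order, through the ray of positive numbers.\<close>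
  have "(\<lambda>r. [r]) ` \<Union>{A} \<in> S 1"
    using assms ominimal by blast
  then show ?thesis by (simp add: dp_def enc_real_def cdim_real_def)
qed

lemma dm_const: "dm (\<lambda>e. c::real)"
proof -
  have "dp (\<lambda>x::real. x \<in> {c})" by (rule dp_real_interval) (simp add: is_interval_1)
  then show ?thesis unfolding dm_def by (auto intro: dp_snd)
qed

lemma dm_add_pair: "dm (\<lambda>z::real \<times> real. fst z + snd z)"
proof -
  have "enc ` {z::(real \<times> real) \<times> real. snd z = fst (fst z) + snd (fst z)} = {[x, y, x + y] | x y. True}"
    by (auto simp: enc_prod_def enc_real_def image_iff)
  then show ?thesis
    using addition unfolding dm_def dp_def by (simp add: cdim_prod_def cdim_real_def numeral_3_eq_3)
qed

lemma dm_mult_pair: "dm (\<lambda>z::real \<times> real. fst z * snd z)"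
proof -
  have "enc ` {z::(real \<times> real) \<times> real. snd z = fst (fst z) * snd (fst z)} = {[x, y, x * y] | x y. True}"
    by (auto simp: enc_prod_def enc_real_def image_iff)
  then show ?thesis
    using multiplication unfolding dm_def dp_def by (simp add: cdim_prod_def cdim_real_def numeral_3_eq_3)
qed

lemma dm_add: "dm (f :: _ \<Rightarrow> real) \<Longrightarrow> dm g \<Longrightarrow> dm (\<lambda>e. f e + g e)"
  using dm_comp[OF dm_add_pair, of "\<lambda>e. (f e, g e)"] dm_Pair[of f g] by simp

lemma dm_mult: "dm (f :: _ \<Rightarrow> real) \<Longrightarrow> dm g \<Longrightarrow> dm (\<lambda>e. f e * g e)"
  using dm_comp[OF dm_mult_pair, of "\<lambda>e. (f e, g e)"] dm_Pair[of f g] by simp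

lemma dm_uminus: "dm (f :: _ \<Rightarrow> real) \<Longrightarrow> dm (\<lambda>e. - f e)"
  using dm_mult[of "\<lambda>e. -1" f] dm_const[of "-1"] by simp

lemma dm_diff: "dm (f :: _ \<Rightarrow> real) \<Longrightarrow> dm g \<Longrightarrow> dm (\<lambda>e. f e - g e)"
  using dm_add[of f "\<lambda>e. - g e"] dm_uminus[of g] by simp

lemma dm_power: "dm (f :: _ \<Rightarrow> real) \<Longrightarrow> dm (\<lambda>e. f e ^ n)"
  by (induction n) (simp_all add: dm_const dm_mult)

lemma dp_eq0: "dm (f :: _ \<Rightarrow> real) \<Longrightarrow> dp (\<lambda>e. f e = 0)"
  using dp_map[of f "\<lambda>x. x \<in> {0}"] dp_real_interval[of "{0}"] by (simp add: is_interval_1)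

lemma dp_eq: "dm (f :: _ \<Rightarrow> real) \<Longrightarrow> dm g \<Longrightarrow> dp (\<lambda>e. f e = g e)"
  using dp_eq0[of "\<lambda>e. f e - g e"] dm_diff[of f g] by simp

lemma dp_less: "dm (f :: _ \<Rightarrow> real) \<Longrightarrow> dm g \<Longrightarrow> dp (\<lambda>e. f e < g e)"
  using dp_map[of "\<lambda>e. g e - f e" "\<lambda>x. x \<in> {0<..}"] dp_real_interval[of "{0<..}"]
  by (simp add: dm_diff is_interval_1)

lemma dp_le: "dm (f :: _ \<Rightarrow> real) \<Longrightarrow> dm g \<Longrightarrow> dp (\<lambda>e. f e \<le> g e)"
  unfolding not_less[symmetric] by (intro dp_not dp_less)

lemma dm_if:
  assumes "dp P" "dm f" "dm g"
  shows "dm (\<lambda>e. if P e then f e else g e)"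
proof -
  have "dp (\<lambda>z. (P (fst z) \<and> snd z = f (fst z)) \<or> (\<not> P (fst z) \<and> snd z = g (fst z)))"
    by (intro dp_or dp_and dp_not dp_fst assms(1) assms(2,3)[unfolded dm_def])
  moreover have "(\<lambda>z. (P (fst z) \<and> snd z = f (fst z)) \<or> (\<not> P (fst z) \<and> snd z = g (fst z)))
      = (\<lambda>z. snd z = (if P (fst z) then f (fst z) else g (fst z)))" by auto
  ultimately show ?thesis unfolding dm_def by simp
qed

lemma dm_abs: "dm (f :: _ \<Rightarrow> real) \<Longrightarrow> dm (\<lambda>e. \<bar>f e\<bar>)"
  unfolding abs_if by (intro dm_if dp_less dm_const dm_uminus)

text \<open>Definition by a formula with exactly one solution. Quotients, derivatives, suprema and
  inverse charts all enter through this rule.\<close>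

lemma dm_unique:
  assumes "dp (\<lambda>z. Q (fst z) (snd z))" "\<And>e y. Q e y \<longleftrightarrow> y = f e"
  shows "dm f"
  using assms unfolding dm_def by simp

lemma dm_divide:
  assumes "dm (f :: _ \<Rightarrow> real)" "dm g"
  shows "dm (\<lambda>e. f e / g e)"
proof (rule dm_unique)
  \<comment> \<open>The second alternative is the convention that a quotient by zero is zero; it
    makes division a total map.\<close>
  show "dp (\<lambda>z. (g (fst z) \<noteq> 0 \<and> snd z * g (fst z) = f (fst z)) \<or> (g (fst z) = 0 \<and> snd z = 0))"
    by (intro dp_or dp_and dp_not dp_eq dm_mult dm_const dm_snd dm_id
        dm_comp[OF assms(1)] dm_comp[OF assms(2)] dm_fst)
qed (auto simp: field_simps)

text \<open>Points of the space are handled through their coordinates: \<open>dv\<close> and \<open>df\<close> are definability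
  of a map into and of a total function on \<^typ>\<open>real^3\<close>.\<close>

definition dv :: "('a::coord \<Rightarrow> real^3) \<Rightarrow> bool" where
  "dv g \<longleftrightarrow> dm (\<lambda>e. g e $ 1) \<and> dm (\<lambda>e. g e $ 2) \<and> dm (\<lambda>e. g e $ 3)"

definition df :: "(real^3 \<Rightarrow> real) \<Rightarrow> bool" where
  "df f \<longleftrightarrow> dm (\<lambda>t. f (vec3 t))"

definition ds :: "(real^3) set \<Rightarrow> bool" where
  "ds A \<longleftrightarrow> dp (\<lambda>t. vec3 t \<in> A)"

lemma dv_triple: "dv g \<Longrightarrow> dm (\<lambda>e. (g e $ 1, g e $ 2, g e $ 3))"
  unfolding dv_def by (intro dm_Pair) auto

lemma dm_df: assumes "df f" "dv g" shows "dm (\<lambda>e. f (g e))"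
  using dm_comp[OF assms(1)[unfolded df_def] dv_triple[OF assms(2)]] by (simp add: vec3_eta)

lemma dp_ds: assumes "ds A" "dv g" shows "dp (\<lambda>e. g e \<in> A)"
  using dp_map[OF dv_triple[OF assms(2)] assms(1)[unfolded ds_def]] by (simp add: vec3_eta)

lemma dv_vec3: "dm f \<Longrightarrow> dv (\<lambda>e. vec3 (f e))"
  unfolding dv_def vec3_nth by (intro conjI dm_fst dm_snd)

lemma dv_add: "dv f \<Longrightarrow> dv g \<Longrightarrow> dv (\<lambda>e. f e + g e)"
  unfolding dv_def by (auto intro!: dm_add)

lemma dv_diff: "dv f \<Longrightarrow> dv g \<Longrightarrow> dv (\<lambda>e. f e - g e)"
  unfolding dv_def by (auto intro!: dm_diff)

lemma dv_scaleR: "dm c \<Longrightarrow> dv g \<Longrightarrow> dv (\<lambda>e. c e *\<^sub>R g e)"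
  unfolding dv_def by (auto intro!: dm_mult)

lemma dm_nth: "dv g \<Longrightarrow> dm (\<lambda>e. g e $ i)"
  using exhaust_3[of i] unfolding dv_def by auto

lemma dv_const: "dv (\<lambda>e. c)"
  unfolding dv_def by (auto intro!: dm_const)

lemma dp_eq_vec: "dv f \<Longrightarrow> dv g \<Longrightarrow> dp (\<lambda>e. f e = g e)"
  unfolding vec_eq_iff forall_3 by (intro dp_and dp_eq dm_nth)

lemma dp_ex_vec:
  assumes "dp (\<lambda>z::'a::coord \<times> real \<times> real \<times> real. P (fst z) (vec3 (snd z)))"
  shows "dp (\<lambda>e. \<exists>q. P e q)"
  unfolding ex_vec3 using assms by (rule dp_ex)

lemma dp_all_vec:
  assumes "dp (\<lambda>z::'a::coord \<times> real \<times> real \<times> real. P (fst z) (vec3 (snd z)))"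
  shows "dp (\<lambda>e. \<forall>q. P e q)"
proof -
  have "dp (\<lambda>e. \<not> (\<exists>q. \<not> P e q))"
    by (rule dp_not, rule dp_ex_vec, rule dp_not, rule assms)
  then show ?thesis by simp
qed

text \<open>Squaring replaces the norm by a polynomial, so that the formula uses ring operations and
  the order only.\<close>

lemma dp_norm_less:
  assumes "dv f" "dm r"
  shows "dp (\<lambda>e. norm (f e) < r e)"
proof -
  have "norm (v::real^3) < s \<longleftrightarrow> 0 < s \<and> v$1 * v$1 + v$2 * v$2 + v$3 * v$3 < s * s" for v s
  proof -
    have "norm v < s \<longleftrightarrow> 0 < s \<and> (norm v)\<^sup>2 < s\<^sup>2"
      using power2_less_imp_less[of "norm v" s] power_strict_mono[of "norm v" s 2] norm_ge_zero[of v]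
      by (smt (verit) zero_less_numeral)
    then show ?thesis
      unfolding power2_norm_eq_inner by (simp add: inner_vec_def sum_3 power2_eq_square)
  qed
  then show ?thesis
    by (simp only:) (intro dp_and dp_less dm_const dm_add dm_mult dm_nth assms)
qed

lemmas d_intros = dp_and dp_or dp_imp dp_not dp_iff dp_ex_vec dp_all_vec dp_ex dp_all dp_norm_less
  dp_eq_vec dp_eq dp_less dp_le dm_add dm_mult dm_diff dm_uminus dm_divide dm_abs dm_power dm_const dm_fst dm_snd
  dv_vec3 dv_add dv_diff dv_scaleR dv_const dm_nth dm_id

end

section \<open>Partial maps as total functions, and the passage from the list encoding\<close>

definition ext :: "'a set \<Rightarrow> ('a \<Rightarrow> real) \<Rightarrow> 'a \<Rightarrow> real" where
  "ext U f p = (if p \<in> U then f p else 0)"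

context ominimal_real_field
begin

text \<open>The bridge from lists to predicates on tuples: \<open>h\<close> is the typed map whose
  code is the list-valued \<open>g\<close>.\<close>

lemma definable_map_iff:
  assumes "cdim TYPE('c::coord) = m" "\<And>p. g p = enc (h p :: 'c)"
  shows "definable_map S m U g \<longleftrightarrow> dp (\<lambda>z. vec3 (fst z) \<in> U \<and> snd z = h (vec3 (fst z)))"
proof -
  have "enc ` {z. vec3 (fst z) \<in> U \<and> snd z = h (vec3 (fst z))} = (\<lambda>p. coords3 p @ g p) ` U"
    (is "?L = ?R")
  proof
    show "?L \<subseteq> ?R" by (auto simp: enc_prod_def[of "(_, h _)"] enc_triple assms(2) simp del: enc_Pair)
    show "?R \<subseteq> ?L"
    proof
      fix v assume "v \<in> ?R"
      then obtain p where p: "p \<in> U" "v = coords3 p @ g p" by blast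
      then have "v = enc ((p $ 1, p $ 2, p $ 3), h p)"
        by (simp only: enc_Pair assms(2)) (simp add: coords3_def enc_real_def)
      then show "v \<in> ?L" using p by (intro image_eqI[of _ _ "((p $ 1, p $ 2, p $ 3), h p)"]) (simp_all add: vec3_eta)
    qed
  qed
  then show ?thesis
    unfolding definable_map_def dp_def
    by (simp add: cdim_prod_def cdim_real_def assms(1)[symmetric] numeral_3_eq_3)
qed

lemma ds_domain:
  assumes "dp (\<lambda>z. vec3 (fst z) \<in> U \<and> snd z = h (vec3 (fst z)))"
  shows "ds U"
  using dp_ex[of "\<lambda>t y. vec3 t \<in> U \<and> y = h (vec3 t)"] assms unfolding ds_def by simp

text \<open>A definable map is given through the graph of all its components at once;
  \<open>k\<close> extracts one of them, and the extension by zero makes it total.\<close>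

lemma df_ext:
  assumes "dp (\<lambda>z. vec3 (fst z) \<in> U \<and> snd z = h (vec3 (fst z)))" "dm k"
  shows "df (ext U (\<lambda>p. k (h p)))"
  unfolding df_def
proof (rule dm_unique)
  have dU: "dp (\<lambda>t. vec3 t \<in> U)" using ds_domain[OF assms(1)] unfolding ds_def .
  have "dp (\<lambda>w. vec3 (fst (fst w)) \<in> U \<and> snd w = h (vec3 (fst (fst w))))"
    using dp_map[OF _ assms(1), of "\<lambda>w. (fst (fst w), snd w)"] by (simp add: dm_Pair dm_fst dm_snd dm_id)
  note graph = this
  have "dp (\<lambda>z. \<exists>y. (vec3 (fst z) \<in> U \<and> y = h (vec3 (fst z))) \<and> snd z = k y)"
    by (rule dp_ex, rule dp_and, rule graph) (intro dp_eq dm_snd dm_fst dm_id dm_comp[OF assms(2)])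
  then show "dp (\<lambda>z. (\<exists>y. (vec3 (fst z) \<in> U \<and> y = h (vec3 (fst z))) \<and> snd z = k y) \<or>
      (vec3 (fst z) \<notin> U \<and> snd z = 0))"
    by (intro dp_or dp_and dp_not dp_map[OF _ dU] dp_eq dm_snd dm_fst dm_const dm_id)
qed (auto simp: ext_def)

lemma ds_Int: "ds A \<Longrightarrow> ds B \<Longrightarrow> ds (A \<inter> B)"
  unfolding ds_def by (auto intro: dp_and)

lemma df_ext_map3:
  assumes "definable_map S 3 U (\<lambda>p. coords3 (g p))"
  shows "ds U" "df (ext U (\<lambda>p. g p $ i))"
proof -
  let ?h = "\<lambda>p. (g p $ 1, g p $ 2, g p $ 3)"
  have "dp (\<lambda>z. vec3 (fst z) \<in> U \<and> snd z = ?h (vec3 (fst z)))"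
    using assms by (subst (asm) definable_map_iff[where h="?h"])
      (auto simp: cdim_prod_def cdim_real_def coords3_def enc_real_def)
  note * = ds_domain[OF this] df_ext[OF this]
  show "ds U" by (rule *)
  show "df (ext U (\<lambda>p. g p $ i))"
    using exhaust_3[of i] *(2)[of fst] *(2)[of "\<lambda>t. fst (snd t)"] *(2)[of "\<lambda>t. snd (snd t)"]
      dm_fst[OF dm_id] dm_snd[OF dm_id] dm_fst[OF dm_snd[OF dm_id]] dm_snd[OF dm_snd[OF dm_id]]
    by auto
qed

lemma df_ext_map2:
  assumes "definable_map S 2 U (\<lambda>p. coords2 (g p))"
  shows "ds U" "df (ext U (\<lambda>p. g p $ i))"
proof -
  let ?h = "\<lambda>p. (g p $ 1, g p $ 2)"
  have "dp (\<lambda>z. vec3 (fst z) \<in> U \<and> snd z = ?h (vec3 (fst z)))"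
    using assms by (subst (asm) definable_map_iff[where h="?h"])
      (auto simp: cdim_prod_def cdim_real_def coords2_def enc_real_def)
  note * = ds_domain[OF this] df_ext[OF this]
  show "ds U" by (rule *)
  show "df (ext U (\<lambda>p. g p $ i))"
    using exhaust_2[of i] *(2)[of fst] *(2)[of snd]
      dm_fst[OF dm_id] dm_snd[OF dm_id] dm_fst[OF dm_snd[OF dm_id]] dm_snd[OF dm_snd[OF dm_id]]
    by auto
qed

lemma definable_map2I:
  assumes "ds U" "\<And>i. df (f i)" "\<And>p i. p \<in> U \<Longrightarrow> f i p = g p $ i"
  shows "definable_map S 2 U (\<lambda>p. coords2 (g p))"
proof -
  let ?h = "\<lambda>p. (g p $ 1, g p $ 2)"
  have "dp (\<lambda>z. vec3 (fst z) \<in> U \<and> fst (snd z) = f 1 (vec3 (fst z)) \<and> snd (snd z) = f 2 (vec3 (fst z)))"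
    by (intro dp_and dp_ds assms(1) dp_eq dm_df assms(2) dv_vec3 d_intros)
  moreover have "(\<lambda>z. vec3 (fst z) \<in> U \<and> fst (snd z) = f 1 (vec3 (fst z)) \<and> snd (snd z) = f 2 (vec3 (fst z)))
      = (\<lambda>z. vec3 (fst z) \<in> U \<and> snd z = ?h (vec3 (fst z)))"
    using assms(3) by (auto simp: fun_eq_iff)
  ultimately show ?thesis
    by (subst definable_map_iff[where h="?h"])
      (auto simp: cdim_prod_def cdim_real_def coords2_def enc_real_def)
qed

lemma definable_map1I:
  assumes "df f"
  shows "definable_map S 1 UNIV (\<lambda>p. [f p])"
  using assms unfolding df_def dm_def
  by (subst definable_map_iff[where h=f]) (auto simp: cdim_real_def enc_real_def)

text \<open>The tameness half of o-minimality: a definable set of reals is a finite union of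
  intervals, and each interval, being convex, contains or misses a right neighbourhood of
  \<open>a\<close>.\<close>

lemma dp_eventually_at_right:
  assumes "dp (P :: real \<Rightarrow> bool)"
  shows "(\<forall>\<^sub>F x in at_right a. P x) \<or> (\<forall>\<^sub>F x in at_right a. \<not> P x)"
proof -
  have "enc ` Collect P \<in> S 1" using assms unfolding dp_def by (simp add: cdim_real_def)
  then obtain \<I> where I: "finite \<I>" "\<forall>I\<in>\<I>. is_interval I" "enc ` Collect P = (\<lambda>r. [r]) ` \<Union>\<I>"
    using ominimal by metis
  have "inj (\<lambda>r::real. [r])" by (simp add: inj_def)
  then have P: "Collect P = \<Union>\<I>"
    using I(3) by (simp add: enc_real_def[abs_def] inj_image_eq_iff)
  have one: "(\<forall>\<^sub>F x in at_right a. x \<in> I) \<or> (\<forall>\<^sub>F x in at_right a. x \<notin> I)" if "is_interval I" for I :: "real set"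
  \<comment> \<open>In the first case \<open>I\<close> has points arbitrarily close to
    \<open>a\<close> on its right, and convexity fills everything up to \<open>u\<close>.\<close>
  proof (cases "\<exists>u\<in>I. u > a \<and> (\<forall>v. a < v \<and> v < u \<longrightarrow> (\<exists>w\<in>I. w < v \<and> w > a))")
    case True
    then obtain u where u: "u \<in> I" "u > a" "\<And>v. a < v \<Longrightarrow> v < u \<Longrightarrow> \<exists>w\<in>I. w < v \<and> w > a" by blast
    have "\<forall>\<^sub>F x in at_right a. x \<in> {a<..<u}" using u(2) by (rule eventually_at_right_real)
    then have "\<forall>\<^sub>F x in at_right a. x \<in> I"
    proof eventually_elim
      case (elim x)
      then obtain w where "w \<in> I" "w < x" using u(3) by auto
      show ?case using mem_is_interval_1_I[OF that \<open>w \<in> I\<close> u(1)] \<open>w < x\<close> elim by simp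
    qed
    then show ?thesis ..
  next
    case False
    show ?thesis
    proof (cases "\<exists>u\<in>I. u > a")
      case True
      then obtain u where u: "u \<in> I" "u > a" by blast
      with False obtain v where v: "a < v" "v < u" "\<And>w. w \<in> I \<Longrightarrow> \<not> (w < v \<and> w > a)" by blast
      have "\<forall>\<^sub>F x in at_right a. x \<in> {a<..<v}" using v(1) by (rule eventually_at_right_real)
      then have "\<forall>\<^sub>F x in at_right a. x \<notin> I" by eventually_elim (use v in auto)
      then show ?thesis ..
    next
      case False
      have "\<forall>\<^sub>F x in at_right a. x > a" by (simp add: eventually_at_filter)
      then have "\<forall>\<^sub>F x in at_right a. x \<notin> I" by eventually_elim (use False in auto)
      then show ?thesis ..
    qed
  qed
  show ?thesis
  proof (cases "\<exists>I\<in>\<I>. \<forall>\<^sub>F x in at_right a. x \<in> I")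
    case True
    then obtain J where "J \<in> \<I>" "\<forall>\<^sub>F x in at_right a. x \<in> J" by blast
    then have "\<forall>\<^sub>F x in at_right a. P x"
      using P by (auto elim!: eventually_mono)
    then show ?thesis ..
  next
    case False
    then have "\<forall>I\<in>\<I>. \<forall>\<^sub>F x in at_right a. x \<notin> I" using one I(2) by blast
    then have "\<forall>\<^sub>F x in at_right a. \<forall>I\<in>\<I>. x \<notin> I" using I(1) by (simp add: eventually_ball_finite)
    then have "\<forall>\<^sub>F x in at_right a. \<not> P x"
      by eventually_elim (use P in auto)
    then show ?thesis ..
  qed
qed

text \<open>The derivative is the unique number satisfying the epsilon-delta condition on the
  difference quotients in direction \<open>v p\<close>, a first-order formula. Extending
  \<open>f\<close> by zero does not disturb it because \<open>U\<close> is open.\<close>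

lemma df_directional_derivative:
  assumes U: "open U" "ds U" "df (ext U f)" and W: "ds W" "\<And>i. df (ext W (\<lambda>p. v p $ i))"
    and diff: "\<And>p. p \<in> U \<Longrightarrow> f differentiable (at p)"
  shows "df (ext (U \<inter> W) (\<lambda>p. frechet_derivative f (at p) (v p)))"
proof -
  let ?v = "\<lambda>p. vec3 (ext W (\<lambda>p. v p $ 1) p, ext W (\<lambda>p. v p $ 2) p, ext W (\<lambda>p. v p $ 3) p)"
  have v: "?v p = v p" if "p \<in> W" for p using that by (simp add: ext_def vec3_eta)
  have D: "((\<lambda>h. ext U f (p + h *\<^sub>R ?v p)) has_real_derivative y) (at 0) \<longleftrightarrow>
      y = frechet_derivative f (at p) (v p)" if p: "p \<in> U" "p \<in> W" for p y
  proof -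
    have "(f has_derivative frechet_derivative f (at p)) (at p)"
      using diff[OF p(1)] frechet_derivative_works by blast
    then have "(ext U f has_derivative frechet_derivative f (at p)) (at p)"
      by (rule has_derivative_transform_within_open[OF _ U(1) p(1)]) (simp add: ext_def)
    moreover have "((\<lambda>h::real. p + h *\<^sub>R v p) has_derivative (\<lambda>h. h *\<^sub>R v p)) (at 0)"
      by (auto intro!: derivative_eq_intros)
    ultimately have "((\<lambda>h. ext U f (p + h *\<^sub>R v p)) has_derivative (\<lambda>h. frechet_derivative f (at p) (h *\<^sub>R v p))) (at 0)"
      using has_derivative_compose[of "\<lambda>h::real. p + h *\<^sub>R v p" _ 0 UNIV "ext U f"] by simp
    moreover have "linear (frechet_derivative f (at p))"
      using diff[OF p(1)] by (rule linear_frechet_derivative)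
    ultimately have d: "((\<lambda>h. ext U f (p + h *\<^sub>R v p)) has_real_derivative frechet_derivative f (at p) (v p)) (at 0)"
      unfolding has_field_derivative_def by (simp add: linear_scale mult.commute[of _ "frechet_derivative f (at p) (v p)"])
    show ?thesis unfolding v[OF p(2)] using d DERIV_unique by blast
  qed
  show ?thesis
    unfolding df_def
  proof (rule dm_unique)
    have dv: "dv (\<lambda>e. ?v (g e))" if "dv g" for g :: "'e::coord \<Rightarrow> real^3"
      using that W(2) by (intro dv_vec3 dm_Pair dm_df)
    show "dp (\<lambda>z. (vec3 (fst z) \<in> U \<and> vec3 (fst z) \<in> W \<and>
        (\<forall>r. 0 < r \<longrightarrow> (\<exists>s. 0 < s \<and> (\<forall>h. \<not> h = 0 \<and> \<bar>h\<bar> < s \<longrightarrow>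
          \<bar>(ext U f (vec3 (fst z) + h *\<^sub>R ?v (vec3 (fst z))) - ext U f (vec3 (fst z))) / h - snd z\<bar> < r)))) \<or>
        (\<not> (vec3 (fst z) \<in> U \<and> vec3 (fst z) \<in> W) \<and> snd z = 0))"
      by (intro d_intros dp_ds[OF U(2)] dp_ds[OF W(1)] dm_df[OF U(3)] dv)
    fix t :: "real \<times> real \<times> real" and y :: real
    show "(vec3 t \<in> U \<and> vec3 t \<in> W \<and>
        (\<forall>r. 0 < r \<longrightarrow> (\<exists>s. 0 < s \<and> (\<forall>h. \<not> h = 0 \<and> \<bar>h\<bar> < s \<longrightarrow>
          \<bar>(ext U f (vec3 t + h *\<^sub>R ?v (vec3 t)) - ext U f (vec3 t)) / h - y\<bar> < r)))) \<or>
        (\<not> (vec3 t \<in> U \<and> vec3 t \<in> W) \<and> y = 0) \<longleftrightarrow>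
        y = ext (U \<inter> W) (\<lambda>p. frechet_derivative f (at p) (v p)) (vec3 t)"
    proof (cases "vec3 t \<in> U \<and> vec3 t \<in> W")
      case True
      have "(\<forall>r. 0 < r \<longrightarrow> (\<exists>s. 0 < s \<and> (\<forall>h. \<not> h = 0 \<and> \<bar>h\<bar> < s \<longrightarrow>
          \<bar>(ext U f (vec3 t + h *\<^sub>R ?v (vec3 t)) - ext U f (vec3 t)) / h - y\<bar> < r))) \<longleftrightarrow>
        ((\<lambda>h. ext U f (vec3 t + h *\<^sub>R ?v (vec3 t))) has_real_derivative y) (at 0)"
        unfolding DERIV_def LIM_eq by simp
      also have "\<dots> \<longleftrightarrow> y = frechet_derivative f (at (vec3 t)) (v (vec3 t))"
        using D True by blast
      finally show ?thesis using True by (simp add: ext_def)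
    qed (simp add: ext_def)
  qed
qed

end

section \<open>Integral curves of vector fields of class C1\<close>

lemma C1_on_locally_lipschitz:
  fixes f :: "'a::euclidean_space \<Rightarrow> 'b::euclidean_space"
  assumes "C1_on f W" "open W" "p \<in> W"
  obtains r L where "r > 0" "cball p r \<subseteq> W" "L \<ge> 0"
    "\<And>u v. u \<in> cball p r \<Longrightarrow> v \<in> cball p r \<Longrightarrow> norm (f u - f v) \<le> L * norm (u - v)"
proof -
  obtain f' where f': "\<And>p. p \<in> W \<Longrightarrow> (f has_derivative blinfun_apply (f' p)) (at p)" "continuous_on W f'"
    using assms(1) unfolding C1_on_def by blast
  obtain r where r: "r > 0" "cball p r \<subseteq> W"
    using assms(2,3) open_contains_cball by blast
  have "bounded (f' ` cball p r)"
    by (intro compact_imp_bounded compact_continuous_image continuous_on_subset[OF f'(2) r(2)]) simp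
  then obtain L where L: "\<And>u. u \<in> cball p r \<Longrightarrow> norm (f' u) \<le> L"
    unfolding bounded_iff by blast
  show ?thesis
  proof
    show "L \<ge> 0" using L[of p] r(1) norm_ge_zero order_trans by (metis centre_in_cball less_imp_le)
    fix u v assume uv: "u \<in> cball p r" "v \<in> cball p r"
    show "norm (f u - f v) \<le> L * norm (u - v)"
    proof (rule differentiable_bound[of "cball p r" f "\<lambda>u. blinfun_apply (f' u)"])
      show "(f has_derivative blinfun_apply (f' w)) (at w within cball p r)" if "w \<in> cball p r" for w
        using f'(1) r(2) that by (meson has_derivative_at_withinI subsetD)
      show "onorm (blinfun_apply (f' w)) \<le> L" if "w \<in> cball p r" for w
        using L[OF that] by (simp add: norm_blinfun.rep_eq)
    qed (use uv in auto)
  qed (use r in auto)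
qed

lemma C1_on_continuous_on: "C1_on f U \<Longrightarrow> continuous_on U f"
  unfolding C1_on_def by (meson continuous_at_imp_continuous_on has_derivative_continuous)

text \<open>\<open>v t * exp (- K * t)\<close> is nonincreasing after \<open>t0\<close> and
  \<open>v t * exp (K * t)\<close> is nondecreasing before it, so a nonnegative \<open>v\<close>
  cannot leave the value zero in either direction.\<close>

lemma gronwall_zero:
  fixes v :: "real \<Rightarrow> real"
  assumes der: "\<And>t. t \<in> {a<..<b} \<Longrightarrow> (v has_real_derivative v' t) (at t)"
    and bound: "\<And>t. t \<in> {a<..<b} \<Longrightarrow> \<bar>v' t\<bar> \<le> K * v t"
    and nonneg: "\<And>t. v t \<ge> 0" and t0: "t0 \<in> {a<..<b}" "v t0 = 0" and t: "t \<in> {a<..<b}"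
  shows "v t = 0"
proof (cases "t0 \<le> t")
  case True
  have "v t * exp (- K * t) \<le> v t0 * exp (- K * t0)"
  proof (rule DERIV_nonpos_imp_nonincreasing[OF True])
    fix x assume "t0 \<le> x" "x \<le> t"
    then have x: "x \<in> {a<..<b}" using t t0 by auto
    have "((\<lambda>x. v x * exp (- K * x)) has_real_derivative (v' x - K * v x) * exp (- K * x)) (at x)"
      by (rule derivative_eq_intros der[OF x] refl)+ (simp add: algebra_simps)
    moreover have "(v' x - K * v x) * exp (- K * x) \<le> 0"
      using bound[OF x] by (intro mult_nonpos_nonneg) auto
    ultimately show "\<exists>y. ((\<lambda>x. v x * exp (- K * x)) has_real_derivative y) (at x) \<and> y \<le> 0" by blast
  qed
  then have "v t * exp (- K * t) \<le> 0" using t0 by simp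
  then show ?thesis using nonneg[of t] by (simp add: mult_le_0_iff)
next
  case False
  then have le: "t \<le> t0" by simp
  have "v t * exp (K * t) \<le> v t0 * exp (K * t0)"
  proof (rule DERIV_nonneg_imp_nondecreasing[OF le])
    fix x assume "t \<le> x" "x \<le> t0"
    then have x: "x \<in> {a<..<b}" using t t0 by auto
    have "((\<lambda>x. v x * exp (K * x)) has_real_derivative (v' x + K * v x) * exp (K * x)) (at x)"
      by (rule derivative_eq_intros der[OF x] refl)+ (simp add: algebra_simps)
    moreover have "(v' x + K * v x) * exp (K * x) \<ge> 0"
      using bound[OF x] by (intro mult_nonneg_nonneg) auto
    ultimately show "\<exists>y. ((\<lambda>x. v x * exp (K * x)) has_real_derivative y) (at x) \<and> y \<ge> 0" by blast
  qed
  then have "v t * exp (K * t) \<le> 0" using t0 by simp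
  then show ?thesis using nonneg[of t] by (simp add: mult_le_0_iff)
qed

text \<open>Gronwall for the squared distance. The common scalar rate \<open>l\<close> is there
  because a trajectory is only tangent to the field and runs through it at an arbitrary
  speed.\<close>

lemma ode_unique_lipschitz:
  fixes c1 c2 :: "real \<Rightarrow> 'a::real_inner"
  assumes lip: "\<And>u v. u \<in> B \<Longrightarrow> v \<in> B \<Longrightarrow> norm (\<xi> u - \<xi> v) \<le> L * norm (u - v)"
    and der: "\<And>t. t \<in> {a<..<b} \<Longrightarrow> (c1 has_vector_derivative l t *\<^sub>R \<xi> (c1 t)) (at t)"
      "\<And>t. t \<in> {a<..<b} \<Longrightarrow> (c2 has_vector_derivative l t *\<^sub>R \<xi> (c2 t)) (at t)"
    and inB: "\<And>t. t \<in> {a<..<b} \<Longrightarrow> c1 t \<in> B" "\<And>t. t \<in> {a<..<b} \<Longrightarrow> c2 t \<in> B"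
    and l: "\<And>t. t \<in> {a<..<b} \<Longrightarrow> \<bar>l t\<bar> \<le> M"
    and t0: "t0 \<in> {a<..<b}" "c1 t0 = c2 t0" and t: "t \<in> {a<..<b}"
  shows "c1 t = c2 t"
proof -
  define v where "v t = (c1 t - c2 t) \<bullet> (c1 t - c2 t)" for t
  have "v t = 0"
  proof (rule gronwall_zero[of a b v "\<lambda>t. 2 * ((c1 t - c2 t) \<bullet> (l t *\<^sub>R (\<xi> (c1 t) - \<xi> (c2 t))))" "2 * M * L" t0])
    fix t assume t: "t \<in> {a<..<b}"
    have "((\<lambda>t. c1 t - c2 t) has_vector_derivative l t *\<^sub>R (\<xi> (c1 t) - \<xi> (c2 t))) (at t)"
      using has_vector_derivative_diff[OF der(1)[OF t] der(2)[OF t]] by (simp add: scaleR_diff_right)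
    then have "((\<lambda>t. c1 t - c2 t) has_derivative (\<lambda>h. h *\<^sub>R (l t *\<^sub>R (\<xi> (c1 t) - \<xi> (c2 t))))) (at t)"
      by (simp add: has_vector_derivative_def)
    from has_derivative_inner[OF this this]
    show "(v has_real_derivative 2 * ((c1 t - c2 t) \<bullet> (l t *\<^sub>R (\<xi> (c1 t) - \<xi> (c2 t))))) (at t)"
      unfolding v_def[abs_def] has_field_derivative_def
      by (rule has_derivative_eq_rhs) (auto simp: inner_commute algebra_simps fun_eq_iff)
    have "\<bar>(c1 t - c2 t) \<bullet> (\<xi> (c1 t) - \<xi> (c2 t))\<bar> \<le> norm (c1 t - c2 t) * (L * norm (c1 t - c2 t))"
      by (rule order_trans[OF Cauchy_Schwarz_ineq2 mult_left_mono[OF lip]]) (use inB t in auto)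
    also have "\<dots> = L * v t" unfolding v_def by (simp add: dot_square_norm power2_eq_square)
    finally have *: "\<bar>(c1 t - c2 t) \<bullet> (\<xi> (c1 t) - \<xi> (c2 t))\<bar> \<le> L * v t" .
    have "\<bar>l t\<bar> * \<bar>(c1 t - c2 t) \<bullet> (\<xi> (c1 t) - \<xi> (c2 t))\<bar> \<le> M * (L * v t)"
      by (rule mult_mono[OF l[OF t] *]) (use l[OF t] in auto)
    then show "\<bar>2 * ((c1 t - c2 t) \<bullet> (l t *\<^sub>R (\<xi> (c1 t) - \<xi> (c2 t))))\<bar> \<le> 2 * M * L * v t"
      by (simp add: abs_mult)
  qed (use t0 t in \<open>auto simp: v_def\<close>)
  then show ?thesis unfolding v_def by simp
qed

lemma continuous_antiderivative:
  fixes g :: "real \<Rightarrow> 'a::banach"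
  assumes "continuous_on {a..b} g"
  obtains G where "\<And>t. t \<in> {a..b} \<Longrightarrow> (G has_vector_derivative g t) (at t within {a..b})" "G s = 0"
proof
  fix t assume "t \<in> {a..b}"
  then show "((\<lambda>u. integral {a..u} g - integral {a..s} g) has_vector_derivative g t) (at t within {a..b})"
    using has_vector_derivative_diff[OF integral_has_vector_derivative[OF assms] has_vector_derivative_const] by simp
qed simp

lemma picard_local_solution:
  fixes \<xi> :: "'a::euclidean_space \<Rightarrow> 'a"
  assumes lip: "\<And>u v. u \<in> cball p r \<Longrightarrow> v \<in> cball p r \<Longrightarrow> norm (\<xi> u - \<xi> v) \<le> L * norm (u - v)"
    and r: "r > 0" and L: "L \<ge> 0"
  obtains e \<phi> where "e > 0" "\<phi> 0 = p" "\<And>t. \<bar>t\<bar> < e \<Longrightarrow> \<phi> t \<in> cball p r"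
    "\<And>t. \<bar>t\<bar> < e \<Longrightarrow> (\<phi> has_vector_derivative \<xi> (\<phi> t)) (at t)"
proof -
  define M where "M = norm (\<xi> p) + L * r"
  have M0: "M \<ge> 0" unfolding M_def using r L by simp
  have M: "norm (\<xi> u) \<le> M" if "u \<in> cball p r" for u
  proof -
    have "norm (\<xi> u - \<xi> p) \<le> L * norm (u - p)" using lip[of u p] that r by simp
    also have "\<dots> \<le> L * r" using that L by (intro mult_left_mono) (auto simp: dist_norm norm_minus_commute)
    finally show ?thesis unfolding M_def using norm_triangle_ineq2[of "\<xi> u" "\<xi> p"] by linarith
  qed
  \<comment> \<open>The first bound keeps the integral inside the ball of radius \<open>r\<close>,
    the second makes the iteration a contraction with factor 1/2.\<close>
  define e where "e = min (r / (M + 1)) (1 / (2 * (L + 1)))"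
  have e: "e > 0" "e * M \<le> r" "e * L \<le> 1/2"
  proof -
    show "e > 0" unfolding e_def using r M0 L by simp
    have "e * M \<le> r / (M + 1) * M" unfolding e_def using M0 by (intro mult_right_mono) auto
    also have "\<dots> \<le> r" using M0 r by (simp add: field_simps)
    finally show "e * M \<le> r" .
    have "e * L \<le> 1 / (2 * (L + 1)) * L" unfolding e_def using L by (intro mult_right_mono) auto
    also have "\<dots> \<le> 1/2" using L by (simp add: field_simps)
    finally show "e * L \<le> 1/2" .
  qed
  \<comment> \<open>Clamping the time lets the iteration act on bounded continuous functions on the
    whole line, which form a complete space. Only times with \<open>\<bar>t\<bar> < e\<close> matter
    in the end.\<close>
  define cl where "cl t = max (-e) (min e t)" for t :: real
  have cl: "cl t \<in> {-e..e}" "\<bar>t\<bar> \<le> e \<Longrightarrow> cl t = t" for t unfolding cl_def using e(1) by auto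
  have ccl: "continuous_on UNIV cl" unfolding cl_def by (intro continuous_intros)
  \<comment> \<open>The integral from 0 to \<open>t\<close>, written as a difference so that
    negative \<open>t\<close> needs no separate treatment.\<close>
  define J where "J f t = integral {-e..t} (\<lambda>s. \<xi> (f s)) - integral {-e..0} (\<lambda>s. \<xi> (f s))" for f :: "real \<Rightarrow> 'a" and t
  define s where "s = {f :: real \<Rightarrow>\<^sub>C 'a. \<forall>t. f t \<in> cball p r}"
  define T where "T f = Bcontfun (\<lambda>t. p + J (apply_bcontfun f) (cl t))" for f :: "real \<Rightarrow>\<^sub>C 'a"
  have cont_xi: "continuous_on (cball p r) \<xi>"
    by (rule lipschitz_on_continuous_on[of L]) (auto intro!: lipschitz_onI lip[folded dist_norm] L)
  have cont_f: "continuous_on A (\<lambda>t. \<xi> (apply_bcontfun f t))" if "f \<in> s" for f A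
    using that unfolding s_def
    by (intro continuous_on_compose2[OF cont_xi]) (auto intro: continuous_intros)
  have dJ: "(J f has_vector_derivative \<xi> (apply_bcontfun f t)) (at t within {-e..e})" if "f \<in> s" "t \<in> {-e..e}" for f t
    unfolding J_def using has_vector_derivative_diff[OF integral_has_vector_derivative[OF cont_f[OF that(1)] that(2)] has_vector_derivative_const] by simp
  have J0: "J f 0 = 0" for f unfolding J_def by simp
  have Jcl: "continuous_on UNIV (\<lambda>t. J f (cl t))" if "f \<in> s" for f
  proof -
    have "continuous_on {-e..e} (J f)"
      using dJ[OF that] by (meson continuous_on_eq_continuous_within has_vector_derivative_continuous)
    then show ?thesis using cl by (intro continuous_on_compose2[OF _ ccl]) auto
  qed
  have Jb: "norm (J f (cl t)) \<le> r" if "f \<in> s" for f t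
  proof -
    have "norm (J f (cl t) - J f 0) \<le> M * norm (cl t - 0)"
    proof (rule differentiable_bound[of "{-e..e}" _ "\<lambda>t h. h *\<^sub>R \<xi> (apply_bcontfun f t)"])
      show "(J f has_derivative (\<lambda>h. h *\<^sub>R \<xi> (apply_bcontfun f x))) (at x within {-e..e})" if "x \<in> {-e..e}" for x
        using dJ[OF \<open>f \<in> s\<close> that] by (simp add: has_vector_derivative_def)
      show "onorm (\<lambda>h. h *\<^sub>R \<xi> (apply_bcontfun f x)) \<le> M" if "x \<in> {-e..e}" for x
        using M[of "apply_bcontfun f x"] \<open>f \<in> s\<close> unfolding s_def by (simp add: onorm_scaleR_left[OF bounded_linear_ident] onorm_id)
    qed (use cl e in auto)
    also have "\<dots> \<le> M * e" using cl[of t] M0 by (intro mult_left_mono) auto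
    finally show ?thesis using J0 e by (simp add: mult.commute)
  qed
  have T: "apply_bcontfun (T f) t = p + J f (cl t)" if "f \<in> s" for f t
  proof -
    have "(\<lambda>t. p + J f (cl t)) \<in> bcontfun"
    proof (rule bcontfun_normI)
      show "continuous_on UNIV (\<lambda>t. p + J f (cl t))" by (intro continuous_intros Jcl that)
      show "norm (p + J f (cl t)) \<le> norm p + r" for t using Jb[OF that, of t] norm_triangle_ineq[of p "J f (cl t)"] by linarith
    qed
    then show ?thesis unfolding T_def by (simp add: Bcontfun_inverse)
  qed
  have Ts: "T f \<in> s" if "f \<in> s" for f
    unfolding s_def using T[OF that] Jb[OF that] by (simp add: dist_norm)
  have contr: "dist (T f) (T g) \<le> 1/2 * dist f g" if "f \<in> s" "g \<in> s" for f g
  proof (rule dist_bound)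
    fix t
    let ?D = "\<lambda>t. J f t - J g t"
    have "norm (?D (cl t) - ?D 0) \<le> (L * dist f g) * norm (cl t - 0)"
    proof (rule differentiable_bound[of "{-e..e}" _ "\<lambda>t h. h *\<^sub>R (\<xi> (apply_bcontfun f t) - \<xi> (apply_bcontfun g t))"])
      show "(?D has_derivative (\<lambda>h. h *\<^sub>R (\<xi> (apply_bcontfun f x) - \<xi> (apply_bcontfun g x)))) (at x within {-e..e})" if "x \<in> {-e..e}" for x
        using has_vector_derivative_diff[OF dJ[OF \<open>f \<in> s\<close> that] dJ[OF \<open>g \<in> s\<close> that]]
        by (simp add: has_vector_derivative_def)
      show "onorm (\<lambda>h. h *\<^sub>R (\<xi> (apply_bcontfun f x) - \<xi> (apply_bcontfun g x))) \<le> L * dist f g" if "x \<in> {-e..e}" for x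
      proof -
        have "norm (\<xi> (apply_bcontfun f x) - \<xi> (apply_bcontfun g x)) \<le> L * norm (apply_bcontfun f x - apply_bcontfun g x)"
          using \<open>f \<in> s\<close> \<open>g \<in> s\<close> unfolding s_def by (intro lip) auto
        also have "\<dots> \<le> L * dist f g"
          using dist_bounded[of f x g] L by (intro mult_left_mono) (auto simp: dist_norm)
        finally show ?thesis by (simp add: onorm_scaleR_left[OF bounded_linear_ident] onorm_id)
      qed
    qed (use cl e in auto)
    also have "\<dots> \<le> (L * dist f g) * e" using cl[of t] L by (intro mult_left_mono) auto
    also have "\<dots> = (e * L) * dist f g" by simp
    also have "\<dots> \<le> 1/2 * dist f g" using e(3) by (intro mult_right_mono) auto
    finally show "dist (T f t) (T g t) \<le> 1/2 * dist f g"
      using T[OF that(1)] T[OF that(2)] J0 by (simp add: dist_norm)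
  qed
  have "complete s"
  proof -
    have "s = (\<Inter>t. (\<lambda>f. apply_bcontfun f t) -` cball p r)" unfolding s_def by auto
    moreover have "closed ((\<lambda>f :: real \<Rightarrow>\<^sub>C 'a. apply_bcontfun f t) -` cball p r)" for t
    proof (intro closed_vimage lipschitz_on_continuous_on[of 1] lipschitz_onI)
      show "dist (apply_bcontfun f t) (apply_bcontfun g t) \<le> 1 * dist f g" for f g :: "real \<Rightarrow>\<^sub>C 'a"
        using dist_bounded[of f t g] by simp
    qed auto
    ultimately have "closed s" by auto
    then show ?thesis by (simp add: complete_eq_closed)
  qed
  moreover have "const_bcontfun p \<in> s" unfolding s_def using r by simp
  ultimately have "\<exists>!f. f \<in> s \<and> T f = f"
    using Ts contr by (intro Banach_fix[of s "1/2" T]) auto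
  then obtain f where f: "f \<in> s" "T f = f"
    by metis
  show ?thesis
  proof
    show "e > 0" by (rule e)
    have *: "apply_bcontfun f t = p + J f (cl t)" for t using T[OF f(1), of t] f(2) by simp
    show "apply_bcontfun f 0 = p" using *[of 0] cl(2)[of 0] J0 e by simp
    fix t :: real assume t: "\<bar>t\<bar> < e"
    show "apply_bcontfun f t \<in> cball p r" using f(1) unfolding s_def by blast
    have "(J f has_vector_derivative \<xi> (apply_bcontfun f t)) (at t)"
    proof -
      have "t \<in> {-e..e}" "t \<in> interior {-e..e}" using t by auto
      then show ?thesis using dJ[OF f(1)] at_within_interior by metis
    qed
    then have "((\<lambda>t. p + J f t) has_vector_derivative \<xi> (apply_bcontfun f t)) (at t)"
      using has_vector_derivative_add[OF has_vector_derivative_const[of p]] by fastforce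
    then show "(apply_bcontfun f has_vector_derivative \<xi> (apply_bcontfun f t)) (at t)"
      by (rule has_vector_derivative_transform_within_open[where S="{-e<..<e}"]) (use t * cl in auto)
  qed
qed

text \<open>The speed \<open>l\<close> is continuous but may vanish or change sign, as for a
  trajectory, whose parameterization is only required to be tangent to the field.\<close>

definition field_curve :: "('a::real_normed_vector \<Rightarrow> 'a) \<Rightarrow> real set \<Rightarrow> (real \<Rightarrow> real) \<Rightarrow> (real \<Rightarrow> 'a) \<Rightarrow> bool" where
  "field_curve \<xi> T l c \<longleftrightarrow> open T \<and> continuous_on T l \<and>
     (\<forall>t\<in>T. (c has_vector_derivative l t *\<^sub>R \<xi> (c t)) (at t))"

text \<open>If \<Lambda> is the antiderivative of \<open>l\<close> vanishing at \<open>t0\<close>,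
  then \<phi> run at time \<Lambda> solves the same equation as \<open>c\<close>, and uniqueness
  identifies them. One \<phi> serves all curves through \<open>p\<close>; the bound \<open>d\<close>
  confines \<Lambda> to a prescribed neighbourhood of 0.\<close>

lemma ode_factors_through_solution:
  fixes \<xi> :: "'a::euclidean_space \<Rightarrow> 'a"
  assumes "C1_on \<xi> W" "open W" "p \<in> W"
  obtains e \<phi> where "e > 0" "\<phi> 0 = p" "\<And>t. \<bar>t\<bar> < e \<Longrightarrow> \<phi> t \<in> W"
    "\<And>t. \<bar>t\<bar> < e \<Longrightarrow> (\<phi> has_vector_derivative \<xi> (\<phi> t)) (at t)"
    "\<forall>T c l t0 d. field_curve \<xi> T l c \<and> t0 \<in> T \<and> c t0 = p \<and> d > 0
      \<longrightarrow> (\<exists>\<Lambda>. \<forall>\<^sub>F t in at t0. \<bar>\<Lambda> t\<bar> < d \<and> c t = \<phi> (\<Lambda> t))"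
proof -
  obtain r L where r: "r > 0" "cball p r \<subseteq> W" "L \<ge> 0"
    and lip: "\<And>u v. u \<in> cball p r \<Longrightarrow> v \<in> cball p r \<Longrightarrow> norm (\<xi> u - \<xi> v) \<le> L * norm (u - v)"
    using C1_on_locally_lipschitz[OF assms] by metis
  obtain e \<phi> where e: "e > 0" "\<phi> 0 = p" "\<And>t. \<bar>t\<bar> < e \<Longrightarrow> \<phi> t \<in> cball p r"
    and d\<phi>: "\<And>t. \<bar>t\<bar> < e \<Longrightarrow> (\<phi> has_vector_derivative \<xi> (\<phi> t)) (at t)"
    using picard_local_solution[of p r \<xi> L] lip r by metis
  have main: "\<exists>\<Lambda>. \<forall>\<^sub>F t in at t0. \<bar>\<Lambda> t\<bar> < d \<and> c t = \<phi> (\<Lambda> t)"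
    if fc: "field_curve \<xi> T l c" and t0: "t0 \<in> T" and c0: "c t0 = p" and d: "d > 0" for T c l t0 d
  proof -
    have T: "open T" "t0 \<in> T" and c: "c t0 = p" "continuous_on T l"
      and dc: "\<And>t. t \<in> T \<Longrightarrow> (c has_vector_derivative l t *\<^sub>R \<xi> (c t)) (at t)"
      using fc t0 c0 unfolding field_curve_def by auto
    obtain d0 where d0: "d0 > 0" "cball t0 d0 \<subseteq> T" using T open_contains_cball by blast
    then have sub: "{t0 - d0..t0 + d0} \<subseteq> T" by (auto simp: cball_eq_atLeastAtMost)
    have cl: "continuous_on {t0 - d0..t0 + d0} l" using c(2) sub continuous_on_subset by blast
    obtain \<Lambda> where \<Lambda>: "\<And>t. t \<in> {t0 - d0..t0 + d0} \<Longrightarrow> (\<Lambda> has_vector_derivative l t) (at t within {t0 - d0..t0 + d0})" "\<Lambda> t0 = 0"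
      using continuous_antiderivative[OF cl] by metis
    have d\<Lambda>: "(\<Lambda> has_vector_derivative l t) (at t)" if "\<bar>t - t0\<bar> < d0" for t
    proof -
      have "t \<in> {t0 - d0..t0 + d0}" "t \<in> interior {t0 - d0..t0 + d0}" using that by auto
      then show ?thesis using \<Lambda>(1) at_within_interior by metis
    qed
    have "compact (l ` {t0 - d0..t0 + d0})" using cl by (intro compact_continuous_image) auto
    then obtain M where M: "\<And>t. t \<in> {t0 - d0..t0 + d0} \<Longrightarrow> \<bar>l t\<bar> \<le> M"
      using compact_imp_bounded[of "l ` {t0 - d0..t0 + d0}"] unfolding bounded_iff by fastforce
    have "isCont \<Lambda> t0" using has_vector_derivative_continuous[OF d\<Lambda>] d0 by simp
    then obtain d1 where d1: "d1 > 0" "\<And>t. \<bar>t - t0\<bar> < d1 \<Longrightarrow> \<bar>\<Lambda> t\<bar> < min d e"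
      using d e(1) \<Lambda>(2) unfolding continuous_at_eps_delta
      by (metis dist_real_def diff_zero min_less_iff_conj)
    have "isCont c t0" using has_vector_derivative_continuous[OF dc[OF T(2)]] .
    then obtain d2 where d2: "d2 > 0" "\<And>t. \<bar>t - t0\<bar> < d2 \<Longrightarrow> c t \<in> cball p r"
      using r(1) c(1) unfolding continuous_at_eps_delta
      by (metis dist_commute dist_real_def less_imp_le mem_cball)
    define m where "m = min d0 (min d1 d2)"
    have m: "m > 0" unfolding m_def using d0 d1 d2 by simp
    have "c t = \<phi> (\<Lambda> t)" if t: "\<bar>t - t0\<bar> < m" for t
    proof (rule ode_unique_lipschitz[of "cball p r" \<xi> L "t0 - m" "t0 + m" c l "\<lambda>t. \<phi> (\<Lambda> t)" M t0])
      fix s assume "s \<in> {t0 - m<..<t0 + m}"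
      then have s: "\<bar>s - t0\<bar> < d0" "\<bar>s - t0\<bar> < d1" "\<bar>s - t0\<bar> < d2" unfolding m_def by auto
      have "s \<in> T" using d0(2) s(1) by (auto simp: dist_real_def abs_minus_commute)
      then show "(c has_vector_derivative l s *\<^sub>R \<xi> (c s)) (at s)" using dc by blast
      have "((\<phi> \<circ> \<Lambda>) has_vector_derivative l s *\<^sub>R \<xi> (\<phi> (\<Lambda> s))) (at s)"
        using vector_diff_chain_at[OF d\<Lambda>[OF s(1)] d\<phi>[of "\<Lambda> s"]] d1(2)[OF s(2)] by simp
      then show "((\<lambda>t. \<phi> (\<Lambda> t)) has_vector_derivative l s *\<^sub>R \<xi> (\<phi> (\<Lambda> s))) (at s)" by (simp add: o_def)
      show "c s \<in> cball p r" using d2 s by blast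
      show "\<phi> (\<Lambda> s) \<in> cball p r" using e(3) d1(2)[OF s(2)] by simp
      show "\<bar>l s\<bar> \<le> M"
        by (rule M) (use s(1) in \<open>simp; linarith\<close>)
    qed (use lip m t c \<Lambda> e in auto)
    then have "\<forall>t. t \<noteq> t0 \<and> dist t t0 < m \<longrightarrow> \<bar>\<Lambda> t\<bar> < d \<and> c t = \<phi> (\<Lambda> t)"
      using d1(2) unfolding m_def dist_real_def by auto
    then show ?thesis
      unfolding eventually_at using m by (metis UNIV_I)
  qed
  show ?thesis
    by (rule that[OF e(1,2) _ d\<phi>]) (use e(3) r(2) main in auto)
qed

text \<open>The function \<open>x\<close> plays the role of time; in a chart it is the first
  coordinate. Where \<open>dx\<close> does not vanish, the rescaled field \<eta> advances
  \<open>x\<close> at unit speed, and the curves \<open>xcurve\<close> are its solutions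
  parameterized by the value of \<open>x\<close>.\<close>

locale clock =
  fixes W :: "'a::euclidean_space set" and \<xi> :: "'a \<Rightarrow> 'a" and V :: "'a set" and x :: "'a \<Rightarrow> real"
  assumes open_W: "open W" and C1_field: "C1_on \<xi> W" and open_V: "open V" and C1_clock: "C1_on x V"
begin

definition dx :: "'a \<Rightarrow> real" where "dx p = frechet_derivative x (at p) (\<xi> p)"

definition \<O> :: "'a set" where "\<O> = {p \<in> V \<inter> W. dx p \<noteq> 0}"

definition \<eta> :: "'a \<Rightarrow> 'a" where "\<eta> p = \<xi> p /\<^sub>R dx p"

definition xcurve :: "real set \<Rightarrow> (real \<Rightarrow> 'a) \<Rightarrow> bool" where
  "xcurve J \<psi> \<longleftrightarrow> (\<forall>s\<in>J. \<psi> s \<in> \<O> \<and> x (\<psi> s) = s \<and> (\<psi> has_vector_derivative \<eta> (\<psi> s)) (at s))"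

lemma continuous_on_xi: "continuous_on W \<xi>"
  using C1_field by (rule C1_on_continuous_on)

lemma continuous_on_directional:
  assumes "C1_on f U"
  shows "continuous_on (U \<inter> W) (\<lambda>p. frechet_derivative f (at p) (\<xi> p))"
proof -
  obtain f' where f': "\<And>p. p \<in> U \<Longrightarrow> (f has_derivative blinfun_apply (f' p)) (at p)" "continuous_on U f'"
    using assms unfolding C1_on_def by blast
  have "continuous_on (U \<inter> W) (\<lambda>p. blinfun_apply (f' p) (\<xi> p))"
    by (intro continuous_intros continuous_on_subset[OF f'(2)] continuous_on_subset[OF continuous_on_xi]) auto
  then show ?thesis
    by (rule continuous_on_eq) (use f'(1) frechet_derivative_at in fastforce)
qed

lemma C1_on_has_derivative:
  assumes "C1_on f U" "p \<in> U"
  shows "(f has_derivative frechet_derivative f (at p)) (at p)"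
  using assms unfolding C1_on_def by (metis frechet_derivative_at)

lemma continuous_on_dx: "continuous_on (V \<inter> W) dx"
  unfolding dx_def[abs_def] by (rule continuous_on_directional[OF C1_clock])

lemma open_O: "open \<O>"
proof -
  have "\<O> = (V \<inter> W) \<inter> dx -` (- {0})" unfolding \<O>_def by auto
  moreover have "open (- {0::real})" by (simp add: open_Compl)
  ultimately show ?thesis
    using continuous_open_preimage[OF continuous_on_dx] open_V open_W by auto
qed

lemma continuous_on_eta: "continuous_on \<O> \<eta>"
  unfolding \<eta>_def[abs_def]
  by (intro continuous_intros continuous_on_subset[OF continuous_on_dx] continuous_on_subset[OF continuous_on_xi])
    (auto simp: \<O>_def)

lemma has_real_derivative_along:
  assumes "C1_on f U" "c s \<in> U" "(c has_vector_derivative k *\<^sub>R \<xi> (c s)) (at s)"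
  shows "((\<lambda>t. f (c t)) has_real_derivative k * frechet_derivative f (at (c s)) (\<xi> (c s))) (at s)"
proof -
  note d = C1_on_has_derivative[OF assms(1,2)]
  have "((\<lambda>t. f (c t)) has_derivative (\<lambda>h. frechet_derivative f (at (c s)) (h *\<^sub>R (k *\<^sub>R \<xi> (c s))))) (at s)"
    using has_derivative_compose[OF assms(3)[unfolded has_vector_derivative_def] d] .
  moreover have "linear (frechet_derivative f (at (c s)))" using d has_derivative_linear by blast
  ultimately show ?thesis unfolding has_field_derivative_def
    by (elim has_derivative_eq_rhs) (auto simp: linear_scale fun_eq_iff)
qed

text \<open>Solve the equation of the field at \<open>p\<close> and invert the clock along the
  solution by the inverse function theorem. Since every field curve through \<open>p\<close> factors
  through that solution, near \<open>p\<close> it is a function of its clock value.\<close>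

lemma local_solution:
  assumes p: "p \<in> \<O>"
  obtains d \<psi> where "d > 0" "xcurve {x p - d<..<x p + d} \<psi>" "\<psi> (x p) = p"
    "\<forall>T c l t0. field_curve \<xi> T l c \<and> t0 \<in> T \<and> c t0 = p
      \<longrightarrow> (\<forall>\<^sub>F t in at t0. \<bar>x (c t) - x p\<bar> < d \<and> c t = \<psi> (x (c t)))"
proof -
  have "p \<in> W" using p unfolding \<O>_def by blast
  obtain e \<phi> where e: "e > 0" "\<phi> 0 = p" "\<And>t. \<bar>t\<bar> < e \<Longrightarrow> \<phi> t \<in> W"
    and d\<phi>: "\<And>t. \<bar>t\<bar> < e \<Longrightarrow> (\<phi> has_vector_derivative \<xi> (\<phi> t)) (at t)"
    and fac: "\<forall>T c l t0 d. field_curve \<xi> T l c \<and> t0 \<in> T \<and> c t0 = p \<and> d > 0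
      \<longrightarrow> (\<exists>\<Lambda>. \<forall>\<^sub>F t in at t0. \<bar>\<Lambda> t\<bar> < d \<and> c t = \<phi> (\<Lambda> t))"
    using ode_factors_through_solution[OF C1_field open_W \<open>p \<in> W\<close>] by blast
  have c\<phi>: "continuous_on {-e<..<e} \<phi>"
    by (intro continuous_at_imp_continuous_on ballI has_vector_derivative_continuous[OF d\<phi>]) auto
  define U where "U = {-e<..<e} \<inter> \<phi> -` \<O>"
  have U: "open U" unfolding U_def using continuous_open_preimage[OF c\<phi> _ open_O] by simp
  have U0: "0 \<in> U" unfolding U_def using e p by simp
  define k where "k s = x (\<phi> s)" for s
  have dk: "(k has_real_derivative dx (\<phi> s)) (at s)" if "s \<in> U" for s
    using has_real_derivative_along[OF C1_clock, of \<phi> s 1] that d\<phi>[of s]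
    unfolding k_def[abs_def] dx_def U_def \<O>_def by auto
  \<comment> \<open>The derivative of the clock along the solution as a bounded linear map, the form
    in which the inverse function theorem asks for its continuity.\<close>
  define k' where "k' s = blinfun_scaleR_left (dx (\<phi> s))" for s
  have k'_apply: "blinfun_apply (k' s) h = dx (\<phi> s) * h" for s and h :: real
    unfolding k'_def by (simp add: mult.commute)
  have ck': "continuous_on U k'"
    unfolding k'_def
    by (intro continuous_intros bounded_linear.continuous_on[OF bounded_linear_blinfun_scaleR_left]
        continuous_on_compose2[OF continuous_on_dx] continuous_on_subset[OF c\<phi>])
      (auto simp: U_def \<O>_def)
  define invf where "invf = blinfun_scaleR_left (1 / dx p)"
  have invf: "invf o\<^sub>L k' 0 = id_blinfun"
    using p e(2) by (intro blinfun_eqI) (auto simp: invf_def k'_def \<O>_def)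
  have "(k has_derivative blinfun_apply (k' s)) (at s)" if "s \<in> U" for s
    using dk[OF that] unfolding has_field_derivative_def by (simp add: k'_apply[abs_def])
  then obtain U' V' \<sigma> \<sigma>' where inv: "open U'" "U' \<subseteq> U" "0 \<in> U'" "open V'" "k 0 \<in> V'" "homeomorphism U' V' k \<sigma>"
    and d\<sigma>: "\<And>y. y \<in> V' \<Longrightarrow> (\<sigma> has_derivative \<sigma>' y) (at y)" "\<And>y. y \<in> V' \<Longrightarrow> \<sigma>' y = inv (blinfun_apply (k' (\<sigma> y)))"
    by (rule inverse_function_theorem[OF U _ ck' U0 invf]) blast+
  have k0: "k 0 = x p" unfolding k_def using e by simp
  obtain d where d: "d > 0" "ball (x p) d \<subseteq> V'" using inv(4,5) k0 open_contains_ball by metis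
  have \<sigma>: "\<sigma> y \<in> U'" "k (\<sigma> y) = y" if "y \<in> V'" for y
    using inv(6) that by (auto simp: homeomorphism_def)
  have \<sigma>k: "\<sigma> (k u) = u" "k u \<in> V'" if "u \<in> U'" for u
    using inv(6) that by (auto simp: homeomorphism_def)
  have ballint: "y \<in> ball (x p) d" if "y \<in> {x p - d<..<x p + d}" for y
    using that by (auto simp: dist_real_def)
  have 1: "xcurve {x p - d<..<x p + d} (\<phi> \<circ> \<sigma>)"
      unfolding xcurve_def
    proof (intro ballI conjI)
      fix y assume "y \<in> {x p - d<..<x p + d}"
      then have y: "y \<in> V'" using ballint d by blast
      have su: "\<sigma> y \<in> U" using \<sigma>(1)[OF y] inv(2) by blast
      then show O: "(\<phi> \<circ> \<sigma>) y \<in> \<O>" unfolding U_def by auto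
      show "x ((\<phi> \<circ> \<sigma>) y) = y" using \<sigma>(2)[OF y] unfolding k_def by simp
      have nz: "dx (\<phi> (\<sigma> y)) \<noteq> 0" using O unfolding \<O>_def by simp
      have "inv (blinfun_apply (k' (\<sigma> y))) = (\<lambda>h. h / dx (\<phi> (\<sigma> y)))"
        by (rule inv_unique_comp) (use nz in \<open>auto simp: fun_eq_iff k'_apply\<close>)
      then have "(\<sigma> has_vector_derivative 1 / dx (\<phi> (\<sigma> y))) (at y)"
        using d\<sigma>(1)[OF y] d\<sigma>(2)[OF y] unfolding has_vector_derivative_def by simp
      from vector_diff_chain_at[OF this d\<phi>[of "\<sigma> y"]] su
      show "((\<phi> \<circ> \<sigma>) has_vector_derivative \<eta> ((\<phi> \<circ> \<sigma>) y)) (at y)"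
        unfolding \<eta>_def U_def by (auto simp: divide_inverse abs_less_iff)
    qed
  have 2: "(\<phi> \<circ> \<sigma>) (x p) = p" using \<sigma>k(1)[OF inv(3)] k0 e by simp
  have 3: "\<forall>\<^sub>F t in at t0. \<bar>x (c t) - x p\<bar> < d \<and> c t = (\<phi> \<circ> \<sigma>) (x (c t))"
    if T: "field_curve \<xi> T l c" "t0 \<in> T" "c t0 = p" for T c l t0
  proof -
    have "isCont k 0" using dk[OF U0] DERIV_isCont by blast
    then have "\<forall>\<^sub>F u in nhds 0. u \<in> U' \<and> k u \<in> ball (x p) d"
      using inv(1,3) d(1) k0
      by (intro eventually_conj) (auto simp: eventually_nhds_in_open continuous_at tendsto_nhds_iff
          intro!: topological_tendstoD[where S="ball _ _"] simp del: mem_ball)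
    then obtain d' where d': "d' > 0" "\<And>u. \<bar>u\<bar> < d' \<Longrightarrow> u \<in> U' \<and> k u \<in> ball (x p) d"
      unfolding eventually_nhds_metric by (auto simp: dist_real_def)
    obtain \<Lambda> where "\<forall>\<^sub>F t in at t0. \<bar>\<Lambda> t\<bar> < d' \<and> c t = \<phi> (\<Lambda> t)"
      using fac T d'(1) by blast
    then show ?thesis
    proof eventually_elim
      case (elim t)
      have "x (c t) = k (\<Lambda> t)" using elim unfolding k_def by simp
      then show ?case using elim d'(2)[of "\<Lambda> t"] \<sigma>k(1)[of "\<Lambda> t"] by (auto simp: dist_real_def abs_minus_commute)
    qed
  qed
  show ?thesis
    by (rule that[OF d(1) 1 2]) (use 3 in blast)
qed

lemma xcurve_subset: "xcurve J \<psi> \<Longrightarrow> J' \<subseteq> J \<Longrightarrow> xcurve J' \<psi>"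
  unfolding xcurve_def by blast

lemma xcurve_isCont: "xcurve J \<psi> \<Longrightarrow> s \<in> J \<Longrightarrow> isCont \<psi> s"
  unfolding xcurve_def using has_vector_derivative_continuous by blast

lemma xcurve_continuous_on: "xcurve J \<psi> \<Longrightarrow> continuous_on J \<psi>"
  using xcurve_isCont continuous_at_imp_continuous_on by blast

lemma xcurve_field:
  assumes "xcurve J \<psi>" "s \<in> J"
  shows "(\<psi> has_vector_derivative (1 / dx (\<psi> s)) *\<^sub>R \<xi> (\<psi> s)) (at s)"
  using assms unfolding xcurve_def \<eta>_def by (simp add: divide_inverse)

lemma xcurve_rate_continuous: "xcurve J \<psi> \<Longrightarrow> continuous_on J (\<lambda>s. 1 / dx (\<psi> s))"
  by (intro continuous_intros continuous_on_compose2[OF continuous_on_dx xcurve_continuous_on])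
    (auto simp: xcurve_def \<O>_def)

lemma xcurve_field_curve: "xcurve J \<psi> \<Longrightarrow> open J \<Longrightarrow> field_curve \<xi> J (\<lambda>s. 1 / dx (\<psi> s)) \<psi>"
  unfolding field_curve_def using xcurve_field xcurve_rate_continuous by blast

text \<open>At the meeting point both curves factor through the same local solution, so nearby the
  field curve runs inside the \<open>xcurve\<close>, at the position given by its own clock.\<close>

lemma follow:
  assumes "xcurve J \<psi>" "open J" "s0 \<in> J" "field_curve \<xi> T l c" "t0 \<in> T" "c t0 = \<psi> s0"
  shows "\<forall>\<^sub>F t in at t0. x (c t) \<in> J \<and> c t = \<psi> (x (c t))"
proof -
  have s0: "\<psi> s0 \<in> \<O>" "x (\<psi> s0) = s0" using assms(1,3) unfolding xcurve_def by auto
  obtain d \<zeta> where d: "d > 0" "xcurve {s0 - d<..<s0 + d} \<zeta>" "\<zeta> s0 = \<psi> s0"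
    and fac: "\<forall>T c l t0. field_curve \<xi> T l c \<and> t0 \<in> T \<and> c t0 = \<psi> s0
      \<longrightarrow> (\<forall>\<^sub>F t in at t0. \<bar>x (c t) - s0\<bar> < d \<and> c t = \<zeta> (x (c t)))"
    using local_solution[OF s0(1), unfolded s0(2)] by blast
  have c: "\<forall>\<^sub>F t in at t0. \<bar>x (c t) - s0\<bar> < d \<and> c t = \<zeta> (x (c t))"
    using fac assms by blast
  have "\<forall>\<^sub>F s in at s0. \<bar>x (\<psi> s) - s0\<bar> < d \<and> \<psi> s = \<zeta> (x (\<psi> s))"
    using fac assms(3) xcurve_field_curve[OF assms(1,2)] by blast
  moreover have "\<forall>\<^sub>F s in at s0. s \<in> J" using assms(2,3) by (rule eventually_at_in_open')
  ultimately have "\<forall>\<^sub>F s in at s0. s \<in> J \<and> \<psi> s = \<zeta> s"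
    by eventually_elim (use assms(1) in \<open>auto simp: xcurve_def\<close>)
  then have near: "\<forall>\<^sub>F s in nhds s0. s \<in> J \<and> \<psi> s = \<zeta> s"
    using d(3) assms(3) unfolding eventually_nhds_conv_at by simp
  have "isCont c t0"
    using assms(4,5) has_vector_derivative_continuous unfolding field_curve_def by blast
  moreover have "isCont x (c t0)"
    unfolding assms(6) by (rule has_derivative_continuous[OF C1_on_has_derivative[OF C1_clock]]) (use s0 in \<open>simp add: \<O>_def\<close>)
  ultimately have "isCont (\<lambda>t. x (c t)) t0" by (rule isCont_o2)
  then have "((\<lambda>t. x (c t)) \<longlongrightarrow> s0) (at t0)" using s0 assms(6) unfolding continuous_at by simp
  then have "\<forall>\<^sub>F t in at t0. x (c t) \<in> J \<and> \<psi> (x (c t)) = \<zeta> (x (c t))"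
    using near by (rule eventually_compose_filterlim[rotated])
  then show ?thesis using c by eventually_elim auto
qed

text \<open>The set of agreement is open by \<open>follow\<close>, the set of disagreement by
  continuity, and \<open>J\<close> is connected.\<close>

lemma xcurve_unique:
  assumes "xcurve J \<psi>" "xcurve J \<zeta>" "open J" "connected J" "s0 \<in> J" "\<psi> s0 = \<zeta> s0" "s \<in> J"
  shows "\<psi> s = \<zeta> s"
proof -
  let ?A = "{s \<in> J. \<psi> s = \<zeta> s}" and ?B = "{s \<in> J. \<psi> s \<noteq> \<zeta> s}"
  have "open ?A"
    unfolding open_dist
  proof
    fix t0 assume t0: "t0 \<in> ?A"
    have "\<forall>\<^sub>F t in at t0. x (\<psi> t) \<in> J \<and> \<psi> t = \<zeta> (x (\<psi> t))"
      by (rule follow[OF assms(2,3) _ xcurve_field_curve[OF assms(1,3)]]) (use t0 in auto)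
    moreover have "\<forall>\<^sub>F s in at t0. s \<in> J" using assms(3) t0 by (intro eventually_at_in_open') auto
    ultimately have "\<forall>\<^sub>F s in at t0. s \<in> ?A"
      by eventually_elim (use assms(1) in \<open>auto simp: xcurve_def\<close>)
    then show "\<exists>e>0. \<forall>y. dist y t0 < e \<longrightarrow> y \<in> ?A"
      using t0 unfolding eventually_at by (metis UNIV_I)
  qed
  moreover have "open ?B"
  proof -
    have "?B = J \<inter> (\<lambda>s. \<psi> s - \<zeta> s) -` (- {0})" by auto
    moreover have "open \<dots>"
      by (rule continuous_open_preimage) (use assms xcurve_continuous_on in \<open>auto intro!: continuous_intros\<close>)
    ultimately show ?thesis by simp
  qed
  ultimately have "?A \<inter> J = {} \<or> ?B \<inter> J = {}"
    using assms(4) by (rule_tac connectedD) auto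
  then show ?thesis using assms(5-7) by blast
qed

end

section \<open>Continuation of integral curves in clock time\<close>

context clock
begin

lemma open_clock_curve:
  assumes "field_curve \<xi> T l c" "t \<in> T" "c t \<in> \<O>"
  shows "isCont (\<lambda>t. x (c t)) t"
proof -
  have "isCont c t"
    using assms(1,2) has_vector_derivative_continuous unfolding field_curve_def by blast
  moreover have "isCont x (c t)"
    by (rule has_derivative_continuous[OF C1_on_has_derivative[OF C1_clock]]) (use assms(3) in \<open>simp add: \<O>_def\<close>)
  ultimately show ?thesis by (rule isCont_o2)
qed

lemma xcurve_glue:
  assumes "xcurve J \<psi>" "open J" "connected J" "xcurve J' \<psi>'" "open J'" "connected J'"
    and s0: "s0 \<in> J" "s0 \<in> J'" "\<psi> s0 = \<psi>' s0"
  obtains \<zeta> where "xcurve (J \<union> J') \<zeta>" "\<And>s. s \<in> J \<Longrightarrow> \<zeta> s = \<psi> s" "\<And>s. s \<in> J' \<Longrightarrow> \<zeta> s = \<psi>' s"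
proof -
  \<comment> \<open>On the line the overlap of two connected sets is connected, so agreement at
    \<open>s0\<close> extends to the whole overlap.\<close>
  have "connected (J \<inter> J')"
    using assms(3,6) by (simp add: is_interval_connected_1[symmetric] is_interval_Int)
  then have eq: "\<psi> s = \<psi>' s" if "s \<in> J" "s \<in> J'" for s
    using xcurve_unique[OF xcurve_subset[OF assms(1)] xcurve_subset[OF assms(4)], of "J \<inter> J'" s0 s] assms that by auto
  define \<zeta> where "\<zeta> s = (if s \<in> J then \<psi> s else \<psi>' s)" for s
  have 1: "\<zeta> s = \<psi> s" if "s \<in> J" for s using that by (simp add: \<zeta>_def)
  have 2: "\<zeta> s = \<psi>' s" if "s \<in> J'" for s using that eq by (simp add: \<zeta>_def)
  have "xcurve (J \<union> J') \<zeta>"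
    unfolding xcurve_def
  proof (intro ballI conjI)
    fix s assume s: "s \<in> J \<union> J'"
    show "\<zeta> s \<in> \<O>" "x (\<zeta> s) = s" using s 1 2 assms(1,4) unfolding xcurve_def by auto
    show "(\<zeta> has_vector_derivative \<eta> (\<zeta> s)) (at s)"
    proof (cases "s \<in> J")
      case True
      then have "(\<psi> has_vector_derivative \<eta> (\<zeta> s)) (at s)" using assms(1) 1 unfolding xcurve_def by simp
      then show ?thesis
        by (rule has_vector_derivative_transform_within_open[OF _ assms(2) True]) (simp add: 1)
    next
      case False
      then have s': "s \<in> J'" using s by simp
      then have "(\<psi>' has_vector_derivative \<eta> (\<zeta> s)) (at s)" using assms(4) 2 unfolding xcurve_def by simp
      then show ?thesis
        by (rule has_vector_derivative_transform_within_open[OF _ assms(5) s']) (simp add: 2)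
    qed
  qed
  then show ?thesis using that 1 2 by blast
qed

text \<open>The speed of \<open>c\<close> may change sign, so \<open>x (c t)\<close> need not be
  monotone in \<open>t\<close>. Nevertheless the curve remains a function of its clock value over a
  whole compact interval: the local solutions are glued by bisection.\<close>

lemma factors_through_xcurve:
  assumes fc: "field_curve \<xi> T l c" and O: "\<And>t. t \<in> T \<Longrightarrow> c t \<in> \<O>"
    and t12: "t1 \<le> t2" "{t1..t2} \<subseteq> T"
  shows "\<exists>J \<psi>. open J \<and> connected J \<and> xcurve J \<psi> \<and> (\<forall>t\<in>{t1..t2}. x (c t) \<in> J \<and> c t = \<psi> (x (c t)))"
    (is "?P t1 t2")
  using t12(1)
proof (induction rule: Bolzano)
  case (trans a b d)
  obtain J \<psi> where 1: "open J" "connected J" "xcurve J \<psi>" "\<forall>t\<in>{a..b}. x (c t) \<in> J \<and> c t = \<psi> (x (c t))"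
    using trans(1) by blast
  obtain J' \<psi>' where 2: "open J'" "connected J'" "xcurve J' \<psi>'" "\<forall>t\<in>{b..d}. x (c t) \<in> J' \<and> c t = \<psi>' (x (c t))"
    using trans(2) by blast
  have b: "x (c b) \<in> J" "x (c b) \<in> J'" "\<psi> (x (c b)) = \<psi>' (x (c b))"
    using 1(4) 2(4) trans(3,4) by (auto dest!: bspec[where x=b])
  obtain \<zeta> where \<zeta>: "xcurve (J \<union> J') \<zeta>" "\<And>s. s \<in> J \<Longrightarrow> \<zeta> s = \<psi> s" "\<And>s. s \<in> J' \<Longrightarrow> \<zeta> s = \<psi>' s"
    using xcurve_glue[OF 1(3,1,2) 2(3,1,2) b] by blast
  have "connected (J \<union> J')" using 1(2) 2(2) b by (intro connected_Un) auto
  moreover have "\<forall>t\<in>{a..d}. x (c t) \<in> J \<union> J' \<and> c t = \<zeta> (x (c t))"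
  proof
    fix t assume "t \<in> {a..d}"
    then show "x (c t) \<in> J \<union> J' \<and> c t = \<zeta> (x (c t))"
      using 1(4) 2(4) \<zeta>(2,3) by (cases "t \<le> b") force+
  qed
  ultimately show ?case using 1(1) 2(1) \<zeta>(1) by (intro exI[of _ "J \<union> J'"] exI[of _ \<zeta>]) auto
next
  case (local t0)
  then have t0: "t0 \<in> T" using t12 by auto
  obtain d \<psi> where d: "d > 0" "xcurve {x (c t0) - d<..<x (c t0) + d} \<psi>"
    "\<psi> (x (c t0)) = c t0"
    and *: "\<forall>T c' l t0'. field_curve \<xi> T l c' \<and> t0' \<in> T \<and> c' t0' = c t0
      \<longrightarrow> (\<forall>\<^sub>F t in at t0'. \<bar>x (c' t) - x (c t0)\<bar> < d \<and> c' t = \<psi> (x (c' t)))"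
    using local_solution[OF O[OF t0]] by blast
  have "\<forall>\<^sub>F t in at t0. \<bar>x (c t) - x (c t0)\<bar> < d \<and> c t = \<psi> (x (c t))"
    using * fc t0 by blast
  then obtain r where r: "r > 0" "\<And>t. t \<noteq> t0 \<Longrightarrow> \<bar>t - t0\<bar> < r \<Longrightarrow> \<bar>x (c t) - x (c t0)\<bar> < d \<and> c t = \<psi> (x (c t))"
    unfolding eventually_at by (auto simp: dist_real_def)
  have r': "\<bar>x (c t) - x (c t0)\<bar> < d \<and> c t = \<psi> (x (c t))" if "\<bar>t - t0\<bar> < r" for t
    using r(2)[of t] that d(1,3) by (cases "t = t0") auto
  show ?case
  proof (intro exI[of _ r] conjI allI impI r(1))
    fix a b assume ab: "a \<le> t0 \<and> t0 \<le> b \<and> b - a < r"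
    show "?P a b"
    proof (intro exI[of _ "{x (c t0) - d<..<x (c t0) + d}"] exI[of _ \<psi>] conjI ballI d(2))
      fix t assume "t \<in> {a..b}"
      then have "\<bar>t - t0\<bar> < r" using ab by auto
      from r'[OF this] show "x (c t) \<in> {x (c t0) - d<..<x (c t0) + d}" "c t = \<psi> (x (c t))"
        by (auto simp: abs_less_iff)
    qed auto
  qed
qed

text \<open>Small clock values are all attained by the intermediate value theorem, and equal values
  mean equal points. The last conclusion says that smaller values are attained at earlier times,
  which is what yields the limit of \<psi> at the origin.\<close>

lemma clock_reparametrization:
  assumes fc: "field_curve \<xi> {0<..<a} l c" and a: "a > 0" and O: "\<And>t. t \<in> {0<..<a} \<Longrightarrow> c t \<in> \<O>"
    and pos: "\<And>t. t \<in> {0<..<a} \<Longrightarrow> x (c t) > 0" and lim: "((\<lambda>t. x (c t)) \<longlongrightarrow> 0) (at_right 0)"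
  obtains b \<psi> where "b > 0" "xcurve {0<..<b} \<psi>" "\<psi> ` {0<..<b} \<subseteq> c ` {0<..<a}"
    "\<forall>t\<in>{0<..<a}. x (c t) < b \<longrightarrow> c t = \<psi> (x (c t))"
    "\<forall>t1\<in>{0<..<a}. \<forall>s. 0 < s \<and> s < x (c t1) \<longrightarrow> (\<exists>t\<in>{0<..<t1}. \<psi> s = c t)"
proof -
  define h where "h t = x (c t)" for t
  have conth: "continuous_on {t1..t2} h" if "{t1..t2} \<subseteq> {0<..<a}" for t1 t2
    unfolding h_def[abs_def]
    by (intro continuous_at_imp_continuous_on ballI open_clock_curve[OF fc] O) (use that in auto)
  have K: "c t = c t'" if "t \<in> {0<..<a}" "t' \<in> {0<..<a}" "h t = h t'" for t t'
  proof -
    have "{min t t'..max t t'} \<subseteq> {0<..<a}" using that by auto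
    moreover have "min t t' \<le> max t t'" by (simp add: min_def max_def)
    ultimately obtain \<psi> where "\<forall>u\<in>{min t t'..max t t'}. c u = \<psi> (h u)"
      using factors_through_xcurve[OF fc O, of "min t t'" "max t t'"] unfolding h_def by blast
    then have "c t = \<psi> (h t)" "c t' = \<psi> (h t')" by auto
    then show ?thesis using that(3) by simp
  qed
  have small: "\<exists>t\<in>{0<..<t1}. h t < s" if "t1 > 0" "s > 0" for t1 s
  proof -
    have "\<forall>\<^sub>F t in at_right 0. h t < s" using lim that(2) unfolding h_def by (rule order_tendstoD)
    moreover have "\<forall>\<^sub>F t in at_right 0. t \<in> {0<..<t1}" using that(1) by (rule eventually_at_right_real)
    ultimately have "\<forall>\<^sub>F t in at_right 0. t \<in> {0<..<t1} \<and> h t < s" by eventually_elim auto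
    then show ?thesis using eventually_happens[of _ "at_right (0::real)"] by fastforce
  qed
  have ivt: "\<exists>t. t' \<le> t \<and> t \<le> t1 \<and> h t = s" if "t' \<le> t1" "h t' \<le> s" "s \<le> h t1" "{t'..t1} \<subseteq> {0<..<a}" for t' t1 s
    using IVT'[of h t' s t1] that conth by blast
  have hit: "\<exists>t\<in>{0<..<t1}. h t = s" if t1: "t1 \<in> {0<..<a}" and s: "0 < s" "s < h t1" for t1 s
  proof -
    obtain t' where t': "t' \<in> {0<..<t1}" "h t' < s" using small[of t1 s] t1 s by auto
    moreover have "{t'..t1} \<subseteq> {0<..<a}" using t' t1 by auto
    ultimately obtain t where "t' \<le> t" "t \<le> t1" "h t = s" using ivt[of t' t1 s] s by auto
    then show ?thesis using t' s by (intro bexI[of _ t]) (auto simp: less_le)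
  qed
  \<comment> \<open>By \<open>K\<close> the point is independent of the chosen time.\<close>
  define \<psi> where "\<psi> s = c (SOME t. t \<in> {0<..<a} \<and> h t = s)" for s
  have \<psi>: "\<psi> (h t) = c t" if "t \<in> {0<..<a}" for t
  proof -
    let ?u = "SOME u. u \<in> {0<..<a} \<and> h u = h t"
    have "?u \<in> {0<..<a} \<and> h ?u = h t"
      by (rule someI[of _ t]) (use that in auto)
    then have "c ?u = c t" using K that by blast
    then show ?thesis by (simp only: \<psi>_def)
  qed
  \<comment> \<open>Any interior time would do; every value below its clock value \<open>b\<close>
    is attained before it.\<close>
  define ts where "ts = a / 2"
  have ts: "ts \<in> {0<..<a}" unfolding ts_def using a by auto
  define b where "b = h ts"
  have b: "b > 0" unfolding b_def h_def using pos ts by blast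
  show ?thesis
  proof (rule that[OF b])
    show "xcurve {0<..<b} \<psi>"
      unfolding xcurve_def
    proof
      fix s assume "s \<in> {0<..<b}"
      then have s: "0 < s" "s < b" by auto
      obtain t where t: "t \<in> {0<..<ts}" "h t = s" using hit[OF ts s(1)] s(2) unfolding b_def by blast
      \<comment> \<open>A time with a smaller clock value makes \<open>s\<close> interior to the
        range of values swept between \<open>t'\<close> and \<open>ts\<close>, on which a single
        \<open>xcurve\<close> describes the curve.\<close>
      obtain t' where t': "t' \<in> {0<..<t}" "h t' < s" using small[of t s] t s by auto
      have sub: "{t'..ts} \<subseteq> {0<..<a}" using t t' ts by auto
      obtain J \<psi>' where J: "open J" "connected J" "xcurve J \<psi>'" "\<forall>u\<in>{t'..ts}. h u \<in> J \<and> c u = \<psi>' (h u)"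
        using factors_through_xcurve[OF fc O _ sub] t t' unfolding h_def by auto
      have eq: "\<psi> u = \<psi>' u \<and> u \<in> J" if u: "u \<in> {h t'<..<b}" for u
      proof -
        obtain w where "t' \<le> w" "w \<le> ts" "h w = u"
          using ivt[of t' ts u] u t t' sub unfolding b_def by auto
        then show ?thesis using J(4) \<psi>[of w] sub by force
      qed
      have s': "s \<in> {h t'<..<b}" using t' s by auto
      then have sJ: "s \<in> J" "\<psi> s = \<psi>' s" using eq by auto
      have "(\<psi>' has_vector_derivative \<eta> (\<psi> s)) (at s)" using J(3) sJ unfolding xcurve_def by simp
      then have "(\<psi> has_vector_derivative \<eta> (\<psi> s)) (at s)"
        by (rule has_vector_derivative_transform_within_open[OF _ _ s']) (use eq in auto)
      then show "\<psi> s \<in> \<O> \<and> x (\<psi> s) = s \<and> (\<psi> has_vector_derivative \<eta> (\<psi> s)) (at s)"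
        using J(3) sJ unfolding xcurve_def by auto
    qed
    show "\<psi> ` {0<..<b} \<subseteq> c ` {0<..<a}"
    proof
      fix p assume "p \<in> \<psi> ` {0<..<b}"
      then obtain s where s: "0 < s" "s < b" "p = \<psi> s" by auto
      then obtain t where "t \<in> {0<..<ts}" "h t = s" using hit[OF ts] unfolding b_def by blast
      then show "p \<in> c ` {0<..<a}" using s \<psi>[of t] ts by auto
    qed
    show "\<forall>t\<in>{0<..<a}. x (c t) < b \<longrightarrow> c t = \<psi> (x (c t))" using \<psi> unfolding h_def by simp
    have "\<exists>t\<in>{0<..<t1}. \<psi> s = c t" if "t1 \<in> {0<..<a}" "0 < s" "s < x (c t1)" for t1 s
      using hit[OF that(1,2)] that \<psi> unfolding h_def by fastforce
    then show "\<forall>t1\<in>{0<..<a}. \<forall>s. 0 < s \<and> s < x (c t1) \<longrightarrow> (\<exists>t\<in>{0<..<t1}. \<psi> s = c t)" by blast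
  qed
qed

end

section \<open>Trajectories in a chart\<close>

lemma C1_on_compose_bounded_linear:
  assumes "C1_on f U" "bounded_linear g"
  shows "C1_on (\<lambda>p. g (f p)) U"
proof -
  obtain f' where f': "\<And>p. p \<in> U \<Longrightarrow> (f has_derivative blinfun_apply (f' p)) (at p)" "continuous_on U f'"
    using assms(1) unfolding C1_on_def by blast
  have "((\<lambda>p. g (f p)) has_derivative blinfun_apply (Blinfun g o\<^sub>L f' p)) (at p)" if "p \<in> U" for p
  proof -
    have "blinfun_apply (Blinfun g o\<^sub>L f' p) = (\<lambda>v. g (blinfun_apply (f' p) v))"
      by (simp add: fun_eq_iff bounded_linear_Blinfun_apply[OF assms(2)])
    then show ?thesis using bounded_linear.has_derivative[OF assms(2) f'(1)[OF that]] by simp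
  qed
  moreover have "continuous_on U (\<lambda>p. Blinfun g o\<^sub>L f' p)"
    by (intro continuous_intros f'(2))
  ultimately show ?thesis
    unfolding C1_on_def by (intro exI[of _ "\<lambda>p. Blinfun g o\<^sub>L f' p"]) auto
qed

lemma C1_on_nth: "C1_on f U \<Longrightarrow> C1_on (\<lambda>p. f p $ i) U"
  by (rule C1_on_compose_bounded_linear[OF _ bounded_linear_vec_nth])

lemma trajectory_field_curve:
  assumes "trajectory_param W \<xi> a c" "continuous_on W \<xi>"
  obtains l where "field_curve \<xi> {0<..<a} l c"
proof -
  obtain D where D: "\<And>t. t \<in> {0<..<a} \<Longrightarrow> (c has_vector_derivative D t) (at t)" "continuous_on {0<..<a} D"
    using assms(1) unfolding trajectory_param_def C1_differentiable_on_def by blast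
  \<comment> \<open>The vanishing cross product yields a proportionality factor at each time
    separately; this quotient equals it and is visibly continuous.\<close>
  define l where "l t = (D t \<bullet> \<xi> (c t)) / (\<xi> (c t) \<bullet> \<xi> (c t))" for t
  have c: "c t \<in> W" "\<xi> (c t) \<noteq> 0" "cross3 (\<xi> (c t)) (D t) = 0" if "t \<in> {0<..<a}" for t
    using assms(1) that vector_derivative_at[OF D(1)[OF that]] unfolding trajectory_param_def by metis+
  have eq: "D t = l t *\<^sub>R \<xi> (c t)" if t: "t \<in> {0<..<a}" for t
  proof -
    have "collinear {0, \<xi> (c t), D t}" using c(3)[OF t] by (simp add: cross_eq_0)
    then obtain k where k: "D t = k *\<^sub>R \<xi> (c t)" using c(2)[OF t] by (auto simp: collinear_lemma)
    then have "l t = k" using c(2)[OF t] unfolding l_def by simp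
    then show ?thesis using k by simp
  qed
  have "continuous_on {0<..<a} c"
    using D(1) by (meson continuous_at_imp_continuous_on has_vector_derivative_continuous)
  then have "continuous_on {0<..<a} (\<lambda>t. \<xi> (c t))"
    using continuous_on_compose2[OF assms(2)] c(1) by blast
  then have "continuous_on {0<..<a} l"
    unfolding l_def using D(2) c(2) by (intro continuous_intros) auto
  then have "field_curve \<xi> {0<..<a} l c"
    unfolding field_curve_def using D(1) eq by simp
  then show ?thesis using that by blast
qed

lemma trajectory_param_restrict:
  "trajectory_param W \<xi> a c \<Longrightarrow> 0 < b \<Longrightarrow> b \<le> a \<Longrightarrow> trajectory_param W \<xi> b c"
  unfolding trajectory_param_def
  using C1_differentiable_on_subset[of c "{0<..<a}" "{0<..<b}"]
  by (auto simp: greaterThanLessThan_subseteq_greaterThanLessThan)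

lemma same_germ_sym: "same_germ A B \<Longrightarrow> same_germ B A"
  unfolding same_germ_def by (rule eventually_mono) blast+

lemma same_germ_trans: "same_germ A B \<Longrightarrow> same_germ B C \<Longrightarrow> same_germ A C"
  unfolding same_germ_def by (erule eventually_elim2) auto

lemma same_germ_eventually:
  assumes "same_germ A B" "(c \<longlongrightarrow> 0) F" "\<forall>\<^sub>F t in F. c t \<in> A"
  shows "\<forall>\<^sub>F t in F. c t \<in> B"
proof -
  have "\<forall>\<^sub>F t in F. c t \<in> A \<longleftrightarrow> c t \<in> B"
    using assms(1) unfolding same_germ_def by (rule eventually_compose_filterlim[OF _ assms(2)])
  then show ?thesis using assms(3) by eventually_elim blast
qed

text \<open>The property under the choice operator in \<open>chart_param\<close>, with the length of
  the interval made explicit.\<close>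

definition germ_param ::
  "(real^3) set \<Rightarrow> (real^3 \<Rightarrow> real^3) \<Rightarrow> (real^3) set \<Rightarrow> (real^3 \<Rightarrow> real^3) \<Rightarrow> (real^3) set \<Rightarrow>
   real \<Rightarrow> (real \<Rightarrow> real^3) \<Rightarrow> bool" where
  "germ_param W \<xi> V X \<Gamma> a c \<longleftrightarrow> trajectory_param W \<xi> a c \<and> c ` {0<..<a} \<subseteq> V \<and>
     same_germ (c ` {0<..<a}) \<Gamma> \<and> (\<forall>t\<in>{0<..<a}. X (c t) $ 1 = t)"

lemma germ_paramD:
  assumes "germ_param W \<xi> V X \<Gamma> a c"
  shows "a > 0" "trajectory_param W \<xi> a c" "(c \<longlongrightarrow> 0) (at_right 0)"
    "\<And>t. t \<in> {0<..<a} \<Longrightarrow> c t \<in> V \<and> c t \<in> W \<and> c t \<noteq> 0 \<and> X (c t) $ 1 = t"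
    "same_germ (c ` {0<..<a}) \<Gamma>"
  using assms unfolding germ_param_def trajectory_param_def by (blast | force)+

lemma germ_param_eventually:
  assumes "germ_param W \<xi> V X \<Gamma> a c"
  shows "\<forall>\<^sub>F t in at_right 0. t \<in> {0<..<a} \<and> c t \<in> V \<and> c t \<in> W \<and> c t \<noteq> 0 \<and> X (c t) $ 1 = t \<and> c t \<in> \<Gamma>"
proof -
  have e: "\<forall>\<^sub>F t in at_right 0. t \<in> {0<..<a}" using germ_paramD(1)[OF assms] by (rule eventually_at_right_real)
  then have "\<forall>\<^sub>F t in at_right 0. c t \<in> c ` {0<..<a}" by eventually_elim auto
  then have "\<forall>\<^sub>F t in at_right 0. c t \<in> \<Gamma>"
    by (rule same_germ_eventually[OF germ_paramD(5)[OF assms] germ_paramD(3)[OF assms]])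
  with e show ?thesis by eventually_elim (use germ_paramD(4)[OF assms] in auto)
qed

text \<open>This is why shortening a parameterization keeps its germ: points of \<open>V\<close>
  near 0 have small clock values. The point 0 is excluded because the limit says nothing about
  it.\<close>

lemma clock_small:
  assumes "(X \<longlongrightarrow> 0) (at 0 within V)" "b > 0"
  shows "\<forall>\<^sub>F p in nhds (0::real^3). p \<in> V \<longrightarrow> p \<noteq> 0 \<longrightarrow> X p $ (1::3) < (b::real)"
proof -
  have "((\<lambda>p. X p $ 1) \<longlongrightarrow> (0::real^3) $ 1) (at 0 within V)" by (rule tendsto_vec_nth[OF assms(1)])
  then have "\<forall>\<^sub>F p in at 0 within V. X p $ 1 < b"
    using assms(2) by (intro order_tendstoD(2)) simp_all
  then show ?thesis unfolding eventually_at_filter by eventually_elim auto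
qed

lemma germ_param_restrict:
  assumes g: "germ_param W \<xi> V X \<Gamma> a c" and X: "(X \<longlongrightarrow> 0) (at 0 within V)" and b: "0 < b" "b \<le> a"
  shows "germ_param W \<xi> V X \<Gamma> b c"
proof -
  have "same_germ (c ` {0<..<b}) (c ` {0<..<a})"
    unfolding same_germ_def using clock_small[OF X b(1)]
  proof eventually_elim
    case (elim p)
    show ?case
    proof
      show "p \<in> c ` {0<..<a}" if "p \<in> c ` {0<..<b}" using that b by auto
      assume "p \<in> c ` {0<..<a}"
      then obtain t where t: "t \<in> {0<..<a}" "p = c t" by blast
      then have "t < b" using elim germ_paramD(4)[OF g t(1)] by auto
      then show "p \<in> c ` {0<..<b}" using t by auto
    qed
  qed
  then show ?thesis
    using g b trajectory_param_restrict[of W \<xi> a c b] same_germ_trans unfolding germ_param_def by auto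
qed

lemma germ_param_representative:
  assumes "germ_param W \<xi> V X \<Gamma> a c"
  shows "representative W \<xi> \<Gamma> (c ` {0<..<a})"
  using assms unfolding germ_param_def representative_def trajectory_def by blast

text \<open>The change of clock between two charts. It later carries the estimates of regular
  separation from their own chart to the chart of the flat contact.\<close>

lemma germ_param_compare:
  assumes g: "germ_param W \<xi> V X \<Gamma> a c" and g0: "germ_param W \<xi> V0 X0 \<Gamma> a0 c0"
    and X0: "(X0 \<longlongrightarrow> 0) (at 0 within V0)"
  shows "\<forall>\<^sub>F t in at_right 0. c t = c0 (X0 (c t) $ 1)"
    "filterlim (\<lambda>t. X0 (c t) $ 1) (at_right 0) (at_right 0)"
proof -
  have "\<forall>\<^sub>F t in at_right 0. c t \<in> \<Gamma>" using germ_param_eventually[OF g] by eventually_elim auto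
  then have "\<forall>\<^sub>F t in at_right 0. c t \<in> c0 ` {0<..<a0}"
    by (rule same_germ_eventually[OF same_germ_sym[OF germ_paramD(5)[OF g0]] germ_paramD(3)[OF g]])
  then have *: "\<forall>\<^sub>F t in at_right 0. c t = c0 (X0 (c t) $ 1) \<and> c t \<in> V0 - {0} \<and> X0 (c t) $ 1 > 0"
    by eventually_elim (use germ_paramD(4)[OF g0] in auto)
  then show "\<forall>\<^sub>F t in at_right 0. c t = c0 (X0 (c t) $ 1)" by eventually_elim auto
  have "filterlim c (at 0 within V0) (at_right 0)"
    unfolding filterlim_at using * germ_paramD(3)[OF g] by (auto elim: eventually_mono)
  then have "((\<lambda>t. X0 (c t)) \<longlongrightarrow> 0) (at_right 0)"
    using X0 filterlim_compose by blast
  then have "((\<lambda>t. X0 (c t) $ 1) \<longlongrightarrow> (0::real^3) $ 1) (at_right 0)" by (rule tendsto_vec_nth)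
  then show "filterlim (\<lambda>t. X0 (c t) $ 1) (at_right 0) (at_right 0)"
    unfolding filterlim_at using * by (auto elim: eventually_mono)
qed

locale chart_field =
  fixes W :: "(real^3) set" and \<xi> :: "real^3 \<Rightarrow> real^3" and V :: "(real^3) set" and X :: "real^3 \<Rightarrow> real^3"
  assumes W: "open W" "C1_on \<xi> W" and V: "open V" and C1_X: "C1_on X V"
    and X_lim: "(X \<longlongrightarrow> 0) (at 0 within V)"

sublocale chart_field \<subseteq> clock W \<xi> V "\<lambda>q. X q $ 1"
  by unfold_locales (rule W V C1_on_nth[OF C1_X])+

context chart_field
begin

text \<open>Differentiating \<open>X (c t) $ 1 = t\<close> gives \<open>l t * dx (c t) = 1\<close>.
  Hence the clock is nowhere stationary along the curve, and its speed is that of \<eta>.\<close>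

lemma germ_param_xcurve:
  assumes "germ_param W \<xi> V X \<Gamma> a c"
  shows "xcurve {0<..<a} c"
proof -
  obtain l where l: "field_curve \<xi> {0<..<a} l c"
    using trajectory_field_curve[OF germ_paramD(2)[OF assms] continuous_on_xi] by blast
  show ?thesis
    unfolding xcurve_def
  proof
    fix t assume t: "t \<in> {0<..<a}"
    note c = germ_paramD(4)[OF assms t]
    have dc: "(c has_vector_derivative l t *\<^sub>R \<xi> (c t)) (at t)" using l t unfolding field_curve_def by blast
    have "((\<lambda>t. X (c t) $ 1) has_real_derivative l t * dx (c t)) (at t)"
      unfolding dx_def using has_real_derivative_along[OF C1_clock _ dc] c by blast
    moreover have "((\<lambda>t. X (c t) $ 1) has_real_derivative 1) (at t)"
      by (rule has_field_derivative_transform_within_open[OF DERIV_ident _ t]) (use germ_paramD(4)[OF assms] in auto)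
    ultimately have "l t * dx (c t) = 1" by (rule DERIV_unique)
    then have nz: "dx (c t) \<noteq> 0" by auto
    have "l t = 1 / dx (c t)" using \<open>l t * dx (c t) = 1\<close> nz by (simp add: eq_divide_eq)
    note nz this
    then show "c t \<in> \<O> \<and> X (c t) $ 1 = t \<and> (c has_vector_derivative \<eta> (c t)) (at t)"
      using c dc unfolding \<O>_def \<eta>_def by (simp add: divide_inverse)
  qed
qed

lemma xcurve_trajectory_param:
  assumes c: "xcurve {0<..<a} c" and a: "a > 0" and lim: "(c \<longlongrightarrow> 0) (at_right 0)"
    and nz: "\<And>t. t \<in> {0<..<a} \<Longrightarrow> c t \<noteq> 0"
  shows "trajectory_param W \<xi> a c"
proof -
  have d: "(c has_vector_derivative \<eta> (c t)) (at t)" "c t \<in> \<O>" if "t \<in> {0<..<a}" for t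
    using c that unfolding xcurve_def by auto
  have "continuous_on {0<..<a} (\<lambda>t. \<eta> (c t))"
    using continuous_on_compose2[OF continuous_on_eta xcurve_continuous_on[OF c]] d(2) by blast
  then have "c C1_differentiable_on {0<..<a}"
    unfolding C1_differentiable_on_def using d(1) by (intro exI[of _ "\<lambda>t. \<eta> (c t)"]) auto
  moreover have "\<xi> (c t) \<noteq> 0" if "t \<in> {0<..<a}" for t
  proof
    assume "\<xi> (c t) = 0"
    moreover have "c t \<in> V" "dx (c t) \<noteq> 0" using d(2)[OF that] unfolding \<O>_def by auto
    moreover have "linear (frechet_derivative (\<lambda>q. X q $ 1) (at (c t)))"
      using C1_on_has_derivative[OF C1_clock \<open>c t \<in> V\<close>] has_derivative_linear by blast
    ultimately show False unfolding dx_def by (simp add: linear_0)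
  qed
  moreover have "cross3 (\<xi> (c t)) (vector_derivative c (at t)) = 0" if "t \<in> {0<..<a}" for t
    using vector_derivative_at[OF d(1)[OF that]] unfolding \<eta>_def by (simp add: cross_mult_right)
  ultimately show ?thesis
    unfolding trajectory_param_def using a lim nz d(2) unfolding \<O>_def by auto
qed

text \<open>Justifies the choice in \<open>chart_param\<close>: an arbitrary parameterization of a
  representative in the chart can be replaced by one in clock time with the same germ.\<close>

lemma germ_param_exists:
  assumes \<Gamma>': "representative W \<xi> \<Gamma> \<Gamma>'" "\<Gamma>' \<subseteq> V" and pos: "\<And>p. p \<in> \<Gamma>' \<Longrightarrow> X p $ 1 > 0 \<and> dx p \<noteq> 0"
  shows "\<exists>a. germ_param W \<xi> V X \<Gamma> a (chart_param W \<xi> V X \<Gamma>)"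
proof -
  obtain a0 c0 where c0: "trajectory_param W \<xi> a0 c0" "\<Gamma>' = c0 ` {0<..<a0}"
    using \<Gamma>'(1) unfolding representative_def trajectory_def by blast
  have a0: "a0 > 0" "(c0 \<longlongrightarrow> 0) (at_right 0)" "\<And>t. t \<in> {0<..<a0} \<Longrightarrow> c0 t \<in> W \<and> c0 t \<noteq> 0"
    using c0(1) unfolding trajectory_param_def by auto
  obtain l where l: "field_curve \<xi> {0<..<a0} l c0"
    using trajectory_field_curve[OF c0(1) continuous_on_xi] by blast
  have c0V: "c0 t \<in> V" "X (c0 t) $ 1 > 0" "dx (c0 t) \<noteq> 0" if "t \<in> {0<..<a0}" for t
    using \<Gamma>'(2) c0(2) pos that by auto
  have c0O: "c0 t \<in> \<O>" if "t \<in> {0<..<a0}" for t using c0V a0(3) that unfolding \<O>_def by auto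
  have "\<forall>\<^sub>F t in at_right 0. t \<in> {0<..<a0}" using a0(1) by (rule eventually_at_right_real)
  then have "filterlim c0 (at 0 within V) (at_right 0)"
    unfolding filterlim_at using a0(2) by (auto elim!: eventually_mono simp: c0V a0(3))
  then have "((\<lambda>t. X (c0 t)) \<longlongrightarrow> 0) (at_right 0)"
    using X_lim filterlim_compose by blast
  then have "((\<lambda>t. X (c0 t) $ 1) \<longlongrightarrow> (0::real^3) $ 1) (at_right 0)" by (rule tendsto_vec_nth)
  then have lim: "((\<lambda>t. X (c0 t) $ 1) \<longlongrightarrow> 0) (at_right 0)" by simp
  obtain b \<psi> where b: "b > 0" "xcurve {0<..<b} \<psi>" "\<psi> ` {0<..<b} \<subseteq> c0 ` {0<..<a0}"
    and through: "\<forall>t\<in>{0<..<a0}. X (c0 t) $ 1 < b \<longrightarrow> c0 t = \<psi> (X (c0 t) $ 1)"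
    and early: "\<forall>t1\<in>{0<..<a0}. \<forall>s. 0 < s \<and> s < X (c0 t1) $ 1 \<longrightarrow> (\<exists>t\<in>{0<..<t1}. \<psi> s = c0 t)"
    by (rule clock_reparametrization[OF l a0(1) c0O c0V(2) lim]) (assumption | rule that)+
  have "(\<psi> \<longlongrightarrow> 0) (at_right 0)"
  proof (rule tendstoI)
    fix e :: real assume "e > 0"
    have "\<forall>\<^sub>F t in at_right 0. dist (c0 t) 0 < e" using tendstoD[OF a0(2) \<open>e > 0\<close>] .
    then obtain t2 where t2: "t2 > 0" "\<forall>t>0. t < t2 \<longrightarrow> dist (c0 t) 0 < e"
      unfolding eventually_at_right_field by auto
    \<comment> \<open>Clock values below that of \<open>t1\<close> are attained before
      \<open>t1\<close>, where \<open>c0\<close> is already within \<open>e\<close> of the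
      origin.\<close>
    define t1 where "t1 = min t2 a0 / 2"
    have t1: "t1 \<in> {0<..<a0}" "t1 < t2" using t2(1) a0(1) unfolding t1_def by (auto simp: min_def)
    have "\<forall>\<^sub>F s in at_right 0. s \<in> {0<..<X (c0 t1) $ 1}" using c0V(2)[OF t1(1)] by (rule eventually_at_right_real)
    then show "\<forall>\<^sub>F s in at_right 0. dist (\<psi> s) 0 < e"
    proof eventually_elim
      case (elim s)
      then obtain t where "t \<in> {0<..<t1}" "\<psi> s = c0 t" using bspec[OF early t1(1)] by auto
      then have "0 < t" "t < t2" "\<psi> s = c0 t" using t1(2) by auto
      then show ?case using t2(2) by simp
    qed
  qed
  moreover have "\<psi> s \<noteq> 0" if "s \<in> {0<..<b}" for s
    using b(3) a0(3) that by (metis image_iff subsetD)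
  ultimately have tp: "trajectory_param W \<xi> b \<psi>" using xcurve_trajectory_param[OF b(2,1)] by blast
  have "same_germ (\<psi> ` {0<..<b}) \<Gamma>'"
    unfolding same_germ_def using clock_small[OF X_lim b(1)]
  proof eventually_elim
    case (elim p)
    show ?case
    proof
      show "p \<in> \<Gamma>'" if "p \<in> \<psi> ` {0<..<b}" using that b(3) c0(2) by blast
      assume "p \<in> \<Gamma>'"
      then obtain t where t: "t \<in> {0<..<a0}" "p = c0 t" using c0(2) by blast
      then have "X p $ 1 < b" using elim c0V a0(3) by blast
      then show "p \<in> \<psi> ` {0<..<b}" using through t c0V(2)[OF t(1)] by auto
    qed
  qed
  then have "same_germ (\<psi> ` {0<..<b}) \<Gamma>"
    using \<Gamma>'(1) same_germ_trans unfolding representative_def by blast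
  then have "\<exists>c a. trajectory_param W \<xi> a c \<and> c ` {0<..<a} \<subseteq> V \<and> same_germ (c ` {0<..<a}) \<Gamma> \<and>
      (\<forall>t\<in>{0<..<a}. X (c t) $ 1 = t)"
    using tp b(2) unfolding xcurve_def \<O>_def by (intro exI[of _ \<psi>] exI[of _ b]) auto
  from someI_ex[OF this] show ?thesis
    unfolding germ_param_def chart_param_def by blast
qed

end

section \<open>Crossings of level sets\<close>

text \<open>Just before the least zero \<open>f\<close> would be positive, and the intermediate
  value theorem would produce an earlier zero. The crossing condition is free of derivatives because
  it is also applied to an angle that is merely continuous.\<close>

lemma stays_negative:
  fixes f :: "real \<Rightarrow> real"
  assumes cont: "continuous_on {a..b} f" and a: "f a < 0"
    and cross: "\<And>x. x \<in> {a..b} \<Longrightarrow> f x = 0 \<Longrightarrow> \<exists>d>0. \<forall>y. x - d < y \<and> y < x \<longrightarrow> f y > 0"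
    and x: "x \<in> {a..b}"
  shows "f x < 0"
proof (rule ccontr)
  assume "\<not> f x < 0"
  define Z where "Z = {y \<in> {a..x}. f y = 0}"
  have sub: "{a..x} \<subseteq> {a..b}" using x by auto
  have "\<exists>y. a \<le> y \<and> y \<le> x \<and> f y = 0"
    by (rule IVT') (use a x \<open>\<not> f x < 0\<close> continuous_on_subset[OF cont sub] in auto)
  then have ne: "Z \<noteq> {}" unfolding Z_def by auto
  have "closed Z"
    unfolding Z_def by (rule continuous_closed_preimage_constant[OF continuous_on_subset[OF cont sub]]) simp
  moreover have "bdd_below Z" unfolding Z_def by (auto intro!: bdd_belowI[of _ a])
  ultimately have z: "Inf Z \<in> Z" using ne closed_contains_Inf by blast
  define z where "z = Inf Z"
  have z: "a \<le> z" "z \<le> x" "f z = 0" using z unfolding z_def Z_def by auto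
  have "a < z" using z a by (metis order_less_irrefl order_le_less)
  obtain d where d: "d > 0" "\<forall>y. z - d < y \<and> y < z \<longrightarrow> f y > 0" using cross[of z] z x by auto
  define y where "y = max ((a + z) / 2) (z - d / 2)"
  have y: "a < y" "y < z" "z - d < y" using \<open>a < z\<close> d unfolding y_def by (auto simp: max_def field_simps)
  have "f y > 0" using d y by auto
  have "\<exists>w. a \<le> w \<and> w \<le> y \<and> f w = 0"
    by (rule IVT') (use a y z x \<open>f y > 0\<close> continuous_on_subset[OF cont, of "{a..y}"] in auto)
  then obtain w where w: "a \<le> w" "w \<le> y" "f w = 0" by blast
  then have "w \<in> Z" unfolding Z_def using y z by auto
  then have "z \<le> w" unfolding z_def using \<open>bdd_below Z\<close> by (rule cInf_lower)
  then show False using w y by simp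
qed

text \<open>The function \<open>- s * f\<close> becomes negative right after \<open>a\<close>, while
  at each zero it arrives from positive values; so it never vanishes again. The number
  \<open>s\<close> fixes the common direction of the crossings.\<close>

lemma two_zeros_same_direction:
  fixes f :: "real \<Rightarrow> real"
  assumes cont: "continuous_on {a..b} f" and ab: "a < b" "f a = 0" "f b = 0"
    and der: "\<And>x. x \<in> {a..b} \<Longrightarrow> f x = 0 \<Longrightarrow> \<exists>D. (f has_real_derivative D) (at x) \<and> s * D > 0"
  shows False
proof -
  define g where "g x = - s * f x" for x
  have gder: "\<exists>D. (g has_real_derivative D) (at x) \<and> D < 0" if x: "x \<in> {a..b}" "g x = 0" for x
  proof -
    have "s \<noteq> 0" using der[of a] ab by auto
    then obtain D where "(f has_real_derivative D) (at x)" "s * D > 0" using der[OF x(1)] x(2) unfolding g_def by auto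
    then have "(g has_real_derivative - s * D) (at x)" unfolding g_def[abs_def] by (intro DERIV_cmult)
    then show ?thesis using \<open>s * D > 0\<close> by (intro exI[of _ "- s * D"]) auto
  qed
  obtain D where "(g has_real_derivative D) (at a)" "D < 0" using gder[of a] ab unfolding g_def by auto
  then obtain d where d: "d > 0" "\<forall>h>0. h < d \<longrightarrow> g (a + h) < g a" using DERIV_neg_dec_right by blast
  define h where "h = min d (b - a) / 2"
  have h: "0 < h" "h < d" "a + h < b" using d ab unfolding h_def by (auto simp: min_def field_simps)
  have "g (a + h) < 0" using d h ab unfolding g_def by auto
  have "g b < 0"
  proof (rule stays_negative[of "a + h" b g])
    show "continuous_on {a + h..b} g"
      unfolding g_def[abs_def] using h by (intro continuous_intros continuous_on_subset[OF cont]) auto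
    fix x assume x: "x \<in> {a + h..b}" "g x = 0"
    then obtain D where "(g has_real_derivative D) (at x)" "D < 0" using gder[of x] h by auto
    then obtain e where e: "e > 0" "\<forall>k>0. k < e \<longrightarrow> g x < g (x - k)" using DERIV_neg_dec_left by blast
    have "g y > 0" if "x - e < y" "y < x" for y
      using e(2)[rule_format, of "x - y"] that x by simp
    then show "\<exists>d>0. \<forall>y. x - d < y \<and> y < x \<longrightarrow> g y > 0" using e(1) by blast
  qed (use \<open>g (a + h) < 0\<close> h in auto)
  then show False using ab unfolding g_def by simp
qed

text \<open>The speed is bounded only inside the ball. Up to the first exit time the mean value
  inequality limits the displacement to \<open>B * d\<close>, which does not suffice to
  leave.\<close>

lemma stays_in_ball:
  fixes y :: "real \<Rightarrow> 'a::real_inner"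
  assumes der: "\<And>u. \<bar>u - t\<bar> \<le> d \<Longrightarrow> (y has_vector_derivative y' u) (at u)"
    and bound: "\<And>u. \<bar>u - t\<bar> \<le> d \<Longrightarrow> norm (y u - y0) < r \<Longrightarrow> norm (y' u) \<le> B"
    and start: "norm (y t - y0) + B * d < r" and B: "B \<ge> 0" and u: "\<bar>u - t\<bar> \<le> d"
  shows "norm (y u - y0) < r"
proof -
  have one: "norm (z u - y0) < r" if u: "t \<le> u" "u \<le> t + d"
    and der: "\<And>u. t \<le> u \<Longrightarrow> u \<le> t + d \<Longrightarrow> (z has_vector_derivative z' u) (at u)"
    and bound: "\<And>u. t \<le> u \<Longrightarrow> u \<le> t + d \<Longrightarrow> norm (z u - y0) < r \<Longrightarrow> norm (z' u) \<le> B"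
    and start: "norm (z t - y0) + B * d < r" for z z' u
  proof (rule ccontr)
    assume no: "\<not> norm (z u - y0) < r"
    have contz: "continuous_on {t..t+d} z"
      using der by (intro continuous_at_imp_continuous_on ballI has_vector_derivative_continuous[of z "z' _"]) auto
    define f where "f u = norm (z u - y0)" for u
    have contf: "continuous_on {t..t+d} f" unfolding f_def[abs_def] by (intro continuous_intros contz)
    define Z where "Z = {v \<in> {t..u}. f v = r}"
    have sub: "{t..u} \<subseteq> {t..t+d}" using u by auto
    have ft: "f t < r" unfolding f_def using start B u by (smt (verit) mult_nonneg_nonneg)
    have "\<exists>v. t \<le> v \<and> v \<le> u \<and> f v = r"
      by (rule IVT') (use ft u no continuous_on_subset[OF contf sub] in \<open>auto simp: f_def\<close>)
    then have ne: "Z \<noteq> {}" unfolding Z_def by auto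
    have "closed Z"
      unfolding Z_def by (rule continuous_closed_preimage_constant[OF continuous_on_subset[OF contf sub]]) simp
    moreover have bdd: "bdd_below Z" unfolding Z_def by (auto intro!: bdd_belowI[of _ t])
    ultimately have "Inf Z \<in> Z" using ne closed_contains_Inf by blast
    then obtain v where v: "v = Inf Z" "t \<le> v" "v \<le> u" "f v = r" unfolding Z_def by auto
    have below: "f s < r" if "t \<le> s" "s < v" for s
    proof (rule ccontr)
      assume "\<not> f s < r"
      then have "\<exists>w. t \<le> w \<and> w \<le> s \<and> f w = r"
        by (intro IVT') (use ft that v u continuous_on_subset[OF contf, of "{t..s}"] in auto)
      then obtain w where "t \<le> w" "w \<le> s" "f w = r" by blast
      then have "w \<in> Z" unfolding Z_def using that v by auto
      then have "v \<le> w" unfolding v(1) using bdd by (rule cInf_lower)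
      then show False using \<open>w \<le> s\<close> that by simp
    qed
    have "t < v" using v ft by (metis order_less_irrefl order_le_less)
    obtain s where s: "s \<in> {t<..<v}" "norm (z v - z t) \<le> norm ((v - t) *\<^sub>R z' s)"
      using mvt_general[OF \<open>t < v\<close>, of z "\<lambda>s h. h *\<^sub>R z' s"] der v u
        continuous_on_subset[OF contz, of "{t..v}"] unfolding has_vector_derivative_def by auto
    have "norm (z' s) \<le> B" using bound[of s] below[of s] s v u unfolding f_def by auto
    then have "norm ((v - t) *\<^sub>R z' s) \<le> d * B"
      using v u by (auto intro!: mult_mono)
    then have "norm (z v - z t) \<le> B * d" using s by (simp add: mult.commute)
    moreover have "f v \<le> norm (z v - z t) + norm (z t - y0)"
      unfolding f_def using norm_triangle_ineq[of "z v - z t" "z t - y0"] by simp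
    ultimately show False using v start by simp
  qed
  show ?thesis
  proof (cases "t \<le> u")
    case True
    then show ?thesis using one[of u y y'] der bound start u by (auto simp: abs_le_iff)
  next
    case False
    \<comment> \<open>Backward times become forward times for the curve reflected at
      \<open>t\<close>.\<close>
    let ?z = "\<lambda>v. y (2 * t - v)"
    have dz: "(?z has_vector_derivative - y' (2 * t - v)) (at v)" if "t \<le> v" "v \<le> t + d" for v
    proof -
      have "((\<lambda>v. 2 * t - v) has_vector_derivative - 1) (at v)"
        by (auto intro!: derivative_eq_intros)
      from vector_diff_chain_at[OF this der[of "2 * t - v"]] that show ?thesis by (simp add: o_def)
    qed
    have "norm (?z (2 * t - u) - y0) < r"
      by (rule one[of "2 * t - u" ?z "\<lambda>v. - y' (2 * t - v)"]) (use dz bound start u False in \<open>auto simp: abs_le_iff\<close>)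
    then show ?thesis by simp
  qed
qed

text \<open>The barrier \<open>c u - \<epsilon> exp (K (u - u0)) e\<close> is pushed across the level set faster than the
  field, Lipschitz and tangent to the level set, can follow.\<close>

lemma level_set_one_sided:
  fixes G :: "'a::euclidean_space \<Rightarrow> real"
  assumes G: "C1_on G U" "open U" and \<xi>: "C1_on \<xi> W" "open W" and q0: "q0 \<in> U" "q0 \<in> W" "G q0 = 0"
    and e: "frechet_derivative G (at q0) e > 0"
    and tangent: "\<And>r. r \<in> U \<Longrightarrow> G r = 0 \<Longrightarrow> frechet_derivative G (at r) (\<xi> r) = 0"
    and c: "field_curve \<xi> T l c" "u0 \<in> T" "c u0 = q0"
  shows "\<exists>d>0. \<forall>u. u0 \<le> u \<and> u < u0 + d \<longrightarrow> G (c u) \<le> 0"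
proof -
  obtain G' where G': "\<And>p. p \<in> U \<Longrightarrow> (G has_derivative blinfun_apply (G' p)) (at p)" "continuous_on U G'"
    using G(1) unfolding C1_on_def by blast
  have fr: "frechet_derivative G (at p) = blinfun_apply (G' p)" if "p \<in> U" for p
    using frechet_derivative_at[OF G'(1)[OF that]] by simp
  obtain r1 L where L: "r1 > 0" "cball q0 r1 \<subseteq> W" "L \<ge> 0"
    "\<And>u v. u \<in> cball q0 r1 \<Longrightarrow> v \<in> cball q0 r1 \<Longrightarrow> norm (\<xi> u - \<xi> v) \<le> L * norm (u - v)"
    using C1_on_locally_lipschitz[OF \<xi> q0(2)] by metis
  define m where "m = G' q0 e / 2"
  have m: "m > 0" "m < G' q0 e" unfolding m_def using e fr[OF q0(1)] by auto
  define B where "B = norm (G' q0) + 1"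
  have contG': "isCont G' q0" using G'(2) G(2) q0(1) by (simp add: continuous_on_eq_continuous_at)
  have "\<forall>\<^sub>F p in nhds q0. norm (G' p) < B \<and> G' p e > m \<and> p \<in> U"
  proof (intro eventually_conj)
    have "(G' \<longlongrightarrow> G' q0) (nhds q0)" using contG' by (simp add: tendsto_nhds_iff continuous_at)
    then show "\<forall>\<^sub>F p in nhds q0. norm (G' p) < B" "\<forall>\<^sub>F p in nhds q0. G' p e > m"
      using m unfolding B_def by (auto intro!: order_tendstoD tendsto_intros)
    show "\<forall>\<^sub>F p in nhds q0. p \<in> U" using G(2) q0(1) by (rule eventually_nhds_in_open)
  qed
  then obtain r2 where r2: "r2 > 0" "\<And>p. dist p q0 < r2 \<Longrightarrow> norm (G' p) < B \<and> G' p e > m \<and> p \<in> U"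
    unfolding eventually_nhds_metric by blast
  define r where "r = min r1 r2"
  have r: "r > 0" "r \<le> r1" "r \<le> r2" unfolding r_def using L r2 by auto
  have near: "p \<in> U" "norm (G' p) \<le> B" "G' p e > m" "p \<in> cball q0 r1" if "dist p q0 < r" for p
    using r2(2)[of p] that r by (auto simp: dist_commute)
  have T: "open T" "continuous_on T l" "\<And>t. t \<in> T \<Longrightarrow> (c has_vector_derivative l t *\<^sub>R \<xi> (c t)) (at t)"
    using c(1) unfolding field_curve_def by auto
  define M where "M = \<bar>l u0\<bar> + 1"
  have "\<forall>\<^sub>F u in nhds u0. u \<in> T \<and> \<bar>l u\<bar> < M \<and> dist (c u) q0 < r / 2"
  proof (intro eventually_conj)
    show "\<forall>\<^sub>F u in nhds u0. u \<in> T" using T(1) c(2) by (rule eventually_nhds_in_open)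
    have "isCont l u0" using T c(2) by (simp add: continuous_on_eq_continuous_at)
    then have "(l \<longlongrightarrow> l u0) (nhds u0)" by (simp add: tendsto_nhds_iff continuous_at)
    then show "\<forall>\<^sub>F u in nhds u0. \<bar>l u\<bar> < M" unfolding M_def by (auto intro!: order_tendstoD tendsto_intros)
    have "isCont c u0" using T(3)[OF c(2)] has_vector_derivative_continuous by blast
    then have "(c \<longlongrightarrow> q0) (nhds u0)" using c(3) by (simp add: tendsto_nhds_iff continuous_at)
    then show "\<forall>\<^sub>F u in nhds u0. dist (c u) q0 < r / 2" using r(1) by (intro tendstoD) auto
  qed
  then obtain d0 where d0: "d0 > 0" "\<And>u. dist u u0 < d0 \<Longrightarrow> u \<in> T \<and> \<bar>l u\<bar> < M \<and> dist (c u) q0 < r / 2"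
    unfolding eventually_nhds_metric by blast
  \<comment> \<open>The 1 keeps the exponential factor of the barrier below
    \<open>exp K\<close>.\<close>
  define d where "d = min d0 1"
  \<comment> \<open>At a zero of \<Psi> the displaced point is on the level set, where the field is
    tangent. What remains of the drift is at most \<open>M * B * L * norm e\<close> times the
    displacement \<beta>, and the barrier contributes at least \<open>K * m\<close> times \<beta>;
    the added 1 makes the comparison strict.\<close>
  define K where "K = M * B * L * norm e / m + 1"
  have "B > 0" "M > 0" unfolding B_def M_def by (auto simp: add_nonneg_pos)
  then have "M * B * L * norm e / m \<ge> 0" using m L by simp
  then have K: "K > 0" "M * B * L * norm e < K * m" unfolding K_def using m by (simp, simp add: field_simps)
  have claim: "G (c u - (\<epsilon> * exp (K * (u - u0))) *\<^sub>R e) < 0"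
    if \<epsilon>: "\<epsilon> > 0" "\<epsilon> * exp K * norm e < r / 2" and u: "u0 \<le> u" "u < u0 + d" for \<epsilon> u
  proof -
    define \<beta> where "\<beta> v = \<epsilon> * exp (K * (v - u0))" for v
    define \<Psi> where "\<Psi> v = G (c v - \<beta> v *\<^sub>R e)" for v
    have \<beta>pos: "\<beta> v > 0" for v unfolding \<beta>_def using \<epsilon> by simp
    have v: "v \<in> T" "\<bar>l v\<bar> < M" "dist (c v) q0 < r / 2" "norm (\<beta> v *\<^sub>R e) < r / 2" if "u0 \<le> v" "v \<le> u" for v
    proof -
      have "dist v u0 < d0" using that u unfolding d_def by (auto simp: dist_real_def)
      then show "v \<in> T" "\<bar>l v\<bar> < M" "dist (c v) q0 < r / 2" using d0 by auto
      have "K * (v - u0) \<le> K * 1" using that u K unfolding d_def by (intro mult_left_mono) auto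
      then have "\<beta> v \<le> \<epsilon> * exp K" unfolding \<beta>_def using \<epsilon> by simp
      then have "\<beta> v * norm e \<le> \<epsilon> * exp K * norm e" by (intro mult_right_mono) auto
      then show "norm (\<beta> v *\<^sub>R e) < r / 2" using \<epsilon> \<beta>pos[of v] by simp
    qed
    have vr: "dist (c v - \<beta> v *\<^sub>R e) q0 < r" "dist (c v) q0 < r" if "u0 \<le> v" "v \<le> u" for v
      using v(3,4)[OF that] norm_triangle_ineq4[of "c v - q0" "\<beta> v *\<^sub>R e"] r(1)
      by (auto simp: dist_norm algebra_simps)
    have d\<Psi>: "(\<Psi> has_real_derivative G' (c v - \<beta> v *\<^sub>R e) (l v *\<^sub>R \<xi> (c v) - (K * \<beta> v) *\<^sub>R e)) (at v)"
      if "u0 \<le> v" "v \<le> u" for v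
    proof -
      have "(\<beta> has_real_derivative K * \<beta> v) (at v)"
        unfolding \<beta>_def[abs_def] by (auto intro!: derivative_eq_intros)
      then have "((\<lambda>v. \<beta> v *\<^sub>R e) has_vector_derivative (K * \<beta> v) *\<^sub>R e) (at v)"
        using has_vector_derivative_scaleR[of \<beta> _ v UNIV "\<lambda>_. e" 0] by simp
      then have "((\<lambda>v. c v - \<beta> v *\<^sub>R e) has_vector_derivative l v *\<^sub>R \<xi> (c v) - (K * \<beta> v) *\<^sub>R e) (at v)"
        by (intro has_vector_derivative_diff T(3) v(1)[OF that])
      from has_derivative_compose[OF this[unfolded has_vector_derivative_def] G'(1)[OF near(1)[OF vr(1)[OF that]]]]
      show ?thesis unfolding \<Psi>_def[abs_def] has_field_derivative_def
        by (elim has_derivative_eq_rhs) (auto simp: fun_eq_iff blinfun.scaleR_right)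
    qed
    have "\<Psi> u0 < 0"
    proof -
      have "(\<lambda>s. G (q0 - s *\<^sub>R e)) (\<beta> u0) < (\<lambda>s. G (q0 - s *\<^sub>R e)) 0"
      proof (rule DERIV_neg_imp_decreasing[OF \<beta>pos])
        fix s assume s: "0 \<le> s" "s \<le> \<beta> u0"
        have "norm (s *\<^sub>R e) \<le> norm (\<beta> u0 *\<^sub>R e)" using s by (auto intro!: mult_right_mono)
        then have "dist (q0 - s *\<^sub>R e) q0 < r" using v(4)[of u0] u r(1) by (simp add: dist_norm)
        note n = near[OF this]
        have "((\<lambda>s. q0 - s *\<^sub>R e) has_derivative (\<lambda>h. - (h *\<^sub>R e))) (at s)"
          by (auto intro!: derivative_eq_intros)
        from has_derivative_compose[OF this G'(1)[OF n(1)]]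
        have "((\<lambda>s. G (q0 - s *\<^sub>R e)) has_real_derivative - G' (q0 - s *\<^sub>R e) e) (at s)"
          unfolding has_field_derivative_def
          by (elim has_derivative_eq_rhs) (auto simp: fun_eq_iff blinfun.scaleR_right blinfun.minus_right)
        then show "\<exists>y. ((\<lambda>s. G (q0 - s *\<^sub>R e)) has_real_derivative y) (at s) \<and> y < 0"
          using n(3) m by (intro exI[of _ "- G' (q0 - s *\<^sub>R e) e"]) auto
      qed
      then show ?thesis unfolding \<Psi>_def using c(3) q0(3) by simp
    qed
    have "\<Psi> u < 0"
    proof (rule stays_negative[of u0 u \<Psi>])
      show "continuous_on {u0..u} \<Psi>"
        using d\<Psi> by (intro continuous_at_imp_continuous_on ballI DERIV_isCont) auto
      fix v assume v': "v \<in> {u0..u}" "\<Psi> v = 0"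
      let ?r = "c v - \<beta> v *\<^sub>R e"
      have nr: "dist ?r q0 < r" "dist (c v) q0 < r" using vr v' by auto
      note n = near[OF nr(1)]
      have "G' ?r (\<xi> ?r) = 0" using tangent[OF n(1)] v'(2) fr[OF n(1)] unfolding \<Psi>_def by simp
      then have eq: "G' ?r (l v *\<^sub>R \<xi> (c v) - (K * \<beta> v) *\<^sub>R e) = l v * G' ?r (\<xi> (c v) - \<xi> ?r) - K * \<beta> v * G' ?r e"
        by (simp add: blinfun.scaleR_right blinfun.diff_right)
      have "\<bar>G' ?r (\<xi> (c v) - \<xi> ?r)\<bar> \<le> norm (G' ?r) * norm (\<xi> (c v) - \<xi> ?r)"
        using norm_blinfun[of "G' ?r"] by simp
      also have "\<dots> \<le> B * (L * norm (c v - ?r))"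
        using n(2) L(4)[OF near(4)[OF nr(2)] n(4)] \<open>B > 0\<close> by (intro mult_mono) auto
      also have "\<dots> = B * (L * (\<beta> v * norm e))" using \<beta>pos[of v] by simp
      finally have *: "\<bar>G' ?r (\<xi> (c v) - \<xi> ?r)\<bar> \<le> B * (L * (\<beta> v * norm e))" .
      have "l v * G' ?r (\<xi> (c v) - \<xi> ?r) \<le> \<bar>l v\<bar> * \<bar>G' ?r (\<xi> (c v) - \<xi> ?r)\<bar>"
        by (metis abs_ge_self abs_mult)
      also have "\<dots> \<le> M * (B * (L * (\<beta> v * norm e)))"
        using v(2)[of v] v' * \<open>M > 0\<close> by (intro mult_mono) auto
      also have "\<dots> = (M * B * L * norm e) * \<beta> v" by simp
      also have "\<dots> < K * m * \<beta> v" using K(2) \<beta>pos[of v] by simp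
      also have "\<dots> \<le> K * \<beta> v * G' ?r e" using n(3) K(1) \<beta>pos[of v] by simp
      finally have neg: "G' ?r (l v *\<^sub>R \<xi> (c v) - (K * \<beta> v) *\<^sub>R e) < 0" unfolding eq by simp
      from DERIV_neg_dec_left[OF d\<Psi> neg] v'
      obtain k where k: "k > 0" "\<forall>h>0. h < k \<longrightarrow> \<Psi> v < \<Psi> (v - h)" by auto
      have "\<Psi> y > 0" if "v - k < y" "y < v" for y
        using k(2)[rule_format, of "v - y"] that v' by simp
      then show "\<exists>d>0. \<forall>y. v - d < y \<and> y < v \<longrightarrow> \<Psi> y > 0" using k(1) by blast
    qed (use u \<open>\<Psi> u0 < 0\<close> in auto)
    then show ?thesis unfolding \<Psi>_def \<beta>_def .
  qed
  show ?thesis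
  proof (intro exI[of _ d] conjI allI impI)
    show "d > 0" unfolding d_def using d0 by simp
    fix u assume u: "u0 \<le> u \<and> u < u0 + d"
    have "dist (c u) q0 < r / 2" using d0(2)[of u] u unfolding d_def by (auto simp: dist_real_def)
    then have cu: "dist (c u) q0 < r" using r(1) by linarith
    \<comment> \<open>Letting the height of the barrier tend to 0 turns the strict inequality for
      the displaced point into a weak one for \<open>c u\<close>.\<close>
    define f where "f \<epsilon> = c u - (\<epsilon> * exp (K * (u - u0))) *\<^sub>R e" for \<epsilon>
    have "isCont G (c u)" using G'(1)[OF near(1)[OF cu]] by (rule has_derivative_continuous)
    moreover have "(f \<longlongrightarrow> f 0) (at_right 0)"
      unfolding f_def by (intro tendsto_intros)
    ultimately have "((\<lambda>\<epsilon>. G (f \<epsilon>)) \<longlongrightarrow> G (c u)) (at_right 0)"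
      using isCont_tendsto_compose[of "c u" G f "at_right 0"] by (simp add: f_def[of 0])
    moreover have "\<forall>\<^sub>F \<epsilon> in at_right 0. G (f \<epsilon>) \<le> 0"
    proof -
      have "r / (2 * (exp K * norm e + 1)) > 0" using r(1) by (simp add: add_nonneg_pos)
      then have "\<forall>\<^sub>F \<epsilon> in at_right 0. \<epsilon> \<in> {0<..<r / (2 * (exp K * norm e + 1))}" by (rule eventually_at_right_real)
      then show ?thesis
      proof eventually_elim
        case (elim \<epsilon>)
        have p: "exp K * norm e + 1 > 0" by (simp add: add_nonneg_pos)
        have "\<epsilon> * (exp K * norm e + 1) < r / 2" using elim p by (simp add: field_simps)
        moreover have "\<epsilon> * exp K * norm e \<le> \<epsilon> * (exp K * norm e + 1)" using elim by (simp add: algebra_simps)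
        ultimately have "\<epsilon> * exp K * norm e < r / 2" by simp
        then show ?case using claim[of \<epsilon> u] elim u unfolding f_def by auto
      qed
    qed
    ultimately show "G (c u) \<le> 0" by (rule tendsto_upperbound) simp
  qed
qed

text \<open>Tangency is known on the level set only and \<open>G\<close> is merely of class C1, so
  \<open>G (c u)\<close> need not obey a Gronwall inequality. Instead the one-sided bound is applied
  to \<open>G\<close> and to \<open>- G\<close>, and once more to the curve run backwards.\<close>

lemma level_set_invariant:
  fixes G :: "'a::euclidean_space \<Rightarrow> real"
  assumes G: "C1_on G U" "open U" and \<xi>: "C1_on \<xi> W" "open W" and q0: "q0 \<in> U" "q0 \<in> W" "G q0 = 0"
    and e: "frechet_derivative G (at q0) e \<noteq> 0"
    and tangent: "\<And>r. r \<in> U \<Longrightarrow> G r = 0 \<Longrightarrow> frechet_derivative G (at r) (\<xi> r) = 0"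
    and c: "field_curve \<xi> T l c" "u0 \<in> T" "c u0 = q0"
  shows "\<forall>\<^sub>F u in nhds u0. G (c u) = 0"
proof -
  have dG: "(G has_derivative frechet_derivative G (at p)) (at p)" if "p \<in> U" for p
    using G(1) that unfolding C1_on_def by (metis frechet_derivative_at)
  have lin: "linear (frechet_derivative G (at p))" if "p \<in> U" for p
    using dG[OF that] has_derivative_linear by blast
  have neg: "frechet_derivative (\<lambda>q. - G q) (at p) = (\<lambda>v. - frechet_derivative G (at p) v)" if "p \<in> U" for p
    using frechet_derivative_at[OF has_derivative_minus[OF dG[OF that]]] by simp
  have C1n: "C1_on (\<lambda>q. - G q) U"
    using C1_on_compose_bounded_linear[OF G(1) bounded_linear_minus[OF bounded_linear_ident]] .
  obtain e1 where e1: "frechet_derivative G (at q0) e1 > 0"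
    using e lin[OF q0(1)] by (metis linear_neg linorder_neqE_linordered_idom neg_0_less_iff_less)
  have e2: "frechet_derivative (\<lambda>q. - G q) (at q0) (- e1) > 0"
    unfolding neg[OF q0(1)] using e1 lin[OF q0(1)] by (simp add: linear_neg)
  have right: "\<exists>d>0. \<forall>u. u0 \<le> u \<and> u < u0 + d \<longrightarrow> G (c u) = 0"
    if c: "field_curve \<xi> T l c" "u0 \<in> T" "c u0 = q0" for T l c u0
  proof -
    obtain d1 where d1: "d1 > 0" "\<forall>u. u0 \<le> u \<and> u < u0 + d1 \<longrightarrow> G (c u) \<le> 0"
      using level_set_one_sided[OF G \<xi> q0 e1 tangent c] by blast
    obtain d2 where d2: "d2 > 0" "\<forall>u. u0 \<le> u \<and> u < u0 + d2 \<longrightarrow> - G (c u) \<le> 0"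
      using level_set_one_sided[OF C1n G(2) \<xi> q0(1,2) _ e2 _ c] q0(3) tangent neg by auto
    show ?thesis using d1 d2 by (intro exI[of _ "min d1 d2"]) (auto intro!: antisym)
  qed
  obtain d1 where d1: "d1 > 0" "\<forall>u. u0 \<le> u \<and> u < u0 + d1 \<longrightarrow> G (c u) = 0" using right[OF c] by blast
  have "field_curve \<xi> ((\<lambda>u. - u) ` T) (\<lambda>u. - l (- u)) (\<lambda>u. c (- u))"
    unfolding field_curve_def
  proof (intro conjI ballI)
    have T: "open T" "continuous_on T l" "\<And>t. t \<in> T \<Longrightarrow> (c has_vector_derivative l t *\<^sub>R \<xi> (c t)) (at t)"
      using c(1) unfolding field_curve_def by auto
    show "open (uminus ` T)" using T(1) by (rule open_negations)
    show "continuous_on (uminus ` T) (\<lambda>u. - l (- u))"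
      by (intro continuous_intros continuous_on_compose2[OF T(2)]) auto
    fix t assume "t \<in> uminus ` T"
    then have t: "- t \<in> T" by auto
    have "((\<lambda>t::real. - t) has_vector_derivative - 1) (at t)"
      by (auto intro!: derivative_eq_intros)
    from vector_diff_chain_at[OF this T(3)[OF t]]
    show "((\<lambda>u. c (- u)) has_vector_derivative (- l (- t)) *\<^sub>R \<xi> (c (- t))) (at t)" by (simp add: o_def)
  qed
  from right[OF this, of "- u0"] c obtain d2 where d2: "d2 > 0" "\<forall>u. - u0 \<le> u \<and> u < - u0 + d2 \<longrightarrow> G (c (- u)) = 0"
    by auto
  have "G (c u) = 0" if "dist u u0 < min d1 d2" for u
    using d1(2)[rule_format, of u] d2(2)[rule_format, of "- u"] that by (cases "u0 \<le> u") (auto simp: dist_real_def)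
  then show ?thesis
    unfolding eventually_nhds_metric using d1 d2 by (intro exI[of _ "min d1 d2"]) auto
qed

section \<open>Regular separation in an arbitrary chart\<close>

lemma definable_chartD:
  assumes "definable_chart S V X"
  shows "open V" "C1_on X V" "(X \<longlongrightarrow> 0) (at 0 within V)" "inj_on X V"
    "definable_map S 3 V (\<lambda>p. coords3 (X p))" "definable_set S V"
  using assms unfolding definable_chart_def diffeomorphism_onto_image_def
  by (auto intro: inj_on_inverseI)

lemma adapted_chart_germ_param:
  assumes "definable_C1_vector_field S W \<xi>" "adapted_chart S W \<xi> V X \<Gamma>"
  shows "chart_field W \<xi> V X" "\<exists>a. germ_param W \<xi> V X \<Gamma> a (chart_param W \<xi> V X \<Gamma>)"
proof -
  have ch: "definable_chart S V X" using assms(2) unfolding adapted_chart_def by blast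
  show "chart_field W \<xi> V X"
    using assms(1) definable_chartD[OF ch] unfolding definable_C1_vector_field_def chart_field_def by blast
  then interpret chart_field W \<xi> V X .
  show "\<exists>a. germ_param W \<xi> V X \<Gamma> a (chart_param W \<xi> V X \<Gamma>)"
    using assms(2) germ_param_exists unfolding adapted_chart_def dx_def by blast
qed

text \<open>Condition (i) of regular separation for a parameterized curve in space and total
  definable functions, so that it no longer refers to a chart.\<close>

definition separates :: "(nat \<Rightarrow> real list set set) \<Rightarrow> (real \<Rightarrow> real^3) \<Rightarrow> bool" where
  "separates S c \<longleftrightarrow> (\<forall>f. ominimal_real_field.df S f \<longrightarrow>
     (\<forall>\<^sub>F t in at_right 0. f (c t) = 0) \<or> (\<exists>k. \<forall>\<^sub>F t in at_right 0. \<bar>f (c t)\<bar> \<ge> t ^ k))"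

section \<open>Consequences of regular separation for definable sets and radii\<close>

context ominimal_real_field
begin

text \<open>Regular separation speaks about functions of the chart coordinates. A function in space
  is brought there by quantifying over the preimage under \<open>X\<close>, with value zero off the
  image.\<close>

lemma df_chart_pullback:
  assumes X: "ds V" "\<And>i. df (ext V (\<lambda>q. X q $ i))" "inj_on X V" and f: "df f"
  shows "df (ext (X ` V) (\<lambda>w. f (the_inv_into V X w)))"
  unfolding df_def
proof (rule dm_unique)
  let ?E = "\<lambda>t q. q \<in> V \<and> ext V (\<lambda>q. X q $ 1) q = fst t \<and> ext V (\<lambda>q. X q $ 2) q = fst (snd t) \<and>
      ext V (\<lambda>q. X q $ 3) q = snd (snd t)"
  show "dp (\<lambda>z. (\<exists>q. ?E (fst z) q \<and> snd z = f q) \<or> (\<not> (\<exists>q. ?E (fst z) q) \<and> snd z = 0))"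
    by (intro d_intros dp_ds[OF X(1)] dm_df[OF X(2)] dm_df[OF f])
  fix t :: "real \<times> real \<times> real" and y
  have E: "?E t q \<longleftrightarrow> q \<in> V \<and> X q = vec3 t" for q
    by (auto simp: ext_def vec_eq_iff forall_3)
  have *: "(\<exists>q. ?E t q) \<longleftrightarrow> vec3 t \<in> X ` V" unfolding E image_iff by metis
  show "(\<exists>q. ?E t q \<and> y = f q) \<or> (\<not> (\<exists>q. ?E t q) \<and> y = 0) \<longleftrightarrow>
      y = ext (X ` V) (\<lambda>w. f (the_inv_into V X w)) (vec3 t)"
  proof (cases "vec3 t \<in> X ` V")
    case True
    then obtain q where q: "q \<in> V" "X q = vec3 t" by (metis imageE)
    then have inv: "the_inv_into V X (vec3 t) = q" using the_inv_into_f_f[OF X(3)] by metis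
    have uniq: "q' = q" if "q' \<in> V" "X q' = vec3 t" for q' using that q X(3) by (metis inj_onD)
    have "(\<exists>q'. ?E t q' \<and> y = f q') \<longleftrightarrow> y = f q" unfolding E using q uniq by blast
    moreover have "\<exists>q. ?E t q" using * True by blast
    moreover have "ext (X ` V) (\<lambda>w. f (the_inv_into V X w)) (vec3 t) = f q" using True inv by (simp add: ext_def)
    ultimately show ?thesis by argo
  next
    case False
    then have "\<not> (\<exists>q. ?E t q)" using * by blast
    moreover have "ext (X ` V) (\<lambda>w. f (the_inv_into V X w)) (vec3 t) = 0" using False by (simp add: ext_def)
    ultimately show ?thesis by auto
  qed
qed

text \<open>Let \<open>s\<close> be the clock of the chart in which separation is given and
  \<open>t\<close> the clock of the target chart. Condition (ii), applied to \<open>t\<close> as a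
  definable function, gives \<open>t < s powr (1 / m)\<close>, that is \<open>t ^ m \<le> s\<close>;
  thus a lower bound \<open>s ^ k\<close> becomes \<open>t ^ (m * k)\<close>.\<close>

lemma regular_separation_separates:
  assumes field: "definable_C1_vector_field S W \<xi>" and reg: "regular_separation S W \<xi> \<Gamma>"
    and chart: "definable_chart S V X" and g: "germ_param W \<xi> V X \<Gamma> a c"
  shows "separates S c"
proof -
  obtain V0 X0 where ad: "adapted_chart S W \<xi> V0 X0 \<Gamma>"
    and i: "\<And>D f. definable_near_graph S (chart_curve W \<xi> V0 X0 \<Gamma>) D f \<Longrightarrow>
        \<exists>a>0. (\<forall>x\<in>{0<..<a}. f (graph_point (chart_curve W \<xi> V0 X0 \<Gamma>) x) = 0) \<or>
          (\<exists>k::nat. \<forall>x\<in>{0<..<a}. \<bar>f (graph_point (chart_curve W \<xi> V0 X0 \<Gamma>) x)\<bar> \<ge> x ^ k)"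
    and ii: "\<And>D f. definable_near_graph S (chart_curve W \<xi> V0 X0 \<Gamma>) D f \<Longrightarrow>
        ((\<lambda>x. f (graph_point (chart_curve W \<xi> V0 X0 \<Gamma>) x)) \<longlongrightarrow> 0) (at_right 0) \<Longrightarrow>
        \<exists>k::nat. k \<ge> 1 \<and> (\<exists>a>0. \<forall>x\<in>{0<..<a}. \<bar>f (graph_point (chart_curve W \<xi> V0 X0 \<Gamma>) x)\<bar> < x powr (1 / real k))"
    using reg unfolding regular_separation_def Let_def by blast
  have ch0: "definable_chart S V0 X0" using ad unfolding adapted_chart_def by blast
  note X0 = definable_chartD[OF ch0] and X = definable_chartD[OF chart]
  define c0 where "c0 = chart_param W \<xi> V0 X0 \<Gamma>"
  obtain a0 where g0: "germ_param W \<xi> V0 X0 \<Gamma> a0 c0"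
    using adapted_chart_germ_param(2)[OF field ad] unfolding c0_def by blast
  define \<gamma> where "\<gamma> = chart_curve W \<xi> V0 X0 \<Gamma>"
  have gp: "graph_point \<gamma> s = X0 (c0 s)" if "s \<in> {0<..<a0}" for s
    using germ_paramD(4)[OF g0 that] unfolding graph_point_def \<gamma>_def chart_curve_def c0_def Let_def
    by (auto simp: vec_eq_iff forall_3)
  have ev0: "\<forall>\<^sub>F s in at_right 0. s \<in> {0<..<a0}" using germ_paramD(1)[OF g0] by (rule eventually_at_right_real)
  define pb where "pb f = ext (X0 ` V0) (\<lambda>w. f (the_inv_into V0 X0 w))" for f
  have pbd: "definable_near_graph S \<gamma> UNIV (pb f)" if "df f" for f
    unfolding definable_near_graph_def pb_def
    using definable_map1I df_chart_pullback[OF _ _ X0(4) that] df_ext_map3[OF X0(5)] by simp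
  have pbv: "pb f (graph_point \<gamma> s) = f (c0 s)" if "s \<in> {0<..<a0}" for f s
    using germ_paramD(4)[OF g0 that] unfolding gp[OF that] pb_def ext_def by (simp add: the_inv_into_f_f[OF X0(4)])
  have ev_ball: "\<forall>\<^sub>F s in at_right 0. P s" if "b > 0" "\<forall>s\<in>{0<..<b}. P s" for b and P :: "real \<Rightarrow> bool"
    using eventually_at_right_real[OF that(1)] by eventually_elim (use that in blast)
  have main0: "(\<forall>\<^sub>F s in at_right 0. f (c0 s) = 0) \<or> (\<exists>k::nat. \<forall>\<^sub>F s in at_right 0. \<bar>f (c0 s)\<bar> \<ge> s ^ k)" if dff: "df f" for f
  proof -
    obtain b where b: "b > 0" "(\<forall>x\<in>{0<..<b}. pb f (graph_point \<gamma> x) = 0) \<or>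
          (\<exists>k::nat. \<forall>x\<in>{0<..<b}. \<bar>pb f (graph_point \<gamma> x)\<bar> \<ge> x ^ k)"
      using i[of UNIV "pb f"] pbd[OF dff] unfolding \<gamma>_def by blast
    from b(2) show ?thesis
    proof
      assume "\<forall>x\<in>{0<..<b}. pb f (graph_point \<gamma> x) = 0"
      from ev_ball[OF b(1) this] ev0 have "\<forall>\<^sub>F s in at_right 0. f (c0 s) = 0"
        by eventually_elim (use pbv in auto)
      then show ?thesis ..
    next
      assume "\<exists>k::nat. \<forall>x\<in>{0<..<b}. \<bar>pb f (graph_point \<gamma> x)\<bar> \<ge> x ^ k"
      then obtain k :: nat where "\<forall>x\<in>{0<..<b}. \<bar>pb f (graph_point \<gamma> x)\<bar> \<ge> x ^ k" by blast
      from ev_ball[OF b(1) this] ev0 have "\<forall>\<^sub>F s in at_right 0. \<bar>f (c0 s)\<bar> \<ge> s ^ k"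
        by eventually_elim (use pbv in auto)
      then show ?thesis by blast
    qed
  qed
  \<comment> \<open>The clock of the target chart, followed along the curve of the other
    one.\<close>
  define u where "u = ext V (\<lambda>q. X q $ 1)"
  have du: "df u" unfolding u_def using df_ext_map3[OF X(5)] by blast
  have "\<forall>\<^sub>F s in at_right 0. c0 s \<in> \<Gamma>" using germ_param_eventually[OF g0] by eventually_elim auto
  then have "\<forall>\<^sub>F s in at_right 0. c0 s \<in> c ` {0<..<a}"
    by (rule same_germ_eventually[OF same_germ_sym[OF germ_paramD(5)[OF g]] germ_paramD(3)[OF g0]])
  then have inV: "\<forall>\<^sub>F s in at_right 0. c0 s \<in> V - {0}"
    by eventually_elim (use germ_paramD(4)[OF g] in auto)
  then have "filterlim c0 (at 0 within V) (at_right 0)"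
    unfolding filterlim_at using germ_paramD(3)[OF g0] by (auto elim: eventually_mono)
  then have "((\<lambda>s. X (c0 s)) \<longlongrightarrow> 0) (at_right 0)" using X(3) filterlim_compose by blast
  then have "((\<lambda>s. X (c0 s) $ 1) \<longlongrightarrow> (0::real^3) $ 1) (at_right 0)" by (rule tendsto_vec_nth)
  then have "((\<lambda>s. X (c0 s) $ 1) \<longlongrightarrow> 0) (at_right 0)" by simp
  then have "((\<lambda>s. u (c0 s)) \<longlongrightarrow> 0) (at_right 0)"
  proof (rule Lim_transform_eventually)
    show "\<forall>\<^sub>F s in at_right 0. X (c0 s) $ 1 = u (c0 s)"
      using inV by eventually_elim (auto simp: u_def ext_def)
  qed
  then have "((\<lambda>s. pb u (graph_point \<gamma> s)) \<longlongrightarrow> 0) (at_right 0)"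
  proof (rule Lim_transform_eventually)
    show "\<forall>\<^sub>F s in at_right 0. u (c0 s) = pb u (graph_point \<gamma> s)"
      using ev0 by eventually_elim (simp add: pbv)
  qed
  then obtain m :: nat and b where m: "m \<ge> 1" "b > 0" "\<forall>x\<in>{0<..<b}. \<bar>pb u (graph_point \<gamma> x)\<bar> < x powr (1 / real m)"
    using ii[of UNIV "pb u"] pbd[OF du] unfolding \<gamma>_def by blast
  have small: "\<forall>\<^sub>F s in at_right 0. \<bar>u (c0 s)\<bar> < s powr (1 / real m)"
    using ev_ball[OF m(2,3)] ev0 by eventually_elim (use pbv in auto)
  note cmp = germ_param_compare[OF g g0 X0(3)]
  have s_of_t: "\<forall>\<^sub>F t in at_right 0. t ^ m \<le> X0 (c t) $ 1 \<and> c t = c0 (X0 (c t) $ 1) \<and> 0 < t"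
  proof -
    have "\<forall>\<^sub>F t in at_right 0. \<bar>u (c0 (X0 (c t) $ 1))\<bar> < (X0 (c t) $ 1) powr (1 / real m)"
      using eventually_compose_filterlim[OF small cmp(2)] .
    moreover have "\<forall>\<^sub>F t in at_right 0. X0 (c t) $ 1 > 0"
      using eventually_compose_filterlim[OF ev0 cmp(2)] by eventually_elim auto
    ultimately show ?thesis
      using cmp(1) germ_param_eventually[OF g]
    proof eventually_elim
      case (elim t)
      let ?s = "X0 (c t) $ 1"
      have "u (c t) = t" using elim unfolding u_def ext_def by simp
      then have "t < ?s powr (1 / real m)" using elim by simp
      then have "t ^ m \<le> (?s powr (1 / real m)) ^ m" using elim by (intro power_mono) auto
      also have "\<dots> = ?s" using elim(2) m(1) by (simp add: powr_realpow[symmetric] powr_powr)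
      finally show ?case using elim by auto
    qed
  qed
  show ?thesis
    unfolding separates_def
  proof (intro allI impI)
    fix f assume "df f"
    from main0[OF this] show "(\<forall>\<^sub>F t in at_right 0. f (c t) = 0) \<or> (\<exists>k::nat. \<forall>\<^sub>F t in at_right 0. \<bar>f (c t)\<bar> \<ge> t ^ k)"
    proof
      assume "\<forall>\<^sub>F s in at_right 0. f (c0 s) = 0"
      from eventually_compose_filterlim[OF this cmp(2)] cmp(1)
      have "\<forall>\<^sub>F t in at_right 0. f (c t) = 0" by eventually_elim simp
      then show ?thesis ..
    next
      assume "\<exists>k::nat. \<forall>\<^sub>F s in at_right 0. \<bar>f (c0 s)\<bar> \<ge> s ^ k"
      then obtain k :: nat where "\<forall>\<^sub>F s in at_right 0. \<bar>f (c0 s)\<bar> \<ge> s ^ k" by blast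
      from eventually_compose_filterlim[OF this cmp(2)] s_of_t
      have "\<forall>\<^sub>F t in at_right 0. \<bar>f (c t)\<bar> \<ge> t ^ (m * k)"
      proof eventually_elim
        case (elim t)
        have "t ^ (m * k) = (t ^ m) ^ k" by (rule power_mult)
        also have "\<dots> \<le> (X0 (c t) $ 1) ^ k" using elim by (intro power_mono) auto
        finally show ?case using elim by simp
      qed
      then show ?thesis by blast
    qed
  qed
qed

text \<open>Apply separation to the characteristic function of \<open>A\<close>: it vanishes
  eventually, or it is bounded below by a positive quantity and hence equal to 1.\<close>

lemma separates_dichotomy:
  assumes "separates S c" "ds A"
  shows "(\<forall>\<^sub>F t in at_right 0. c t \<in> A) \<or> (\<forall>\<^sub>F t in at_right 0. c t \<notin> A)"
proof -
  have "df (\<lambda>p. if p \<in> A then 1 else 0)"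
    unfolding df_def using assms(2) unfolding ds_def by (intro dm_if dm_const)
  then consider "\<forall>\<^sub>F t in at_right 0. (if c t \<in> A then 1 else 0::real) = 0"
    | k where "\<forall>\<^sub>F t in at_right 0. \<bar>if c t \<in> A then 1 else 0::real\<bar> \<ge> t ^ k"
    using assms(1) unfolding separates_def by blast
  then show ?thesis
  proof cases
    case 1
    then have "\<forall>\<^sub>F t in at_right 0. c t \<notin> A" by eventually_elim (auto split: if_splits)
    then show ?thesis ..
  next
    case 2
    moreover have "\<forall>\<^sub>F t in at_right (0::real). t > 0" by (simp add: eventually_at_filter)
    ultimately have "\<forall>\<^sub>F t in at_right 0. c t \<in> A"
    proof eventually_elim
      case (elim t)
      then have pos: "t ^ k > 0" by simp
      show ?case
      proof (rule ccontr)
        assume "c t \<notin> A"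
        with elim(1) have "t ^ k \<le> 0" by simp
        with pos show False by linarith
      qed
    qed
    then show ?thesis ..
  qed
qed

text \<open>The points where alternative \<open>j\<close> holds with some radius form a definable
  set, and as \<open>J\<close> is finite one of these sets contains the curve eventually. The
  supremum of the admissible radii is then a definable function, positive along the curve, so
  separation bounds it below by a power of \<open>t\<close>.\<close>

lemma separates_uniform_radius:
  assumes sep: "separates S c" and J: "finite J"
    and P: "\<And>j. j \<in> J \<Longrightarrow> dp (\<lambda>z. P j (vec3 (fst z)) (snd z))"
    and mono: "\<And>j p r r'. P j p r \<Longrightarrow> 0 < r' \<Longrightarrow> r' \<le> r \<Longrightarrow> P j p r'"
    and ex: "\<forall>\<^sub>F t in at_right 0. \<exists>j\<in>J. \<exists>r>0. P j (c t) r"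
  obtains j k where "j \<in> J" "\<forall>\<^sub>F t in at_right 0. \<forall>n\<ge>k. P j (c t) (t ^ n)"
proof -
  define A where "A j = {p. \<exists>r. 0 < r \<and> P j p r}" for j
  have P2: "dp (\<lambda>w. P j (vec3 (fst (fst w))) (snd w))" if "j \<in> J" for j
    using dp_map[OF _ P[OF that], of "\<lambda>w. (fst (fst w), snd w)"] by (simp add: dm_Pair dm_fst dm_snd dm_id)
  have A: "ds (A j)" if "j \<in> J" for j
    unfolding ds_def A_def mem_Collect_eq
    by (intro dp_ex dp_and dp_less P[OF that] dm_const dm_snd dm_id)
  obtain j where j: "j \<in> J" "\<forall>\<^sub>F t in at_right 0. c t \<in> A j"
  proof (rule ccontr)
    assume no: "\<not> thesis"
    have "\<forall>j\<in>J. \<forall>\<^sub>F t in at_right 0. c t \<notin> A j"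
      using separates_dichotomy[OF sep A] that no by blast
    then have "\<forall>\<^sub>F t in at_right 0. \<forall>j\<in>J. c t \<notin> A j" using J by (simp add: eventually_ball_finite)
    with ex have "\<forall>\<^sub>F t in at_right (0::real). False"
      by eventually_elim (auto simp: A_def)
    then show False by simp
  qed
  \<comment> \<open>Radii are capped at 1 to make the supremum finite; off \<open>A j\<close> the
    value 0 is a default.\<close>
  define f where "f p = (if p \<in> A j then Sup {r. 0 < r \<and> r \<le> 1 \<and> P j p r} else 0)" for p
  have Q: "\<exists>r. 0 < r \<and> r \<le> 1 \<and> P j p r" if pA: "p \<in> A j" for p
  proof -
    obtain r where "0 < r" "P j p r" using pA unfolding A_def by blast
    then show ?thesis using mono[of j p r "min r 1"] by (intro exI[of _ "min r 1"]) auto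
  qed
  have bdd: "bdd_above {r. 0 < r \<and> r \<le> 1 \<and> P j p r}" for p by (auto intro!: bdd_aboveI[of _ 1])
  have "df f"
    unfolding df_def
  proof (rule dm_unique)
    have P3: "dp (\<lambda>w. P j (vec3 (fst (fst w))) (snd w))" by (rule P2[OF j(1)])
    have P4: "dp (\<lambda>w. P j (vec3 (fst (fst (fst w)))) (snd w))"
      using dp_map[OF _ P[OF j(1)], of "\<lambda>w. (fst (fst (fst w)), snd w)"] by (simp add: dm_Pair dm_fst dm_snd dm_id)
    show "dp (\<lambda>z. (vec3 (fst z) \<in> A j \<and> (\<forall>r. 0 < r \<and> r \<le> 1 \<and> P j (vec3 (fst z)) r \<longrightarrow> r \<le> snd z) \<and>
        (\<forall>y. y < snd z \<longrightarrow> (\<exists>r. (0 < r \<and> r \<le> 1 \<and> P j (vec3 (fst z)) r) \<and> y < r))) \<or>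
        (vec3 (fst z) \<notin> A j \<and> snd z = 0))"
      by (intro dp_or dp_and dp_not dp_all dp_imp dp_ex dp_less dp_le dp_eq P3 P4 dp_ds[OF A[OF j(1)]]
          dm_const dm_fst dm_snd dm_id dv_vec3)
    fix t :: "real \<times> real \<times> real" and y
    let ?R = "{r. 0 < r \<and> r \<le> 1 \<and> P j (vec3 t) r}"
    show "(vec3 t \<in> A j \<and> (\<forall>r. 0 < r \<and> r \<le> 1 \<and> P j (vec3 t) r \<longrightarrow> r \<le> y) \<and>
        (\<forall>y'. y' < y \<longrightarrow> (\<exists>r. (0 < r \<and> r \<le> 1 \<and> P j (vec3 t) r) \<and> y' < r))) \<or>
        (vec3 t \<notin> A j \<and> y = 0) \<longleftrightarrow> y = f (vec3 t)"
    proof (cases "vec3 t \<in> A j")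
      case True
      have ne: "?R \<noteq> {}" using Q[OF True] by blast
      have "(\<forall>r\<in>?R. r \<le> y) \<and> (\<forall>y'<y. \<exists>r\<in>?R. y' < r) \<longleftrightarrow> y = Sup ?R"
      proof
        assume "(\<forall>r\<in>?R. r \<le> y) \<and> (\<forall>y'<y. \<exists>r\<in>?R. y' < r)"
        then show "y = Sup ?R" using ne by (intro cSup_eq_non_empty[symmetric]) (auto, meson not_less)
      next
        assume "y = Sup ?R"
        then show "(\<forall>r\<in>?R. r \<le> y) \<and> (\<forall>y'<y. \<exists>r\<in>?R. y' < r)"
          using cSup_upper[OF _ bdd] less_cSup_iff[OF ne bdd] by auto
      qed
      then show ?thesis using True unfolding f_def by auto
    next
      case False
      then show ?thesis unfolding f_def by auto
    qed
  qed
  have fpos: "f p > 0" if pA: "p \<in> A j" for p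
  proof -
    obtain r where "0 < r" "r \<le> 1" "P j p r" using Q[OF pA] by blast
    then have "r \<le> f p" unfolding f_def using pA cSup_upper[OF _ bdd, of r p] by auto
    then show ?thesis using \<open>0 < r\<close> by simp
  qed
  have "\<not> (\<forall>\<^sub>F t in at_right 0. f (c t) = 0)"
  proof
    assume "\<forall>\<^sub>F t in at_right 0. f (c t) = 0"
    with j(2) have "\<forall>\<^sub>F t in at_right (0::real). False" by eventually_elim (use fpos in force)
    then show False by simp
  qed
  then obtain k where k: "\<forall>\<^sub>F t in at_right 0. \<bar>f (c t)\<bar> \<ge> t ^ k"
    using sep \<open>df f\<close> unfolding separates_def by blast
  have "\<forall>\<^sub>F t in at_right (0::real). t \<in> {0<..<1}" by (rule eventually_at_right_real) simp
  \<comment> \<open>One power more than \<open>k\<close> leaves room strictly below the supremum,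
    which need not be admissible itself.\<close>
  with k j(2) have "\<forall>\<^sub>F t in at_right 0. \<forall>n\<ge>Suc k. P j (c t) (t ^ n)"
  proof eventually_elim
    case (elim t)
    let ?R = "{r. 0 < r \<and> r \<le> 1 \<and> P j (c t) r}"
    have "t ^ Suc k < t ^ k" using elim by (simp add: mult_less_cancel_right1)
    moreover have "t ^ k \<le> Sup ?R" using elim fpos[of "c t"] unfolding f_def by auto
    ultimately have "t ^ Suc k < Sup ?R" by (rule less_le_trans)
    moreover have "?R \<noteq> {}" using Q[of "c t"] elim by blast
    ultimately obtain r where "P j (c t) r" "t ^ Suc k < r" using less_cSup_iff[OF _ bdd] by blast
    moreover have "0 < t ^ n \<and> t ^ n \<le> t ^ Suc k" if "n \<ge> Suc k" for n
      using elim power_decreasing[OF that, of t] by auto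
    ultimately show ?case using mono by (meson less_imp_le order_trans)
  qed
  then show ?thesis using that j(1) by blast
qed

end

section \<open>Trajectories in flat contact\<close>

lemma reciprocal_basis:
  fixes a b k v :: "real^3"
  shows "(cross3 a b \<bullet> k) *\<^sub>R v = (a \<bullet> v) *\<^sub>R cross3 b k + (b \<bullet> v) *\<^sub>R cross3 k a + (k \<bullet> v) *\<^sub>R cross3 a b"
  by (simp add: cross3_simps forall_3)

text \<open>With \<open>a\<close> and \<open>b\<close> representing the functionals,
  \<open>k\<close> is their cross product, and \<open>k \<bullet> cross3 u v = 1\<close> shows that
  it is nonzero. Expanding \<open>z\<close> in the reciprocal basis of \<open>a\<close>,
  \<open>b\<close>, \<open>k\<close> bounds its distance from the line of \<open>k\<close> by the
  two values.\<close>

lemma two_functionals_kernel: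
  fixes f g :: "real^3 \<Rightarrow> real"
  assumes lin: "linear f" "linear g" and u: "f u = 1" "g u = 0" and v: "f v = 0" "g v = 1"
  obtains k K where "k \<noteq> 0" "f k = 0" "g k = 0" "K \<ge> 0" "\<And>z. \<exists>s. norm (z - s *\<^sub>R k) \<le> K * (\<bar>f z\<bar> + \<bar>g z\<bar>)"
proof -
  define a b where "a = adjoint f 1" and "b = adjoint g 1"
  have fa: "f z = a \<bullet> z" for z using adjoint_works[OF lin(1), of z 1] unfolding a_def by (simp add: inner_commute)
  have gb: "g z = b \<bullet> z" for z using adjoint_works[OF lin(2), of z 1] unfolding b_def by (simp add: inner_commute)
  define k where "k = cross3 a b"
  have "k \<bullet> cross3 u v = (a \<bullet> u) * (b \<bullet> v) - (a \<bullet> v) * (b \<bullet> u)"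
    unfolding k_def by (simp add: cross3_simps)
  then have "k \<bullet> cross3 u v = 1" using u v fa gb by simp
  then have k0: "k \<noteq> 0" by auto
  then have slope: "k \<bullet> k > 0" by simp
  define K where "K = (norm (cross3 b k) + norm (cross3 k a)) / (k \<bullet> k)"
  show ?thesis
  proof
    show "k \<noteq> 0" by (rule k0)
    show "f k = 0" "g k = 0" unfolding fa gb k_def by (simp_all add: dot_cross_self)
    show "K \<ge> 0" unfolding K_def using slope by simp
    fix z
    have eq: "(k \<bullet> k) *\<^sub>R (z - ((k \<bullet> z) / (k \<bullet> k)) *\<^sub>R k) = f z *\<^sub>R cross3 b k + g z *\<^sub>R cross3 k a"
      using reciprocal_basis[of a b k z] slope unfolding fa gb k_def[symmetric] by (simp add: algebra_simps)
    have "(k \<bullet> k) * norm (z - ((k \<bullet> z) / (k \<bullet> k)) *\<^sub>R k) = norm ((k \<bullet> k) *\<^sub>R (z - ((k \<bullet> z) / (k \<bullet> k)) *\<^sub>R k))"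
      using slope by simp
    also have "\<dots> \<le> \<bar>f z\<bar> * norm (cross3 b k) + \<bar>g z\<bar> * norm (cross3 k a)"
      unfolding eq by (rule order_trans[OF norm_triangle_ineq]) simp
    also have "\<dots> \<le> (\<bar>f z\<bar> + \<bar>g z\<bar>) * (norm (cross3 b k) + norm (cross3 k a))"
      by (simp add: algebra_simps)
    also have "\<dots> = (k \<bullet> k) * (K * (\<bar>f z\<bar> + \<bar>g z\<bar>))" unfolding K_def using slope by simp
    finally have "norm (z - ((k \<bullet> z) / (k \<bullet> k)) *\<^sub>R k) \<le> K * (\<bar>f z\<bar> + \<bar>g z\<bar>)"
      using slope by (simp add: mult_le_cancel_left_pos del: inner_gt_zero_iff)
    then show "\<exists>s. norm (z - s *\<^sub>R k) \<le> K * (\<bar>f z\<bar> + \<bar>g z\<bar>)" by blast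
  qed
qed

text \<open>Strict differentiability: the linear approximation at \<open>w\<close> is good for all
  pairs of points near \<open>w\<close>, which is what comparing two points of one fibre
  requires.\<close>

lemma C1_on_strict:
  fixes f :: "'a::euclidean_space \<Rightarrow> real"
  assumes "C1_on f A" "open A" "w \<in> A" "e > 0"
  obtains r where "r > 0" "ball w r \<subseteq> A"
    "\<And>u v. u \<in> ball w r \<Longrightarrow> v \<in> ball w r \<Longrightarrow> \<bar>f u - f v - frechet_derivative f (at w) (u - v)\<bar> \<le> e * norm (u - v)"
proof -
  obtain f' where f': "\<And>p. p \<in> A \<Longrightarrow> (f has_derivative blinfun_apply (f' p)) (at p)" "continuous_on A f'"
    using assms(1) unfolding C1_on_def by blast
  have fr: "frechet_derivative f (at w) = blinfun_apply (f' w)"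
    using frechet_derivative_at[OF f'(1)[OF assms(3)]] by simp
  have "isCont f' w" using f'(2) assms(2,3) by (simp add: continuous_on_eq_continuous_at)
  then have "(f' \<longlongrightarrow> f' w) (nhds w)" by (simp add: tendsto_nhds_iff continuous_at)
  then have "\<forall>\<^sub>F p in nhds w. dist (f' p) (f' w) < e" using assms(4) by (rule tendstoD)
  then have "\<forall>\<^sub>F p in nhds w. dist (f' p) (f' w) < e \<and> p \<in> A"
    using eventually_nhds_in_open[OF assms(2,3)] by eventually_elim auto
  then obtain r where r: "r > 0" "\<And>p. dist p w < r \<Longrightarrow> dist (f' p) (f' w) < e \<and> p \<in> A"
    unfolding eventually_nhds_metric by blast
  show ?thesis
  proof
    show "r > 0" by (rule r)
    show "ball w r \<subseteq> A" using r by (auto simp: dist_commute)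
    fix u v assume uv: "u \<in> ball w r" "v \<in> ball w r"
    have "norm ((f u - f' w u) - (f v - f' w v)) \<le> e * norm (u - v)"
    proof (rule differentiable_bound[of "ball w r" _ "\<lambda>p. blinfun_apply (f' p - f' w)"])
      fix p assume "p \<in> ball w r"
      then have p: "dist (f' p) (f' w) < e" "p \<in> A" using r(2)[of p] by (auto simp: dist_commute)
      have "((\<lambda>u. f u - f' w u) has_derivative (\<lambda>h. f' p h - f' w h)) (at p)"
        by (intro has_derivative_diff f'(1) p blinfun.bounded_linear_right bounded_linear_imp_has_derivative)
      then have "((\<lambda>u. f u - f' w u) has_derivative blinfun_apply (f' p - f' w)) (at p)"
        by (simp add: blinfun.diff_left[abs_def])
      then show "((\<lambda>u. f u - f' w u) has_derivative blinfun_apply (f' p - f' w)) (at p within ball w r)"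
        by (rule has_derivative_at_withinI)
      show "onorm (blinfun_apply (f' p - f' w)) \<le> e"
        using p(1) by (simp add: norm_blinfun.rep_eq[symmetric] dist_norm)
    qed (use uv in auto)
    then show "\<bar>f u - f v - frechet_derivative f (at w) (u - v)\<bar> \<le> e * norm (u - v)"
      unfolding fr by (simp add: blinfun.diff_right algebra_simps)
  qed
qed

text \<open>A cone condition in place of an implicit parameterization: differences of nearby points
  of one fibre lie in an arbitrarily thin cone around \<open>k\<close>.\<close>

lemma fibre_direction:
  fixes f g :: "real^3 \<Rightarrow> real"
  assumes f: "C1_on f A" and g: "C1_on g A" and A: "open A" "w \<in> A"
    and u: "frechet_derivative f (at w) u = 1" "frechet_derivative g (at w) u = 0"
    and v: "frechet_derivative f (at w) v = 0" "frechet_derivative g (at w) v = 1"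
  obtains k where "k \<noteq> 0" "frechet_derivative f (at w) k = 0" "frechet_derivative g (at w) k = 0"
    "\<And>\<theta>. \<theta> > 0 \<Longrightarrow> \<exists>r>0. ball w r \<subseteq> A \<and> (\<forall>a\<in>ball w r. \<forall>b\<in>ball w r. f a = f b \<and> g a = g b \<longrightarrow>
      (\<exists>s. norm (a - b - s *\<^sub>R k) \<le> \<theta> * \<bar>s\<bar>))"
proof -
  have lin: "linear (frechet_derivative f (at w))" "linear (frechet_derivative g (at w))"
    using f g A(2) unfolding C1_on_def
    by (meson differentiableI linear_frechet_derivative)+
  obtain k K where k: "k \<noteq> 0" "frechet_derivative f (at w) k = 0" "frechet_derivative g (at w) k = 0" "K \<ge> 0"
    and K: "\<And>z. \<exists>s. norm (z - s *\<^sub>R k) \<le> K * (\<bar>frechet_derivative f (at w) z\<bar> + \<bar>frechet_derivative g (at w) z\<bar>)"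
    using two_functionals_kernel[OF lin u v] by metis
  show ?thesis
  proof (rule that[OF k(1-3)])
    fix \<theta> :: real assume \<theta>: "\<theta> > 0"
    have nk: "norm k > 0" using k(1) by simp
    \<comment> \<open>The bound 1/2 lets the deviation be absorbed into \<open>norm (a - b)\<close>,
      giving \<open>norm (a - b) \<le> 2 * \<bar>s\<bar> * norm k\<close>; the other bound then
      yields the deviation \<open>\<theta> * \<bar>s\<bar>\<close>. The denominator compensates the
      constant \<open>K\<close> of the two functionals.\<close>
    define e where "e = min (1/2) (\<theta> / (2 * norm k)) / (2 * K + 1)"
    have e: "e > 0" unfolding e_def using \<theta> nk k(4) by simp
    have Ke: "K * (2 * e) \<le> min (1/2) (\<theta> / (2 * norm k))"
    proof -
      have "K * (2 * e) \<le> (2 * K + 1) * e" using e by (simp add: algebra_simps)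
      also have "\<dots> = min (1/2) (\<theta> / (2 * norm k))" unfolding e_def using k(4) by simp
      finally show ?thesis .
    qed
    obtain r1 where r1: "r1 > 0" "ball w r1 \<subseteq> A"
      "\<And>u v. u \<in> ball w r1 \<Longrightarrow> v \<in> ball w r1 \<Longrightarrow> \<bar>f u - f v - frechet_derivative f (at w) (u - v)\<bar> \<le> e * norm (u - v)"
      using C1_on_strict[OF f A e] by blast
    obtain r2 where r2: "r2 > 0" "ball w r2 \<subseteq> A"
      "\<And>u v. u \<in> ball w r2 \<Longrightarrow> v \<in> ball w r2 \<Longrightarrow> \<bar>g u - g v - frechet_derivative g (at w) (u - v)\<bar> \<le> e * norm (u - v)"
      using C1_on_strict[OF g A e] by blast
    show "\<exists>r>0. ball w r \<subseteq> A \<and> (\<forall>a\<in>ball w r. \<forall>b\<in>ball w r. f a = f b \<and> g a = g b \<longrightarrow>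
      (\<exists>s. norm (a - b - s *\<^sub>R k) \<le> \<theta> * \<bar>s\<bar>))"
    proof (rule exI[of _ "min r1 r2"], intro conjI ballI impI)
      show "min r1 r2 > 0" "ball w (min r1 r2) \<subseteq> A" using r1 r2 by auto
      fix a b assume ab: "a \<in> ball w (min r1 r2)" "b \<in> ball w (min r1 r2)" and eq: "f a = f b \<and> g a = g b"
      let ?n = "norm (a - b)"
      obtain s where s: "norm (a - b - s *\<^sub>R k) \<le> K * (\<bar>frechet_derivative f (at w) (a - b)\<bar> + \<bar>frechet_derivative g (at w) (a - b)\<bar>)"
        using K by blast
      have "\<bar>frechet_derivative f (at w) (a - b)\<bar> \<le> e * ?n" "\<bar>frechet_derivative g (at w) (a - b)\<bar> \<le> e * ?n"
        using r1(3)[of a b] r2(3)[of a b] ab eq by auto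
      then have "K * (\<bar>frechet_derivative f (at w) (a - b)\<bar> + \<bar>frechet_derivative g (at w) (a - b)\<bar>) \<le> K * (2 * e * ?n)"
        using k(4) by (intro mult_left_mono) auto
      also have "\<dots> = K * (2 * e) * ?n" by simp
      also have "\<dots> \<le> min (1/2) (\<theta> / (2 * norm k)) * ?n" using Ke by (intro mult_right_mono) auto
      finally have n: "norm (a - b - s *\<^sub>R k) \<le> min (1/2) (\<theta> / (2 * norm k)) * ?n" using s by linarith
      then have "norm (a - b - s *\<^sub>R k) \<le> 1/2 * ?n"
        by (rule order_trans) (intro mult_right_mono, auto)
      moreover have "?n \<le> norm (a - b - s *\<^sub>R k) + norm (s *\<^sub>R k)"
        using norm_triangle_ineq[of "a - b - s *\<^sub>R k" "s *\<^sub>R k"] by simp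
      ultimately have n2: "?n \<le> 2 * (\<bar>s\<bar> * norm k)" by simp
      have "norm (a - b - s *\<^sub>R k) \<le> \<theta> / (2 * norm k) * ?n"
        using n by (rule order_trans) (intro mult_right_mono, auto)
      also have "\<dots> \<le> \<theta> / (2 * norm k) * (2 * (\<bar>s\<bar> * norm k))"
        using n2 \<theta> nk by (intro mult_left_mono) auto
      also have "\<dots> = \<theta> * \<bar>s\<bar>" using nk by simp
      finally show "\<exists>s. norm (a - b - s *\<^sub>R k) \<le> \<theta> * \<bar>s\<bar>" by blast
    qed
  qed
qed

lemma C1_on_compose:
  assumes "C1_on f A" "C1_on g B" "g ` B \<subseteq> A"
  shows "C1_on (\<lambda>p. f (g p)) B"
proof -
  obtain f' where f': "\<And>p. p \<in> A \<Longrightarrow> (f has_derivative blinfun_apply (f' p)) (at p)" "continuous_on A f'"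
    using assms(1) unfolding C1_on_def by blast
  obtain g' where g': "\<And>p. p \<in> B \<Longrightarrow> (g has_derivative blinfun_apply (g' p)) (at p)" "continuous_on B g'"
    using assms(2) unfolding C1_on_def by blast
  have cg: "continuous_on B g"
    using g'(1) by (meson continuous_at_imp_continuous_on has_derivative_continuous)
  have "((\<lambda>p. f (g p)) has_derivative blinfun_apply (f' (g p) o\<^sub>L g' p)) (at p)" if "p \<in> B" for p
  proof -
    have "g p \<in> A" using assms(3) that by blast
    from has_derivative_compose[OF g'(1)[OF that] f'(1)[OF this]] show ?thesis
      by (elim has_derivative_eq_rhs) (simp add: fun_eq_iff)
  qed
  moreover have "continuous_on B (\<lambda>p. f' (g p) o\<^sub>L g' p)"
    by (intro continuous_intros g'(2) continuous_on_compose2[OF f'(2) cg assms(3)])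
  ultimately show ?thesis unfolding C1_on_def by (intro exI[of _ "\<lambda>p. f' (g p) o\<^sub>L g' p"]) auto
qed

lemma (in ominimal_real_field) dp_const: "dp (\<lambda>e::'a::coord. b)"
proof -
  have "dp (\<lambda>e::'a. (0::real) = (if b then 0 else 1))" by (intro dp_eq dm_const)
  then show ?thesis by (cases b) auto
qed

lemma (in ominimal_real_field) dp_sgn:
  assumes "dm f" shows "dp (\<lambda>e. sgn (f e :: real) = s)"
proof -
  have "sgn y = s \<longleftrightarrow> (0 < y \<and> s = 1) \<or> (y = 0 \<and> s = 0) \<or> (y < 0 \<and> s = -1)" for y :: real
    by (auto simp: sgn_if)
  then show ?thesis
    by (simp only:) (intro dp_or dp_and dp_less dp_eq dp_const assms dm_const)
qed

text \<open>Two curves on the clock of a common chart, with \<open>Y\<close> the inverse chart. That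
  \<open>X\<close> and \<xi> are definable as total functions is arranged later by extending them by
  zero, and \<open>distinct\<close> may demand all times because integral curves meeting once
  coincide.\<close>

locale contact = chart_field W \<xi> V X + ominimal_real_field S
  for W \<xi> V X S +
  fixes Y :: "real^3 \<Rightarrow> real^3" and a :: real and g d :: "real \<Rightarrow> real^3"
  assumes ds_V: "ds V" and ds_W: "ds W" and df_X: "\<And>i. df (\<lambda>p. X p $ i)" and df_xi: "\<And>i. df (\<lambda>p. \<xi> p $ i)"
    and open_image: "open (X ` V)" and C1_Y: "C1_on Y (X ` V)" and Y_X: "\<And>p. p \<in> V \<Longrightarrow> Y (X p) = p"
    and a: "a > 0" and g: "xcurve {0<..<a} g" and d: "xcurve {0<..<a} d" and sep: "separates S g"
    and flat: "\<And>k. \<forall>\<^sub>F t in at_right 0. norm (X (d t) - X (g t)) \<le> t ^ k"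
    and distinct: "\<And>t. t \<in> {0<..<a} \<Longrightarrow> g t \<noteq> d t"
begin

definition along :: "(real^3) set \<Rightarrow> (real^3 \<Rightarrow> real) \<Rightarrow> real^3 \<Rightarrow> real" where
  "along U f = ext (U \<inter> W) (\<lambda>p. frechet_derivative f (at p) (\<xi> p))"

definition rate :: "3 \<Rightarrow> real^3 \<Rightarrow> real" where "rate i = along V (\<lambda>q. X q $ i)"

text \<open>The derivative of chart coordinate \<open>i\<close> with respect to the clock along the
  field.\<close>

definition slope :: "3 \<Rightarrow> real^3 \<Rightarrow> real" where "slope i p = rate i p / rate 1 p"

lemma df_ext': "ds U \<Longrightarrow> df f \<Longrightarrow> df (ext U f)"
  unfolding df_def ext_def ds_def by (intro dm_if dm_const)

lemma df_along:
  assumes "open U" "ds U" "C1_on f U" "df f"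
  shows "df (along U f)"
  unfolding along_def
proof (rule df_directional_derivative[OF assms(1,2) df_ext'[OF assms(2,4)] ds_W])
  show "df (ext W (\<lambda>p. \<xi> p $ i))" for i by (rule df_ext'[OF ds_W df_xi])
  show "f differentiable at p" if "p \<in> U" for p
    using assms(3) that unfolding C1_on_def by (meson differentiableI)
qed

lemma df_rate: "df (rate i)"
  unfolding rate_def by (rule df_along[OF V ds_V C1_on_nth[OF C1_X] df_X])

lemma df_divide: "df f \<Longrightarrow> df h \<Longrightarrow> df (\<lambda>p. f p / h p)"
  unfolding df_def by (rule dm_divide)

lemma df_slope: "df (slope i)"
  unfolding slope_def by (rule df_divide[OF df_rate df_rate])

lemma dv_X: "dv f \<Longrightarrow> dv (\<lambda>e. X (f e))"
  unfolding dv_def[of "\<lambda>e. X (f e)"] by (intro conjI dm_df df_X)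

lemma rate_clock: "p \<in> V \<Longrightarrow> p \<in> W \<Longrightarrow> rate 1 p = dx p"
  unfolding rate_def along_def ext_def dx_def by simp

lemma isCont_along:
  assumes "C1_on f U" "open U" "p \<in> U" "p \<in> W"
  shows "isCont (along U f) p"
proof -
  have "continuous_on (U \<inter> W) (along U f)"
    by (rule continuous_on_eq[OF continuous_on_directional[OF assms(1)]]) (simp add: along_def ext_def)
  then show ?thesis using assms W by (simp add: continuous_on_eq_continuous_at open_Int)
qed

lemma curve_derivative:
  assumes c: "xcurve {0<..<a} c" "t \<in> {0<..<a}" and f: "C1_on f U" "c t \<in> U"
  shows "((\<lambda>t. f (c t)) has_real_derivative along U f (c t) / rate 1 (c t)) (at t)"
proof -
  have "c t \<in> V" "c t \<in> W" using c unfolding xcurve_def \<O>_def by auto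
  then show ?thesis
    using has_real_derivative_along[OF f xcurve_field[OF c]] f(2) by (simp add: rate_clock along_def ext_def)
qed

text \<open>Radii are measured in chart coordinates, the ones in which flatness compares the two
  curves. Continuity of the inverse chart converts them to neighbourhoods in space.\<close>

lemma chart_nhds:
  assumes "p \<in> V" "\<forall>\<^sub>F q in nhds p. Q q"
  shows "\<exists>r>0. \<forall>q\<in>V. norm (X q - X p) < r \<longrightarrow> Q q"
proof -
  have "isCont Y (X p)"
    using C1_on_continuous_on[OF C1_Y] open_image assms(1) by (simp add: continuous_on_eq_continuous_at)
  then have "(Y \<longlongrightarrow> p) (nhds (X p))"
    using Y_X[OF assms(1)] by (simp add: continuous_at tendsto_nhds_iff)
  then have "\<forall>\<^sub>F w in nhds (X p). Q (Y w)"
    using assms(2) by (rule eventually_compose_filterlim[rotated])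
  then obtain r where "r > 0" "\<forall>w. dist w (X p) < r \<longrightarrow> Q (Y w)"
    unfolding eventually_nhds_metric by blast
  then show ?thesis using Y_X by (metis dist_norm)
qed

end

text \<open>The two components of a projection in a chosen order: the first serves as a second clock
  along \<open>g\<close>.\<close>

locale contact_pair = contact +
  fixes U :: "(real^3) set" and F1 F2 :: "real^3 \<Rightarrow> real"
  assumes U: "open U" "ds U" and C1_F: "C1_on F1 U" "C1_on F2 U" and df_F: "df F1" "df F2"
    and indep1: "\<And>p. p \<in> U \<Longrightarrow> \<exists>u. frechet_derivative F1 (at p) u = 1 \<and> frechet_derivative F2 (at p) u = 0"
    and indep2: "\<And>p. p \<in> U \<Longrightarrow> \<exists>u. frechet_derivative F1 (at p) u = 0 \<and> frechet_derivative F2 (at p) u = 1"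
    and transversal: "\<forall>\<^sub>F t in at_right 0. g t \<in> U \<and> along U F1 (g t) \<noteq> 0"
begin

text \<open>\<open>h\<close> is the speed of \<open>F1\<close> in clock time along the field, and
  \<open>R\<close> below is the slope of the projected integral curve in the plane.\<close>

definition h :: "real^3 \<Rightarrow> real" where "h p = along U F1 p / rate 1 p"

definition R :: "real^3 \<Rightarrow> real" where "R p = along U F2 p / along U F1 p"

lemma df_h: "df h" unfolding h_def[abs_def] by (intro df_divide df_along U C1_F df_F df_rate)

lemma df_R: "df R" unfolding R_def[abs_def] by (intro df_divide df_along U C1_F df_F)

text \<open>The alternatives listed by \<open>J\<close> describe the fibre through \<^term>\<open>p\<close>, which is ordered by the chart
  coordinate \<open>m\<close>: \<open>sp\<close> and \<open>sm\<close> are the signs of \<^term>\<open>R q - R p\<close> on its upper and lower sides, and \<open>\<kappa>\<close>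
  tells on which side coordinate \<open>i\<close> exceeds its value at the same clock time on the integral curve
  through \<^term>\<open>p\<close>.\<close>

definition nice :: "real^3 \<Rightarrow> real \<Rightarrow> real \<Rightarrow> real^3 \<Rightarrow> bool" where
  "nice p B b q \<longleftrightarrow> q \<in> U \<and> q \<in> W \<and> rate 1 q \<noteq> 0 \<and> 0 < h q * h p \<and> b \<le> \<bar>h q\<bar> \<and> \<bar>slope 2 q\<bar> \<le> B \<and> \<bar>slope 3 q\<bar> \<le> B"

text \<open>The slope is taken at every \<open>q'\<close> of the ball since it will be evaluated at
  an unknown point of the second curve, supplied by the mean value theorem between \<open>t\<close>
  and \<open>\<tau> t\<close>.\<close>

definition side :: "3 \<Rightarrow> real \<Rightarrow> real \<Rightarrow> real^3 \<Rightarrow> real \<Rightarrow> real^3 \<Rightarrow> bool" where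
  "side i \<kappa> s p r q \<longleftrightarrow> sgn (R q - R p) = s \<and>
     (\<forall>q'. q' \<in> V \<longrightarrow> norm (X q' - X p) < r \<longrightarrow> 0 < \<kappa> * ((X q $ i - X p $ i) - (X q $ 1 - X p $ 1) * slope i q'))"

definition good :: "3 \<times> 3 \<times> real \<times> real \<times> real \<Rightarrow> real^3 \<Rightarrow> real \<Rightarrow> bool" where
  "good j p r \<longleftrightarrow> (case j of (m, i, \<kappa>, sp, sm) \<Rightarrow> p \<in> V \<and> p \<in> U \<and> p \<in> W \<and>
     (\<exists>B b. 0 < B \<and> 0 < b \<and> (\<forall>q. q \<in> V \<longrightarrow> norm (X q - X p) < r \<longrightarrow> nice p B b q)) \<and>
     (\<forall>q. q \<in> V \<longrightarrow> norm (X q - X p) < r \<longrightarrow> F1 q = F1 p \<longrightarrow> F2 q = F2 p \<longrightarrow>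
       (X q $ m = X p $ m \<longrightarrow> q = p) \<and>
       (X p $ m < X q $ m \<longrightarrow> side i \<kappa> sp p r q) \<and> (X q $ m < X p $ m \<longrightarrow> side i (- \<kappa>) sm p r q)))"

definition J :: "(3 \<times> 3 \<times> real \<times> real \<times> real) set" where
  "J = UNIV \<times> UNIV \<times> {1, -1} \<times> {1, 0, -1} \<times> {1, 0, -1}"

lemma finite_J: "finite J" unfolding J_def by simp

lemma good_mono: "good j p r \<Longrightarrow> r' \<le> r \<Longrightarrow> good j p r'"
proof -
  assume "good j p r" "r' \<le> r"
  moreover have "side i \<kappa> s p r q \<Longrightarrow> side i \<kappa> s p r' q" for i \<kappa> s q
    using \<open>r' \<le> r\<close> unfolding side_def by auto
  ultimately show ?thesis
    unfolding good_def by (cases j) (simp, meson less_le_trans)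
qed

lemma dp_nice:
  assumes "dv p" "dm B" "dm b" "dv q"
  shows "dp (\<lambda>e. nice (p e) (B e) (b e) (q e))"
  unfolding nice_def
  by (intro dp_and dp_not dp_less dp_le dp_eq dm_const dm_mult dm_abs dp_ds[OF U(2)] dp_ds[OF ds_W]
      dm_df[OF df_h] dm_df[OF df_slope] dm_df[OF df_rate] assms)

lemma dp_side:
  assumes "dv p" "dm r" "dv q"
  shows "dp (\<lambda>e. side i \<kappa> s (p e) (r e) (q e))"
  unfolding side_def
proof (intro dp_and dp_sgn dp_all_vec dp_imp)
  note fst = dm_fst[OF dm_id] and snd = dv_vec3[OF dm_snd[OF dm_id]]
  have "dv (\<lambda>z. f (fst z))" if "dv f" for f :: "'a \<Rightarrow> real^3"
    using that dm_comp[OF _ fst] unfolding dv_def by blast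
  note lift = this[OF assms(1)] dm_comp[OF assms(2) fst] this[OF assms(3)]
  show "dm (\<lambda>e. R (q e) - R (p e))" by (intro dm_diff dm_df[OF df_R] assms)
  show "dp (\<lambda>z. vec3 (snd z) \<in> V)" by (intro dp_ds[OF ds_V] snd)
  show "dp (\<lambda>z. norm (X (vec3 (snd z)) - X (p (fst z))) < r (fst z))"
    by (intro dp_norm_less dv_diff dv_X snd lift)
  show "dp (\<lambda>z. 0 < \<kappa> * ((X (q (fst z)) $ i - X (p (fst z)) $ i) -
      (X (q (fst z)) $ 1 - X (p (fst z)) $ 1) * slope i (vec3 (snd z))))"
    by (intro dp_less dm_mult dm_diff dm_const dm_df[OF df_X] dm_df[OF df_slope] snd lift)
qed

lemma dp_good: "dp (\<lambda>z. good j (vec3 (fst z)) (snd z))"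
proof -
  obtain m i \<kappa> sp sm where j: "j = (m, i, \<kappa>, sp, sm)" by (cases j)
  note vars = dv_vec3[OF dm_fst[OF dm_id]] dm_snd[OF dm_id]
  have v1: "dv (\<lambda>e :: ((real \<times> real \<times> real) \<times> real) \<times> (real \<times> real \<times> real). vec3 (fst (fst e)))"
    "dv (\<lambda>e :: ((real \<times> real \<times> real) \<times> real) \<times> (real \<times> real \<times> real). vec3 (snd e))"
    "dm (\<lambda>e :: ((real \<times> real \<times> real) \<times> real) \<times> (real \<times> real \<times> real). snd (fst e))"
    by (intro dv_vec3 dm_fst dm_snd dm_id)+
  have "dp (\<lambda>z. \<exists>B b. 0 < B \<and> 0 < b \<and> (\<forall>q. q \<in> V \<longrightarrow> norm (X q - X (vec3 (fst z))) < snd z \<longrightarrow> nice (vec3 (fst z)) B b q))"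
    by (intro dp_ex dp_and dp_all_vec dp_imp dp_less dp_norm_less dp_nice dv_diff dv_X dv_vec3 dm_const
        dp_ds[OF ds_V] dm_fst dm_snd dm_id)
  moreover have "dp (\<lambda>z. \<forall>q. q \<in> V \<longrightarrow> norm (X q - X (vec3 (fst z))) < snd z \<longrightarrow> F1 q = F1 (vec3 (fst z)) \<longrightarrow> F2 q = F2 (vec3 (fst z)) \<longrightarrow>
       (X q $ m = X (vec3 (fst z)) $ m \<longrightarrow> q = vec3 (fst z)) \<and>
       (X (vec3 (fst z)) $ m < X q $ m \<longrightarrow> side i \<kappa> sp (vec3 (fst z)) (snd z) q) \<and>
       (X q $ m < X (vec3 (fst z)) $ m \<longrightarrow> side i (- \<kappa>) sm (vec3 (fst z)) (snd z) q))"
    by (intro dp_all_vec dp_imp dp_and dp_eq dp_eq_vec dp_less dp_norm_less dp_side dv_diff dv_X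
        dm_df[OF df_X] dm_df[OF df_F(1)] dm_df[OF df_F(2)] dp_ds[OF ds_V] v1)
  ultimately show ?thesis
    unfolding good_def j prod.case
    by (intro dp_and dp_ds[OF ds_V] dp_ds[OF ds_W] dp_ds[OF U(2)] vars)
qed

text \<open>In the chart the fibre through \<open>p\<close> is close to the line of some
  \<open>k\<close>. As \<open>F1\<close> is stationary along \<open>k\<close> but not along the
  field, \<open>k\<close> is not parallel to the field, and some coordinate \<open>i\<close> sees on
  which side of the integral curve the fibre points lie. The signs of \<open>R q - R p\<close>
  stabilize on both sides by o-minimality.\<close>

lemma good_exists:
  assumes p: "p \<in> V" "p \<in> U" "p \<in> W" "rate 1 p \<noteq> 0" "along U F1 p \<noteq> 0"
  shows "\<exists>j\<in>J. \<exists>r>0. good j p r"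
proof -
  define A where "A = X ` V \<inter> Y -` U"
  have openA: "open A" unfolding A_def
    by (rule continuous_open_preimage[OF C1_on_continuous_on[OF C1_Y] open_image U(1)])
  have pA: "X p \<in> A" unfolding A_def using p Y_X by auto
  have C1Y: "C1_on Y A" using C1_Y unfolding C1_on_def A_def by (meson Int_iff continuous_on_subset inf_le1)
  have C1f: "C1_on (\<lambda>w. F1 (Y w)) A" "C1_on (\<lambda>w. F2 (Y w)) A"
    using C1_on_compose[OF C1_F(1) C1Y] C1_on_compose[OF C1_F(2) C1Y] unfolding A_def by auto
  let ?X' = "frechet_derivative X (at p)" and ?Y' = "frechet_derivative Y (at (X p))"
  have dX: "(X has_derivative ?X') (at p)" using C1_on_has_derivative[OF C1_X p(1)] .
  have dY: "(Y has_derivative ?Y') (at (X p))" using C1_on_has_derivative[OF C1Y pA] .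
  have "((\<lambda>q. Y (X q)) has_derivative (\<lambda>z. ?Y' (?X' z))) (at p)" by (rule has_derivative_compose[OF dX dY])
  then have "((\<lambda>q. q) has_derivative (\<lambda>z. ?Y' (?X' z))) (at p)"
    by (rule has_derivative_transform_within_open[OF _ V p(1)]) (rule Y_X)
  then have Y'X': "?Y' (?X' z) = z" for z
    using has_derivative_unique[OF _ has_derivative_ident] by metis
  have fr: "frechet_derivative (\<lambda>w. F (Y w)) (at (X p)) z = frechet_derivative F (at p) (?Y' z)"
    if "C1_on F U" for F :: "real^3 \<Rightarrow> real" and z
  proof -
    have "(F has_derivative frechet_derivative F (at p)) (at (Y (X p)))"
      using C1_on_has_derivative[OF that p(2)] Y_X[OF p(1)] by simp
    from frechet_derivative_at[OF has_derivative_compose[OF dY this]] show ?thesis by metis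
  qed
  obtain u v where "frechet_derivative F1 (at p) u = 1" "frechet_derivative F2 (at p) u = 0"
    "frechet_derivative F1 (at p) v = 0" "frechet_derivative F2 (at p) v = 1"
    using indep1[OF p(2)] indep2[OF p(2)] by blast
  then have uv: "frechet_derivative (\<lambda>w. F1 (Y w)) (at (X p)) (?X' u) = 1" "frechet_derivative (\<lambda>w. F2 (Y w)) (at (X p)) (?X' u) = 0"
    "frechet_derivative (\<lambda>w. F1 (Y w)) (at (X p)) (?X' v) = 0" "frechet_derivative (\<lambda>w. F2 (Y w)) (at (X p)) (?X' v) = 1"
    by (simp_all add: fr C1_F Y'X')
  obtain k where k: "k \<noteq> 0" "frechet_derivative (\<lambda>w. F1 (Y w)) (at (X p)) k = 0"
    and k\<theta>: "\<And>\<theta>. \<theta> > 0 \<Longrightarrow> \<exists>r>0. ball (X p) r \<subseteq> A \<and> (\<forall>a\<in>ball (X p) r. \<forall>b\<in>ball (X p) r.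
      F1 (Y a) = F1 (Y b) \<and> F2 (Y a) = F2 (Y b) \<longrightarrow> (\<exists>s. norm (a - b - s *\<^sub>R k) \<le> \<theta> * \<bar>s\<bar>))"
    using fibre_direction[OF C1f openA pA uv] by metis
  have comp: "?X' (\<xi> p) $ i = rate i p" for i
    using frechet_derivative_at[OF bounded_linear.has_derivative[OF bounded_linear_vec_nth dX, of i]] p
    unfolding rate_def along_def ext_def by (metis Int_iff)
  \<comment> \<open>The part of \<open>k $ i\<close> not explained by moving along the field for
    clock time \<open>k $ 1\<close>. If all of them vanished, \<open>k\<close> would be a multiple
    of the field, and stationarity of \<open>F1\<close> would make it zero.\<close>
  define D where "D i = k $ i - k $ 1 * slope i p" for i
  obtain i where i: "D i \<noteq> 0"
  proof (rule ccontr)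
    assume no: "\<not> thesis"
    have D0: "D i = 0" for i using that[of i] no by blast
    have kc: "k $ i = k $ 1 / rate 1 p * (?X' (\<xi> p) $ i)" for i
      using D0[of i] unfolding D_def slope_def comp by simp
    have keq: "k = (k $ 1 / rate 1 p) *\<^sub>R ?X' (\<xi> p)"
      by (rule iffD2[OF vec_eq_iff], rule allI) (simp only: vector_scaleR_component real_scaleR_def kc[symmetric])
    have lin: "linear (frechet_derivative (\<lambda>w. F1 (Y w)) (at (X p)))"
      using C1_on_has_derivative[OF C1f(1) pA] has_derivative_linear by blast
    have "frechet_derivative (\<lambda>w. F1 (Y w)) (at (X p)) k = (k $ 1 / rate 1 p) * along U F1 p"
      by (subst keq) (simp add: linear_scale[OF lin] fr C1_F Y'X' along_def ext_def p)
    then have "k $ 1 = 0" using k(2) p by auto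
    then show False using keq k(1) by simp
  qed
  obtain m where m: "k $ m \<noteq> 0" using k(1) by (auto simp: vec_eq_iff)
  \<comment> \<open>\<delta> limits the variation of the slope and \<theta> the deviation of the
    fibre from \<open>k\<close>; each may cost a quarter of \<open>\<bar>D i\<bar>\<close>. In
    addition \<theta> is smaller than \<open>\<bar>k $ m\<bar>\<close>, so coordinate
    \<open>m\<close> separates the points of the fibre.\<close>
  define \<delta> where "\<delta> = min 1 (\<bar>D i\<bar> / (4 * (\<bar>k $ 1\<bar> + 1)))"
  define \<theta> where "\<theta> = min (\<bar>k $ m\<bar> / 2) (\<bar>D i\<bar> / (4 * (2 + \<bar>slope i p\<bar>)))"
  have \<delta>: "\<delta> > 0" "\<delta> \<le> 1" unfolding \<delta>_def using i by (auto intro!: divide_pos_pos)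
  have \<theta>: "\<theta> > 0" "\<theta> < \<bar>k $ m\<bar>" unfolding \<theta>_def using i m by (auto intro!: divide_pos_pos simp: min_less_iff_disj)
  have \<delta>D: "\<bar>k $ 1\<bar> * \<delta> \<le> \<bar>D i\<bar> / 4"
  proof -
    have "\<bar>k $ 1\<bar> * \<delta> \<le> (\<bar>k $ 1\<bar> + 1) * (\<bar>D i\<bar> / (4 * (\<bar>k $ 1\<bar> + 1)))"
      unfolding \<delta>_def by (intro mult_mono) auto
    also have "\<dots> = \<bar>D i\<bar> / 4" by (simp add: field_simps add_nonneg_eq_0_iff)
    finally show ?thesis .
  qed
  have \<theta>D: "\<theta> * (2 + \<bar>slope i p\<bar>) \<le> \<bar>D i\<bar> / 4"
  proof -
    have "\<theta> * (2 + \<bar>slope i p\<bar>) \<le> (\<bar>D i\<bar> / (4 * (2 + \<bar>slope i p\<bar>))) * (2 + \<bar>slope i p\<bar>)"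
      unfolding \<theta>_def by (intro mult_right_mono) auto
    also have "\<dots> = \<bar>D i\<bar> / 4" by (simp add: field_simps add_nonneg_eq_0_iff)
    finally show ?thesis .
  qed
  obtain r1 where r1: "r1 > 0" "\<And>a b. a \<in> ball (X p) r1 \<Longrightarrow> b \<in> ball (X p) r1 \<Longrightarrow>
      F1 (Y a) = F1 (Y b) \<Longrightarrow> F2 (Y a) = F2 (Y b) \<Longrightarrow> \<exists>s. norm (a - b - s *\<^sub>R k) \<le> \<theta> * \<bar>s\<bar>"
    using k\<theta>[OF \<theta>(1)] by metis
  define B b where "B = max \<bar>slope 2 p\<bar> \<bar>slope 3 p\<bar> + 1" and "b = \<bar>h p\<bar> / 2"
  have hp: "h p \<noteq> 0" unfolding h_def using p by simp
  have Bb: "B > 0" "b > 0" unfolding B_def b_def using hp by (auto simp: max_def)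
  have cee: "isCont (rate j) p" for j unfolding rate_def by (rule isCont_along[OF C1_on_nth[OF C1_X] V p(1,3)])
  have ckk: "isCont (slope j) p" for j unfolding slope_def[abs_def] by (intro continuous_intros cee p)
  have ch: "isCont h p" unfolding h_def[abs_def] by (intro continuous_intros cee p isCont_along[OF C1_F(1) U(1)])
  have "\<forall>\<^sub>F q in nhds p. nice p B b q \<and> \<bar>slope i q - slope i p\<bar> < \<delta>"
    unfolding nice_def
  proof (intro eventually_conj)
    show "\<forall>\<^sub>F q in nhds p. q \<in> U" "\<forall>\<^sub>F q in nhds p. q \<in> W"
      using U W p by (auto intro!: eventually_nhds_in_open)
    have lk: "(slope j \<longlongrightarrow> slope j p) (nhds p)" for j using ckk by (simp add: continuous_at tendsto_nhds_iff)
    have le: "(rate 1 \<longlongrightarrow> rate 1 p) (nhds p)" using cee by (simp add: continuous_at tendsto_nhds_iff)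
    have lh: "(h \<longlongrightarrow> h p) (nhds p)" using ch by (simp add: continuous_at tendsto_nhds_iff)
    show "\<forall>\<^sub>F q in nhds p. rate 1 q \<noteq> 0" using tendsto_imp_eventually_ne[OF le p(4)] .
    have "((\<lambda>q. h q * h p) \<longlongrightarrow> h p * h p) (nhds p)" by (intro tendsto_intros lh)
    moreover have "0 < h p * h p" using hp by (metis not_square_less_zero mult_eq_0_iff linorder_neqE_linordered_idom)
    ultimately show "\<forall>\<^sub>F q in nhds p. 0 < h q * h p" by (rule order_tendstoD)
    have "\<forall>\<^sub>F q in nhds p. b < \<bar>h q\<bar>"
      by (rule order_tendstoD(1)[OF tendsto_rabs[OF lh]]) (use hp in \<open>simp add: b_def\<close>)
    then show "\<forall>\<^sub>F q in nhds p. b \<le> \<bar>h q\<bar>" by eventually_elim simp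
    have kB: "\<forall>\<^sub>F q in nhds p. \<bar>slope j q\<bar> < B" if "j = 2 \<or> j = 3" for j
      by (rule order_tendstoD(2)[OF tendsto_rabs[OF lk]]) (use that in \<open>auto simp: B_def\<close>)
    have "\<forall>\<^sub>F q in nhds p. \<bar>slope 2 q\<bar> < B" by (rule kB) simp
    then show "\<forall>\<^sub>F q in nhds p. \<bar>slope 2 q\<bar> \<le> B" by eventually_elim simp
    have "\<forall>\<^sub>F q in nhds p. \<bar>slope 3 q\<bar> < B" by (rule kB) simp
    then show "\<forall>\<^sub>F q in nhds p. \<bar>slope 3 q\<bar> \<le> B" by eventually_elim simp
    show "\<forall>\<^sub>F q in nhds p. \<bar>slope i q - slope i p\<bar> < \<delta>"
      using tendstoD[OF lk \<delta>(1), of i] by (simp add: dist_real_def)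
  qed
  from chart_nhds[OF p(1) this] obtain r2 where r2: "r2 > 0"
    "\<forall>q\<in>V. norm (X q - X p) < r2 \<longrightarrow> nice p B b q \<and> \<bar>slope i q - slope i p\<bar> < \<delta>"
    by blast
  define r0 where "r0 = min r1 r2"
  have r0: "r0 > 0" unfolding r0_def using r1 r2 by simp
  define fib where "fib q \<longleftrightarrow> q \<in> V \<and> norm (X q - X p) < r0 \<and> F1 q = F1 p \<and> F2 q = F2 p" for q
  have fib_p: "fib p" unfolding fib_def using p r0 by simp
  have diff: "\<exists>s. norm (X q - X q' - s *\<^sub>R k) \<le> \<theta> * \<bar>s\<bar>" if "fib q" "fib q'" for q q'
    using r1(2)[of "X q" "X q'"] that Y_X unfolding fib_def r0_def by (auto simp: dist_norm norm_minus_commute)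
  have uniq: "q = q'" if q: "fib q" "fib q'" "X q $ m = X q' $ m" for q q'
  proof -
    obtain s where s: "norm (X q - X q' - s *\<^sub>R k) \<le> \<theta> * \<bar>s\<bar>" using diff[OF q(1,2)] by blast
    have "\<bar>s\<bar> * \<bar>k $ m\<bar> \<le> \<bar>s\<bar> * \<theta>"
      using order_trans[OF component_le_norm_cart[of "X q - X q' - s *\<^sub>R k" m] s] q(3) by (simp add: abs_mult mult.commute)
    then have "s = 0" using \<theta>(2) by (metis abs_le_zero_iff mult_le_cancel_left not_less abs_ge_zero le_less)
    then have "X q = X q'" using s by simp
    then show ?thesis using Y_X q unfolding fib_def by metis
  qed
  \<comment> \<open>Up to the tolerances this quantity is \<open>s * D i\<close>, while the
    difference of heights is \<open>s * k $ m\<close>; the product of the two signs therefore does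
    not depend on the parameter \<open>s\<close>.\<close>
  have sides: "0 < \<sigma> * sgn (D i * k $ m) * ((X q $ i - X p $ i) - (X q $ 1 - X p $ 1) * slope i q')"
    if q: "fib q" "\<sigma> * (X q $ m - X p $ m) > 0" "\<bar>\<sigma>\<bar> = 1" and q': "q' \<in> V" "norm (X q' - X p) < r0" for q q' \<sigma>
  proof -
    obtain s where s: "norm (X q - X p - s *\<^sub>R k) \<le> \<theta> * \<bar>s\<bar>" using diff[OF q(1) fib_p] by blast
    define er where "er = X q - X p - s *\<^sub>R k"
    have er: "\<bar>er $ j\<bar> \<le> \<theta> * \<bar>s\<bar>" for j
      using order_trans[OF component_le_norm_cart s, of j] unfolding er_def .
    have X: "X q $ j - X p $ j = s * k $ j + er $ j" for j unfolding er_def by simp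
    have s0: "s \<noteq> 0" using q(2) X[of m] er[of m] by auto
    have "\<theta> * \<bar>s\<bar> < \<bar>k $ m\<bar> * \<bar>s\<bar>" using \<theta>(2) s0 by (intro mult_strict_right_mono) auto
    then have "\<bar>er $ m\<bar> < \<bar>s * k $ m\<bar>" using er[of m] by (simp add: abs_mult mult.commute)
    then have sg1: "sgn (X q $ m - X p $ m) = sgn (s * k $ m)" unfolding X by (auto simp: sgn_if)
    let ?E = "(X q $ i - X p $ i) - (X q $ 1 - X p $ 1) * slope i q'"
    have kd: "\<bar>slope i q' - slope i p\<bar> < \<delta>" using r2(2) q' unfolding r0_def by auto
    have eq: "?E - s * D i = - s * k $ 1 * (slope i q' - slope i p) + er $ i - er $ 1 * slope i q'"
      unfolding X D_def by (simp add: algebra_simps)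
    have "\<bar>?E - s * D i\<bar> \<le> \<bar>s\<bar> * (\<bar>k $ 1\<bar> * \<delta>) + \<theta> * \<bar>s\<bar> + \<theta> * \<bar>s\<bar> * (\<bar>slope i p\<bar> + 1)"
    proof -
      have "\<bar>s * k $ 1 * (slope i q' - slope i p)\<bar> \<le> \<bar>s\<bar> * (\<bar>k $ 1\<bar> * \<delta>)"
        unfolding abs_mult mult.assoc using kd by (intro mult_left_mono) auto
      moreover have "\<bar>er $ 1 * slope i q'\<bar> \<le> \<theta> * \<bar>s\<bar> * (\<bar>slope i p\<bar> + 1)"
        unfolding abs_mult using er[of 1] kd \<delta>(2) \<theta>(1) by (intro mult_mono) auto
      ultimately show ?thesis unfolding eq using er[of i] by (simp add: abs_le_iff; linarith)
    qed
    also have "\<dots> = \<bar>s\<bar> * (\<bar>k $ 1\<bar> * \<delta> + \<theta> * (2 + \<bar>slope i p\<bar>))" by (simp add: algebra_simps)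
    also have "\<dots> \<le> \<bar>s\<bar> * (\<bar>D i\<bar> / 4 + \<bar>D i\<bar> / 4)"
      using \<delta>D \<theta>D by (intro mult_left_mono add_mono) auto
    also have "\<dots> < \<bar>s * D i\<bar>" using s0 i by (simp add: abs_mult)
    finally have "\<bar>?E - s * D i\<bar> < \<bar>s * D i\<bar>" .
    then have sg2: "sgn ?E = sgn (s * D i)" by (auto simp: sgn_if)
    have "\<sigma> = sgn (s * k $ m)" using q(2,3) sg1 by (auto simp: sgn_if zero_less_mult_iff abs_if split: if_splits)
    then have "\<sigma> * sgn (D i * k $ m) * sgn ?E = sgn (s * k $ m * (D i * k $ m) * (s * D i))"
      unfolding sg2 by (simp add: sgn_mult)
    also have "\<dots> = 1"
    proof -
      have "s * k $ m * (D i * k $ m) * (s * D i) = (s * k $ m * D i)\<^sup>2" by (simp add: power2_eq_square)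
      moreover have "(s * k $ m * D i)\<^sup>2 > 0" using s0 i m by simp
      ultimately show ?thesis by (simp only: sgn_1_pos)
    qed
    finally have one: "\<sigma> * sgn (D i * k $ m) * sgn ?E = 1" .
    have "\<sigma> * sgn (D i * k $ m) * ?E = (\<sigma> * sgn (D i * k $ m) * sgn ?E) * \<bar>?E\<bar>"
      by (simp only: mult.assoc sgn_mult_abs)
    also have "\<dots> = \<bar>?E\<bar>" unfolding one by simp
    finally show ?thesis using one by (metis mult_zero_right sgn_0 zero_less_abs_iff zero_neq_one)
  qed
  \<comment> \<open>The heights above \<open>p\<close> of fibre points with a given sign of
    \<open>R q - R p\<close> form a definable set of reals, so near zero the sign occurs always or
    never; by \<open>uniq\<close> a height determines its point. The factor \<sigma> selects the
    upper or the lower side.\<close>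
  have pick: "\<exists>s\<in>{1, 0, -1}. \<exists>r>0. \<forall>q. fib q \<longrightarrow> 0 < \<sigma> * (X q $ m - X p $ m) \<longrightarrow> \<sigma> * (X q $ m - X p $ m) < r \<longrightarrow> sgn (R q - R p) = s"
    if \<sigma>: "\<bar>\<sigma>\<bar> = 1" for \<sigma> :: real
  proof -
    define Q where "Q s z \<longleftrightarrow> (\<exists>q. fib q \<and> \<sigma> * (X q $ m - X p $ m) = z \<and> sgn (R q - R p) = s)" for s z
    have dpQ: "dp (Q s)" for s
      unfolding Q_def[abs_def] fib_def
      by (intro d_intros dp_sgn dp_ds[OF ds_V] dm_df[OF df_R] dm_df[OF df_X] dm_df[OF df_F(1)] dm_df[OF df_F(2)] dv_X)
    have alt: "(\<forall>\<^sub>F z in at_right 0. Q s z) \<or> (\<forall>\<^sub>F z in at_right 0. \<not> Q s z)" for s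
      by (rule dp_eventually_at_right[OF dpQ])
    show ?thesis
    proof (cases "\<exists>s\<in>{1, 0, -1}. \<forall>\<^sub>F z in at_right 0. Q s z")
      case True
      then obtain s where s: "s \<in> {1, 0, -1}" "\<forall>\<^sub>F z in at_right 0. Q s z" by blast
      then obtain r where r: "r > 0" "\<forall>z>0. z < r \<longrightarrow> Q s z" unfolding eventually_at_right_field by (elim exE conjE) (rule that)
      have "sgn (R q - R p) = s" if q: "fib q" "0 < \<sigma> * (X q $ m - X p $ m)" "\<sigma> * (X q $ m - X p $ m) < r" for q
      proof -
        obtain q' where q': "fib q'" "\<sigma> * (X q' $ m - X p $ m) = \<sigma> * (X q $ m - X p $ m)" "sgn (R q' - R p) = s"
          using r(2) q(2,3) unfolding Q_def by blast
        have "X q $ m = X q' $ m" using q'(2) \<sigma> by auto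
        then have "q = q'" using uniq q(1) q'(1) by blast
        then show ?thesis using q' by simp
      qed
      then show ?thesis using s(1) r(1) by blast
    next
      \<comment> \<open>No sign occurs at small heights, so this side has no fibre point near
        \<open>p\<close> and any sign is correct.\<close>
      case False
      then have "\<forall>s\<in>{1, 0, -1}. \<forall>\<^sub>F z in at_right 0. \<not> Q s z" using alt by blast
      then have "\<forall>\<^sub>F z in at_right 0. \<forall>s\<in>{1, 0, -1}. \<not> Q s z" by (intro eventually_ball_finite) simp_all
      then obtain r where r: "r > 0" "\<forall>z>0. z < r \<longrightarrow> (\<forall>s\<in>{1, 0, -1}. \<not> Q s z)"
        unfolding eventually_at_right_field by (elim exE conjE) (rule that)
      have "sgn (R q - R p) \<in> {1, 0, -1}" for q by (auto simp: sgn_if)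
      then have "\<not> (fib q \<and> 0 < \<sigma> * (X q $ m - X p $ m) \<and> \<sigma> * (X q $ m - X p $ m) < r)" for q
        using r(2) unfolding Q_def by blast
      then show ?thesis using r(1) by blast
    qed
  qed
  obtain sp rp where sp: "sp \<in> {1, 0, -1}" "rp > 0"
    "\<And>q. fib q \<Longrightarrow> 0 < X q $ m - X p $ m \<Longrightarrow> X q $ m - X p $ m < rp \<Longrightarrow> sgn (R q - R p) = sp"
    using pick[of 1] by auto
  obtain sm rm where sm: "sm \<in> {1, 0, -1}" "rm > 0"
    "\<And>q. fib q \<Longrightarrow> 0 < X p $ m - X q $ m \<Longrightarrow> X p $ m - X q $ m < rm \<Longrightarrow> sgn (R q - R p) = sm"
    using pick[of "-1"] by auto
  define r where "r = min r0 (min rp rm)"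
  have r: "r > 0" "r \<le> r0" "r \<le> rp" "r \<le> rm" unfolding r_def using r0 sp sm by auto
  define \<kappa> where "\<kappa> = sgn (D i * k $ m)"
  have "good (m, i, \<kappa>, sp, sm) p r"
    unfolding good_def prod.case
  proof (intro conjI allI impI)
    show "p \<in> V" "p \<in> U" "p \<in> W" by (rule p)+
    show "\<exists>B b. 0 < B \<and> 0 < b \<and> (\<forall>q. q \<in> V \<longrightarrow> norm (X q - X p) < r \<longrightarrow> nice p B b q)"
      using Bb r2(2) r(2) unfolding r0_def by (metis less_le_trans min.boundedE)
    fix q assume q: "q \<in> V" "norm (X q - X p) < r" "F1 q = F1 p" "F2 q = F2 p"
    have fq: "fib q" unfolding fib_def using q r by auto
    show "q = p" if "X q $ m = X p $ m" by (rule uniq[OF fq fib_p that])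
    have c: "\<bar>X q $ m - X p $ m\<bar> < r" using component_le_norm_cart[of "X q - X p" m] q(2) by simp
    show "side i \<kappa> sp p r q" if "X p $ m < X q $ m"
      unfolding side_def
    proof (intro conjI allI impI)
      show "sgn (R q - R p) = sp" using sp(3)[OF fq] that c r by auto
      show "0 < \<kappa> * (X q $ i - X p $ i - (X q $ 1 - X p $ 1) * slope i q')" if "q' \<in> V" "norm (X q' - X p) < r" for q'
        using sides[OF fq, of 1 q'] \<open>X p $ m < X q $ m\<close> that r(2) unfolding \<kappa>_def by simp
    qed
    show "side i (- \<kappa>) sm p r q" if "X q $ m < X p $ m"
      unfolding side_def
    proof (intro conjI allI impI)
      show "sgn (R q - R p) = sm" using sm(3)[OF fq] that c r by auto
      show "0 < - \<kappa> * (X q $ i - X p $ i - (X q $ 1 - X p $ 1) * slope i q')" if "q' \<in> V" "norm (X q' - X p) < r" for q'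
        using sides[OF fq, of "-1" q'] \<open>X q $ m < X p $ m\<close> that r(2) unfolding \<kappa>_def by simp
    qed
  qed
  moreover have "\<kappa> \<in> {1, -1}" unfolding \<kappa>_def using i m by (auto simp: sgn_if)
  ultimately show ?thesis using sp(1) sm(1) r(1) unfolding J_def by blast
qed

end

lemma constant_sign:
  fixes f :: "real \<Rightarrow> real"
  assumes "continuous_on {0<..<b} f" "\<And>t. t \<in> {0<..<b} \<Longrightarrow> f t \<noteq> 0"
  obtains s where "s \<in> {1, -1}" "\<And>t. t \<in> {0<..<b} \<Longrightarrow> s * f t > 0"
proof -
  have no: False if "t1 \<in> {0<..<b}" "t2 \<in> {0<..<b}" "f t1 < 0" "0 < f t2" for t1 t2
  proof -
    have "connected (f ` {0<..<b})" by (intro connected_continuous_image assms(1)) simp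
    then have "0 \<in> f ` {0<..<b}" using connectedD_interval[of "f ` {0<..<b}" "f t1" "f t2" 0] that by auto
    then show False using assms(2) by auto
  qed
  show ?thesis
  proof (cases "\<exists>t\<in>{0<..<b}. f t < 0")
    case True
    then have "\<And>t. t \<in> {0<..<b} \<Longrightarrow> -1 * f t > 0" using no assms(2) by (metis linorder_neqE_linordered_idom mult_minus1 neg_0_less_iff_less)
    then show ?thesis using that[of "-1"] by blast
  next
    case False
    then have "\<And>t. t \<in> {0<..<b} \<Longrightarrow> 1 * f t > 0" using assms(2) by (metis linorder_neqE_linordered_idom mult_1)
    then show ?thesis using that[of 1] by blast
  qed
qed

section \<open>Velocities in the chart\<close>

context contact
begin

lemma on_curve:
  assumes "xcurve {0<..<a} c" "t \<in> {0<..<a}"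
  shows "c t \<in> V" "c t \<in> W" "rate 1 (c t) \<noteq> 0" "X (c t) $ 1 = t"
  using assms rate_clock[of "c t"] unfolding xcurve_def \<O>_def by auto

lemma X_curve_derivative:
  assumes c: "xcurve {0<..<a} c" "t \<in> {0<..<a}"
  obtains y' where "((\<lambda>t. X (c t)) has_vector_derivative y') (at t)" "\<forall>i. y' $ i = slope i (c t)"
proof -
  note oc = on_curve[OF c]
  let ?X' = "frechet_derivative X (at (c t))"
  have dX: "(X has_derivative ?X') (at (c t))" using C1_on_has_derivative[OF C1_X oc(1)] .
  have dc: "(c has_vector_derivative \<eta> (c t)) (at t)" using c unfolding xcurve_def by auto
  have lin: "linear ?X'" using dX has_derivative_linear by blast
  have "((\<lambda>t. X (c t)) has_vector_derivative ?X' (\<eta> (c t))) (at t)"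
    using has_derivative_compose[OF dc[unfolded has_vector_derivative_def] dX]
    unfolding has_vector_derivative_def by (simp add: linear_scale[OF lin])
  moreover have "?X' (\<eta> (c t)) $ i = slope i (c t)" for i
  proof -
    have "?X' (\<xi> (c t)) $ i = rate i (c t)"
      using frechet_derivative_at[OF bounded_linear.has_derivative[OF bounded_linear_vec_nth dX, of i]] oc
      unfolding rate_def along_def ext_def by (metis Int_iff)
    then show ?thesis
      unfolding \<eta>_def slope_def using oc rate_clock[OF oc(1,2)] by (simp add: linear_scale[OF lin] divide_inverse)
  qed
  ultimately show ?thesis using that by blast
qed

lemma close_eventually: "\<forall>\<^sub>F t in at_right 0. norm (X (d t) - X (g t)) < t ^ k"
proof -
  have "\<forall>\<^sub>F t in at_right (0::real). t \<in> {0<..<1}" by (rule eventually_at_right_real) simp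
  with flat[of "Suc k"] show ?thesis
  proof eventually_elim
    case (elim t)
    have "t ^ Suc k < t ^ k" using elim by (simp add: mult_less_cancel_right1)
    then show ?case using elim by linarith
  qed
qed

end

section \<open>Points of the second curve on the levels of F1\<close>

context contact_pair
begin

lemma common_good_type:
  obtains j k where "j \<in> J" "\<forall>\<^sub>F t in at_right 0. \<forall>n\<ge>k. good j (g t) (t ^ n)"
proof (rule separates_uniform_radius[OF sep finite_J, where P = good])
  show "dp (\<lambda>z. good j (vec3 (fst z)) (snd z))" for j by (rule dp_good)
  show "good j p r'" if "good j p r" "0 < r'" "r' \<le> r" for j p r r' using good_mono that by blast
  have "\<forall>\<^sub>F t in at_right 0. t \<in> {0<..<a}" using a by (rule eventually_at_right_real)
  with transversal show "\<forall>\<^sub>F t in at_right 0. \<exists>j\<in>J. \<exists>r>0. good j (g t) r"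
    by eventually_elim (use good_exists on_curve[OF g] in blast)
qed (rule that)

text \<open>If \<open>\<bar>h\<bar> \<ge> b\<close> for a time \<delta> and \<open>F1\<close> is off
  by less than \<open>b * \<delta>\<close>, the level is reached within \<delta>; here \<delta> is
  \<open>t ^ n / (8 * (B + 1))\<close>. Since \<open>B\<close> and \<open>b\<close> depend on the
  point, the radius that guarantees this is again made a power of \<open>t\<close> by separation.
  The clock is read off as \<open>X p $ 1\<close> to make the condition one on \<open>p\<close>
  alone.\<close>

definition near :: "nat \<Rightarrow> real^3 \<Rightarrow> real \<Rightarrow> bool" where
  "near n p r \<longleftrightarrow> (\<exists>B b. 0 < B \<and> 0 < b \<and>
     (\<forall>q. q \<in> V \<longrightarrow> norm (X q - X p) < (X p $ 1) ^ n \<longrightarrow> nice p B b q) \<and> r \<le> (X p $ 1) ^ n / 4 \<and>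
     (\<forall>q. q \<in> V \<longrightarrow> norm (X q - X p) < r \<longrightarrow> \<bar>F1 q - F1 p\<bar> < b * ((X p $ 1) ^ n / (8 * (B + 1)))))"

lemma dp_near: "dp (\<lambda>z. near n (vec3 (fst z)) (snd z))"
  unfolding near_def
  by (intro dp_ex dp_and dp_all_vec dp_imp dp_less dp_le dp_norm_less dp_nice dv_diff dv_X dv_vec3 dm_const
      dm_mult dm_divide dm_add dm_abs dm_diff dm_power dm_df[OF df_X] dm_df[OF df_F(1)] dp_ds[OF ds_V] dm_fst dm_snd dm_id)

lemma near_exists:
  assumes "good j p ((X p $ 1) ^ n)" "X p $ 1 > 0"
  shows "\<exists>r>0. near n p r"
proof -
  obtain B b where Bb: "0 < B" "0 < b" "\<forall>q. q \<in> V \<longrightarrow> norm (X q - X p) < (X p $ 1) ^ n \<longrightarrow> nice p B b q"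
    and p: "p \<in> V" "p \<in> U"
    using assms(1) unfolding good_def by (cases j) auto
  define e where "e = b * ((X p $ 1) ^ n / (8 * (B + 1)))"
  have e: "e > 0" unfolding e_def using Bb assms(2) by simp
  have "isCont F1 p"
    using C1_on_continuous_on[OF C1_F(1)] U(1) p by (simp add: continuous_on_eq_continuous_at)
  then have "(F1 \<longlongrightarrow> F1 p) (nhds p)" by (simp add: continuous_at tendsto_nhds_iff)
  from tendstoD[OF this e] have "\<forall>\<^sub>F q in nhds p. \<bar>F1 q - F1 p\<bar> < e" by (simp add: dist_real_def)
  from chart_nhds[OF p(1) this] obtain r where r: "r > 0" "\<forall>q\<in>V. norm (X q - X p) < r \<longrightarrow> \<bar>F1 q - F1 p\<bar> < e" by blast
  define r' where "r' = min r ((X p $ 1) ^ n / 4)"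
  have "r' > 0" unfolding r'_def using r assms(2) by simp
  moreover have "near n p r'"
    unfolding near_def e_def[symmetric]
    using Bb r(2) by (intro exI[of _ B] exI[of _ b]) (auto simp: r'_def e_def)
  ultimately show ?thesis by blast
qed

lemma near_mono: "near n p r \<Longrightarrow> r' \<le> r \<Longrightarrow> near n p r'"
  unfolding near_def by (meson less_le_trans order_trans)

text \<open>While the second curve stays in the good neighbourhood of \<open>g t\<close>,
  \<open>F1\<close> changes along it at speed at least \<open>b\<close>, hence it attains the level
  of \<open>g t\<close> before the curve can leave.\<close>

lemma reach:
  assumes n: "n \<ge> 1" and good: "\<forall>\<^sub>F t in at_right 0. good j (g t) (t ^ n)"
  shows "\<forall>\<^sub>F t in at_right 0. \<exists>u. \<bar>u - t\<bar> \<le> t / 2 \<and> F1 (d u) = F1 (g t) \<and>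
    (\<forall>v. min t u \<le> v \<and> v \<le> max t u \<longrightarrow> norm (X (d v) - X (g t)) < t ^ n)"
proof -
  \<comment> \<open>With \<open>t < a / 2\<close> and \<open>\<bar>u - t\<bar> \<le> t / 2\<close>
    all times \<open>u\<close> in use remain in the common domain; \<open>t < 1\<close> makes powers
    of \<open>t\<close> decrease.\<close>
  have ea: "\<forall>\<^sub>F t in at_right 0. t \<in> {0<..<min (a / 2) 1}" using a by (intro eventually_at_right_real) simp
  have ex: "\<forall>\<^sub>F t in at_right 0. \<exists>j\<in>{()}. \<exists>r>0. near n (g t) r"
    using good ea
  proof eventually_elim
    case (elim t)
    then have "X (g t) $ 1 = t" using on_curve(4)[OF g] by auto
    then show ?case using near_exists[of j "g t" n] elim by auto
  qed
  obtain j' :: unit and k where k: "\<forall>\<^sub>F t in at_right 0. \<forall>m\<ge>k. near n (g t) (t ^ m)"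
  proof (rule separates_uniform_radius[OF sep, where P = "\<lambda>_::unit. near n" and J = "{()}"])
    show "dp (\<lambda>z. near n (vec3 (fst z)) (snd z))" by (rule dp_near)
    show "near n p r'" if "near n p r" "0 < r'" "r' \<le> r" for p r r' using near_mono that by blast
  qed (use ex in auto)
  from k close_eventually[of k] ea show ?thesis
  proof eventually_elim
    case (elim t)
    then have t: "t \<in> {0<..<a}" "0 < t" "t < 1" "t < a / 2" by auto
    let ?p = "g t"
    note p = on_curve[OF g t(1)]
    obtain B b where Bb: "0 < B" "0 < b"
      and nice: "\<And>q. q \<in> V \<Longrightarrow> norm (X q - X ?p) < t ^ n \<Longrightarrow> nice ?p B b q"
      and r: "t ^ k \<le> t ^ n / 4"
      and F: "\<And>q. q \<in> V \<Longrightarrow> norm (X q - X ?p) < t ^ k \<Longrightarrow> \<bar>F1 q - F1 ?p\<bar> < b * (t ^ n / (8 * (B + 1)))"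
      using elim(1) unfolding near_def p(4) by blast
    \<comment> \<open>In the chart the curve moves with speed at most \<open>1 + 2 * B\<close>, the
      1 coming from the clock. In time \<delta> it covers at most a quarter of \<open>t ^ n\<close>,
      and it starts within another quarter. As \<open>n \<ge> 1\<close>, also
      \<open>\<delta> \<le> t / 2\<close>.\<close>
    define \<delta> where "\<delta> = t ^ n / (8 * (B + 1))"
    have \<delta>0: "\<delta> > 0" unfolding \<delta>_def using t Bb by simp
    have tn: "t ^ n \<le> t" using power_decreasing[OF n, of t] t by simp
    have \<delta>n: "\<delta> * (8 * (B + 1)) = t ^ n" unfolding \<delta>_def using Bb by simp
    have \<delta>: "(1 + 2 * B) * \<delta> \<le> t ^ n / 4" "\<delta> \<le> t / 2"
    proof -
      have "8 * \<delta> + 8 * (B * \<delta>) = t ^ n" using \<delta>n by (simp add: algebra_simps)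
      moreover have "B * \<delta> \<ge> 0" using Bb \<delta>0 by simp
      ultimately show "(1 + 2 * B) * \<delta> \<le> t ^ n / 4" "\<delta> \<le> t / 2" using \<delta>0 tn by (auto simp: algebra_simps)
    qed
    have int: "u \<in> {0<..<a}" if "\<bar>u - t\<bar> \<le> \<delta>" for u using that \<delta>(2) t by auto
    define y' where "y' u = vector_derivative (\<lambda>t. X (d t)) (at u)" for u
    have y': "((\<lambda>t. X (d t)) has_vector_derivative y' u) (at u)" "y' u $ i = slope i (d u)"
      if u: "\<bar>u - t\<bar> \<le> \<delta>" for u i
    proof -
      obtain z where z: "((\<lambda>t. X (d t)) has_vector_derivative z) (at u)" "\<forall>i. z $ i = slope i (d u)"
        using X_curve_derivative[OF d int[OF u]] by blast
      then have "y' u = z" unfolding y'_def by (simp add: vector_derivative_at)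
      then show "((\<lambda>t. X (d t)) has_vector_derivative y' u) (at u)" "y' u $ i = slope i (d u)" using z by auto
    qed
    have stay: "norm (X (d u) - X ?p) < t ^ n" if "\<bar>u - t\<bar> \<le> \<delta>" for u
    proof (rule stays_in_ball[of t \<delta> "\<lambda>u. X (d u)" y' "X ?p" "t ^ n" "1 + 2 * B", OF y'(1)])
      show "norm (y' u) \<le> 1 + 2 * B" if u: "\<bar>u - t\<bar> \<le> \<delta>" "norm (X (d u) - X ?p) < t ^ n" for u
      proof -
        note du = on_curve[OF d int[OF u(1)]]
        have "norm (y' u) \<le> (\<Sum>i\<in>UNIV. \<bar>y' u $ i\<bar>)" by (rule norm_le_l1_cart)
        also have "\<dots> = \<bar>slope 1 (d u)\<bar> + \<bar>slope 2 (d u)\<bar> + \<bar>slope 3 (d u)\<bar>" by (simp add: sum_3 y'(2)[OF u(1)])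
        also have "\<dots> \<le> 1 + 2 * B" using nice[OF du(1) u(2)] du(3) unfolding nice_def slope_def[of 1] by simp
        finally show ?thesis .
      qed
      show "norm (X (d t) - X ?p) + (1 + 2 * B) * \<delta> < t ^ n"
        using elim(2) r \<delta>(1) zero_less_power[OF t(2), of n] by linarith
    qed (use that Bb in auto)
    define s where "s = sgn (h ?p)"
    have hp: "h ?p \<noteq> 0" using nice[OF p(1)] t unfolding nice_def by auto
    have hs: "s * h (d u) \<ge> b" if u: "\<bar>u - t\<bar> \<le> \<delta>" for u
      using nice[OF on_curve(1)[OF d int[OF u]] stay[OF u]] hp unfolding nice_def s_def
      by (auto simp: sgn_if zero_less_mult_iff abs_if split: if_splits)
    define \<phi> where "\<phi> u = s * (F1 (d u) - F1 ?p)" for u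
    have d\<phi>: "(\<phi> has_real_derivative s * h (d u)) (at u)" if u: "\<bar>u - t\<bar> \<le> \<delta>" for u
    proof -
      have "d u \<in> U" using nice[OF on_curve(1)[OF d int[OF u]] stay[OF u]] unfolding nice_def by blast
      from curve_derivative[OF d int[OF u] C1_F(1) this] show ?thesis
        unfolding \<phi>_def[abs_def] h_def by (auto intro!: derivative_eq_intros)
    qed
    have grow: "\<phi> v - \<phi> u \<ge> b * (v - u)" if "t - \<delta> \<le> u" "u < v" "v \<le> t + \<delta>" for u v
    proof -
      have "\<exists>z. u < z \<and> z < v \<and> \<phi> v - \<phi> u = (v - u) * (s * h (d z))"
        using that by (intro MVT2 d\<phi>) auto
      then obtain z where z: "u < z" "z < v" "\<phi> v - \<phi> u = (v - u) * (s * h (d z))" by blast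
      have "b * (v - u) \<le> (s * h (d z)) * (v - u)" using hs[of z] z that by (intro mult_right_mono) auto
      then show ?thesis using z by (simp add: mult.commute)
    qed
    have "\<bar>\<phi> t\<bar> < b * \<delta>"
      using F[OF on_curve(1)[OF d t(1)] elim(2)] hp unfolding \<phi>_def \<delta>_def s_def by (auto simp: abs_mult sgn_if)
    then have "\<phi> (t - \<delta>) \<le> 0" "0 \<le> \<phi> (t + \<delta>)"
      using grow[of "t - \<delta>" t] grow[of t "t + \<delta>"] \<delta>0 by (auto simp: abs_less_iff)
    moreover have "continuous_on {t - \<delta>..t + \<delta>} \<phi>"
    proof (intro continuous_at_imp_continuous_on ballI)
      fix u assume "u \<in> {t - \<delta>..t + \<delta>}"
      then have "\<bar>u - t\<bar> \<le> \<delta>" by auto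
      then show "isCont \<phi> u" using d\<phi> DERIV_isCont by blast
    qed
    ultimately obtain u where u: "t - \<delta> \<le> u" "u \<le> t + \<delta>" "\<phi> u = 0"
      using IVT'[of \<phi> "t - \<delta>" 0 "t + \<delta>"] \<delta>0 by auto
    have "s \<noteq> 0" using hp unfolding s_def by (simp add: sgn_zero_iff)
    then have "F1 (d u) = F1 ?p" using u(3) unfolding \<phi>_def by simp
    moreover have "\<bar>u - t\<bar> \<le> t / 2" using u(1,2) \<delta>(2) by linarith
    moreover have "norm (X (d v) - X ?p) < t ^ n" if "min t u \<le> v \<and> v \<le> max t u" for v
    proof (rule stay)
      show "\<bar>v - t\<bar> \<le> \<delta>" using that u(1,2) \<delta>0 by (auto simp: min_def max_def split: if_splits)
    qed
    ultimately show ?case by blast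
  qed
qed

end

context contact_pair
begin

lemma isCont_h: "p \<in> V \<Longrightarrow> p \<in> W \<Longrightarrow> p \<in> U \<Longrightarrow> rate 1 p \<noteq> 0 \<Longrightarrow> isCont h p"
  unfolding h_def[abs_def] rate_def
  by (intro continuous_intros isCont_along[OF C1_F(1) U(1)] isCont_along[OF C1_on_nth[OF C1_X] V])

text \<open>\<open>\<tau> t\<close> is the time at which the second curve lies on the level set of \<open>F1\<close> through
  \<^term>\<open>g t\<close>; zeros of \<open>w\<close> are the common points of the two projected curves.\<close>

definition synchronized where
  "synchronized j n s b b2 \<tau> \<longleftrightarrow> j \<in> J \<and> s \<in> {1, -1} \<and> 0 < b \<and> b \<le> b2 \<and> b2 \<le> a \<and>
     (\<forall>t\<in>{0<..<b2}. g t \<in> U \<and> d t \<in> U \<and> 0 < s * h (g t) \<and> 0 < s * h (d t) \<and> good j (g t) (t ^ n)) \<and>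
     (\<forall>t\<in>{0<..<b}. \<tau> t \<in> {0<..<b2} \<and> F1 (d (\<tau> t)) = F1 (g t) \<and>
        (\<forall>u\<in>{0<..<b2}. F1 (d u) = F1 (g t) \<longrightarrow> u = \<tau> t) \<and>
        (\<tau> has_real_derivative h (g t) / h (d (\<tau> t))) (at t) \<and>
        (\<forall>v. min t (\<tau> t) \<le> v \<and> v \<le> max t (\<tau> t) \<longrightarrow> norm (X (d v) - X (g t)) < t ^ n))"

text \<open>The speed \<open>h\<close> keeps one sign along \<open>g\<close>, and
  \<open>nice\<close> forces the same sign along \<open>d\<close>. So \<open>F1\<close> is strictly
  monotone along \<open>d\<close>, and \<tau> is \<open>F1\<close> along \<open>g\<close> followed
  by the inverse of that function.\<close>

lemma synchronized_exists: "\<exists>j n s b b2 \<tau>. synchronized j n s b b2 \<tau>"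
proof -
  obtain j k where j: "j \<in> J" "\<forall>\<^sub>F t in at_right 0. \<forall>n\<ge>k. good j (g t) (t ^ n)"
    using common_good_type by blast
  define n where "n = max k 1"
  have good: "\<forall>\<^sub>F t in at_right 0. good j (g t) (t ^ n)"
    using j(2) by eventually_elim (simp add: n_def)
  define reached where "reached t u \<longleftrightarrow> \<bar>u - t\<bar> \<le> t / 2 \<and> F1 (d u) = F1 (g t) \<and>
    (\<forall>v. min t u \<le> v \<and> v \<le> max t u \<longrightarrow> norm (X (d v) - X (g t)) < t ^ n)" for t u
  have "\<forall>\<^sub>F t in at_right 0. \<exists>u. reached t u"
    unfolding reached_def by (rule reach[OF _ good]) (simp add: n_def)
  with good close_eventually[of n]
  have "\<forall>\<^sub>F t in at_right 0. good j (g t) (t ^ n) \<and> norm (X (d t) - X (g t)) < t ^ n \<and> (\<exists>u. reached t u)"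
    by eventually_elim auto
  then obtain b0 where b0: "b0 > 0" "\<forall>t>0. t < b0 \<longrightarrow> good j (g t) (t ^ n) \<and> norm (X (d t) - X (g t)) < t ^ n \<and> (\<exists>u. reached t u)"
    unfolding eventually_at_right_field by (elim exE conjE) (rule that)
  define b2 where "b2 = min b0 a"
  have b2: "b2 > 0" "b2 \<le> a" unfolding b2_def using b0 a by auto
  have all: "good j (g t) (t ^ n)" "norm (X (d t) - X (g t)) < t ^ n" "\<exists>u. reached t u" if "t \<in> {0<..<b2}" for t
    using b0(2) that unfolding b2_def by auto
  have int: "t \<in> {0<..<a}" if "t \<in> {0<..<b2}" for t using that b2 by auto
  have hgd: "g t \<in> U" "d t \<in> U" "h (g t) \<noteq> 0" "0 < h (d t) * h (g t)" if t: "t \<in> {0<..<b2}" for t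
  proof -
    obtain B b where nice: "\<forall>q. q \<in> V \<longrightarrow> norm (X q - X (g t)) < t ^ n \<longrightarrow> nice (g t) B b q" and "g t \<in> U"
      using all(1)[OF t] unfolding good_def by (cases j) auto
    show "g t \<in> U" by fact
    have "nice (g t) B b (d t)" using nice all(2)[OF t] on_curve(1)[OF d int[OF t]] by blast
    then show "d t \<in> U" "0 < h (d t) * h (g t)" "h (g t) \<noteq> 0" unfolding nice_def by auto
  qed
  have "continuous_on {0<..<b2} (\<lambda>t. h (g t))"
  proof (intro continuous_at_imp_continuous_on ballI)
    fix t assume t: "t \<in> {0<..<b2}"
    show "isCont (\<lambda>t. h (g t)) t"
      by (rule isCont_o2[OF xcurve_isCont[OF g int[OF t]]])
        (rule isCont_h[OF on_curve(1,2)[OF g int[OF t]] hgd(1)[OF t] on_curve(3)[OF g int[OF t]]])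
  qed
  then obtain s where s: "s \<in> {1, -1}" "\<And>t. t \<in> {0<..<b2} \<Longrightarrow> s * h (g t) > 0"
    using constant_sign hgd(3) by blast
  have sd: "s * h (d t) > 0" if "t \<in> {0<..<b2}" for t
    using s(1) s(2)[OF that] hgd(4)[OF that] by (auto simp: zero_less_mult_iff)
  define G where "G u = F1 (d u)" for u
  have dG: "(G has_real_derivative h (d u)) (at u)" if "u \<in> {0<..<b2}" for u
    unfolding G_def[abs_def] h_def by (rule curve_derivative[OF d int[OF that] C1_F(1) hgd(2)[OF that]])
  have less: "s * G u < s * G v" if "u \<in> {0<..<b2}" "v \<in> {0<..<b2}" "u < v" for u v
  proof (rule DERIV_pos_imp_increasing[OF that(3)])
    fix x assume "u \<le> x" "x \<le> v"
    then have x: "x \<in> {0<..<b2}" using that by auto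
    show "\<exists>y. ((\<lambda>u. s * G u) has_real_derivative y) (at x) \<and> 0 < y"
      using DERIV_cmult[OF dG[OF x], of s] sd[OF x] by blast
  qed
  have inj: "inj_on G {0<..<b2}"
  proof (rule linorder_inj_onI)
    show "G u \<noteq> G v" if "u < v" "u \<in> {0<..<b2}" "v \<in> {0<..<b2}" for u v using less[OF that(2,3,1)] by auto
  qed auto
  define \<sigma> where "\<sigma> = the_inv_into {0<..<b2} G"
  have \<sigma>: "\<sigma> (G u) = u" if "u \<in> {0<..<b2}" for u unfolding \<sigma>_def by (rule the_inv_into_f_f[OF inj that])
  have d\<sigma>: "(\<sigma> has_real_derivative inverse (h (d u))) (at (G u))" if u: "u \<in> {0<..<b2}" for u
  proof -
    have hu: "h (d u) \<noteq> 0" using sd[OF u] by auto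
    have "(\<sigma> has_derivative (\<lambda>z. inverse (h (d u)) * z)) (at (G u))"
    proof (rule has_derivative_inverse_strong[of "{0<..<b2}" u G \<sigma> "(*) (h (d u))"])
      show "continuous_on {0<..<b2} G" using dG by (meson DERIV_isCont continuous_at_imp_continuous_on)
      show "(G has_derivative (*) (h (d u))) (at u)" using dG[OF u] by (simp add: has_field_derivative_def)
      show "(*) (h (d u)) \<circ> (\<lambda>z. inverse (h (d u)) * z) = id" using hu by (auto simp: fun_eq_iff)
    qed (use u \<sigma> in auto)
    then show ?thesis by (simp add: has_field_derivative_def)
  qed
  define \<tau> where "\<tau> t = \<sigma> (F1 (g t))" for t
  \<comment> \<open>Half the interval suffices: \<open>\<tau> t\<close> exceeds \<open>t\<close> by
    at most \<open>t / 2\<close> and stays below \<open>b2\<close>.\<close>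
  define b where "b = b2 / 2"
  have b: "0 < b" "b \<le> b2" unfolding b_def using b2 by auto
  have \<tau>: "reached t (\<tau> t)" "\<tau> t \<in> {0<..<b2}" if t: "t \<in> {0<..<b}" for t
  proof -
    have t2: "t \<in> {0<..<b2}" using t b by auto
    obtain u where u: "reached t u" using all(3)[OF t2] by blast
    then have "\<bar>u - t\<bar> \<le> t / 2" unfolding reached_def by blast
    moreover have "0 < t" "t < b2 / 2" using t unfolding b_def by auto
    ultimately have "0 < u" "u < b2" by linarith+
    then have u2: "u \<in> {0<..<b2}" by simp
    have "\<tau> t = u" unfolding \<tau>_def using u \<sigma>[OF u2] unfolding reached_def G_def by simp
    then show "reached t (\<tau> t)" "\<tau> t \<in> {0<..<b2}" using u u2 by auto
  qed
  have "synchronized j n s b b2 \<tau>"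
    unfolding synchronized_def
  proof (intro conjI ballI)
    fix t assume t: "t \<in> {0<..<b2}"
    show "g t \<in> U" "d t \<in> U" "0 < s * h (g t)" "0 < s * h (d t)" "good j (g t) (t ^ n)"
      using hgd(1,2)[OF t] s(2)[OF t] sd[OF t] all(1)[OF t] by auto
  next
    fix t assume t: "t \<in> {0<..<b}"
    then have t2: "t \<in> {0<..<b2}" using b by auto
    show "\<tau> t \<in> {0<..<b2}" "F1 (d (\<tau> t)) = F1 (g t)" using \<tau>[OF t] unfolding reached_def by auto
    show "F1 (d u) = F1 (g t) \<longrightarrow> u = \<tau> t" if "u \<in> {0<..<b2}" for u
      using \<sigma>[OF that] unfolding \<tau>_def G_def by metis
    have "((\<lambda>t. F1 (g t)) has_real_derivative h (g t)) (at t)"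
      unfolding h_def by (rule curve_derivative[OF g int[OF t2] C1_F(1) hgd(1)[OF t2]])
    moreover have "(\<sigma> has_real_derivative inverse (h (d (\<tau> t)))) (at (F1 (g t)))"
      using d\<sigma>[OF \<tau>(2)[OF t]] \<tau>(1)[OF t] unfolding reached_def G_def by simp
    ultimately have "((\<lambda>t. \<sigma> (F1 (g t))) has_real_derivative inverse (h (d (\<tau> t))) * h (g t)) (at t)"
      by (rule DERIV_chain2[rotated])
    then show "(\<tau> has_real_derivative h (g t) / h (d (\<tau> t))) (at t)"
      unfolding \<tau>_def[abs_def] by (simp add: divide_inverse mult.commute)
    show "\<forall>v. min t (\<tau> t) \<le> v \<and> v \<le> max t (\<tau> t) \<longrightarrow> norm (X (d v) - X (g t)) < t ^ n"
      using \<tau>(1)[OF t] unfolding reached_def by blast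
  qed (use j s b b2 in auto)
  then show ?thesis by blast
qed

text \<open>At a zero the point \<open>d (\<tau> t)\<close> lies on the fibre through
  \<open>g t\<close>, and it differs from \<open>g t\<close> because equal points would have equal
  clocks, so that both curves would meet at time \<open>t\<close>. Its side is carried back from
  time \<open>\<tau> t\<close> to time \<open>t\<close> by the mean value theorem, giving the sign
  of coordinate \<open>i\<close> of the difference at equal clock times.\<close>

lemma synchronized_zero:
  assumes syn: "synchronized (m, i, \<kappa>, sp, sm) n s b b2 \<tau>" and t: "t \<in> {0<..<b}"
    and zero: "F2 (d (\<tau> t)) = F2 (g t)"
  shows "(X (g t) $ m < X (d (\<tau> t)) $ m \<and> sgn (R (d (\<tau> t)) - R (g t)) = sp \<and> 0 < \<kappa> * (X (d t) $ i - X (g t) $ i)) \<or>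
    (X (d (\<tau> t)) $ m < X (g t) $ m \<and> sgn (R (d (\<tau> t)) - R (g t)) = sm \<and> 0 < - \<kappa> * (X (d t) $ i - X (g t) $ i))"
proof -
  have b: "b \<le> b2" "b2 \<le> a" using syn unfolding synchronized_def by auto
  have t2: "t \<in> {0<..<b2}" "t \<in> {0<..<a}" using t b by auto
  have gd: "good (m, i, \<kappa>, sp, sm) (g t) (t ^ n)" using syn t2(1) unfolding synchronized_def by blast
  have \<tau>: "\<tau> t \<in> {0<..<b2}" "F1 (d (\<tau> t)) = F1 (g t)"
    and path: "\<And>v. min t (\<tau> t) \<le> v \<Longrightarrow> v \<le> max t (\<tau> t) \<Longrightarrow> norm (X (d v) - X (g t)) < t ^ n"
    using syn t unfolding synchronized_def by blast+
  have \<tau>a: "\<tau> t \<in> {0<..<a}" using \<tau>(1) b by auto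
  let ?p = "g t" and ?q = "d (\<tau> t)"
  note p = on_curve[OF g t2(2)] and q = on_curve[OF d \<tau>a]
  have F: "X ?q $ m = X ?p $ m \<longrightarrow> ?q = ?p" "X ?p $ m < X ?q $ m \<longrightarrow> side i \<kappa> sp ?p (t ^ n) ?q"
    "X ?q $ m < X ?p $ m \<longrightarrow> side i (- \<kappa>) sm ?p (t ^ n) ?q"
    using gd q(1) path[of "\<tau> t"] \<tau>(2) zero unfolding good_def by auto
  have ne: "X ?q $ m \<noteq> X ?p $ m"
  proof
    assume "X ?q $ m = X ?p $ m"
    then have "?q = ?p" using F(1) by blast
    then have "\<tau> t = t" using p(4) q(4) by metis
    then show False using \<open>?q = ?p\<close> distinct[OF t2(2)] by metis
  qed
  \<comment> \<open>The mean value theorem in either order of the two times; for equal times any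
    point does.\<close>
  obtain v where v: "min t (\<tau> t) \<le> v" "v \<le> max t (\<tau> t)" "X ?q $ i - X (d t) $ i = (\<tau> t - t) * slope i (d v)"
  proof -
    have dv: "((\<lambda>u. X (d u) $ i) has_real_derivative slope i (d u)) (at u)" if "u \<in> {0<..<a}" for u
      using curve_derivative[OF d that C1_on_nth[OF C1_X, of i] on_curve(1)[OF d that]] unfolding slope_def rate_def .
    have mv: "\<exists>z. u1 < z \<and> z < u2 \<and> X (d u2) $ i - X (d u1) $ i = (u2 - u1) * slope i (d z)"
      if "u1 < u2" "u1 \<in> {0<..<a}" "u2 \<in> {0<..<a}" for u1 u2
      by (rule MVT2[OF that(1)]) (use that in \<open>auto intro!: dv\<close>)
    consider "t < \<tau> t" | "\<tau> t < t" | "\<tau> t = t" by linarith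
    then show thesis
    proof cases
      case 1
      from mv[OF this t2(2) \<tau>a] obtain z
        where z: "t < z" "z < \<tau> t" "X ?q $ i - X (d t) $ i = (\<tau> t - t) * slope i (d z)" by blast
      show thesis by (rule that[of z]) (use z 1 in auto)
    next
      case 2
      from mv[OF this \<tau>a t2(2)] obtain z
        where z: "\<tau> t < z" "z < t" "X (d t) $ i - X ?q $ i = (t - \<tau> t) * slope i (d z)" by blast
      have "X ?q $ i - X (d t) $ i = (\<tau> t - t) * slope i (d z)" using z(3) by (simp add: algebra_simps)
      then show thesis by (rule that[of z, rotated 2]) (use z 2 in auto)
    next
      case 3
      then show thesis using that[of t] by simp
    qed
  qed
  have va: "v \<in> {0<..<a}" using v(1,2) t2(2) \<tau>a by (auto simp: min_def max_def split: if_splits)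
  have E: "(X ?q $ i - X ?p $ i) - (X ?q $ 1 - X ?p $ 1) * slope i (d v) = X (d t) $ i - X ?p $ i"
    using v(3) p(4) q(4) by simp
  have side: "sgn (R ?q - R ?p) = s' \<and> 0 < \<kappa>' * (X (d t) $ i - X ?p $ i)" if "side i \<kappa>' s' ?p (t ^ n) ?q" for \<kappa>' s'
    using that on_curve(1)[OF d va] path[OF v(1,2)] unfolding side_def E[symmetric] by blast
  show ?thesis
  proof (cases "X ?p $ m < X ?q $ m")
    case True
    then show ?thesis using side F(2) by blast
  next
    case False
    then have "X ?q $ m < X ?p $ m" using ne by simp
    then show ?thesis using side F(3) by blast
  qed
qed

text \<open>Both projected curves are read at the same value of \<open>F1\<close>, which advances at
  speed \<open>h (g t)\<close>; the difference of heights grows at this speed times the difference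
  of slopes.\<close>

lemma synchronized_derivative:
  assumes syn: "synchronized j n s b b2 \<tau>" and t: "t \<in> {0<..<b}"
  shows "((\<lambda>t. F2 (d (\<tau> t)) - F2 (g t)) has_real_derivative h (g t) * (R (d (\<tau> t)) - R (g t))) (at t)"
proof -
  have b: "b \<le> b2" "b2 \<le> a" using syn unfolding synchronized_def by auto
  have t2: "t \<in> {0<..<b2}" "t \<in> {0<..<a}" using t b by auto
  have \<tau>: "\<tau> t \<in> {0<..<b2}" "(\<tau> has_real_derivative h (g t) / h (d (\<tau> t))) (at t)"
    using syn t unfolding synchronized_def by blast+
  have \<tau>a: "\<tau> t \<in> {0<..<a}" using \<tau>(1) b by auto
  have U2: "g t \<in> U" "d (\<tau> t) \<in> U" "h (g t) \<noteq> 0" "h (d (\<tau> t)) \<noteq> 0"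
  proof -
    have "\<forall>u\<in>{0<..<b2}. g u \<in> U \<and> d u \<in> U \<and> 0 < s * h (g u) \<and> 0 < s * h (d u)"
      using syn unfolding synchronized_def by blast
    from bspec[OF this t2(1)] bspec[OF this \<tau>(1)]
    show "g t \<in> U" "d (\<tau> t) \<in> U" "h (g t) \<noteq> 0" "h (d (\<tau> t)) \<noteq> 0" by auto
  qed
  have Rh: "along U F2 p / rate 1 p = R p * h p" if "h p \<noteq> 0" for p
    using that unfolding R_def h_def by (simp add: field_simps)
  have "((\<lambda>t. F2 (g t)) has_real_derivative R (g t) * h (g t)) (at t)"
    using curve_derivative[OF g t2(2) C1_F(2) U2(1)] Rh U2 by simp
  moreover have "((\<lambda>t. F2 (d t)) has_real_derivative R (d (\<tau> t)) * h (d (\<tau> t))) (at (\<tau> t))"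
    using curve_derivative[OF d \<tau>a C1_F(2) U2(2)] Rh U2 by simp
  ultimately have "((\<lambda>t. F2 (d (\<tau> t)) - F2 (g t)) has_real_derivative
      R (d (\<tau> t)) * h (d (\<tau> t)) * (h (g t) / h (d (\<tau> t))) - R (g t) * h (g t)) (at t)"
    by (intro DERIV_diff DERIV_chain2[OF _ \<tau>(2)])
  then show ?thesis using U2 by (simp add: field_simps)
qed

end

section \<open>Coincidence and crossings of the projected curves\<close>

context contact_pair
begin

text \<open>The surface \<open>G = 0\<close> is the preimage of the projected curve
  \<open>g\<close>. On a side with sign zero, \<open>R\<close> has at each point of the surface the
  value it has at the point of \<open>g\<close> on the same fibre. The field is thus tangent to the
  surface there, and the integral curve \<open>d\<close> cannot leave it.\<close>

lemma coincidence_spreads_locally: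
  assumes syn: "synchronized (m, i, \<kappa>, sp, sm) n s b b2 \<tau>" and t0: "t0 \<in> {0<..<b}"
    and zero: "F2 (d (\<tau> t0)) = F2 (g t0)"
    and side0: "0 < \<sigma> * (X (d (\<tau> t0)) $ m - X (g t0) $ m)" "\<sigma> = 1 \<and> sp = 0 \<or> \<sigma> = -1 \<and> sm = 0"
  shows "\<forall>\<^sub>F t in nhds t0. F2 (d (\<tau> t)) = F2 (g t)"
proof -
  have b: "b \<le> b2" "b2 \<le> a" using syn unfolding synchronized_def by auto
  have int: "t \<in> {0<..<a}" "t \<in> {0<..<b2}" if "t \<in> {0<..<b}" for t using that b by auto
  have hyp: "g t \<in> U \<and> d t \<in> U \<and> 0 < s * h (g t) \<and> 0 < s * h (d t) \<and> good (m, i, \<kappa>, sp, sm) (g t) (t ^ n)" if "t \<in> {0<..<b2}" for t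
    using syn that unfolding synchronized_def by blast
  have \<tau>: "\<tau> t \<in> {0<..<b2}" "F1 (d (\<tau> t)) = F1 (g t)" "(\<tau> has_real_derivative h (g t) / h (d (\<tau> t))) (at t)"
    "\<forall>v. min t (\<tau> t) \<le> v \<and> v \<le> max t (\<tau> t) \<longrightarrow> norm (X (d v) - X (g t)) < t ^ n" if "t \<in> {0<..<b}" for t
    using syn that unfolding synchronized_def by blast+
  have hg0: "h (g t) \<noteq> 0" if "t \<in> {0<..<b}" for t using hyp[OF int(2)[OF that]] by auto
  have daF1: "along U F1 (g t) \<noteq> 0" if "t \<in> {0<..<b}" for t using hg0[OF that] unfolding h_def by auto
  define G1 where "G1 t = F1 (g t)" for t
  have dG1: "(G1 has_real_derivative h (g t)) (at t)" if "t \<in> {0<..<b}" for t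
    unfolding G1_def[abs_def] h_def using curve_derivative[OF g int(1)[OF that] C1_F(1)] hyp[OF int(2)[OF that]] by blast
  have cG1: "continuous_on {0<..<b} G1" using dG1 by (meson DERIV_isCont continuous_at_imp_continuous_on)
  have less: "s * G1 u < s * G1 v" if "u \<in> {0<..<b}" "v \<in> {0<..<b}" "u < v" for u v
  proof (rule DERIV_pos_imp_increasing[OF that(3)])
    fix x assume "u \<le> x" "x \<le> v"
    then have x: "x \<in> {0<..<b}" using that by auto
    show "\<exists>y. ((\<lambda>u. s * G1 u) has_real_derivative y) (at x) \<and> 0 < y"
      using DERIV_cmult[OF dG1[OF x], of s] hyp[OF int(2)[OF x]] by blast
  qed
  have inj: "inj_on G1 {0<..<b}"
  proof (rule linorder_inj_onI)
    show "G1 u \<noteq> G1 v" if "u < v" "u \<in> {0<..<b}" "v \<in> {0<..<b}" for u v using less[OF that(2,3,1)] by auto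
  qed auto
  define I where "I = G1 ` {0<..<b}"
  have openI: "open I" unfolding I_def by (rule invariance_of_domain[OF cG1 _ inj]) simp
  define T where "T = the_inv_into {0<..<b} G1"
  have T: "T (G1 t) = t" if "t \<in> {0<..<b}" for t unfolding T_def by (rule the_inv_into_f_f[OF inj that])
  have TI: "T y \<in> {0<..<b}" "G1 (T y) = y" if "y \<in> I" for y using that T unfolding I_def by auto
  have dT: "(T has_real_derivative inverse (h (g t))) (at (G1 t))" if t: "t \<in> {0<..<b}" for t
  proof -
    have "(T has_derivative (\<lambda>z. inverse (h (g t)) * z)) (at (G1 t))"
    proof (rule has_derivative_inverse_strong[of "{0<..<b}" t G1 T "(*) (h (g t))"])
      show "(G1 has_derivative (*) (h (g t))) (at t)" using dG1[OF t] by (simp add: has_field_derivative_def)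
      show "(*) (h (g t)) \<circ> (\<lambda>z. inverse (h (g t)) * z) = id" using hg0[OF t] by (auto simp: fun_eq_iff)
    qed (use t T cG1 in auto)
    then show ?thesis by (simp add: has_field_derivative_def)
  qed
  have cT: "continuous_on I T"
    using dT TI by (intro continuous_at_imp_continuous_on ballI) (metis DERIV_isCont)
  have cg: "continuous_on {0<..<b} g"
    by (rule continuous_on_subset[OF xcurve_continuous_on[OF g]]) (use int in auto)
  \<comment> \<open>The point of the first curve on the same level of \<open>F1\<close> as
    \<open>r\<close>.\<close>
  define \<pi> where "\<pi> r = g (T (F1 r))" for r
  define O1 where "O1 = U \<inter> V \<inter> W \<inter> F1 -` I"
  have "O1 = (V \<inter> W) \<inter> (U \<inter> F1 -` I)" unfolding O1_def by auto
  then have openO1: "open O1"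
    using continuous_open_preimage[OF C1_on_continuous_on[OF C1_F(1)] U(1) openI] V W by auto
  have cF1: "continuous_on O1 F1" by (rule continuous_on_subset[OF C1_on_continuous_on[OF C1_F(1)]]) (auto simp: O1_def)
  have cTF: "continuous_on O1 (\<lambda>r. T (F1 r))" by (rule continuous_on_compose2[OF cT cF1]) (auto simp: O1_def)
  have c\<pi>: "continuous_on O1 \<pi>" unfolding \<pi>_def
    by (rule continuous_on_compose2[OF cg cTF]) (use TI in \<open>auto simp: O1_def\<close>)
  have \<pi>V: "\<pi> r \<in> V \<and> \<pi> r \<in> W \<and> rate 1 (\<pi> r) \<noteq> 0 \<and> \<pi> r \<in> U \<and> F1 (\<pi> r) = F1 r \<and> along U F1 (\<pi> r) \<noteq> 0" if "r \<in> O1" for r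
  proof -
    have t: "T (F1 r) \<in> {0<..<b}" "G1 (T (F1 r)) = F1 r" using TI that unfolding O1_def by auto
    show ?thesis using on_curve[OF g int(1)[OF t(1)]] hyp[OF int(2)[OF t(1)]] t daF1[OF t(1)] unfolding \<pi>_def G1_def by auto
  qed
  have cX: "continuous_on V X" by (rule C1_on_continuous_on[OF C1_X])
  have cXO: "continuous_on O1 X" by (rule continuous_on_subset[OF cX]) (auto simp: O1_def)
  have cX\<pi>: "continuous_on O1 (\<lambda>r. X (\<pi> r))" by (rule continuous_on_compose2[OF cX c\<pi>]) (use \<pi>V in auto)
  \<comment> \<open>Positivity of \<open>f1\<close> and \<open>f2\<close> cuts out the open set of
    points that are within the good radius of \<open>\<pi> r\<close> and on the chosen side of
    it.\<close>
  define f1 where "f1 r = T (F1 r) ^ n - norm (X r - X (\<pi> r))" for r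
  define f2 where "f2 r = \<sigma> * (X r $ m - X (\<pi> r) $ m)" for r
  have cf: "continuous_on O1 f1" "continuous_on O1 f2"
    unfolding f1_def[abs_def] f2_def[abs_def] by (intro continuous_intros cTF cXO cX\<pi>)+
  define O2 where "O2 = (O1 \<inter> f1 -` {0<..}) \<inter> (O1 \<inter> f2 -` {0<..})"
  have openO2: "open O2" unfolding O2_def
    using continuous_open_preimage[OF cf(1) openO1] continuous_open_preimage[OF cf(2) openO1] by auto
  define \<psi> where "\<psi> y = F2 (g (T y))" for y
  have d\<psi>: "(\<psi> has_real_derivative R (g (T y))) (at y)" if y: "y \<in> I" for y
  proof -
    note t = TI[OF y]
    have "((\<lambda>t. F2 (g t)) has_real_derivative along U F2 (g (T y)) / rate 1 (g (T y))) (at (T y))"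
      using curve_derivative[OF g int(1)[OF t(1)] C1_F(2)] hyp[OF int(2)[OF t(1)]] by blast
    moreover have "(T has_real_derivative inverse (h (g (T y)))) (at y)" using dT[OF t(1)] t(2) by simp
    ultimately have "(\<psi> has_real_derivative along U F2 (g (T y)) / rate 1 (g (T y)) * inverse (h (g (T y)))) (at y)"
      unfolding \<psi>_def[abs_def] by (rule DERIV_chain2)
    moreover have "along U F2 (g (T y)) / rate 1 (g (T y)) * inverse (h (g (T y))) = R (g (T y))"
      unfolding R_def h_def using on_curve(3)[OF g int(1)[OF t(1)]] daF1[OF t(1)] by (simp add: field_simps)
    ultimately show ?thesis by simp
  qed
  define G where "G r = F2 r - \<psi> (F1 r)" for r
  obtain F1' where F1': "\<And>p. p \<in> U \<Longrightarrow> (F1 has_derivative blinfun_apply (F1' p)) (at p)" "continuous_on U F1'"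
    using C1_F(1) unfolding C1_on_def by blast
  obtain F2' where F2': "\<And>p. p \<in> U \<Longrightarrow> (F2 has_derivative blinfun_apply (F2' p)) (at p)" "continuous_on U F2'"
    using C1_F(2) unfolding C1_on_def by blast
  have fr: "frechet_derivative F1 (at p) = blinfun_apply (F1' p)" "frechet_derivative F2 (at p) = blinfun_apply (F2' p)" if "p \<in> U" for p
    using frechet_derivative_at[OF F1'(1)[OF that]] frechet_derivative_at[OF F2'(1)[OF that]] by auto
  \<comment> \<open>The derivative of \<psi> is \<open>R (g (T y))\<close>. Its continuity is enough
    to make \<open>G\<close> of class C1.\<close>
  define G' where "G' r = F2' r - R (\<pi> r) *\<^sub>R F1' r" for r
  have dG: "(G has_derivative blinfun_apply (G' r)) (at r)" if r: "r \<in> O2" for r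
  proof -
    have rO: "r \<in> U" "F1 r \<in> I" using r unfolding O2_def O1_def by auto
    have "((\<lambda>r. \<psi> (F1 r)) has_derivative (\<lambda>v. R (\<pi> r) * F1' r v)) (at r)"
      using has_derivative_compose[OF F1'(1)[OF rO(1)] d\<psi>[OF rO(2), unfolded has_field_derivative_def]] unfolding \<pi>_def .
    from has_derivative_diff[OF F2'(1)[OF rO(1)] this] show ?thesis
      unfolding G_def[abs_def] G'_def by (elim has_derivative_eq_rhs) (simp add: fun_eq_iff blinfun.diff_left blinfun.scaleR_left)
  qed
  have cR: "continuous_on O1 (\<lambda>r. R (\<pi> r))"
  proof -
    let ?P = "{p \<in> U \<inter> W. along U F1 p \<noteq> 0}"
    have cda: "continuous_on (U \<inter> W) (along U F)" if "C1_on F U" for F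
      by (rule continuous_on_eq[OF continuous_on_directional[OF that]]) (simp add: along_def ext_def)
    have "continuous_on ?P R" unfolding R_def[abs_def]
      by (intro continuous_intros continuous_on_subset[OF cda[OF C1_F(1)]] continuous_on_subset[OF cda[OF C1_F(2)]]) auto
    then show ?thesis by (rule continuous_on_compose2[OF _ c\<pi>]) (use \<pi>V in auto)
  qed
  have sub: "O2 \<subseteq> O1" "O1 \<subseteq> U" unfolding O2_def O1_def by auto
  have C1G: "C1_on G O2"
    unfolding C1_on_def
  proof (intro exI[of _ G'] conjI ballI dG)
    show "continuous_on O2 G'" unfolding G'_def
      by (intro continuous_intros continuous_on_subset[OF cR sub(1)] continuous_on_subset[OF F1'(2)] continuous_on_subset[OF F2'(2)])
        (use sub in auto)
  qed auto
  have frG: "frechet_derivative G (at r) v = frechet_derivative F2 (at r) v - R (\<pi> r) * frechet_derivative F1 (at r) v" if "r \<in> O2" for r v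
    using frechet_derivative_at[OF dG[OF that]] fr sub that unfolding G'_def
    by (metis blinfun.diff_left blinfun.scaleR_left real_scaleR_def subsetD)
  note \<tau>0 = \<tau>[OF t0]
  let ?q = "d (\<tau> t0)"
  have \<tau>a: "\<tau> t0 \<in> {0<..<a}" using \<tau>0(1) b by auto
  have TF: "T (F1 (d (\<tau> t))) = t" if "t \<in> {0<..<b}" for t
    using T[OF that] \<tau>(2)[OF that] unfolding G1_def by simp
  have "?q \<in> O1" unfolding O1_def I_def
    using on_curve[OF d \<tau>a] hyp[OF \<tau>0(1)] \<tau>0(2) t0 by (auto simp: G1_def)
  moreover have "\<pi> ?q = g t0" unfolding \<pi>_def TF[OF t0] ..
  moreover have "norm (X ?q - X (g t0)) < t0 ^ n" using \<tau>0(4) by auto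
  ultimately have q0: "?q \<in> O2" unfolding O2_def f1_def f2_def using side0(1) TF[OF t0] by auto
  have Gd: "G (d (\<tau> t)) = F2 (d (\<tau> t)) - F2 (g t)" if "t \<in> {0<..<b}" for t
    unfolding G_def \<psi>_def TF[OF that] ..
  obtain e where e: "frechet_derivative F1 (at ?q) e = 0" "frechet_derivative F2 (at ?q) e = 1"
    using indep2 q0 sub by blast
  have ev: "\<forall>\<^sub>F u in nhds (\<tau> t0). G (d u) = 0"
  proof (rule level_set_invariant[OF C1G openO2 W(2) W(1) q0])
    show "?q \<in> W" using q0 sub unfolding O1_def by auto
    show "G ?q = 0" using Gd[OF t0] zero by simp
    show "frechet_derivative G (at ?q) e \<noteq> 0" unfolding frG[OF q0] using e by simp
    show "field_curve \<xi> {0<..<a} (\<lambda>s. 1 / dx (d s)) d" by (rule xcurve_field_curve[OF d]) simp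
    show "\<tau> t0 \<in> {0<..<a}" "d (\<tau> t0) = ?q" using \<tau>a by auto
    fix r assume r: "r \<in> O2" "G r = 0"
    define t where "t = T (F1 r)"
    have rO: "r \<in> O1" "r \<in> U" "r \<in> V" "r \<in> W" using r sub unfolding O1_def by auto
    have t: "t \<in> {0<..<b}" "g t = \<pi> r" unfolding t_def \<pi>_def using TI rO unfolding O1_def by auto
    have gd: "good (m, i, \<kappa>, sp, sm) (g t) (t ^ n)" using hyp[OF int(2)[OF t(1)]] by blast
    have F: "F1 r = F1 (g t)" "F2 r = F2 (g t)"
      using \<pi>V[OF rO(1)] t(2) r(2) unfolding G_def \<psi>_def t_def by auto
    have "f1 r > 0" "f2 r > 0" using r(1) unfolding O2_def by auto
    then have nr: "norm (X r - X (g t)) < t ^ n" "0 < \<sigma> * (X r $ m - X (g t) $ m)"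
      unfolding f1_def f2_def t(2) t_def[symmetric] by auto
    obtain B b where nice: "nice (g t) B b r" using gd rO(3) nr(1) unfolding good_def prod.case by blast
    \<comment> \<open>The point \<open>r\<close> is on the fibre through \<open>g t\<close>, inside
      the radius and on the side whose recorded sign is zero.\<close>
    have "sgn (R r - R (g t)) = 0"
    proof (cases "\<sigma> = 1")
      case True
      then have "sp = 0" "X (g t) $ m < X r $ m" using side0(2) nr(2) by auto
      then have "side i \<kappa> 0 (g t) (t ^ n) r" using gd rO(3) nr(1) F unfolding good_def by auto
      then show ?thesis unfolding side_def by blast
    next
      case False
      then have "sm = 0" "X r $ m < X (g t) $ m" using side0(2) nr(2) by auto
      then have "side i (- \<kappa>) 0 (g t) (t ^ n) r" using gd rO(3) nr(1) F unfolding good_def by auto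
      then show ?thesis unfolding side_def by blast
    qed
    then have "R r = R (g t)" by (simp add: sgn_zero_iff)
    moreover have "along U F1 r \<noteq> 0" using nice unfolding nice_def h_def by auto
    ultimately have "along U F2 r = R (\<pi> r) * along U F1 r" unfolding R_def t(2)[symmetric] by (simp add: field_simps)
    then show "frechet_derivative G (at r) (\<xi> r) = 0"
      unfolding frG[OF r(1)] using rO unfolding along_def ext_def by simp
  qed
  have "isCont \<tau> t0" using \<tau>0(3) DERIV_isCont by blast
  then have "(\<tau> \<longlongrightarrow> \<tau> t0) (nhds t0)" by (simp add: continuous_at tendsto_nhds_iff)
  with ev have "\<forall>\<^sub>F t in nhds t0. G (d (\<tau> t)) = 0" by (rule eventually_compose_filterlim)
  moreover have "\<forall>\<^sub>F t in nhds t0. t \<in> {0<..<b}" using t0 by (intro eventually_nhds_in_open) auto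
  ultimately show ?thesis by eventually_elim (use Gd in auto)
qed

text \<open>Coincidences on the chosen side form an open set of times. Its complement is open too,
  because at a common point the difference of heights \<open>z\<close> never vanishes, so the side
  cannot change in passing.\<close>

lemma coincidence_spreads:
  assumes syn: "synchronized (m, i, \<kappa>, sp, sm) n s b b2 \<tau>" and t0: "t0 \<in> {0<..<b}"
    and zero: "F2 (d (\<tau> t0)) = F2 (g t0)"
    and side0: "0 < \<sigma> * (X (d (\<tau> t0)) $ m - X (g t0) $ m)" "\<sigma> = 1 \<and> sp = 0 \<or> \<sigma> = -1 \<and> sm = 0"
    and t: "t \<in> {0<..<b}"
  shows "F2 (d (\<tau> t)) = F2 (g t)"
proof -
  have b: "b \<le> b2" "b2 \<le> a" using syn unfolding synchronized_def by auto
  have \<tau>: "\<tau> t \<in> {0<..<b2}" "(\<tau> has_real_derivative h (g t) / h (d (\<tau> t))) (at t)" if "t \<in> {0<..<b}" for t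
    using syn that unfolding synchronized_def by blast+
  define w where "w t = F2 (d (\<tau> t)) - F2 (g t)" for t
  define z where "z t = \<sigma> * (X (d (\<tau> t)) $ m - X (g t) $ m)" for t
  have cw: "continuous_on {0<..<b} w"
    unfolding w_def[abs_def] using synchronized_derivative[OF syn]
    by (meson DERIV_isCont continuous_at_imp_continuous_on)
  have c\<tau>: "continuous_on {0<..<b} \<tau>" using \<tau>(2) by (meson DERIV_isCont continuous_at_imp_continuous_on)
  have cX: "continuous_on V X" by (rule C1_on_continuous_on[OF C1_X])
  have cXc: "continuous_on {0<..<a} (\<lambda>t. X (c t))" if "xcurve {0<..<a} c" for c
    by (rule continuous_on_compose2[OF cX xcurve_continuous_on[OF that]]) (use on_curve(1)[OF that] in auto)
  have "continuous_on {0<..<b} (\<lambda>t. X (d (\<tau> t)))"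
    by (rule continuous_on_compose2[OF cXc[OF d] c\<tau>]) (use \<tau>(1) b in force)
  moreover have "continuous_on {0<..<b} (\<lambda>t. X (g t))"
    by (rule continuous_on_subset[OF cXc[OF g]]) (use b in auto)
  ultimately have cz: "continuous_on {0<..<b} z"
    unfolding z_def[abs_def] by (intro continuous_intros)
  \<comment> \<open>Within the interval the two sets are complementary: where \<open>w\<close>
    vanishes, \<open>z\<close> does not.\<close>
  let ?A = "{t \<in> {0<..<b}. w t = 0 \<and> 0 < z t}"
  let ?B = "({0<..<b} \<inter> w -` (- {0})) \<union> ({0<..<b} \<inter> z -` {..<0})"
  have oA: "open ?A"
    unfolding open_subopen[of ?A]
  proof
    fix t assume t: "t \<in> ?A"
    have "\<forall>\<^sub>F u in nhds t. w u = 0"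
      using coincidence_spreads_locally[OF syn _ _ _ side0(2), of t] t unfolding w_def z_def by simp
    moreover have "\<forall>\<^sub>F u in nhds t. u \<in> {0<..<b} \<inter> z -` {0<..}"
      by (rule eventually_nhds_in_open[OF continuous_open_preimage[OF cz]]) (use t in auto)
    ultimately have "\<forall>\<^sub>F u in nhds t. u \<in> ?A" by eventually_elim auto
    then show "\<exists>T. open T \<and> t \<in> T \<and> T \<subseteq> ?A" unfolding eventually_nhds by blast
  qed
  have oB: "open ?B"
    by (intro open_Un continuous_open_preimage[OF cw] continuous_open_preimage[OF cz]) (auto simp: open_Compl)
  have disj: "?A \<inter> ?B \<inter> {0<..<b} = {}" by auto
  have cover: "{0<..<b} \<subseteq> ?A \<union> ?B"
  proof
    fix t assume t: "t \<in> {0<..<b}"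
    show "t \<in> ?A \<union> ?B"
    proof (cases "w t = 0")
      case True
      then have "F2 (d (\<tau> t)) = F2 (g t)" unfolding w_def by simp
      from synchronized_zero[OF syn t this] have "X (d (\<tau> t)) $ m \<noteq> X (g t) $ m" by auto
      then have "z t \<noteq> 0" using side0(2) unfolding z_def by auto
      then show ?thesis using t True by auto
    qed (use t in auto)
  qed
  have "?A \<inter> {0<..<b} = {} \<or> ?B \<inter> {0<..<b} = {}"
    by (rule connectedD[OF _ oA oB disj cover]) simp
  moreover have "t0 \<in> ?A" using t0 zero side0(1) unfolding w_def z_def by simp
  ultimately have "?B \<inter> {0<..<b} = {}" using t0 by blast
  then have "w t = 0" using t by auto
  then show ?thesis unfolding w_def by simp
qed

text \<open>A sign is known to be nonzero only for a side that is actually visited, since a zero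
  sign there would spread the coincidence to the whole interval. If zeros of \<open>w\<close>
  accumulate at 0 while one side is avoided, two of them are crossed in the same direction, and so
  are all zeros between them.\<close>

lemma trichotomy:
  obtains m i \<kappa> sp sm n s b b2 \<tau> where "synchronized (m, i, \<kappa>, sp, sm) n s b b2 \<tau>"
    "(\<exists>b1. 0 < b1 \<and> b1 \<le> b \<and> (\<forall>t\<in>{0<..<b1}. F2 (d (\<tau> t)) \<noteq> F2 (g t))) \<or>
     (\<forall>t\<in>{0<..<b}. F2 (d (\<tau> t)) = F2 (g t)) \<or>
     (sp \<noteq> 0 \<and> sm \<noteq> 0 \<and> (\<forall>b'>0. (\<exists>t\<in>{0<..<b}. t < b' \<and> F2 (d (\<tau> t)) = F2 (g t) \<and> X (g t) $ m < X (d (\<tau> t)) $ m) \<and>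
       (\<exists>t\<in>{0<..<b}. t < b' \<and> F2 (d (\<tau> t)) = F2 (g t) \<and> X (d (\<tau> t)) $ m < X (g t) $ m)))"
proof -
  obtain m i \<kappa> sp sm n s b b2 \<tau> where syn: "synchronized (m, i, \<kappa>, sp, sm) n s b b2 \<tau>"
    using synchronized_exists by (metis prod_cases5)
  have b: "0 < b" "b \<le> b2" "s \<in> {1, -1}" using syn unfolding synchronized_def by auto
  define w where "w t = F2 (d (\<tau> t)) - F2 (g t)" for t
  define pos neg where "pos t \<longleftrightarrow> t \<in> {0<..<b} \<and> w t = 0 \<and> X (g t) $ m < X (d (\<tau> t)) $ m"
    and "neg t \<longleftrightarrow> t \<in> {0<..<b} \<and> w t = 0 \<and> X (d (\<tau> t)) $ m < X (g t) $ m" for t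
  have dw: "(w has_real_derivative h (g t) * (R (d (\<tau> t)) - R (g t))) (at t)" if "t \<in> {0<..<b}" for t
    unfolding w_def[abs_def] by (rule synchronized_derivative[OF syn that])
  have hs: "0 < s * h (g t)" if "t \<in> {0<..<b}" for t
  proof -
    have "t \<in> {0<..<b2}" using that b by auto
    then show ?thesis using syn unfolding synchronized_def by blast
  qed
  have zero: "pos t \<or> neg t" if "t \<in> {0<..<b}" "w t = 0" for t
    using synchronized_zero[OF syn that(1)] that unfolding pos_def neg_def w_def by auto
  have sgn_pos: "sgn (R (d (\<tau> t)) - R (g t)) = sp" if "pos t" for t
    using synchronized_zero[OF syn, of t] that unfolding pos_def w_def by auto
  have sgn_neg: "sgn (R (d (\<tau> t)) - R (g t)) = sm" if "neg t" for t
    using synchronized_zero[OF syn, of t] that unfolding neg_def w_def by auto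
  have same: False if zs: "t1 \<in> {0<..<b}" "t2 \<in> {0<..<b}" "t1 < t2" "w t1 = 0" "w t2 = 0"
    and sg: "\<And>t. t \<in> {t1..t2} \<Longrightarrow> w t = 0 \<Longrightarrow> sgn (R (d (\<tau> t)) - R (g t)) = \<sigma>" and \<sigma>: "\<sigma> \<noteq> 0" for t1 t2 \<sigma>
  proof (rule two_zeros_same_direction[of t1 t2 w "s * \<sigma>"])
    have sub: "t \<in> {0<..<b}" if "t \<in> {t1..t2}" for t using that zs by auto
    show "continuous_on {t1..t2} w" using dw sub by (meson DERIV_isCont continuous_at_imp_continuous_on)
    fix t assume t: "t \<in> {t1..t2}" "w t = 0"
    let ?r = "R (d (\<tau> t)) - R (g t)"
    have "\<sigma> * ?r > 0" using sg[OF t] \<sigma> by (auto simp: sgn_if split: if_splits)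
    then have "s * h (g t) * (\<sigma> * ?r) > 0" using hs[OF sub[OF t(1)]] by simp
    then show "\<exists>D. (w has_real_derivative D) (at t) \<and> 0 < s * \<sigma> * D"
      using dw[OF sub[OF t(1)]] by (intro exI[of _ "h (g t) * ?r"]) (simp add: algebra_simps)
  qed (use zs in auto)
  show ?thesis
  proof (rule that[OF syn], unfold eq_iff_diff_eq_0[of "F2 (d (\<tau> _))"], fold w_def, rule ccontr)
    assume no: "\<not> ((\<exists>b1. 0 < b1 \<and> b1 \<le> b \<and> (\<forall>t\<in>{0<..<b1}. w t \<noteq> 0)) \<or>
     (\<forall>t\<in>{0<..<b}. w t = 0) \<or>
     (sp \<noteq> 0 \<and> sm \<noteq> 0 \<and> (\<forall>b'>0. (\<exists>t\<in>{0<..<b}. t < b' \<and> w t = 0 \<and> X (g t) $ m < X (d (\<tau> t)) $ m) \<and>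
       (\<exists>t\<in>{0<..<b}. t < b' \<and> w t = 0 \<and> X (d (\<tau> t)) $ m < X (g t) $ m))))"
    have zeros: "\<exists>t\<in>{0<..<b}. t < b' \<and> w t = 0" if "b' > 0" for b'
    proof -
      have "\<exists>t\<in>{0<..<min b b'}. w t = 0" using no b that by (metis min.cobounded1 min_less_iff_conj)
      then show ?thesis by auto
    qed
    have sp: "sp \<noteq> 0" if "pos t" for t
      using coincidence_spreads[OF syn, of t 1] that no unfolding pos_def w_def by auto
    have sm: "sm \<noteq> 0" if "neg t" for t
      using coincidence_spreads[OF syn, of t "-1"] that no unfolding neg_def w_def by auto
    have two: "\<exists>t1 t2. t1 \<in> {0<..<b} \<and> t2 \<in> {0<..<b} \<and> t1 < t2 \<and> t2 < b' \<and> w t1 = 0 \<and> w t2 = 0" if "b' > 0" for b'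
      using zeros[OF that] zeros by (metis greaterThanLessThan_iff)
    \<comment> \<open>Otherwise all zeros near 0 lie on the lower side and are crossed as
      \<open>sm\<close> prescribes.\<close>
    have posex: "\<exists>t. pos t \<and> t < b'" if bp: "b' > 0" for b'
    proof (rule ccontr)
      assume np: "\<nexists>t. pos t \<and> t < b'"
      obtain t1 t2 where t: "t1 \<in> {0<..<b}" "t2 \<in> {0<..<b}" "t1 < t2" "t2 < b'" "w t1 = 0" "w t2 = 0"
        using two[OF bp] by blast
      have neg: "neg t" if "t \<in> {t1..t2}" "w t = 0" for t
        using zero[of t] np that t by auto
      have "sm \<noteq> 0" using sm[OF neg[of t1]] t by auto
      then show False
        by (rule same[OF t(1-3,5,6), of sm, rotated]) (use neg sgn_neg in auto)
    qed
    have negex: "\<exists>t. neg t \<and> t < b'" if bp: "b' > 0" for b'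
    proof (rule ccontr)
      assume np: "\<nexists>t. neg t \<and> t < b'"
      obtain t1 t2 where t: "t1 \<in> {0<..<b}" "t2 \<in> {0<..<b}" "t1 < t2" "t2 < b'" "w t1 = 0" "w t2 = 0"
        using two[OF bp] by blast
      have pos: "pos t" if "t \<in> {t1..t2}" "w t = 0" for t
        using zero[of t] np that t by auto
      have "sp \<noteq> 0" using sp[OF pos[of t1]] t by auto
      then show False
        by (rule same[OF t(1-3,5,6), of sp, rotated]) (use pos sgn_pos in auto)
    qed
    have "sp \<noteq> 0" "sm \<noteq> 0" using posex[of 1] negex[of 1] sp sm by auto
    moreover have "\<exists>t\<in>{0<..<b}. t < b' \<and> w t = 0 \<and> X (g t) $ m < X (d (\<tau> t)) $ m" if "b' > 0" for b'
      using posex[OF that] unfolding pos_def by blast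
    moreover have "\<exists>t\<in>{0<..<b}. t < b' \<and> w t = 0 \<and> X (d (\<tau> t)) $ m < X (g t) $ m" if "b' > 0" for b'
      using negex[OF that] unfolding neg_def by blast
    ultimately show False using no by blast
  qed
qed

end

section \<open>Interlacement\<close>

text \<open>The sign condition says that at each zero of \<open>A\<close> the angle decreases with
  \<open>t\<close>. So going towards 0 it crosses each level \<open>pi / 2 + i * pi\<close> upwards
  only and never returns, and infinitely many zeros force it to climb without bound. The angle is
  merely continuous, so its monotonicity at a zero is read off from \<open>A\<close>.\<close>

lemma rotation_to_infinity:
  fixes A B r \<psi> :: "real \<Rightarrow> real"
  assumes b: "b > 0" and cont: "continuous_on {0<..<b} \<psi>" and r: "\<And>t. t \<in> {0<..<b} \<Longrightarrow> r t > 0"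
    and A: "\<And>t. t \<in> {0<..<b} \<Longrightarrow> A t = r t * cos (\<psi> t)" and B: "\<And>t. t \<in> {0<..<b} \<Longrightarrow> B t = r t * sin (\<psi> t)"
    and zeros: "\<And>c. c > 0 \<Longrightarrow> \<exists>t\<in>{0<..<b}. t < c \<and> A t = 0"
    and der: "\<And>t. t \<in> {0<..<b} \<Longrightarrow> A t = 0 \<Longrightarrow> \<exists>D. (A has_real_derivative D) (at t) \<and> 0 < D * B t"
  shows "filterlim \<psi> at_top (at_right 0)"
proof -
  have zc: "A t = 0 \<longleftrightarrow> cos (\<psi> t) = 0" if "t \<in> {0<..<b}" for t using A[OF that] r[OF that] by simp
  have loc: "\<exists>e>0. \<forall>y. (x - e < y \<and> y < x \<longrightarrow> \<psi> x < \<psi> y) \<and> (x < y \<and> y < x + e \<longrightarrow> \<psi> y < \<psi> x)"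
    if x: "x \<in> {0<..<b}" "A x = 0" for x
  proof -
    obtain D where D: "(A has_real_derivative D) (at x)" "0 < D * B x" using der[OF x] by blast
    define s where "s = sin (\<psi> x)"
    have c0: "cos (\<psi> x) = 0" using zc x by blast
    then have ss: "s * s = 1" unfolding s_def using sin_cos_squared_add3[of "\<psi> x"] by simp
    have sD: "0 < s * D" using D(2) B[OF x(1)] r[OF x(1)] unfolding s_def by (auto simp: zero_less_mult_iff mult_less_0_iff)
    have "((\<lambda>t. s * A t) has_real_derivative s * D) (at x)" by (rule DERIV_cmult[OF D(1)])
    from DERIV_pos_inc_left[OF this sD] DERIV_pos_inc_right[OF this sD]
    obtain e1 e2 where e1: "e1 > 0" "\<forall>h>0. h < e1 \<longrightarrow> s * A (x - h) < s * A x"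
      and e2: "e2 > 0" "\<forall>h>0. h < e2 \<longrightarrow> s * A x < s * A (x + h)" by blast
    have "isCont \<psi> x" using cont x(1) by (simp add: continuous_on_eq_continuous_at)
    then obtain e3 where e3: "e3 > 0" "\<forall>y. dist y x < e3 \<longrightarrow> dist (\<psi> y) (\<psi> x) < pi"
      unfolding continuous_at_eps_delta using pi_gt_zero by blast
    define e where "e = min (min e1 e2) (min e3 (min x (b - x)))"
    have e: "e > 0" unfolding e_def using e1 e2 e3 x by auto
    have val: "s * A y = - (r y * sin (\<psi> y - \<psi> x))" "\<bar>\<psi> y - \<psi> x\<bar> < pi" "r y > 0" if y: "\<bar>y - x\<bar> < e" for y
    proof -
      have yb: "y \<in> {0<..<b}" using y unfolding e_def by (auto simp: abs_less_iff)
      have "cos (\<psi> y) = cos (\<psi> x + (\<psi> y - \<psi> x))" by simp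
      also have "\<dots> = - s * sin (\<psi> y - \<psi> x)" unfolding cos_add s_def using c0 by simp
      finally have "s * A y = - (s * s) * (r y * sin (\<psi> y - \<psi> x))" using A[OF yb] by simp
      then show "s * A y = - (r y * sin (\<psi> y - \<psi> x))" unfolding ss by simp
      show "\<bar>\<psi> y - \<psi> x\<bar> < pi" using e3(2) y unfolding e_def by (auto simp: dist_real_def)
      show "r y > 0" by (rule r[OF yb])
    qed
    show ?thesis
    proof (rule exI[of _ e], intro conjI allI impI)
      show "e > 0" by (rule e)
      fix y
      show "\<psi> x < \<psi> y" if y: "x - e < y \<and> y < x"
      proof -
        have a: "\<bar>y - x\<bar> < e" using y by auto
        have "s * A y < 0" using e1(2)[rule_format, of "x - y"] y x(2) unfolding e_def by auto
        then have "sin (\<psi> y - \<psi> x) > 0" using val[OF a] by (simp add: zero_less_mult_iff)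
        then show ?thesis using val(2)[OF a] sin_lt_zero[of "\<psi> y - \<psi> x + 2 * pi"] sin_periodic[of "\<psi> y - \<psi> x"]
          by (cases "\<psi> y = \<psi> x") (auto simp: abs_less_iff not_less[symmetric], smt (verit))
      qed
      show "\<psi> y < \<psi> x" if y: "x < y \<and> y < x + e"
      proof -
        have a: "\<bar>y - x\<bar> < e" using y by auto
        have "s * A y > 0" using e2(2)[rule_format, of "y - x"] y x(2) unfolding e_def by auto
        then have "r y * sin (\<psi> y - \<psi> x) < 0" using val(1)[OF a] by linarith
        then have "sin (\<psi> y - \<psi> x) < 0" using val(3)[OF a] by (simp add: mult_less_0_iff)
        moreover have "\<psi> y - \<psi> x \<le> pi" using val(2)[OF a] by linarith
        ultimately have "\<not> 0 \<le> \<psi> y - \<psi> x" using sin_ge_zero[of "\<psi> y - \<psi> x"] by linarith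
        then show ?thesis by simp
      qed
    qed
  qed
  have mono: "\<psi> x0 < \<psi> x" if x0: "x0 \<in> {0<..<b}" "A x0 = 0" and x: "0 < x" "x < x0" for x x0
  proof -
    obtain e where e: "e > 0" "\<forall>y. x0 - e < y \<and> y < x0 \<longrightarrow> \<psi> x0 < \<psi> y" using loc[OF x0] by blast
    define y0 where "y0 = max ((x + x0) / 2) (x0 - e / 2)"
    have y0: "x < y0" "y0 < x0" "x0 - e < y0" unfolding y0_def using x e(1) by (auto simp: max_def)
    \<comment> \<open>Time is reversed because the barrier argument runs forward whereas the angle
      grows towards 0.\<close>
    define f where "f u = \<psi> x0 - \<psi> (- u)" for u
    have "f (- x) < 0"
    proof (rule stays_negative[of "- y0" "- x" f])
      have "continuous_on {- y0..- x} (\<lambda>u. \<psi> (- u))"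
        by (rule continuous_on_compose2[OF cont]) (use x y0 x0 in \<open>auto intro!: continuous_intros\<close>)
      then show "continuous_on {- y0..- x} f" unfolding f_def[abs_def] by (intro continuous_intros)
      show "f (- y0) < 0" using e(2) y0 unfolding f_def by auto
      fix u assume u: "u \<in> {- y0..- x}" "f u = 0"
      then have y: "- u \<in> {0<..<b}" using x y0 x0 by auto
      have "\<psi> (- u) = \<psi> x0" using u unfolding f_def by simp
      then have "A (- u) = 0" using zc[OF y] zc[OF x0(1)] x0(2) by simp
      from loc[OF y this] obtain k where k: "k > 0" "\<forall>y. - u < y \<and> y < - u + k \<longrightarrow> \<psi> y < \<psi> (- u)" by blast
      have "f v > 0" if "u - k < v" "v < u" for v
        using k(2)[rule_format, of "- v"] that \<open>\<psi> (- u) = \<psi> x0\<close> unfolding f_def by auto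
      then show "\<exists>d>0. \<forall>y. u - d < y \<and> y < u \<longrightarrow> f y > 0" using k(1) by blast
    qed (use y0 in auto)
    then show ?thesis unfolding f_def by simp
  qed
  obtain x1 where x1: "x1 \<in> {0<..<b}" "A x1 = 0" using zeros[of 1] by auto
  \<comment> \<open>At zeros of \<open>A\<close> the angle is an odd multiple of
    \<open>pi / 2\<close>, so a strict increase is an increase by at least
    \<open>pi\<close>.\<close>
  have climb: "\<exists>x\<in>{0<..<b}. A x = 0 \<and> \<psi> x1 + real n * pi \<le> \<psi> x" for n
  proof (induction n)
    case 0
    then show ?case using x1 by auto
  next
    case (Suc n)
    then obtain x where x: "x \<in> {0<..<b}" "A x = 0" "\<psi> x1 + real n * pi \<le> \<psi> x" by blast
    obtain y where y: "y \<in> {0<..<b}" "y < x" "A y = 0" using zeros[of x] x by auto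
    have lt: "\<psi> x < \<psi> y" using mono[OF x(1,2)] y by auto
    obtain i j :: int where ij: "\<psi> x = of_int i * pi + pi / 2" "\<psi> y = of_int j * pi + pi / 2"
      using zc[OF x(1)] zc[OF y(1)] x(2) y(3) unfolding cos_zero_iff_int2 by auto
    then have "of_int i * pi < of_int j * pi" using lt by simp
    then have "i < j" by simp
    then have "real_of_int i + 1 \<le> real_of_int j" by linarith
    then have "(real_of_int i + 1) * pi \<le> real_of_int j * pi" by (intro mult_right_mono) auto
    then have "\<psi> x + pi \<le> \<psi> y" using ij by (simp add: algebra_simps)
    then show ?case using x(3) y by (intro bexI[of _ y]) (auto simp: algebra_simps)
  qed
  show ?thesis
    unfolding filterlim_at_top
  proof
    fix Z
    obtain n :: nat where "(Z - \<psi> x1) / pi \<le> real n" using real_arch_simple by blast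
    then have n: "Z \<le> \<psi> x1 + real n * pi" by (simp add: field_simps)
    obtain x where x: "x \<in> {0<..<b}" "A x = 0" "\<psi> x1 + real n * pi \<le> \<psi> x" using climb by blast
    have "\<forall>\<^sub>F y in at_right 0. y \<in> {0<..<x}" using x(1) by (intro eventually_at_right_real) auto
    then show "\<forall>\<^sub>F y in at_right 0. Z \<le> \<psi> y"
      by eventually_elim (use mono[OF x(1,2)] n x(3) in force)
  qed
qed

text \<open>The imaginary part of a continuous logarithm of the curve, viewed in the complex plane;
  the interval is contractible.\<close>

lemma angle_measure_exists:
  fixes \<epsilon> :: "real \<Rightarrow> real^2"
  assumes "continuous_on {0<..<a} \<epsilon>" "\<And>t. t \<in> {0<..<a} \<Longrightarrow> \<epsilon> t \<noteq> 0"
  shows "\<exists>\<theta>. angle_measure \<epsilon> a \<theta>"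
proof -
  define z where "z t = Complex (\<epsilon> t $ 1) (\<epsilon> t $ 2)" for t
  have n: "cmod (z t) = norm (\<epsilon> t)" for t
    unfolding z_def cmod_def norm_vec_def L2_set_def by (simp add: sum_2)
  have "continuous_on {0<..<a} z"
    unfolding z_def Complex_eq by (intro continuous_intros assms(1))
  moreover have "contractible {0<..<a}" by (intro convex_imp_contractible) simp
  moreover have "z t \<noteq> 0" if "t \<in> {0<..<a}" for t
    using n[of t] assms(2)[OF that] by (metis norm_eq_zero)
  ultimately obtain l where l: "continuous_on {0<..<a} l" "\<And>t. t \<in> {0<..<a} \<Longrightarrow> z t = exp (l t)"
    using continuous_logarithm_on_contractible[of "{0<..<a}" z] by metis
  have "angle_measure \<epsilon> a (\<lambda>t. Im (l t))"
    unfolding angle_measure_def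
  proof (intro conjI ballI)
    show "continuous_on {0<..<a} (\<lambda>t. Im (l t))" by (intro continuous_intros l(1))
    fix t assume t: "t \<in> {0<..<a}"
    show "\<epsilon> t \<noteq> 0" by (rule assms(2)[OF t])
    have nt: "norm (\<epsilon> t) = exp (Re (l t))" using n[of t] l(2)[OF t] by (simp add: norm_exp_eq_Re)
    have "Re (z t) = exp (Re (l t)) * cos (Im (l t))" "Im (z t) = exp (Re (l t)) * sin (Im (l t))"
      unfolding l(2)[OF t] by (simp_all add: Re_exp Im_exp)
    then show "\<epsilon> t /\<^sub>R norm (\<epsilon> t) = vector [cos (Im (l t)), sin (Im (l t))]"
      unfolding nt z_def by (simp add: vec_eq_iff forall_2)
  qed
  then show ?thesis by blast
qed

section \<open>Interlacement from sign changes of one coordinate\<close>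

context contact
begin

definition plane :: "(real \<Rightarrow> real^3) \<Rightarrow> real \<Rightarrow> real^2" where
  "plane c t = vector [X (c t) $ 2, X (c t) $ 3]"

text \<open>Coordinate \<open>i\<close> of the difference has infinitely many zeros, and the sign of
  its derivative there is governed by the side, that is by the sign of the remaining coordinate
  \<open>m\<close>. Hence the vector with these two coordinates crosses its axis always in the same
  sense of rotation.\<close>

lemma interlaced_if_sign_changes:
  assumes i: "\<And>c. c > 0 \<Longrightarrow> \<exists>t\<in>{0<..<a}. t < c \<and> X (g t) $ i < X (d t) $ i"
    "\<And>c. c > 0 \<Longrightarrow> \<exists>t\<in>{0<..<a}. t < c \<and> X (d t) $ i < X (g t) $ i"
  shows "interlaced_curves (plane g) (plane d)"
proof -
  have first: "X (g t) $ 1 = t" "X (d t) $ 1 = t" if "t \<in> {0<..<a}" for t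
    using on_curve(4)[OF g that] on_curve(4)[OF d that] by auto
  have i1: "i \<noteq> 1" using i(1)[of 1] first by force
  have cX: "continuous_on V X" by (rule C1_on_continuous_on[OF C1_X])
  have cXc: "continuous_on {0<..<a} (\<lambda>t. X (c t))" if "xcurve {0<..<a} c" for c
    by (rule continuous_on_compose2[OF cX xcurve_continuous_on[OF that]]) (use on_curve(1)[OF that] in auto)
  have ind: "\<exists>u. frechet_derivative (\<lambda>q. X q $ j) (at p) u = (if j = k then 1 else 0) \<and>
      frechet_derivative (\<lambda>q. X q $ l) (at p) u = (if l = k then 1 else 0)" if p: "p \<in> V" for p j k l
  proof -
    let ?X' = "frechet_derivative X (at p)" and ?Y' = "frechet_derivative Y (at (X p))"
    have dX: "(X has_derivative ?X') (at p)" using C1_on_has_derivative[OF C1_X p] .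
    have dY: "(Y has_derivative ?Y') (at (X p))" using C1_on_has_derivative[OF C1_Y] p by blast
    have "((\<lambda>w. X (Y w)) has_derivative (\<lambda>z. ?X' (?Y' z))) (at (X p))"
      using has_derivative_compose[OF dY] dX Y_X[OF p] by simp
    then have "((\<lambda>w. w) has_derivative (\<lambda>z. ?X' (?Y' z))) (at (X p))"
      by (rule has_derivative_transform_within_open[OF _ open_image]) (use p Y_X in auto)
    then have XY: "?X' (?Y' z) = z" for z using has_derivative_unique[OF _ has_derivative_ident] by metis
    have fr: "frechet_derivative (\<lambda>q. X q $ j) (at p) u = ?X' u $ j" for j u
      using frechet_derivative_at[OF bounded_linear.has_derivative[OF bounded_linear_vec_nth dX, of j]] by metis
    show ?thesis
      by (rule exI[of _ "?Y' (axis k 1)"]) (simp add: fr XY axis_def)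
  qed
  \<comment> \<open>With the clock itself as first component the synchronization is trivial:
    \<open>\<tau> t = t\<close> and \<open>h\<close> has value 1 along the curves.\<close>
  interpret P: contact_pair W \<xi> V X S Y a g d V "\<lambda>q. X q $ 1" "\<lambda>q. X q $ i"
  proof unfold_locales
    show "open V" "ds V" by (rule V, rule ds_V)
    show "C1_on (\<lambda>q. X q $ 1) V" "C1_on (\<lambda>q. X q $ i) V" by (rule C1_on_nth[OF C1_X])+
    show "df (\<lambda>q. X q $ 1)" "df (\<lambda>q. X q $ i)" by (rule df_X)+
    show "\<exists>u. frechet_derivative (\<lambda>q. X q $ 1) (at p) u = 1 \<and> frechet_derivative (\<lambda>q. X q $ i) (at p) u = 0" if "p \<in> V" for p
      using ind[OF that, of 1 1 i] i1 by auto
    show "\<exists>u. frechet_derivative (\<lambda>q. X q $ 1) (at p) u = 0 \<and> frechet_derivative (\<lambda>q. X q $ i) (at p) u = 1" if "p \<in> V" for p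
      using ind[OF that, of 1 i i] i1 by auto
    have "\<forall>\<^sub>F t in at_right 0. t \<in> {0<..<a}" using a by (rule eventually_at_right_real)
    then show "\<forall>\<^sub>F t in at_right 0. g t \<in> V \<and> along V (\<lambda>q. X q $ 1) (g t) \<noteq> 0"
      by eventually_elim (use on_curve[OF g] in \<open>auto simp: rate_def[symmetric]\<close>)
  qed
  obtain m i' \<kappa> sp sm n s b b2 \<tau> where syn: "P.synchronized (m, i', \<kappa>, sp, sm) n s b b2 \<tau>"
    and tri: "(\<exists>b1. 0 < b1 \<and> b1 \<le> b \<and> (\<forall>t\<in>{0<..<b1}. X (d (\<tau> t)) $ i \<noteq> X (g t) $ i)) \<or>
     (\<forall>t\<in>{0<..<b}. X (d (\<tau> t)) $ i = X (g t) $ i) \<or>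
     (sp \<noteq> 0 \<and> sm \<noteq> 0 \<and> (\<forall>b'>0. (\<exists>t\<in>{0<..<b}. t < b' \<and> X (d (\<tau> t)) $ i = X (g t) $ i \<and> X (g t) $ m < X (d (\<tau> t)) $ m) \<and>
       (\<exists>t\<in>{0<..<b}. t < b' \<and> X (d (\<tau> t)) $ i = X (g t) $ i \<and> X (d (\<tau> t)) $ m < X (g t) $ m)))"
    by (rule P.trichotomy)
  have b: "0 < b" "b \<le> b2" "b2 \<le> a" "(m, i', \<kappa>, sp, sm) \<in> P.J" "s \<in> {1, -1}" using syn unfolding P.synchronized_def by auto
  have int: "t \<in> {0<..<a}" if "t \<in> {0<..<b}" for t using that b by auto
  have \<tau>: "\<tau> t = t" if t: "t \<in> {0<..<b}" for t
  proof -
    have "\<tau> t \<in> {0<..<b2}" "X (d (\<tau> t)) $ 1 = X (g t) $ 1" using syn t unfolding P.synchronized_def by blast+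
    moreover have "\<tau> t \<in> {0<..<a}" using calculation(1) b by auto
    ultimately show ?thesis using first[OF int[OF t]] first(2)[of "\<tau> t"] by simp
  qed
  define w where "w j t = X (d t) $ j - X (g t) $ j" for j t
  have cw: "continuous_on {0<..<a} (w j)" for j
    unfolding w_def[abs_def] by (intro continuous_intros cXc d g)
  have neg1: "\<not> (\<forall>t\<in>{0<..<b1}. X (d (\<tau> t)) $ i \<noteq> X (g t) $ i)" if b1: "0 < b1" "b1 \<le> b" for b1
  proof
    assume no: "\<forall>t\<in>{0<..<b1}. X (d (\<tau> t)) $ i \<noteq> X (g t) $ i"
    obtain t1 t2 where t: "t1 \<in> {0<..<a}" "t1 < b1" "w i t1 < 0" "t2 \<in> {0<..<a}" "t2 < b1" "w i t2 > 0"
      using i(1)[OF b1(1)] i(2)[OF b1(1)] unfolding w_def by auto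
    have "connected (w i ` {0<..<b1})"
      by (rule connected_continuous_image[OF continuous_on_subset[OF cw]]) (use b b1 in auto)
    then have "0 \<in> w i ` {0<..<b1}" using connectedD_interval[of "w i ` {0<..<b1}" "w i t1" "w i t2" 0] t by auto
    then obtain t where t: "t \<in> {0<..<b1}" "w i t = 0" by auto
    then have "\<tau> t = t" using b1 by (intro \<tau>) auto
    then show False using bspec[OF no t(1)] t(2) unfolding w_def by simp
  qed
  have neg2: "\<not> (\<forall>t\<in>{0<..<b}. X (d (\<tau> t)) $ i = X (g t) $ i)"
    using i(1)[OF b(1)] \<tau> by force
  have sp: "sp \<noteq> 0" "sm \<noteq> 0"
    and plus: "\<And>b'. b' > 0 \<Longrightarrow> \<exists>t\<in>{0<..<b}. t < b' \<and> X (d (\<tau> t)) $ i = X (g t) $ i \<and> X (g t) $ m < X (d (\<tau> t)) $ m"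
    using tri neg1 neg2 by blast+
  have zeros: "\<exists>t\<in>{0<..<b}. t < c \<and> w i t = 0" if "c > 0" for c
    using plus[OF that] \<tau> unfolding w_def by force
  \<comment> \<open>At a zero the points differ in coordinate \<open>m\<close>, while their clocks
    and their coordinates \<open>i\<close> agree; so \<open>m\<close> is the third
    coordinate.\<close>
  have mi: "m \<noteq> 1" "m \<noteq> i" using plus[of 1] \<tau> first int by force+
  have D: "\<exists>D. (w i has_real_derivative D) (at t) \<and> (w m t > 0 \<and> sgn D = sp \<or> w m t < 0 \<and> sgn D = sm)"
    if t: "t \<in> {0<..<b}" "w i t = 0" for t
  proof -
    have "P.h p = 1" if "rate 1 p \<noteq> 0" for p using that unfolding P.h_def rate_def by simp
    then have h1: "P.h (g t) = 1" using on_curve(3)[OF g int[OF t(1)]] by blast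
    have "((\<lambda>t. X (d (\<tau> t)) $ i - X (g t) $ i) has_real_derivative (P.R (d (\<tau> t)) - P.R (g t))) (at t)"
      using P.synchronized_derivative[OF syn t(1)] unfolding h1 by simp
    then have "(w i has_real_derivative (P.R (d (\<tau> t)) - P.R (g t))) (at t)"
      by (rule has_field_derivative_transform_within_open[of _ _ _ "{0<..<b}"]) (use t \<tau> in \<open>auto simp: w_def\<close>)
    moreover have "w m t > 0 \<and> sgn (P.R (d (\<tau> t)) - P.R (g t)) = sp \<or> w m t < 0 \<and> sgn (P.R (d (\<tau> t)) - P.R (g t)) = sm"
      using P.synchronized_zero[OF syn t(1)] t \<tau>[OF t(1)] unfolding w_def by auto
    ultimately show ?thesis by blast
  qed
  have sps: "sp \<in> {1, -1}" "sm \<in> {1, -1}" using b(4) sp unfolding P.J_def by auto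
  \<comment> \<open>Equal signs would make two zeros, and all zeros between them, crossings in the
    same direction.\<close>
  have "sm = - sp"
  proof (rule ccontr)
    assume "sm \<noteq> - sp"
    then have eq: "sm = sp" using sps by auto
    obtain t2 where t2: "t2 \<in> {0<..<b}" "w i t2 = 0" using zeros[of 1] by auto
    obtain t1 where t1: "t1 \<in> {0<..<b}" "t1 < t2" "w i t1 = 0" using zeros[of t2] t2 by auto
    show False
    proof (rule two_zeros_same_direction[of t1 t2 "w i" sp])
      show "continuous_on {t1..t2} (w i)" by (rule continuous_on_subset[OF cw]) (use t1 t2 int in auto)
      fix t assume t: "t \<in> {t1..t2}" "w i t = 0"
      then have "t \<in> {0<..<b}" using t1 t2 by auto
      from D[OF this t(2)] eq obtain D' where "(w i has_real_derivative D') (at t)" "sgn D' = sp" by blast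
      then show "\<exists>D. (w i has_real_derivative D) (at t) \<and> 0 < sp * D"
        using sp by (intro exI[of _ D']) (auto simp: sgn_if split: if_splits)
    qed (use t1 t2 in auto)
  qed
  then have der: "\<exists>D. (w i has_real_derivative D) (at t) \<and> 0 < D * (sp * w m t)" if t: "t \<in> {0<..<b}" "w i t = 0" for t
  proof -
    obtain D' where D': "(w i has_real_derivative D') (at t)" "w m t > 0 \<and> sgn D' = sp \<or> w m t < 0 \<and> sgn D' = - sp"
      using D[OF t] \<open>sm = - sp\<close> by blast
    have "0 < D' * (sp * w m t)" using D'(2) sps(1) by (auto simp: sgn_if zero_less_mult_iff mult_less_0_iff split: if_splits)
    then show ?thesis using D'(1) by blast
  qed
  define \<epsilon> where "\<epsilon> t = plane d t - plane g t" for t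
  have \<epsilon>: "\<epsilon> t $ 1 = w 2 t" "\<epsilon> t $ 2 = w 3 t" for t unfolding \<epsilon>_def plane_def w_def by auto
  have c\<epsilon>: "continuous_on {0<..<a} \<epsilon>"
  proof -
    have "\<epsilon> = (\<lambda>t. \<chi> j. if j = 1 then w 2 t else w 3 t)"
      by (simp add: fun_eq_iff vec_eq_iff forall_2 \<epsilon>)
    moreover have "continuous_on {0<..<a} (\<lambda>t. if j = 1 then w 2 t else w 3 t)" for j :: 2
      using cw by (cases "j = 1") auto
    ultimately show ?thesis by (auto intro: continuous_on_vec_lambda)
  qed
  have \<epsilon>0: "\<epsilon> t \<noteq> 0" if t: "t \<in> {0<..<a}" for t
  proof
    assume "\<epsilon> t = 0"
    then have "w 2 t = 0" "w 3 t = 0" using \<epsilon>[of t] by auto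
    then have "X (d t) = X (g t)" using first[OF t] unfolding w_def by (auto simp: vec_eq_iff forall_3)
    then have "d t = g t" using Y_X on_curve(1)[OF g t] on_curve(1)[OF d t] by metis
    then show False using distinct[OF t] by metis
  qed
  have lim: "filterlim \<theta> at_top (at_right 0) \<or> filterlim \<theta> at_bot (at_right 0)"
    if a': "a' > 0" and ang: "angle_measure \<epsilon> a' \<theta>" for a' \<theta>
  proof -
    define c where "c = min a' b"
    have c: "c > 0" "c \<le> a'" "c \<le> b" unfolding c_def using a' b by auto
    have th: "continuous_on {0<..<c} \<theta>" using ang c unfolding angle_measure_def by (auto elim: continuous_on_subset)
    have pol: "w 2 t = norm (\<epsilon> t) * cos (\<theta> t)" "w 3 t = norm (\<epsilon> t) * sin (\<theta> t)" "norm (\<epsilon> t) > 0" if "t \<in> {0<..<c}" for t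
    proof -
      have e: "\<epsilon> t \<noteq> 0" "\<epsilon> t /\<^sub>R norm (\<epsilon> t) = vector [cos (\<theta> t), sin (\<theta> t)]"
        using ang that c unfolding angle_measure_def by auto
      have "\<epsilon> t = norm (\<epsilon> t) *\<^sub>R (\<epsilon> t /\<^sub>R norm (\<epsilon> t))" using e(1) by simp
      then have "\<epsilon> t = norm (\<epsilon> t) *\<^sub>R vector [cos (\<theta> t), sin (\<theta> t)]" unfolding e(2) .
      from arg_cong[OF this, of "\<lambda>v. v $ 1"] arg_cong[OF this, of "\<lambda>v. v $ 2"]
      show "w 2 t = norm (\<epsilon> t) * cos (\<theta> t)" "w 3 t = norm (\<epsilon> t) * sin (\<theta> t)" unfolding \<epsilon> by simp_all
      show "norm (\<epsilon> t) > 0" using e(1) by simp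
    qed
    have zc: "\<exists>t\<in>{0<..<c}. t < c' \<and> w i t = 0" if "c' > 0" for c'
      using zeros[of "min c c'"] c that by auto
    have dc: "\<exists>D. (w i has_real_derivative D) (at t) \<and> 0 < D * (sp * w m t)" if "t \<in> {0<..<c}" "w i t = 0" for t
      by (rule der) (use that c in auto)
    have rot: "filterlim \<psi> at_top (at_right 0)"
      if "continuous_on {0<..<c} \<psi>" "\<And>t. t \<in> {0<..<c} \<Longrightarrow> w i t = norm (\<epsilon> t) * cos (\<psi> t)"
        "\<And>t. t \<in> {0<..<c} \<Longrightarrow> sp * w m t = norm (\<epsilon> t) * sin (\<psi> t)" for \<psi>
      by (rule rotation_to_infinity[OF c(1) that(1) pol(3) that(2,3) zc dc])
    have up: "filterlim (\<lambda>t. \<theta> t - pi / 2) at_top (at_right 0) \<Longrightarrow> filterlim \<theta> at_top (at_right 0)"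
      unfolding filterlim_at_top by (metis (mono_tags, lifting) eventually_mono diff_ge_0_iff_ge pi_half_ge_zero order_trans diff_le_eq le_add_same_cancel1)
    have down: "filterlim (\<lambda>t. - \<theta> t) at_top (at_right 0) \<Longrightarrow> filterlim \<theta> at_bot (at_right 0)"
      by (simp add: filterlim_uminus_at_top)
    have down2: "filterlim (\<lambda>t. pi / 2 - \<theta> t) at_top (at_right 0) \<Longrightarrow> filterlim \<theta> at_bot (at_right 0)"
      using filterlim_tendsto_add_at_top[OF tendsto_const[of "- (pi / 2)"], of "\<lambda>t. pi / 2 - \<theta> t"] down by simp
    \<comment> \<open>In the four cases the pair of \<open>w i\<close> and \<open>sp * w m\<close>
      has the polar angle \<theta>, \<open>- \<theta>\<close>, \<open>pi / 2 - \<theta>\<close> and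
      \<open>\<theta> - pi / 2\<close>. This decides whether \<theta> goes up or down.\<close>
    consider "i = 2" "m = 3" "sp = 1" | "i = 2" "m = 3" "sp = -1" | "i = 3" "m = 2" "sp = 1" | "i = 3" "m = 2" "sp = -1"
      using exhaust_3[of i] exhaust_3[of m] i1 mi sps(1) by auto
    then show ?thesis
    proof cases
      case 1
      have "filterlim \<theta> at_top (at_right 0)" by (rule rot[OF th]) (use 1 pol in auto)
      then show ?thesis ..
    next
      case 2
      have "filterlim (\<lambda>t. - \<theta> t) at_top (at_right 0)"
        by (rule rot) (use 2 pol in \<open>auto intro!: continuous_intros th\<close>)
      then show ?thesis using down by blast
    next
      case 3
      have "filterlim (\<lambda>t. pi / 2 - \<theta> t) at_top (at_right 0)"
        by (rule rot) (use 3 pol in \<open>auto intro!: continuous_intros th simp: cos_diff sin_diff\<close>)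
      then show ?thesis using down2 by blast
    next
      case 4
      have "filterlim (\<lambda>t. \<theta> t - pi / 2) at_top (at_right 0)"
        by (rule rot) (use 4 pol in \<open>auto intro!: continuous_intros th simp: cos_diff sin_diff\<close>)
      then show ?thesis using up by blast
    qed
  qed
  show ?thesis
    unfolding interlaced_curves_def Let_def \<epsilon>_def[symmetric]
    using a angle_measure_exists[OF c\<epsilon> \<epsilon>0] lim by blast
qed

end

section \<open>Intersection of the projected curves\<close>

context contact_pair
begin

text \<open>When both sides recur, \<kappa> converts them into opposite signs of coordinate
  \<open>i\<close> of the difference at equal clock times, so that coordinate changes sign
  arbitrarily near 0. In the other cases uniqueness of \<tau> reduces common points of the
  projections to zeros of \<open>w\<close>.\<close>

lemma interlaced_or_trivial_intersection:
  "interlaced_curves (plane g) (plane d) \<or>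
   (\<exists>b1 b2. 0 < b1 \<and> b1 \<le> a \<and> 0 < b2 \<and> b2 \<le> a \<and>
     (\<forall>t\<in>{0<..<b1}. g t \<in> U) \<and> (\<forall>t\<in>{0<..<b2}. d t \<in> U) \<and>
     ((\<forall>t\<in>{0<..<b1}. \<forall>u\<in>{0<..<b2}. \<not> (F1 (d u) = F1 (g t) \<and> F2 (d u) = F2 (g t))) \<or>
      (\<forall>t\<in>{0<..<b1}. \<exists>u\<in>{0<..<b2}. F1 (d u) = F1 (g t) \<and> F2 (d u) = F2 (g t))))"
    (is "?I \<or> ?T")
proof -
  obtain m i \<kappa> sp sm n s b b2 \<tau> where syn: "synchronized (m, i, \<kappa>, sp, sm) n s b b2 \<tau>"
    and tri: "(\<exists>b1. 0 < b1 \<and> b1 \<le> b \<and> (\<forall>t\<in>{0<..<b1}. F2 (d (\<tau> t)) \<noteq> F2 (g t))) \<or>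
     (\<forall>t\<in>{0<..<b}. F2 (d (\<tau> t)) = F2 (g t)) \<or>
     (sp \<noteq> 0 \<and> sm \<noteq> 0 \<and> (\<forall>b'>0. (\<exists>t\<in>{0<..<b}. t < b' \<and> F2 (d (\<tau> t)) = F2 (g t) \<and> X (g t) $ m < X (d (\<tau> t)) $ m) \<and>
       (\<exists>t\<in>{0<..<b}. t < b' \<and> F2 (d (\<tau> t)) = F2 (g t) \<and> X (d (\<tau> t)) $ m < X (g t) $ m)))"
    by (rule trichotomy)
  have b: "0 < b" "b \<le> b2" "b2 \<le> a" "(m, i, \<kappa>, sp, sm) \<in> J" using syn unfolding synchronized_def by auto
  have inU: "g t \<in> U" "d t \<in> U" if "t \<in> {0<..<b2}" for t using syn that unfolding synchronized_def by blast+
  have \<tau>: "\<tau> t \<in> {0<..<b2}" "F1 (d (\<tau> t)) = F1 (g t)" "\<forall>u\<in>{0<..<b2}. F1 (d u) = F1 (g t) \<longrightarrow> u = \<tau> t"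
    if "t \<in> {0<..<b}" for t using syn that unfolding synchronized_def by blast+
  from tri consider (1) b1 where "0 < b1" "b1 \<le> b" "\<forall>t\<in>{0<..<b1}. F2 (d (\<tau> t)) \<noteq> F2 (g t)"
    | (2) "\<forall>t\<in>{0<..<b}. F2 (d (\<tau> t)) = F2 (g t)"
    | (3) "\<And>c. c > 0 \<Longrightarrow> \<exists>t\<in>{0<..<b}. t < c \<and> F2 (d (\<tau> t)) = F2 (g t) \<and> X (g t) $ m < X (d (\<tau> t)) $ m"
       "\<And>c. c > 0 \<Longrightarrow> \<exists>t\<in>{0<..<b}. t < c \<and> F2 (d (\<tau> t)) = F2 (g t) \<and> X (d (\<tau> t)) $ m < X (g t) $ m"
    by blast
  then show ?thesis
  proof cases
    case 1
    have "\<forall>t\<in>{0<..<b1}. \<forall>u\<in>{0<..<b2}. \<not> (F1 (d u) = F1 (g t) \<and> F2 (d u) = F2 (g t))"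
    proof (intro ballI notI)
      fix t u assume tu: "t \<in> {0<..<b1}" "u \<in> {0<..<b2}" "F1 (d u) = F1 (g t) \<and> F2 (d u) = F2 (g t)"
      have "t \<in> {0<..<b}" using tu(1) 1(2) by auto
      then have "u = \<tau> t" using \<tau>(3) tu by blast
      then show False using 1(3) tu by blast
    qed
    then have ?T using 1 b inU by (intro exI[of _ b1] exI[of _ b2]) auto
    then show ?thesis ..
  next
    case 2
    then have "\<forall>t\<in>{0<..<b}. \<exists>u\<in>{0<..<b2}. F1 (d u) = F1 (g t) \<and> F2 (d u) = F2 (g t)" using \<tau>(1,2) by blast
    then have ?T using b inU by (intro exI[of _ b] exI[of _ b2]) auto
    then show ?thesis ..
  next
    case 3
    have \<kappa>: "\<kappa> = 1 \<or> \<kappa> = -1" using b(4) unfolding J_def by auto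
    have p: "\<exists>t\<in>{0<..<a}. t < c \<and> 0 < \<kappa> * (X (d t) $ i - X (g t) $ i)" if c: "c > 0" for c
    proof -
      obtain t where t: "t \<in> {0<..<b}" "t < c" "F2 (d (\<tau> t)) = F2 (g t)" "X (g t) $ m < X (d (\<tau> t)) $ m" using 3(1)[OF c] by blast
      then show ?thesis using synchronized_zero[OF syn t(1,3)] b by (intro bexI[of _ t]) auto
    qed
    have n: "\<exists>t\<in>{0<..<a}. t < c \<and> 0 < - \<kappa> * (X (d t) $ i - X (g t) $ i)" if c: "c > 0" for c
    proof -
      obtain t where t: "t \<in> {0<..<b}" "t < c" "F2 (d (\<tau> t)) = F2 (g t)" "X (d (\<tau> t)) $ m < X (g t) $ m" using 3(2)[OF c] by blast
      then show ?thesis using synchronized_zero[OF syn t(1,3)] b by (intro bexI[of _ t]) auto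
    qed
    have ?I
      by (rule interlaced_if_sign_changes[of i]) (use \<kappa> p n in force)+
    then show ?thesis ..
  qed
qed

end

section \<open>Projections of interlaced trajectories\<close>

text \<open>Before reaching infinity the angle passes two consecutive odd multiples of
  \<open>pi / 2\<close> and a multiple of \<open>pi\<close> between them. The set \<open>T\<close>
  is known near 0 only, and this suffices because a connected set of reals is convex.\<close>

lemma cos_zeros_disconnected:
  fixes \<theta> :: "real \<Rightarrow> real"
  assumes c: "c > 0" and cont: "continuous_on {0<..<c} \<theta>"
    and lim: "filterlim \<theta> at_top (at_right 0) \<or> filterlim \<theta> at_bot (at_right 0)"
    and T: "\<And>t. t \<in> {0<..<c} \<Longrightarrow> t \<in> T \<longleftrightarrow> cos (\<theta> t) = 0"
  shows "\<not> connected T"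
proof
  assume conn: "connected T"
  have main: False if top: "filterlim \<psi> at_top (at_right 0)" and cont: "continuous_on {0<..<c} \<psi>"
    and T: "\<And>t. t \<in> {0<..<c} \<Longrightarrow> t \<in> T \<longleftrightarrow> cos (\<psi> t) = 0" for \<psi> :: "real \<Rightarrow> real"
  proof -
    define u2 where "u2 = c / 2"
    have u2: "0 < u2" "u2 < c" unfolding u2_def using c by auto
    \<comment> \<open>With \<psi> at most \<open>n * pi\<close> at \<open>u2\<close> and at least
      \<open>n * pi + 2 * pi\<close> at \<open>u1\<close>, it takes the values
      \<open>n * pi + 3 * pi / 2\<close>, \<open>n * pi + pi\<close> and
      \<open>n * pi + pi / 2\<close> in this order; only the middle one is not a zero of the
      cosine.\<close>
    define n where "n = \<lceil>\<psi> u2 / pi\<rceil>"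
    have "\<psi> u2 / pi \<le> of_int n" unfolding n_def by (rule le_of_int_ceiling)
    then have n: "\<psi> u2 \<le> of_int n * pi" by (simp add: pos_divide_le_eq)
    have "\<forall>\<^sub>F u in at_right 0. of_int n * pi + 2 * pi \<le> \<psi> u" using top unfolding filterlim_at_top by blast
    moreover have "\<forall>\<^sub>F u in at_right 0. u \<in> {0<..<u2}" using u2(1) by (rule eventually_at_right_real)
    ultimately have "\<forall>\<^sub>F u in at_right (0::real). \<exists>u. u \<in> {0<..<u2} \<and> of_int n * pi + 2 * pi \<le> \<psi> u"
      by eventually_elim blast
    then obtain u1 where u1: "u1 \<in> {0<..<u2}" "of_int n * pi + 2 * pi \<le> \<psi> u1" by auto
    have ivt: "\<exists>t. p \<le> t \<and> t \<le> q \<and> \<psi> t = y" if "u1 \<le> p" "p \<le> q" "q \<le> u2" "\<psi> q \<le> y" "y \<le> \<psi> p" for p q y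
    proof -
      have "continuous_on {p..q} \<psi>" by (rule continuous_on_subset[OF cont]) (use that u1 u2 in auto)
      from IVT2'[OF that(4,5,2) this] show ?thesis .
    qed
    note pi = pi_gt_zero
    have "u1 \<le> u2" "\<psi> u2 \<le> of_int n * pi + pi + pi / 2" "of_int n * pi + pi + pi / 2 \<le> \<psi> u1"
      using u1 n pi by (simp, linarith, linarith)
    then obtain t1 where t1: "u1 \<le> t1" "t1 \<le> u2" "\<psi> t1 = of_int n * pi + pi + pi / 2"
      using ivt[of u1 u2] by blast
    have "\<psi> u2 \<le> of_int n * pi + pi / 2" "of_int n * pi + pi / 2 \<le> \<psi> t1"
      using n t1(3) pi by linarith+
    then obtain t2 where t2: "t1 \<le> t2" "t2 \<le> u2" "\<psi> t2 = of_int n * pi + pi / 2"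
      using ivt[of t1 u2] t1 by blast
    have "\<psi> t2 \<le> of_int n * pi + pi" "of_int n * pi + pi \<le> \<psi> t1"
      using t1(3) t2(3) pi by linarith+
    then obtain t where t: "t1 \<le> t" "t \<le> t2" "\<psi> t = of_int n * pi + pi"
      using ivt[of t1 t2] t1 t2 by blast
    have "\<psi> t1 = of_int (n + 1) * pi + pi / 2" unfolding t1(3) by (simp add: algebra_simps)
    then have "cos (\<psi> t1) = 0" "cos (\<psi> t2) = 0" using t2(3) unfolding cos_zero_iff_int2 by blast+
    then have "t1 \<in> T" "t2 \<in> T" using T[of t1] T[of t2] t1 t2 u1 u2 by auto
    then have "t \<in> T" using connectedD_interval[OF conn] t by blast
    then have "cos (\<psi> t) = 0" using T[of t] t t1 t2 u1 u2 by auto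
    then obtain i :: int where "of_int n * pi + pi = of_int i * pi + pi / 2"
      unfolding t(3) cos_zero_iff_int2 by blast
    then have "of_int (2 * (n - i) + 1) * pi = 0" by (simp add: algebra_simps)
    then have "real_of_int (2 * (n - i) + 1) = 0" by simp
    then have "2 * (n - i) + 1 = 0" by (simp only: of_int_eq_0_iff)
    then show False by presburger
  qed
  show False
    using lim
  proof
    assume "filterlim \<theta> at_top (at_right 0)"
    then show False by (rule main[OF _ cont T])
  next
    assume "filterlim \<theta> at_bot (at_right 0)"
    then have "filterlim (\<lambda>t. - \<theta> t) at_top (at_right 0)" by (simp add: filterlim_uminus_at_top)
    then show False by (rule main) (auto intro!: continuous_intros cont simp: T)
  qed
qed

lemma C1_on_subset: "C1_on f U \<Longrightarrow> U' \<subseteq> U \<Longrightarrow> C1_on f U'"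
  unfolding C1_on_def using continuous_on_subset by blast

lemma diffeomorphism_derivative_surj:
  assumes "diffeomorphism_onto_image X V" "open V" "p \<in> V" "(X has_derivative X') (at p)"
  shows "surj X'"
proof -
  obtain Y where Y: "C1_on Y (X ` V)" "\<And>p. p \<in> V \<Longrightarrow> Y (X p) = p"
    using assms(1) unfolding diffeomorphism_onto_image_def by blast
  obtain Y' where Y': "(Y has_derivative Y') (at (X p))"
    using Y(1) assms(3) unfolding C1_on_def by blast
  have "((\<lambda>q. Y (X q)) has_derivative (\<lambda>u. Y' (X' u))) (at p)"
    by (rule has_derivative_compose[OF assms(4) Y'])
  moreover have "((\<lambda>q. Y (X q)) has_derivative (\<lambda>u. u)) (at p)"
    by (rule has_derivative_transform_within_open[OF has_derivative_ident assms(2,3)]) (simp add: Y(2))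
  ultimately have "(\<lambda>u. Y' (X' u)) = (\<lambda>u. u)" by (rule has_derivative_unique)
  then have "inj X'" by (metis injI)
  then show ?thesis
    using has_derivative_linear[OF assms(4)] linear_injective_imp_surjective by blast
qed

lemma same_germ_nhds:
  assumes "same_germ A B" "A \<subseteq> C" "r > 0"
  shows "same_germ (B \<inter> (C \<inter> ball 0 r)) B"
proof -
  have "\<forall>\<^sub>F p::real^3 in nhds 0. p \<in> ball 0 r" using assms(3) by (intro eventually_nhds_in_open) auto
  with assms(1) show ?thesis
    unfolding same_germ_def by eventually_elim (use assms(2) in auto)
qed

section \<open>Representatives confined to an arc\<close>

context chart_field
begin

text \<open>A representative avoiding the point \<open>c b\<close> cannot leave the arc \<open>c ((0, b))\<close>: it avoids the
  two end points of the closed arc.\<close>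

lemma representative_subset_arc:
  assumes c: "germ_param W \<xi> V X \<Gamma> a c" and b: "0 < b" "b < a"
    and rep: "representative W \<xi> \<Gamma> \<Gamma>'" and avoid: "c b \<notin> \<Gamma>'"
  shows "\<Gamma>' \<subseteq> c ` {0<..<b}"
proof -
  have cb: "germ_param W \<xi> V X \<Gamma> b c" using germ_param_restrict[OF c X_lim b(1)] b(2) by simp
  obtain a' c' where c': "trajectory_param W \<xi> a' c'" "\<Gamma>' = c' ` {0<..<a'}" and germ: "same_germ \<Gamma>' \<Gamma>"
    using rep unfolding representative_def trajectory_def by blast
  have a': "a' > 0" "(c' \<longlongrightarrow> 0) (at_right 0)" "\<And>t. t \<in> {0<..<a'} \<Longrightarrow> c' t \<noteq> 0"
    using c'(1) unfolding trajectory_param_def by auto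
  obtain l where l: "field_curve \<xi> {0<..<a'} l c'"
    using trajectory_field_curve[OF c'(1) continuous_on_xi] by blast
  have cont': "continuous_on {0<..<a'} c'"
    using l unfolding field_curve_def
    by (meson continuous_at_imp_continuous_on has_vector_derivative_continuous)
  \<comment> \<open>The value 0 at time 0 closes the arc to a compact set \<open>K\<close>; the
    representative misses the origin by definition and the other end by hypothesis.\<close>
  define C where "C t = (if t \<le> 0 then 0 else c t)" for t
  define K where "K = C ` {0..b}"
  have isC: "isCont c t" if "t \<in> {0<..<a}" for t
    by (rule xcurve_isCont[OF germ_param_xcurve[OF c] that])
  have "continuous_on {0..b} C"
  proof (rule continuous_on_IccI)
    have "\<forall>\<^sub>F t in at_right 0. C t = c t" unfolding eventually_at_filter by (simp add: C_def)
    then show "(C \<longlongrightarrow> C 0) (at_right 0)"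
      using germ_paramD(3)[OF c] by (simp add: C_def tendsto_cong)
    have near: "(C \<longlongrightarrow> C t) (at t)" if t: "0 < t" "t \<le> b" for t
    proof -
      have "(c \<longlongrightarrow> c t) (at t)" using isC[of t] t b by (simp add: continuous_at)
      moreover have "\<forall>\<^sub>F s in at t. s \<in> {0<..}" using t by (intro eventually_at_in_open') auto
      then have "\<forall>\<^sub>F s in at t. C s = c s" by eventually_elim (simp add: C_def)
      ultimately show ?thesis using t by (simp add: C_def tendsto_cong)
    qed
    show "(C \<longlongrightarrow> C b) (at_left b)" using near[of b] b filterlim_at_split by blast
    show "C \<midarrow>t\<rightarrow> C t" if "0 < t" "t < b" for t using near that by simp
  qed (use b in auto)
  then have "closed K" unfolding K_def by (intro compact_imp_closed compact_continuous_image) auto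
  have K: "c' t \<in> K \<longleftrightarrow> c' t \<in> c ` {0<..<b}" if t: "t \<in> {0<..<a'}" for t
  proof
    assume "c' t \<in> c ` {0<..<b}"
    then show "c' t \<in> K" unfolding K_def C_def by force
  next
    assume "c' t \<in> K"
    then obtain s where s: "s \<in> {0..b}" "c' t = C s" unfolding K_def by blast
    have "C s \<noteq> 0" using s(2) a'(3)[OF t] by simp
    then have "0 < s" "C s = c s" unfolding C_def by (auto split: if_splits)
    moreover have "s \<noteq> b" using avoid t s(2) \<open>C s = c s\<close> unfolding c'(2) by force
    ultimately show "c' t \<in> c ` {0<..<b}" using s by auto
  qed
  \<comment> \<open>The times on the open arc form an open set by \<open>follow\<close>, the times
    off the closed arc one by closedness of \<open>K\<close>; no time is left over.\<close>
  let ?A = "{t \<in> {0<..<a'}. c' t \<in> c ` {0<..<b}}" and ?B = "{0<..<a'} \<inter> c' -` (- K)"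
  have "open ?A"
    unfolding open_dist
  proof
    fix t0 assume "t0 \<in> ?A"
    then obtain s0 where t0: "t0 \<in> {0<..<a'}" "s0 \<in> {0<..<b}" "c' t0 = c s0" by blast
    have "\<forall>\<^sub>F t in at t0. X (c' t) $ 1 \<in> {0<..<b} \<and> c' t = c (X (c' t) $ 1)"
      by (rule follow[OF germ_param_xcurve[OF cb] _ t0(2) l t0(1,3)]) simp
    moreover have "\<forall>\<^sub>F t in at t0. t \<in> {0<..<a'}" using t0 by (intro eventually_at_in_open') auto
    ultimately have "\<forall>\<^sub>F t in at t0. t \<in> ?A" by eventually_elim auto
    then show "\<exists>e>0. \<forall>y. dist y t0 < e \<longrightarrow> y \<in> ?A"
      using \<open>t0 \<in> ?A\<close> unfolding eventually_at by (metis UNIV_I)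
  qed
  moreover have "open ?B"
    by (rule continuous_open_preimage[OF cont']) (use \<open>closed K\<close> in auto)
  moreover have "connected {0<..<a'}" by simp
  ultimately have "?A \<inter> {0<..<a'} = {} \<or> ?B \<inter> {0<..<a'} = {}"
    by (rule_tac connectedD) (use K in auto)
  moreover have "?A \<inter> {0<..<a'} \<noteq> {}"
  proof -
    have e: "\<forall>\<^sub>F t in at_right 0. t \<in> {0<..<a'}" using a'(1) by (rule eventually_at_right_real)
    then have "\<forall>\<^sub>F t in at_right 0. c' t \<in> \<Gamma>'" unfolding c'(2) by eventually_elim auto
    moreover have "same_germ \<Gamma>' (c ` {0<..<b})"
      using same_germ_trans[OF germ same_germ_sym[OF germ_paramD(5)[OF cb]]] .
    ultimately have "\<forall>\<^sub>F t in at_right 0. c' t \<in> c ` {0<..<b}" using same_germ_eventually a'(2) by blast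
    with e have "\<forall>\<^sub>F t in at_right (0::real). ?A \<inter> {0<..<a'} \<noteq> {}" by eventually_elim blast
    then show ?thesis by simp
  qed
  ultimately have "?B \<inter> {0<..<a'} = {}" by blast
  then show ?thesis unfolding c'(2) using K by auto
qed

end

section \<open>An interlaced pair seen in the first two chart coordinates\<close>

context ominimal_real_field
begin

text \<open>The ball leaves the germs unchanged; its radius is a free parameter by which
  representatives in the domain are kept away from chosen points.\<close>

lemma chart_projection_adapted:
  assumes ch: "definable_chart S V X" and \<Gamma>: "same_germ A \<Gamma>" "A \<subseteq> V" and \<Delta>: "same_germ B \<Delta>" "B \<subseteq> V" and r: "r > 0"
  shows "adapted_projection S \<Gamma> \<Delta> (V \<inter> ball 0 r) (\<lambda>p. vector [X p $ 1, X p $ 2])"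
proof -
  note X = definable_chartD[OF ch]
  let ?U = "V \<inter> ball 0 r" and ?L = "\<lambda>v::real^3. vector [v $ 1, v $ 2] :: real^2"
  have L: "bounded_linear ?L"
    unfolding linear_conv_bounded_linear[symmetric] by (intro linearI) (simp_all add: vec_eq_iff forall_2)
  have L0: "?L 0 = 0" by (simp add: vec_eq_iff forall_2)
  have "ds (ball 0 r)"
    unfolding ds_def mem_ball_0 by (intro dp_norm_less dv_vec3 dm_id dm_const)
  then have "ds ?U" using df_ext_map3(1)[OF X(5)] ds_Int by blast
  then have "definable_map S 2 ?U (\<lambda>p. coords2 (?L (X p)))"
  proof (rule definable_map2I)
    show "df (ext V (\<lambda>p. X p $ (if i = 1 then 1 else 2)))" for i :: 2 by (rule df_ext_map3(2)[OF X(5)])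
    show "ext V (\<lambda>p. X p $ (if i = 1 then 1 else 2)) p = ?L (X p) $ i" if "p \<in> ?U" for p and i :: 2
      using that exhaust_2[of i] by (auto simp: ext_def)
  qed
  moreover have "C1_on (\<lambda>p. ?L (X p)) ?U"
    by (rule C1_on_subset[OF C1_on_compose_bounded_linear[OF X(2) L]]) simp
  moreover have "surj (frechet_derivative (\<lambda>p. ?L (X p)) (at p))" if p: "p \<in> ?U" for p
  proof -
    obtain X' where X': "(X has_derivative X') (at p)"
      using X(2) p unfolding C1_on_def by blast
    have "surj X'"
      by (rule diffeomorphism_derivative_surj[OF _ X(1) _ X']) (use ch p in \<open>auto simp: definable_chart_def\<close>)
    moreover have "surj ?L"
      by (rule surjI[where f="\<lambda>w. vector [w $ 1, w $ 2, 0]"]) (simp add: vec_eq_iff forall_2)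
    ultimately have "surj (?L \<circ> X')" by (rule comp_surj)
    moreover have "((\<lambda>p. ?L (X p)) has_derivative ?L \<circ> X') (at p)"
      using bounded_linear.has_derivative[OF L X'] by (simp add: o_def)
    then have "frechet_derivative (\<lambda>p. ?L (X p)) (at p) = ?L \<circ> X'" by (rule frechet_derivative_at[symmetric])
    ultimately show ?thesis by simp
  qed
  moreover have "((\<lambda>p. ?L (X p)) \<longlongrightarrow> 0) (at 0 within ?U)"
    using bounded_linear.tendsto[OF L tendsto_within_subset[OF X(3), of ?U]] unfolding L0 by simp
  ultimately show ?thesis
    unfolding adapted_projection_def using X(1) same_germ_nhds[OF \<Gamma> r] same_germ_nhds[OF \<Delta> r] by auto
qed

text \<open>The first component of the projection is the clock, so two points with the same image
  have the same clock time, provided they lie on the arcs parameterized by it. Then the second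
  component compares the first coordinates of the two chart curves, which agree exactly where
  \<open>cos \<theta>\<close> vanishes.\<close>

lemma interlaced_not_connected_germ:
  assumes field: "definable_C1_vector_field S W \<xi>" and inter: "interlaced S W \<xi> \<Gamma> \<Delta>"
  shows "\<exists>U F. adapted_projection S \<Gamma> \<Delta> U F \<and> \<not> connected_germ_of_intersection W \<xi> \<Gamma> \<Delta> U F"
proof -
  obtain V X where ad: "adapted_chart S W \<xi> V X \<Gamma>" "adapted_chart S W \<xi> V X \<Delta>"
    and il: "interlaced_curves (chart_curve W \<xi> V X \<Gamma>) (chart_curve W \<xi> V X \<Delta>)"
    using inter unfolding interlaced_def by blast
  interpret chart_field W \<xi> V X by (rule adapted_chart_germ_param(1)[OF field ad(1)])
  define g d where "g = chart_param W \<xi> V X \<Gamma>" and "d = chart_param W \<xi> V X \<Delta>"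
  obtain ag where g: "germ_param W \<xi> V X \<Gamma> ag g"
    using adapted_chart_germ_param(2)[OF field ad(1)] unfolding g_def by blast
  obtain ad' where d: "germ_param W \<xi> V X \<Delta> ad' d"
    using adapted_chart_germ_param(2)[OF field ad(2)] unfolding d_def by blast
  define \<epsilon> where "\<epsilon> x = chart_curve W \<xi> V X \<Delta> x - chart_curve W \<xi> V X \<Gamma> x" for x
  have \<epsilon>1: "\<epsilon> t $ 1 = X (d t) $ 2 - X (g t) $ 2" for t
    unfolding \<epsilon>_def chart_curve_def Let_def g_def d_def by simp
  obtain a0 \<theta> where a0: "a0 > 0" and ang: "angle_measure \<epsilon> a0 \<theta>"
    and lim: "filterlim \<theta> at_top (at_right 0) \<or> filterlim \<theta> at_bot (at_right 0)"
    using il unfolding interlaced_curves_def Let_def \<epsilon>_def[abs_def] by blast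
  define b where "b = min ag (min ad' a0) / 2"
  have b: "0 < b" "b < ag" "b < ad'" "b < a0"
    unfolding b_def using germ_paramD(1)[OF g] germ_paramD(1)[OF d] a0 by auto
  have nz: "g b \<noteq> 0" "d b \<noteq> 0" using germ_paramD(4)[OF g, of b] germ_paramD(4)[OF d, of b] b by auto
  \<comment> \<open>The open ball of this radius contains neither \<open>g b\<close> nor
    \<open>d b\<close>; this confines all representatives in the domain to the arcs before time
    \<open>b\<close>.\<close>
  define r where "r = min (norm (g b)) (norm (d b))"
  have r: "r > 0" unfolding r_def using nz by simp
  let ?U = "V \<inter> ball 0 r" and ?F = "\<lambda>p. vector [X p $ 1, X p $ 2] :: real^2"
  have "adapted_projection S \<Gamma> \<Delta> ?U ?F"
  proof (rule chart_projection_adapted[OF _ germ_paramD(5)[OF g] _ germ_paramD(5)[OF d] _ r])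
    show "definable_chart S V X" using ad(1) unfolding adapted_chart_def by blast
  qed (use germ_paramD(4)[OF g] germ_paramD(4)[OF d] in blast)+
  moreover have "\<not> connected_germ_of_intersection W \<xi> \<Gamma> \<Delta> ?U ?F"
  proof
    assume "connected_germ_of_intersection W \<xi> \<Gamma> \<Delta> ?U ?F"
    then obtain \<Gamma>' \<Delta>' where rep: "representative W \<xi> \<Gamma> \<Gamma>'" "representative W \<xi> \<Delta> \<Delta>'"
      and sub: "\<Gamma>' \<subseteq> ?U" "\<Delta>' \<subseteq> ?U" and conn: "connected (?F ` \<Gamma>' \<inter> ?F ` \<Delta>')"
      unfolding connected_germ_of_intersection_def by blast
    have arc: "\<Gamma>' \<subseteq> g ` {0<..<b}" "\<Delta>' \<subseteq> d ` {0<..<b}"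
      by (rule representative_subset_arc[OF g b(1,2) rep(1)], use sub r_def in fastforce)
        (rule representative_subset_arc[OF d b(1,3) rep(2)], use sub r_def in fastforce)
    have evin: "\<forall>\<^sub>F t in at_right 0. c t \<in> \<Gamma>2"
      if c: "germ_param W \<xi> V X \<Gamma>1 a1 c" and r1: "representative W \<xi> \<Gamma>1 \<Gamma>2" for \<Gamma>1 \<Gamma>2 a1 c
    proof (rule same_germ_eventually)
      show "same_germ \<Gamma>1 \<Gamma>2" using r1 same_germ_sym unfolding representative_def by blast
      show "\<forall>\<^sub>F t in at_right 0. c t \<in> \<Gamma>1" using germ_param_eventually[OF c] by eventually_elim blast
    qed (rule germ_paramD(3)[OF c])
    have "\<forall>\<^sub>F t in at_right 0. g t \<in> \<Gamma>' \<and> d t \<in> \<Delta>'"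
      using evin[OF g rep(1)] evin[OF d rep(2)] by eventually_elim blast
    then obtain e where e: "e > 0" "\<And>t. 0 < t \<Longrightarrow> t < e \<Longrightarrow> g t \<in> \<Gamma>' \<and> d t \<in> \<Delta>'"
      unfolding eventually_at_right_field by blast
    define c where "c = min e b"
    have c: "c > 0" "c \<le> e" "c \<le> b" unfolding c_def using e b by auto
    \<comment> \<open>The clock times of the common points: a connected intersection would have a
      connected image here.\<close>
    let ?T = "(\<lambda>q. q $ 1) ` (?F ` \<Gamma>' \<inter> ?F ` \<Delta>')"
    have "t \<in> ?T \<longleftrightarrow> cos (\<theta> t) = 0" if t: "t \<in> {0<..<c}" for t
    proof -
      have clock: "X (g t) $ 1 = t" "X (d t) $ 1 = t" if "t \<in> {0<..<b}" for t
        using germ_paramD(4)[OF g, of t] germ_paramD(4)[OF d, of t] that b by auto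
      have "\<epsilon> t \<noteq> 0" "\<epsilon> t /\<^sub>R norm (\<epsilon> t) = vector [cos (\<theta> t), sin (\<theta> t)]"
        using ang t c b unfolding angle_measure_def by auto
      from arg_cong[OF this(2), of "\<lambda>v. v $ 1"] this(1)
      have "cos (\<theta> t) = 0 \<longleftrightarrow> X (g t) $ 2 = X (d t) $ 2" using \<epsilon>1[of t] by (auto simp: vector_2)
      also have "\<dots> \<longleftrightarrow> t \<in> ?T"
      proof
        assume eq: "X (g t) $ 2 = X (d t) $ 2"
        have m: "g t \<in> \<Gamma>'" "d t \<in> \<Delta>'" using e(2)[of t] t c by auto
        have tb: "t \<in> {0<..<b}" using t c by auto
        have "?F (g t) = ?F (d t)" using eq clock[OF tb] by simp
        then have "?F (g t) \<in> ?F ` \<Delta>'" by (rule image_eqI) (rule m(2))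
        then have "?F (g t) \<in> ?F ` \<Gamma>' \<inter> ?F ` \<Delta>'" by (intro IntI imageI[OF m(1)])
        moreover have "t = ?F (g t) $ 1" using clock[OF tb] by simp
        ultimately show "t \<in> ?T" by (rule rev_image_eqI)
      next
        assume "t \<in> ?T"
        then obtain p q where pq: "p \<in> \<Gamma>'" "q \<in> \<Delta>'" "?F p = ?F q" "t = ?F p $ 1" by (elim imageE IntE) (rule that, assumption+, simp_all)
        obtain s s' where s: "s \<in> {0<..<b}" "p = g s" "s' \<in> {0<..<b}" "q = d s'" using pq(1,2) arc by blast
        have "X p $ 1 = X q $ 1" "X p $ 2 = X q $ 2"
          using arg_cong[OF pq(3), of "\<lambda>v. v $ 1"] arg_cong[OF pq(3), of "\<lambda>v. v $ 2"] by simp_all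
        moreover have "s = t" "s' = t" using pq(4) calculation(1) clock[OF s(1)] clock[OF s(3)] s by auto
        ultimately show "X (g t) $ 2 = X (d t) $ 2" using s by simp
      qed
      finally show ?thesis by blast
    qed
    moreover have "continuous_on {0<..<c} \<theta>"
      using ang c b unfolding angle_measure_def by (auto elim: continuous_on_subset)
    moreover have "connected ?T"
      by (rule connected_continuous_image[OF _ conn]) (intro continuous_intros)
    ultimately show False using cos_zeros_disconnected[OF c(1) _ lim] by blast
  qed
  ultimately show ?thesis by blast
qed

end

section \<open>The alternative\<close>

lemma C1_on_cong:
  assumes "C1_on f U" "open U" "\<And>p. p \<in> U \<Longrightarrow> f p = h p"
  shows "C1_on h U"
proof -
  obtain f' where f': "\<And>p. p \<in> U \<Longrightarrow> (f has_derivative blinfun_apply (f' p)) (at p)" "continuous_on U f'"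
    using assms(1) unfolding C1_on_def by blast
  have "(h has_derivative blinfun_apply (f' p)) (at p)" if "p \<in> U" for p
    by (rule has_derivative_transform_within_open[OF f'(1)[OF that] assms(2) that assms(3)])
  then show ?thesis unfolding C1_on_def using f'(2) by blast
qed

lemma germ_param_cong:
  assumes "germ_param W \<xi> V X \<Gamma> a c" "\<And>p. p \<in> W \<Longrightarrow> \<xi> p = \<xi>' p" "\<And>p. p \<in> V \<Longrightarrow> X p = X' p"
  shows "germ_param W \<xi>' V X' \<Gamma> a c"
  using assms(1) assms(2,3)[symmetric] unfolding germ_param_def trajectory_param_def by (auto simp: image_subset_iff)

text \<open>Interlacement depends on germs only, since every angle measure restricts to the interval
  of agreement and keeps its limit.\<close>

lemma interlaced_curves_cong:
  assumes "interlaced_curves \<gamma> \<delta>" and a: "a > 0" and eq: "\<And>t. t \<in> {0<..<a} \<Longrightarrow> \<gamma> t = \<gamma>' t \<and> \<delta> t = \<delta>' t"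
  shows "interlaced_curves \<gamma>' \<delta>'"
proof -
  have restrict: "angle_measure (\<lambda>x. \<delta>2 x - \<gamma>2 x) (min a b) \<theta>"
    if "angle_measure (\<lambda>x. \<delta>1 x - \<gamma>1 x) b \<theta>" "\<And>t. t \<in> {0<..<a} \<Longrightarrow> \<gamma>1 t = \<gamma>2 t \<and> \<delta>1 t = \<delta>2 t"
    for b \<theta> and \<gamma>1 \<delta>1 \<gamma>2 \<delta>2 :: "real \<Rightarrow> real^2"
    unfolding angle_measure_def
  proof (intro conjI ballI)
    show "continuous_on {0<..<min a b} \<theta>"
      using that(1) unfolding angle_measure_def by (auto elim: continuous_on_subset)
    fix x assume x: "x \<in> {0<..<min a b}"
    have "\<delta>2 x - \<gamma>2 x = \<delta>1 x - \<gamma>1 x" using that(2)[of x] x by simp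
    then show "\<delta>2 x - \<gamma>2 x \<noteq> 0"
      "(\<delta>2 x - \<gamma>2 x) /\<^sub>R norm (\<delta>2 x - \<gamma>2 x) = vector [cos (\<theta> x), sin (\<theta> x)]"
      using that(1) x unfolding angle_measure_def by auto
  qed
  obtain b \<theta> where b: "b > 0" "angle_measure (\<lambda>x. \<delta> x - \<gamma> x) b \<theta>"
    using assms(1) unfolding interlaced_curves_def Let_def by blast
  have "angle_measure (\<lambda>x. \<delta>' x - \<gamma>' x) (min a b) \<theta>" by (rule restrict[OF b(2) eq])
  moreover have "min a b > 0" using a b(1) by simp
  moreover have "filterlim \<theta> at_top (at_right 0) \<or> filterlim \<theta> at_bot (at_right 0)"
    if "b' > 0" "angle_measure (\<lambda>x. \<delta>' x - \<gamma>' x) b' \<theta>" for b' \<theta>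
  proof -
    have "angle_measure (\<lambda>x. \<delta> x - \<gamma> x) (min a b') \<theta>" by (rule restrict[OF that(2)]) (use eq in auto)
    moreover have "min a b' > 0" using a that(1) by simp
    ultimately show ?thesis using assms(1) unfolding interlaced_curves_def Let_def by blast
  qed
  ultimately show ?thesis unfolding interlaced_curves_def Let_def by blast
qed

context contact
begin

text \<open>By regular separation each component of the projection is eventually transversal to the
  field along \<open>g\<close> or eventually stationary. One transversal component can be put first;
  if both are stationary, the projection is constant along \<open>g\<close>.\<close>

lemma plane_pair_or_constant:
  assumes proj: "open U" "ds U" "C1_on F1 U" "C1_on F2 U" "df F1" "df F2"
    and onto: "\<And>p w1 w2. p \<in> U \<Longrightarrow> \<exists>u. frechet_derivative F1 (at p) u = w1 \<and> frechet_derivative F2 (at p) u = w2"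
    and gU: "\<forall>\<^sub>F t in at_right 0. g t \<in> U"
    and lim: "((\<lambda>t. F1 (g t)) \<longlongrightarrow> 0) (at_right 0)" "((\<lambda>t. F2 (g t)) \<longlongrightarrow> 0) (at_right 0)"
    and not: "\<not> interlaced_curves (plane g) (plane d)"
  shows "(\<exists>b. 0 < b \<and> b \<le> a \<and> (\<forall>t\<in>{0<..<b}. g t \<in> U \<and> F1 (g t) = 0 \<and> F2 (g t) = 0)) \<or>
   (\<exists>b1 b2. 0 < b1 \<and> b1 \<le> a \<and> 0 < b2 \<and> b2 \<le> a \<and>
     (\<forall>t\<in>{0<..<b1}. g t \<in> U) \<and> (\<forall>t\<in>{0<..<b2}. d t \<in> U) \<and>
     ((\<forall>t\<in>{0<..<b1}. \<forall>u\<in>{0<..<b2}. \<not> (F1 (d u) = F1 (g t) \<and> F2 (d u) = F2 (g t))) \<or>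
      (\<forall>t\<in>{0<..<b1}. \<exists>u\<in>{0<..<b2}. F1 (d u) = F1 (g t) \<and> F2 (d u) = F2 (g t))))"
    (is "?Z \<or> ?T")
proof -
  have dich: "(\<forall>\<^sub>F t in at_right 0. along U f (g t) \<noteq> 0) \<or> (\<forall>\<^sub>F t in at_right 0. along U f (g t) = 0)"
    if "C1_on f U" "df f" for f
  proof -
    have "ds {p. along U f p \<noteq> 0}"
      unfolding ds_def mem_Collect_eq by (intro dp_not dp_eq0 dm_df[OF df_along] proj that dv_vec3 dm_id)
    from separates_dichotomy[OF sep this] show ?thesis by simp
  qed
  consider (1) "\<forall>\<^sub>F t in at_right 0. along U F1 (g t) \<noteq> 0" | (2) "\<forall>\<^sub>F t in at_right 0. along U F2 (g t) \<noteq> 0"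
    | (3) "\<forall>\<^sub>F t in at_right 0. along U F1 (g t) = 0" "\<forall>\<^sub>F t in at_right 0. along U F2 (g t) = 0"
    using dich[of F1] dich[of F2] proj by blast
  then show ?thesis
  proof cases
    case 1
    interpret P: contact_pair W \<xi> V X S Y a g d U F1 F2
    proof unfold_locales
      show "\<forall>\<^sub>F t in at_right 0. g t \<in> U \<and> along U F1 (g t) \<noteq> 0" using gU 1 by (rule eventually_conj)
    qed (use proj onto in auto)
    show ?thesis using P.interlaced_or_trivial_intersection not by blast
  next
    case 2
    interpret P: contact_pair W \<xi> V X S Y a g d U F2 F1
    proof unfold_locales
      show "\<forall>\<^sub>F t in at_right 0. g t \<in> U \<and> along U F2 (g t) \<noteq> 0" using gU 2 by (rule eventually_conj)
      show "\<exists>u. frechet_derivative F2 (at p) u = 1 \<and> frechet_derivative F1 (at p) u = 0" if "p \<in> U" for p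
        using onto[OF that, of 0 1] by blast
      show "\<exists>u. frechet_derivative F2 (at p) u = 0 \<and> frechet_derivative F1 (at p) u = 1" if "p \<in> U" for p
        using onto[OF that, of 1 0] by blast
    qed (use proj in auto)
    show ?thesis using P.interlaced_or_trivial_intersection not by (simp only: conj_commute[of "F2 _ = F2 _"]) blast
  next
    case 3
    have "\<forall>\<^sub>F t in at_right 0. t \<in> {0<..<a}" using a by (rule eventually_at_right_real)
    with gU 3 have "\<forall>\<^sub>F t in at_right 0. t \<in> {0<..<a} \<and> g t \<in> U \<and> along U F1 (g t) = 0 \<and> along U F2 (g t) = 0"
      by eventually_elim blast
    then obtain b where b: "b > 0" "\<And>t. 0 < t \<Longrightarrow> t < b \<Longrightarrow> t \<in> {0<..<a} \<and> g t \<in> U \<and> along U F1 (g t) = 0 \<and> along U F2 (g t) = 0"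
      unfolding eventually_at_right_field by blast
    \<comment> \<open>A stationary component is constant along \<open>g\<close>, and its limit at
      the origin identifies the constant as 0.\<close>
    have zero: "f (g t) = 0"
      if f: "C1_on f U" "((\<lambda>t. f (g t)) \<longlongrightarrow> 0) (at_right 0)" "\<And>t. t \<in> {0<..<b} \<Longrightarrow> along U f (g t) = 0" and t: "t \<in> {0<..<b}"
      for f :: "real^3 \<Rightarrow> real" and t
    proof -
      have "((\<lambda>t. f (g t)) has_real_derivative 0) (at s)" if "s \<in> {0<..<b}" for s
        using curve_derivative[OF g _ f(1), of s] b(2)[of s] f(3)[OF that] that by simp
      then have "\<exists>k. \<forall>s\<in>{0<..<b}. f (g s) = k"
        by (intro has_field_derivative_zero_constant) (auto intro: has_field_derivative_at_within)
      then obtain k where k: "\<forall>s\<in>{0<..<b}. f (g s) = k" by blast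
      have "\<forall>\<^sub>F s in at_right 0. s \<in> {0<..<b}" using b(1) by (rule eventually_at_right_real)
      then have "\<forall>\<^sub>F s in at_right 0. f (g s) = k" by eventually_elim (use k in blast)
      then have "((\<lambda>t. f (g t)) \<longlongrightarrow> k) (at_right 0)" by (rule tendsto_eventually)
      then have "k = 0" using tendsto_unique[OF trivial_limit_at_right_real _ f(2)] by blast
      then show ?thesis using k t by blast
    qed
    have "\<forall>t\<in>{0<..<min b a}. g t \<in> U \<and> F1 (g t) = 0 \<and> F2 (g t) = 0"
      using zero[OF proj(3) lim(1)] zero[OF proj(4) lim(2)] b(2) by auto
    then have ?Z using b(1) a by (intro exI[of _ "min b a"]) auto
    then show ?thesis ..
  qed
qed

end

context ominimal_real_field
begin

text \<open>Non-interlacement in the chart of the flat contact is enough: it leaves, for suitable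
  arcs, an intersection that is empty, at most one point, or the whole projected arc of
  \<Gamma>.\<close>

lemma flat_contact_alternative:
  assumes field: "definable_C1_vector_field S W \<xi>" and reg: "regular_separation S W \<xi> \<Gamma>"
    and flat: "flat_contact S W \<xi> \<Gamma> \<Delta>" and not: "\<not> interlaced S W \<xi> \<Gamma> \<Delta>"
    and F: "adapted_projection S \<Gamma> \<Delta> U F"
  shows "connected_germ_of_intersection W \<xi> \<Gamma> \<Delta> U F"
proof -
  obtain V X where adg: "adapted_chart S W \<xi> V X \<Gamma>" and add: "adapted_chart S W \<xi> V X \<Delta>"
    and neq: "\<not> (\<forall>\<^sub>F x in at_right 0. chart_curve W \<xi> V X \<Gamma> x = chart_curve W \<xi> V X \<Delta> x)"
    and small: "\<And>k. \<exists>a>0. \<forall>x\<in>{0<..<a}. norm (chart_curve W \<xi> V X \<Delta> x - chart_curve W \<xi> V X \<Gamma> x) \<le> x ^ k"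
    using flat unfolding flat_contact_def Let_def by blast
  have ch: "definable_chart S V X" using adg unfolding adapted_chart_def by blast
  note X = definable_chartD[OF ch]
  have W: "open W" "C1_on \<xi> W" "definable_map S 3 W (\<lambda>p. coords3 (\<xi> p))"
    using field unfolding definable_C1_vector_field_def by auto
  obtain Y where Y: "open (X ` V)" "C1_on Y (X ` V)" "\<And>p. p \<in> V \<Longrightarrow> Y (X p) = p"
    using ch unfolding definable_chart_def diffeomorphism_onto_image_def by blast
  define g d where "g = chart_param W \<xi> V X \<Gamma>" and "d = chart_param W \<xi> V X \<Delta>"
  obtain ag where ag: "germ_param W \<xi> V X \<Gamma> ag g"
    using adapted_chart_germ_param(2)[OF field adg] unfolding g_def by blast
  obtain ad where ad: "germ_param W \<xi> V X \<Delta> ad d"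
    using adapted_chart_germ_param(2)[OF field add] unfolding d_def by blast
  define a where "a = min ag ad"
  have a: "a > 0" unfolding a_def using germ_paramD(1)[OF ag] germ_paramD(1)[OF ad] by simp
  have g: "germ_param W \<xi> V X \<Gamma> a g" by (rule germ_param_restrict[OF ag X(3) a]) (simp add: a_def)
  have d: "germ_param W \<xi> V X \<Delta> a d" by (rule germ_param_restrict[OF ad X(3) a]) (simp add: a_def)
  have curve: "chart_curve W \<xi> V X \<Gamma> t = vector [X (g t) $ 2, X (g t) $ 3]"
    "chart_curve W \<xi> V X \<Delta> t = vector [X (d t) $ 2, X (d t) $ 3]" for t
    unfolding chart_curve_def Let_def g_def d_def by simp_all
  \<comment> \<open>Extension by zero makes the chart and the field total definable maps; on the
    open sets \<open>V\<close> and \<open>W\<close>, where the curves live, nothing changes.\<close>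
  define X' where "X' p = (if p \<in> V then X p else 0)" for p
  define \<xi>' where "\<xi>' p = (if p \<in> W then \<xi> p else 0)" for p
  have X': "X' p = X p" if "p \<in> V" for p using that by (simp add: X'_def)
  have \<xi>': "\<xi>' p = \<xi> p" if "p \<in> W" for p using that by (simp add: \<xi>'_def)
  have g': "germ_param W \<xi>' V X' \<Gamma> a g" and d': "germ_param W \<xi>' V X' \<Delta> a d"
    using germ_param_cong[OF g] germ_param_cong[OF d] X' \<xi>' by simp_all
  have V': "g t \<in> V" "d t \<in> V" "X (g t) $ 1 = t" "X (d t) $ 1 = t" if "t \<in> {0<..<a}" for t
    using germ_paramD(4)[OF g that] germ_paramD(4)[OF d that] by auto
  have eva: "\<forall>\<^sub>F t in at_right 0. t \<in> {0<..<a}" using a by (rule eventually_at_right_real)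
  interpret C: chart_field W \<xi>' V X'
  proof
    show "C1_on \<xi>' W" by (rule C1_on_cong[OF W(2,1)]) (simp add: \<xi>')
    show "C1_on X' V" by (rule C1_on_cong[OF X(2,1)]) (simp add: X')
    have "\<forall>\<^sub>F p in at 0 within V. X' p = X p" unfolding eventually_at_filter by (simp add: X')
    then show "(X' \<longlongrightarrow> 0) (at 0 within V)" using X(3) by (simp add: tendsto_cong)
  qed (fact W X)+
  interpret C: contact W \<xi>' V X' S Y a g d
  proof
    show "ds V" "ds W" using df_ext_map3(1)[OF X(5)] df_ext_map3(1)[OF W(3)] by simp_all
    have "ext V (\<lambda>p. X p $ i) = (\<lambda>p. X' p $ i)" for i by (simp add: fun_eq_iff ext_def X'_def)
    then show "df (\<lambda>p. X' p $ i)" for i using df_ext_map3(2)[OF X(5), of i] by simp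
    have "ext W (\<lambda>p. \<xi> p $ i) = (\<lambda>p. \<xi>' p $ i)" for i by (simp add: fun_eq_iff ext_def \<xi>'_def)
    then show "df (\<lambda>p. \<xi>' p $ i)" for i using df_ext_map3(2)[OF W(3), of i] by simp
    have im: "X' ` V = X ` V" using X' by auto
    show "open (X' ` V)" "C1_on Y (X' ` V)" unfolding im using Y by simp_all
    show "Y (X' p) = p" if "p \<in> V" for p using that by (simp add: X' Y(3))
    show gx: "C.xcurve {0<..<a} g" and dx: "C.xcurve {0<..<a} d" by (rule C.germ_param_xcurve[OF g'] C.germ_param_xcurve[OF d'])+
    show "separates S g" by (rule regular_separation_separates[OF field reg ch g])
    show "\<forall>\<^sub>F t in at_right 0. norm (X' (d t) - X' (g t)) \<le> t ^ k" for k
    proof -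
      obtain e where e: "e > 0" "\<forall>x\<in>{0<..<e}. norm (chart_curve W \<xi> V X \<Delta> x - chart_curve W \<xi> V X \<Gamma> x) \<le> x ^ k"
        using small by blast
      have "\<forall>\<^sub>F t in at_right 0. t \<in> {0<..<e}" using e(1) by (rule eventually_at_right_real)
      with eva show ?thesis
      proof eventually_elim
        case (elim t)
        \<comment> \<open>The clocks agree, so the distance in space equals the distance of the
          plane curves.\<close>
        have "norm (X' (d t) - X' (g t)) = norm (chart_curve W \<xi> V X \<Delta> t - chart_curve W \<xi> V X \<Gamma> t)"
          using V'[OF elim(1)] unfolding curve by (simp add: X' norm_vec_def L2_set_def sum_2 sum_3)
        then show ?case using e(2) elim(2) by simp
      qed
    qed
    \<comment> \<open>One common point at equal clock times would make the curves identical, against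
      the hypothesis that the chart curves have different germs.\<close>
    show "g t \<noteq> d t" if t: "t \<in> {0<..<a}" for t
    proof
      assume "g t = d t"
      then have "g s = d s" if "s \<in> {0<..<a}" for s
        using C.xcurve_unique[OF gx dx _ _ t _ that] by simp
      then have "\<forall>\<^sub>F t in at_right 0. chart_curve W \<xi> V X \<Gamma> t = chart_curve W \<xi> V X \<Delta> t"
        using eva unfolding curve by (auto elim: eventually_mono)
      then show False using neq by blast
    qed
  qed (rule a)
  have not': "\<not> interlaced_curves (C.plane g) (C.plane d)"
  proof
    assume "interlaced_curves (C.plane g) (C.plane d)"
    then have "interlaced_curves (chart_curve W \<xi> V X \<Gamma>) (chart_curve W \<xi> V X \<Delta>)"
      by (rule interlaced_curves_cong[OF _ a]) (simp add: curve C.plane_def X' V')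
    then show False using not adg add unfolding interlaced_def by blast
  qed
  have U: "open U" "definable_map S 2 U (\<lambda>p. coords2 (F p))" "C1_on F U" "(F \<longlongrightarrow> 0) (at 0 within U)"
    and sur: "\<And>p. p \<in> U \<Longrightarrow> surj (frechet_derivative F (at p))"
    and germU: "same_germ (\<Gamma> \<inter> U) \<Gamma>" "same_germ (\<Delta> \<inter> U) \<Delta>"
    using F unfolding adapted_projection_def by auto
  define G where "G i = ext U (\<lambda>p. F p $ i)" for i
  have G: "G i p = F p $ i" if "p \<in> U" for i p using that by (simp add: G_def ext_def)
  have dG: "frechet_derivative (G i) (at p) = (\<lambda>u. frechet_derivative F (at p) u $ i)" if p: "p \<in> U" for i p
  proof -
    obtain F' where F': "(F has_derivative F') (at p)" using U(3) p unfolding C1_on_def by blast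
    have "((\<lambda>p. F p $ i) has_derivative (\<lambda>u. F' u $ i)) (at p)"
      by (rule bounded_linear.has_derivative[OF bounded_linear_vec_nth F'])
    then have "(G i has_derivative (\<lambda>u. F' u $ i)) (at p)"
      by (rule has_derivative_transform_within_open[OF _ U(1) p]) (simp add: G)
    then show ?thesis using frechet_derivative_at[OF F'] frechet_derivative_at by metis
  qed
  have inU: "\<forall>\<^sub>F t in at_right 0. t \<in> {0<..<a} \<and> c t \<in> U" if c: "germ_param W \<xi> V X \<Gamma>1 a c" "same_germ (\<Gamma>1 \<inter> U) \<Gamma>1" for c \<Gamma>1
  proof -
    have "\<forall>\<^sub>F t in at_right 0. c t \<in> \<Gamma>1" using germ_param_eventually[OF c(1)] by eventually_elim blast
    then have "\<forall>\<^sub>F t in at_right 0. c t \<in> \<Gamma>1 \<inter> U"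
      by (rule same_germ_eventually[OF same_germ_sym[OF c(2)] germ_paramD(3)[OF c(1)]])
    with eva show ?thesis by eventually_elim blast
  qed
  have gU: "\<forall>\<^sub>F t in at_right 0. g t \<in> U" using inU[OF g germU(1)] by eventually_elim blast
  have limG: "((\<lambda>t. G i (g t)) \<longlongrightarrow> 0) (at_right 0)" for i
  proof -
    have "\<forall>\<^sub>F t in at_right 0. g t \<in> U \<and> g t \<noteq> 0"
      using inU[OF g germU(1)] by eventually_elim (use germ_paramD(4)[OF g] in blast)
    then have "filterlim g (at 0 within U) (at_right 0)"
      unfolding filterlim_at using germ_paramD(3)[OF g] by blast
    then have "((\<lambda>t. F (g t)) \<longlongrightarrow> 0) (at_right 0)" using U(4) filterlim_compose by blast
    then have "((\<lambda>t. F (g t) $ i) \<longlongrightarrow> (0::real^2) $ i) (at_right 0)" by (rule tendsto_vec_nth)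
    moreover have "\<forall>\<^sub>F t in at_right 0. G i (g t) = F (g t) $ i" using gU by eventually_elim (simp add: G)
    ultimately show ?thesis by (simp add: tendsto_cong)
  qed
  have rep: "representative W \<xi> \<Gamma>1 (c ` {0<..<b})" if "germ_param W \<xi> V X \<Gamma>1 a c" "0 < b" "b \<le> a" for \<Gamma>1 c b
    by (rule germ_param_representative[OF germ_param_restrict[OF that(1) X(3) that(2,3)]])
  have finish: ?thesis
    if b: "0 < b1" "b1 \<le> a" "0 < b2" "b2 \<le> a" "\<And>t. t \<in> {0<..<b1} \<Longrightarrow> g t \<in> U" "\<And>t. t \<in> {0<..<b2} \<Longrightarrow> d t \<in> U"
      and conn: "connected (F ` g ` {0<..<b1} \<inter> F ` d ` {0<..<b2})" for b1 b2
    unfolding connected_germ_of_intersection_def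
    by (rule exI[of _ "g ` {0<..<b1}"], rule exI[of _ "d ` {0<..<b2}"]) (use b conn rep[OF g] rep[OF d] in auto)
  have FG: "F p = F q \<longleftrightarrow> G 1 p = G 1 q \<and> G 2 p = G 2 q" if "p \<in> U" "q \<in> U" for p q
    using that by (simp add: G vec_eq_iff forall_2)
  have "(\<exists>b. 0 < b \<and> b \<le> a \<and> (\<forall>t\<in>{0<..<b}. g t \<in> U \<and> G 1 (g t) = 0 \<and> G 2 (g t) = 0)) \<or>
   (\<exists>b1 b2. 0 < b1 \<and> b1 \<le> a \<and> 0 < b2 \<and> b2 \<le> a \<and>
     (\<forall>t\<in>{0<..<b1}. g t \<in> U) \<and> (\<forall>t\<in>{0<..<b2}. d t \<in> U) \<and>
     ((\<forall>t\<in>{0<..<b1}. \<forall>u\<in>{0<..<b2}. \<not> (G 1 (d u) = G 1 (g t) \<and> G 2 (d u) = G 2 (g t))) \<or>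
      (\<forall>t\<in>{0<..<b1}. \<exists>u\<in>{0<..<b2}. G 1 (d u) = G 1 (g t) \<and> G 2 (d u) = G 2 (g t))))"
  proof (rule C.plane_pair_or_constant[OF U(1) _ _ _ _ _ _ gU limG limG not'])
    show "ds U" "df (G 1)" "df (G 2)" using df_ext_map2[OF U(2)] unfolding G_def by simp_all
    show "C1_on (G 1) U" "C1_on (G 2) U"
      by (rule C1_on_cong[OF C1_on_nth[OF U(3)] U(1)], simp add: G)+
    show "\<exists>u. frechet_derivative (G 1) (at p) u = w1 \<and> frechet_derivative (G 2) (at p) u = w2" if p: "p \<in> U" for p w1 w2
    proof -
      obtain u where "frechet_derivative F (at p) u = vector [w1, w2]" using sur[OF p] by (metis surjD)
      then show ?thesis unfolding dG[OF p] by (intro exI[of _ u]) simp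
    qed
  qed
  then consider (zero) b where "0 < b" "b \<le> a" "\<forall>t\<in>{0<..<b}. g t \<in> U \<and> G 1 (g t) = 0 \<and> G 2 (g t) = 0"
    | (apart) b1 b2 where "0 < b1" "b1 \<le> a" "0 < b2" "b2 \<le> a" "\<forall>t\<in>{0<..<b1}. g t \<in> U" "\<forall>t\<in>{0<..<b2}. d t \<in> U"
      "\<forall>t\<in>{0<..<b1}. \<forall>u\<in>{0<..<b2}. \<not> (G 1 (d u) = G 1 (g t) \<and> G 2 (d u) = G 2 (g t))"
    | (inside) b1 b2 where "0 < b1" "b1 \<le> a" "0 < b2" "b2 \<le> a" "\<forall>t\<in>{0<..<b1}. g t \<in> U" "\<forall>t\<in>{0<..<b2}. d t \<in> U"
      "\<forall>t\<in>{0<..<b1}. \<exists>u\<in>{0<..<b2}. G 1 (d u) = G 1 (g t) \<and> G 2 (d u) = G 2 (g t)"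
    by blast
  then show ?thesis
  proof cases
    case zero
    obtain b2 where b2: "b2 > 0" "\<And>t. 0 < t \<Longrightarrow> t < b2 \<Longrightarrow> t \<in> {0<..<a} \<and> d t \<in> U"
      using inU[OF d germU(2)] unfolding eventually_at_right_field by blast
    \<comment> \<open>The arc of \<Gamma> is projected to a single point, so the intersection is
      contained in it.\<close>
    have "F (g t) = 0" if "t \<in> {0<..<b}" for t
    proof -
      have "g t \<in> U" "G 1 (g t) = 0" "G 2 (g t) = 0" using zero(3) that by blast+
      then show ?thesis by (simp add: G vec_eq_iff forall_2)
    qed
    then have "F ` g ` {0<..<b} \<inter> F ` d ` {0<..<min b2 a} \<subseteq> {0}" by auto
    then have "connected (F ` g ` {0<..<b} \<inter> F ` d ` {0<..<min b2 a})"
      by (metis connected_empty connected_sing subset_singletonD)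
    then show ?thesis by (rule finish[rotated -1]) (use zero b2 a in auto)
  next
    case apart
    have "F (g t) \<noteq> F (d u)" if "t \<in> {0<..<b1}" "u \<in> {0<..<b2}" for t u
    proof -
      have "g t \<in> U" "d u \<in> U" using apart that by blast+
      from FG[OF this] show ?thesis using bspec[OF bspec[OF apart(7) that(1)] that(2)] by auto
    qed
    then have "F ` g ` {0<..<b1} \<inter> F ` d ` {0<..<b2} = {}" by auto
    then have "connected (F ` g ` {0<..<b1} \<inter> F ` d ` {0<..<b2})" by simp
    then show ?thesis by (rule finish[rotated -1]) (use apart in auto)
  next
    case inside
    have "F (g t) \<in> F ` d ` {0<..<b2}" if t: "t \<in> {0<..<b1}" for t
    proof -
      obtain u where u: "u \<in> {0<..<b2}" "G 1 (d u) = G 1 (g t)" "G 2 (d u) = G 2 (g t)" using bspec[OF inside(7) t] by blast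
      have "g t \<in> U" "d u \<in> U" using bspec[OF inside(5) t] bspec[OF inside(6) u(1)] by blast+
      from FG[OF this] have "F (g t) = F (d u)" using u by simp
      then show ?thesis using u(1) by blast
    qed
    then have "F ` g ` {0<..<b1} \<inter> F ` d ` {0<..<b2} = F ` g ` {0<..<b1}" by blast
    moreover have "connected (F ` g ` {0<..<b1})"
    proof -
      have "continuous_on {0<..<b1} g"
        by (rule C.xcurve_continuous_on[OF C.xcurve_subset[OF C.g]]) (use inside(2) in auto)
      moreover have "continuous_on (g ` {0<..<b1}) F"
        by (rule continuous_on_subset[OF C1_on_continuous_on[OF U(3)]]) (use inside(5) in blast)
      ultimately show ?thesis by (intro connected_continuous_image) auto
    qed
    ultimately have "connected (F ` g ` {0<..<b1} \<inter> F ` d ` {0<..<b2})" by simp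
    then show ?thesis by (rule finish[rotated -1]) (use inside in auto)
  qed
qed

end

theorem theorem3p9:
  fixes S :: "nat \<Rightarrow> real list set set"
    and W :: "(real^3) set" and \<xi> :: "real^3 \<Rightarrow> real^3"
    and \<Gamma> \<Delta> :: "(real^3) set"
  assumes "polynomially_bounded_ominimal S"
    and "definable_C1_vector_field S W \<xi>" and "\<xi> 0 = 0"
    and "trajectory W \<xi> \<Gamma>" and "trajectory W \<xi> \<Delta>"
    and "regular_separation S W \<xi> \<Gamma>"
    and "flat_contact S W \<xi> \<Gamma> \<Delta>"
  shows "(interlaced S W \<xi> \<Gamma> \<Delta> \<or>
          (\<forall>U F. adapted_projection S \<Gamma> \<Delta> U F \<longrightarrow>
             connected_germ_of_intersection W \<xi> \<Gamma> \<Delta> U F)) \<and>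
         \<not> (interlaced S W \<xi> \<Gamma> \<Delta> \<and>
            (\<forall>U F. adapted_projection S \<Gamma> \<Delta> U F \<longrightarrow>
               connected_germ_of_intersection W \<xi> \<Gamma> \<Delta> U F))"
proof -
  interpret polynomially_bounded_ominimal S by (rule assms(1))
  have "connected_germ_of_intersection W \<xi> \<Gamma> \<Delta> U F"
    if "\<not> interlaced S W \<xi> \<Gamma> \<Delta>" "adapted_projection S \<Gamma> \<Delta> U F" for U F
    using flat_contact_alternative[OF assms(2,6,7) that] .
  moreover have "\<exists>U F. adapted_projection S \<Gamma> \<Delta> U F \<and> \<not> connected_germ_of_intersection W \<xi> \<Gamma> \<Delta> U F"
    if "interlaced S W \<xi> \<Gamma> \<Delta>"
    using interlaced_not_connected_germ[OF assms(2) that] .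
  ultimately show ?thesis by blast
qed

end
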